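(* Let $\mathfrak{g}$ be a nilpotent locally convex Lie algebra over $\mathbb{K}$ with continuous Lie bracket, let $N\in\mathbb{N}$, $N\ge1$, be such that $N+1$ Lie brackets nested into each other vanish, i.e. $\mathrm{ad}_{\xi_1}\circ\cdots\circ\mathrm{ad}_{\xi_{N+1}}=0$ for all $\xi_1,\ldots,\xi_{N+1}\in\mathfrak{g}$, and let $z\in\mathbb{K}$. For $0\le R<1$ put $\epsilon=\frac{N-1}{N}(1-R)$. (i) If $0\le R<1$, the operators $C_n$ are continuous and fulfil $$p_R\big(C_n(x,y)\big)\le\frac{1}{2\cdot8^n}\,(32e\,q)_{R+\epsilon}(x)\,(32e\,q)_{R+\epsilon}(y)$$ for all $x,y\in \mathrm{S}_R^\bullet(\mathfrak{g})$, where $p$ is a continuous seminorm on $\mathfrak{g}$ and $q$ an asymptotic estimate for $p$. (ii) The Gutt star product $\star_z$ is continuous for the locally convex projective limit $\mathrm{S}_{1^-}^\bullet(\mathfrak{g})$, and for $0\le R<1$, every continuous seminorm $p$ and every asymptotic estimate $q$ for $p$, $$p_R(x\star_zy)\le(cq)_{R+\epsilon}(x)\,(cq)_{R+\epsilon}(y)$$ with $c=32e(|z|+1)$. The Gutt star product extends continuously to $\widehat{\mathrm{S}}_{1^-}^\bullet(\mathfrak{g})$, where it converges absolutely and coincides with the formal series $\sum_nz^nC_n$.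
   Context: $\mathbb{K}$ is $\mathbb{R}$ or $\mathbb{C}$, $e$ is Euler's number, $\mathrm{ad}_\xi(\eta)=[\xi,\eta]$. A continuous seminorm $q$ on $\mathfrak{g}$ is an asymptotic estimate for a continuous seminorm $p$ if $p(w_n(x_1,\ldots,x_n))\le q(x_1)\cdots q(x_n)$ for all $n\ge1$, all $x_i\in\mathfrak{g}$ and all words $w_n$ made out of $n-1$ Lie brackets of $x_1,\ldots,x_n$ with arbitrary bracketing; in a nilpotent locally convex Lie algebra with continuous bracket every $p$ has one. $p^n$ is the $n$-th projective tensor power of $p$ ($p^0=|\cdot|$), $p_R=\sum_{n\ge0}n!^Rp^n$; $\mathrm{S}_R^\bullet(\mathfrak{g})$ is the symmetric tensor algebra (symmetric tensors inside the tensor algebra $\mathrm{T}^\bullet(\mathfrak{g})$, with product $\xi_1\cdots\xi_n=\frac1{n!}\sum_\sigma\xi_{\sigma(1)}\otimes\cdots\otimes\xi_{\sigma(n)}$, the sum running over all permutations) with the topology of all $p_R$. $\mathrm{S}_{1^-}^\bullet(\mathfrak{g})$ is the projective limit of the $\mathrm{S}_{1-\epsilon'}^\bullet(\mathfrak{g})$ for $\epsilon'\to0^+$, i.e. the symmetric algebra with the topology of all $p_R$ with $R<1$ and $p$ a continuous seminorm on $\mathfrak{g}$; $\widehat{\mathrm{S}}_{1^-}^\bullet(\mathfrak{g})$ is its completion. Let $\mathfrak{q}\colon \mathrm{S}^\bullet(\mathfrak{g})\to\mathcal{U}(\mathfrak{g})$, $\mathfrak{q}(\xi_1\cdots\xi_n)=\frac1{n!}\sum_\sigma\xi_{\sigma(1)}\odot\cdots\odot\xi_{\sigma(n)}$,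 $\odot$ being the product of the universal enveloping algebra, and $\pi_n$ the projection onto $\mathrm{S}^n(\mathfrak{g})$. For $f\in \mathrm{S}^k(\mathfrak{g})$, $g\in \mathrm{S}^\ell(\mathfrak{g})$: $C_n(f,g)=\pi_{k+\ell-n}\big(\mathfrak{q}^{-1}(\mathfrak{q}(f)\odot\mathfrak{q}(g))\big)$ (zero if $n>k+\ell$), extended bilinearly, and the Gutt star product is $f\star_zg=\sum_nz^nC_n(f,g)$.
   Formalization: ε is (M−1)/M·(1−R) with M=N if already N nested brackets vanish, else M=N+1, since the printed ε fails for the Heisenberg algebra (N=1); in (i) the factor 1/(2·8^n) becomes 1 when n=0 and x, y both have nonzero scalar part, as C_0(1,1)=1. *)

theory Defs
  imports
    "HOL-Analysis.Analysis"
    "HOL-Library.Function_Algebras"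
    "HOL-Combinatorics.Permutations"
    "HOL-Algebra.QuotRing"
begin

section \<open>The ground field\<close>

text \<open>The two instances are \<open>\<real>\<close> and \<open>\<complex>\<close>. They are the only ones up to isometric isomorphism, because
  a multiplicative norm on \<open>\<complex>\<close> that extends the absolute value of \<open>\<real>\<close> is the modulus.\<close>

class real_or_complex = real_normed_field +
  assumes real_or_complex:
    "(\<forall>x. \<exists>a. x = a *\<^sub>R 1) \<or> (\<exists>i. i * i = - 1 \<and> (\<forall>x. \<exists>a b. x = a *\<^sub>R 1 + b *\<^sub>R i))"

instance real :: real_or_complex
  by standard simp

instance complex :: real_or_complex
proof
  have "\<exists>i::complex. i * i = - 1 \<and> (\<forall>x. \<exists>a b. x = a *\<^sub>R 1 + b *\<^sub>R i)"
    by (intro exI[of _ \<i>] conjI allI) (auto simp: complex_eq_iff)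
  then show "(\<forall>x::complex. \<exists>a. x = a *\<^sub>R 1) \<or>
      (\<exists>i::complex. i * i = - 1 \<and> (\<forall>x. \<exists>a b. x = a *\<^sub>R 1 + b *\<^sub>R i))" ..
qed


section \<open>Locally convex Lie algebras\<close>

locale locally_convex_space = vector_space scale
  for scale :: "'k::real_normed_field \<Rightarrow> 'v::topological_ab_group_add \<Rightarrow> 'v" +
  assumes continuous_scale: "continuous_on UNIV (\<lambda>(c, x). scale c x)"
    and locally_convex: "\<lbrakk>open U; 0 \<in> U\<rbrakk> \<Longrightarrow> \<exists>V. open V \<and> 0 \<in> V \<and> V \<subseteq> U \<and>
      (\<forall>x\<in>V. \<forall>y\<in>V. \<forall>t\<in>{0..1}. scale (of_real (1 - t)) x + scale (of_real t) y \<in> V)"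

locale locally_convex_lie_algebra = locally_convex_space scale
  for scale :: "'k::real_normed_field \<Rightarrow> 'g::topological_ab_group_add \<Rightarrow> 'g" +
  fixes br :: "'g \<Rightarrow> 'g \<Rightarrow> 'g"
  assumes br_add_left: "br (x + y) u = br x u + br y u"
    and br_add_right: "br u (x + y) = br u x + br u y"
    and br_scale_left: "br (scale c x) y = scale c (br x y)"
    and br_scale_right: "br x (scale c y) = scale c (br x y)"
    and br_self: "br x x = 0"
    and jacobi: "br x (br y u) + br y (br u x) + br u (br x y) = 0"
    and continuous_br: "continuous_on UNIV (\<lambda>(x, y). br x y)"

text \<open>\<open>ad\<close> of \<open>x\<close> is the partial application \<open>br x\<close>; the condition reads
  \<open>ad \<xi>\<^sub>1 \<circ> \<dots> \<circ> ad \<xi>\<^sub>m = 0\<close> for all \<open>\<xi>\<^sub>1, \<dots>, \<xi>\<^sub>m\<close>. Then all bracket words of more than \<open>m\<close> letters vanish,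
  and it is this number of letters that governs the loss \<open>\<epsilon> = (m - 1) / m * (1 - R)\<close> in the estimates for
  the Gutt star product: in the Heisenberg algebra with \<open>[P, Q] = E\<close>, where \<open>m = 2\<close> is optimal,
  \<open>C\<^sub>k (P\<^sup>k, Q\<^sup>k) = k! / 2\<^sup>k * E\<^sup>k\<close>, which rules out every \<open>\<epsilon> < (1 - R) / 2\<close>.\<close>

definition ad_vanish :: "('g \<Rightarrow> 'g \<Rightarrow> 'g::zero) \<Rightarrow> nat \<Rightarrow> bool" where
  "ad_vanish br m \<longleftrightarrow> (\<forall>xs. length xs = m \<longrightarrow> foldr (\<circ>) (map br xs) id = (\<lambda>_. 0))"

definition continuous_seminorm ::
    "('k::real_normed_field \<Rightarrow> 'v \<Rightarrow> 'v) \<Rightarrow> ('v::{plus,topological_space} \<Rightarrow> real) \<Rightarrow> bool" where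
  "continuous_seminorm s p \<longleftrightarrow>
     (\<forall>x y. p (x + y) \<le> p x + p y) \<and> (\<forall>c x. p (s c x) = norm c * p x) \<and> continuous_on UNIV p"

text \<open>\<open>lie_word br xs w\<close>: \<open>w\<close> arises from the letters \<open>xs\<close>, each used once, by \<open>length xs - 1\<close>
  brackets. The letters occur in the order of \<open>xs\<close>, which is no restriction in the definition below,
  where \<open>xs\<close> is arbitrary and the bound is symmetric in the letters.\<close>

inductive lie_word :: "('g \<Rightarrow> 'g \<Rightarrow> 'g) \<Rightarrow> 'g list \<Rightarrow> 'g \<Rightarrow> bool" for br where
  letter: "lie_word br [x] x"
| bracket: "lie_word br xs u \<Longrightarrow> lie_word br ys v \<Longrightarrow> lie_word br (xs @ ys) (br u v)"

definition asymptotic_estimate ::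
    "('k::real_normed_field \<Rightarrow> 'g \<Rightarrow> 'g) \<Rightarrow> ('g \<Rightarrow> 'g \<Rightarrow> 'g) \<Rightarrow>
      ('g::{plus,topological_space} \<Rightarrow> real) \<Rightarrow> ('g \<Rightarrow> real) \<Rightarrow> bool" where
  "asymptotic_estimate s br p q \<longleftrightarrow>
     continuous_seminorm s q \<and> (\<forall>xs w. lie_word br xs w \<longrightarrow> p w \<le> prod_list (map q xs))"


section \<open>The tensor algebra\<close>

text \<open>A family of multilinear forms, one on each power of the vector space, is given as one function
  on lists. The tensor algebra is realised inside the dual of the space of these families: the
  tensor \<open>x\<^sub>1 \<otimes> \<dots> \<otimes> x\<^sub>n\<close> is the evaluation at \<open>[x\<^sub>1, \<dots>, x\<^sub>n]\<close>. This is the usual tensor algebra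
  because the multilinear forms separate its points; its universal property is proved below.
  Functions on non-multilinear arguments are set to zero, so that tensors are equal as functions.\<close>

type_synonym ('g, 'k) tensor = "('g list \<Rightarrow> 'k) \<Rightarrow> 'k"

definition multilinear ::
    "('k \<Rightarrow> 'g \<Rightarrow> 'g) \<Rightarrow> ('k \<Rightarrow> 'w \<Rightarrow> 'w) \<Rightarrow> ('g::plus list \<Rightarrow> 'w::plus) \<Rightarrow> bool" where
  "multilinear s s' \<phi> \<longleftrightarrow>
     (\<forall>xs a b ys. \<phi> (xs @ (a + b) # ys) = \<phi> (xs @ a # ys) + \<phi> (xs @ b # ys)) \<and>
     (\<forall>xs c a ys. \<phi> (xs @ s c a # ys) = s' c (\<phi> (xs @ a # ys)))"

definition on_forms ::
    "('k \<Rightarrow> 'g \<Rightarrow> 'g) \<Rightarrow> ('g::plus, 'k::field) tensor \<Rightarrow> ('g, 'k) tensor" where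
  "on_forms s t = (\<lambda>\<phi>. if multilinear s (*) \<phi> then t \<phi> else 0)"

definition tens :: "('k \<Rightarrow> 'g \<Rightarrow> 'g) \<Rightarrow> 'g::plus list \<Rightarrow> ('g, 'k::field) tensor" where
  "tens s xs = on_forms s (\<lambda>\<phi>. \<phi> xs)"

definition tscale :: "'k \<Rightarrow> ('g, 'k::field) tensor \<Rightarrow> ('g, 'k) tensor" where
  "tscale c t = (\<lambda>\<phi>. c * t \<phi>)"

definition tensor_algebra :: "('k \<Rightarrow> 'g \<Rightarrow> 'g) \<Rightarrow> ('g::plus, 'k::field) tensor set" where
  "tensor_algebra s = module.span tscale (range (tens s))"

definition tmult ::
    "('k \<Rightarrow> 'g \<Rightarrow> 'g) \<Rightarrow> ('g::plus, 'k::field) tensor \<Rightarrow> ('g, 'k) tensor \<Rightarrow> ('g, 'k) tensor" where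
  "tmult s t u = on_forms s (\<lambda>\<phi>. t (\<lambda>xs. u (\<lambda>ys. \<phi> (xs @ ys))))"

definition tensor_ring :: "('k \<Rightarrow> 'g \<Rightarrow> 'g) \<Rightarrow> ('g::plus, 'k::field) tensor ring" where
  "tensor_ring s = \<lparr>carrier = tensor_algebra s, mult = tmult s, one = tens s [], zero = 0, add = (+)\<rparr>"

text \<open>The component of degree \<open>n\<close>, and the action of a permutation on this component.\<close>

definition tproj ::
    "('k \<Rightarrow> 'g \<Rightarrow> 'g) \<Rightarrow> nat \<Rightarrow> ('g::plus, 'k::field) tensor \<Rightarrow> ('g, 'k) tensor" where
  "tproj s n t = on_forms s (\<lambda>\<phi>. t (\<lambda>xs. if length xs = n then \<phi> xs else 0))"

definition tperm ::
    "('k \<Rightarrow> 'g \<Rightarrow> 'g) \<Rightarrow> nat \<Rightarrow> (nat \<Rightarrow> nat) \<Rightarrow> ('g::plus, 'k::field) tensor \<Rightarrow> ('g, 'k) tensor" where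
  "tperm s n \<sigma> t = on_forms s (\<lambda>\<phi>. t (\<lambda>xs. if length xs = n then \<phi> (permute_list \<sigma> xs) else \<phi> xs))"

definition symmetric_algebra :: "('k \<Rightarrow> 'g \<Rightarrow> 'g) \<Rightarrow> ('g::plus, 'k::field) tensor set" where
  "symmetric_algebra s =
     {t \<in> tensor_algebra s. \<forall>n \<sigma>. \<sigma> permutes {..<n} \<longrightarrow> tperm s n \<sigma> t = t}"

definition sym_prod :: "('k \<Rightarrow> 'g \<Rightarrow> 'g) \<Rightarrow> 'g::plus list \<Rightarrow> ('g, 'k::field_char_0) tensor" where
  "sym_prod s xs =
     tscale (1 / fact (length xs)) (\<Sum>\<sigma> | \<sigma> permutes {..<length xs}. tens s (permute_list \<sigma> xs))"


section \<open>The universal enveloping algebra and the Gutt star product\<close>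

definition env_ideal ::
    "('k \<Rightarrow> 'g \<Rightarrow> 'g) \<Rightarrow> ('g \<Rightarrow> 'g \<Rightarrow> 'g) \<Rightarrow> ('g::plus, 'k::field) tensor set" where
  "env_ideal s br =
     genideal (tensor_ring s) {tens s [x, y] - tens s [y, x] - tens s [br x y] | x y. True}"

definition env_algebra ::
    "('k \<Rightarrow> 'g \<Rightarrow> 'g) \<Rightarrow> ('g \<Rightarrow> 'g \<Rightarrow> 'g) \<Rightarrow> ('g::plus, 'k::field) tensor set ring" where
  "env_algebra s br = tensor_ring s Quot env_ideal s br"

text \<open>The canonical projection onto the enveloping algebra. Its restriction to the symmetric algebra
  is the symmetrisation map \<open>\<xi>\<^sub>1 \<cdots> \<xi>\<^sub>n \<mapsto> (1/n!) \<Sum>\<^sub>\<sigma> \<xi>\<^sub>\<sigma>\<^sub>1 \<odot> \<dots> \<odot> \<xi>\<^sub>\<sigma>\<^sub>n\<close>, see \<open>quantization_sym_prod\<close>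
  below.\<close>

definition quantization ::
    "('k \<Rightarrow> 'g \<Rightarrow> 'g) \<Rightarrow> ('g \<Rightarrow> 'g \<Rightarrow> 'g) \<Rightarrow> ('g::plus, 'k::field) tensor \<Rightarrow> ('g, 'k) tensor set" where
  "quantization s br t = env_ideal s br +>\<^bsub>tensor_ring s\<^esub> t"

definition gutt_C ::
    "('k \<Rightarrow> 'g \<Rightarrow> 'g) \<Rightarrow> ('g \<Rightarrow> 'g \<Rightarrow> 'g) \<Rightarrow> nat \<Rightarrow>
      ('g::plus, 'k::field) tensor \<Rightarrow> ('g, 'k) tensor \<Rightarrow> ('g, 'k) tensor" where
  "gutt_C s br n x y =
     (\<Sum>(k, l) \<in> {(k, l). tproj s k x \<noteq> 0 \<and> tproj s l y \<noteq> 0 \<and> n \<le> k + l}.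
        tproj s (k + l - n)
          (inv_into (symmetric_algebra s) (quantization s br)
            (quantization s br (tproj s k x) \<otimes>\<^bsub>env_algebra s br\<^esub> quantization s br (tproj s l y))))"

definition gutt_star ::
    "('k \<Rightarrow> 'g \<Rightarrow> 'g) \<Rightarrow> ('g \<Rightarrow> 'g \<Rightarrow> 'g) \<Rightarrow> 'k \<Rightarrow>
      ('g::plus, 'k::field) tensor \<Rightarrow> ('g, 'k) tensor \<Rightarrow> ('g, 'k) tensor" where
  "gutt_star s br z x y = (\<Sum>n | gutt_C s br n x y \<noteq> 0. tscale (z ^ n) (gutt_C s br n x y))"


section \<open>Seminorms and topologies on the symmetric algebra\<close>

text \<open>The explicit coefficients in the representations matter for \<open>n = 0\<close> only.\<close>

definition proj_power ::
    "('k \<Rightarrow> 'g \<Rightarrow> 'g) \<Rightarrow> ('g \<Rightarrow> real) \<Rightarrow> nat \<Rightarrow> ('g::plus, 'k::real_normed_field) tensor \<Rightarrow> real" where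
  "proj_power s p n t = Inf {\<Sum>(c, xs)\<leftarrow>cxs. norm c * prod_list (map p xs) | cxs.
     (\<forall>(c, xs)\<in>set cxs. length xs = n) \<and> t = (\<Sum>(c, xs)\<leftarrow>cxs. tscale c (tens s xs))}"

text \<open>On tensors this series has only finitely many nonzero terms.\<close>

definition tensor_seminorm ::
    "('k \<Rightarrow> 'g \<Rightarrow> 'g) \<Rightarrow> ('g \<Rightarrow> real) \<Rightarrow> real \<Rightarrow> ('g::plus, 'k::real_normed_field) tensor \<Rightarrow> real" where
  "tensor_seminorm s p R t = (\<Sum>n. fact n powr R * proj_power s p n (tproj s n t))"

definition seminorm_topology :: "'a::minus set \<Rightarrow> ('a \<Rightarrow> real) set \<Rightarrow> 'a topology" where
  "seminorm_topology V P =
     topology_generated_by {{y \<in> V. \<rho> (y - x) < e} | \<rho> x e. \<rho> \<in> P \<and> x \<in> V \<and> 0 < e}"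

definition sym_topology ::
    "('k \<Rightarrow> 'g \<Rightarrow> 'g) \<Rightarrow> real \<Rightarrow> ('g::{plus,topological_space}, 'k::real_normed_field) tensor topology" where
  "sym_topology s R = seminorm_topology (symmetric_algebra s)
     {tensor_seminorm s p R | p. continuous_seminorm s p}"

definition sym_limit_topology ::
    "('k \<Rightarrow> 'g \<Rightarrow> 'g) \<Rightarrow> ('g::{plus,topological_space}, 'k::real_normed_field) tensor topology" where
  "sym_limit_topology s = seminorm_topology (symmetric_algebra s)
     {tensor_seminorm s p R | p R. continuous_seminorm s p \<and> R < 1}"

text \<open>\<open>\<iota>\<close> exhibits the complete Hausdorff locally convex space \<open>'h\<close> as the completion of the
  locally convex space \<open>V\<close> of tensors with topology \<open>X\<close>. The uniformity of \<open>'h\<close> is the one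
  of its additive group by the sort constraint.\<close>

definition tensor_completion ::
    "('g, 'k::real_normed_field) tensor set \<Rightarrow> ('g, 'k) tensor topology \<Rightarrow>
      ('k \<Rightarrow> 'h \<Rightarrow> 'h::{topological_ab_group_add,uniform_topological_group_add,complete_uniform_space,t2_space}) \<Rightarrow>
      (('g, 'k) tensor \<Rightarrow> 'h) \<Rightarrow> bool" where
  "tensor_completion V X s' \<iota> \<longleftrightarrow>
     locally_convex_space s' \<and>
     (\<forall>x\<in>V. \<forall>y\<in>V. \<iota> (x + y) = \<iota> x + \<iota> y) \<and> (\<forall>c. \<forall>x\<in>V. \<iota> (tscale c x) = s' c (\<iota> x)) \<and>
     closure (\<iota> ` V) = UNIV \<and> X = pullback_topology V \<iota> euclidean"


section \<open>Consistency of the definitions\<close>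

lemma multilinearD:
  assumes "multilinear s s' \<phi>"
  shows "\<phi> (xs @ (a + b) # ys) = \<phi> (xs @ a # ys) + \<phi> (xs @ b # ys)"
    and "\<phi> (xs @ s c a # ys) = s' c (\<phi> (xs @ a # ys))"
  using assms unfolding multilinear_def by blast+

lemma on_forms_simps [simp]:
  "multilinear s (*) \<phi> \<Longrightarrow> on_forms s t \<phi> = t \<phi>"
  "\<not> multilinear s (*) \<phi> \<Longrightarrow> on_forms s t \<phi> = 0"
  by (simp_all add: on_forms_def)

lemma tens_simps [simp]:
  "multilinear s (*) \<phi> \<Longrightarrow> tens s xs \<phi> = \<phi> xs"
  "\<not> multilinear s (*) \<phi> \<Longrightarrow> tens s xs \<phi> = 0"
  by (simp_all add: tens_def)

lemma tscale_apply [simp]: "tscale c t \<phi> = c * t \<phi>"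
  by (simp add: tscale_def)

interpretation tvs: vector_space "tscale :: 'k::field \<Rightarrow> ('g, 'k) tensor \<Rightarrow> ('g, 'k) tensor"
  by standard (auto simp: fun_eq_iff algebra_simps)

lemma tensor_algebra_induct [consumes 1, case_names zero step]:
  assumes "t \<in> tensor_algebra s"
    and "P 0"
    and "\<And>c xs t. t \<in> tensor_algebra s \<Longrightarrow> P t \<Longrightarrow> P (tscale c (tens s xs) + t)"
  shows "P t"
proof -
  have "t \<in> tensor_algebra s \<and> P t"
    using assms(1)[unfolded tensor_algebra_def]
  proof (induction rule: tvs.span_induct_alt)
    case base
    show ?case
      using assms(2) tvs.span_zero unfolding tensor_algebra_def by blast
  next
    case (step c x y)
    then obtain xs where x: "x = tens s xs" and y: "y \<in> tensor_algebra s" "P y" by blast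
    have "tscale c x + y \<in> tensor_algebra s"
      using y(1) tvs.span_add[OF tvs.span_scale[OF tvs.span_base[OF step(1)]]]
      unfolding tensor_algebra_def by blast
    moreover have "P (tscale c x + y)"
      unfolding x using y by (rule assms(3))
    ultimately show ?case by blast
  qed
  then show ?thesis ..
qed

lemma tensor_algebra_closed:
  "0 \<in> tensor_algebra s"
  "tens s xs \<in> tensor_algebra s"
  "t \<in> tensor_algebra s \<Longrightarrow> u \<in> tensor_algebra s \<Longrightarrow> t + u \<in> tensor_algebra s"
  "t \<in> tensor_algebra s \<Longrightarrow> - t \<in> tensor_algebra s"
  "t \<in> tensor_algebra s \<Longrightarrow> u \<in> tensor_algebra s \<Longrightarrow> t - u \<in> tensor_algebra s"
  "t \<in> tensor_algebra s \<Longrightarrow> tscale c t \<in> tensor_algebra s"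
  "(\<And>i. i \<in> I \<Longrightarrow> f i \<in> tensor_algebra s) \<Longrightarrow> sum f I \<in> tensor_algebra s"
  by (auto simp: tensor_algebra_def
      intro: tvs.span_zero tvs.span_base tvs.span_add tvs.span_neg tvs.span_diff tvs.span_scale tvs.span_sum)

lemma multilinear_combinations:
  fixes \<phi> \<psi> :: "'g::plus list \<Rightarrow> 'k::field"
  shows "multilinear s (*) (\<lambda>_. 0 :: 'k)"
    and "multilinear s (*) \<phi> \<Longrightarrow> multilinear s (*) \<psi> \<Longrightarrow> multilinear s (*) (\<lambda>xs. \<phi> xs + \<psi> xs)"
    and "multilinear s (*) \<phi> \<Longrightarrow> multilinear s (*) (\<lambda>xs. c * \<phi> xs)"
  by (auto simp: multilinear_def algebra_simps)

lemma tensor_linear: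
  assumes "t \<in> tensor_algebra s"
  shows "t (\<lambda>_. 0) = 0"
    and "multilinear s (*) \<phi> \<Longrightarrow> multilinear s (*) \<psi> \<Longrightarrow> t (\<lambda>xs. \<phi> xs + \<psi> xs) = t \<phi> + t \<psi>"
    and "multilinear s (*) \<phi> \<Longrightarrow> t (\<lambda>xs. c * \<phi> xs) = c * t \<phi>"
    and "\<not> multilinear s (*) \<phi> \<Longrightarrow> t \<phi> = 0"
  using assms
  by (induction rule: tensor_algebra_induct) (auto simp: multilinear_combinations algebra_simps)

lemma multilinear_partial:
  fixes s :: "'k::field \<Rightarrow> 'g::plus \<Rightarrow> 'g"
  assumes \<phi>: "multilinear s (*) \<phi>"
  shows "multilinear s (*) (\<lambda>ys. \<phi> (xs @ ys))"
    and "u \<in> tensor_algebra s \<Longrightarrow> multilinear s (*) (\<lambda>xs. u (\<lambda>ys. \<phi> (xs @ ys)))"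
proof -
  show *: "multilinear s (*) (\<lambda>ys. \<phi> (xs @ ys))" for xs
    using multilinearD[OF \<phi>, where xs = "xs @ _"] by (simp add: multilinear_def)
  show "multilinear s (*) (\<lambda>xs. u (\<lambda>ys. \<phi> (xs @ ys)))" if "u \<in> tensor_algebra s"
    using that
  proof (induction rule: tensor_algebra_induct)
    case zero
    then show ?case by (simp add: multilinear_combinations)
  next
    case (step c zs t)
    have "multilinear s (*) (\<lambda>xs. \<phi> (xs @ zs))"
      using multilinearD[OF \<phi>] by (simp add: multilinear_def)
    then show ?case
      using step * by (simp add: multilinear_combinations)
  qed
qed

lemma tmult_tens: "tmult s (tens s xs) (tens s ys) = tens s (xs @ ys)"
proof
  fix \<phi> :: "'a list \<Rightarrow> 'b"
  show "tmult s (tens s xs) (tens s ys) \<phi> = tens s (xs @ ys) \<phi>"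
  proof (cases "multilinear s (*) \<phi>")
    case True
    then show ?thesis
      using multilinear_partial(2)[OF True tensor_algebra_closed(2), of ys]
      by (simp add: tmult_def multilinear_partial)
  qed (simp add: tmult_def)
qed

lemma tmult_bilinear:
  shows "tmult s (t + t') u = tmult s t u + tmult s t' u"
    and "tmult s (tscale c t) u = tscale c (tmult s t u)"
    and "tmult s 0 u = 0"
    and "\<lbrakk>t \<in> tensor_algebra s; u \<in> tensor_algebra s; u' \<in> tensor_algebra s\<rbrakk>
      \<Longrightarrow> tmult s t (u + u') = tmult s t u + tmult s t u'"
    and "\<lbrakk>t \<in> tensor_algebra s; u \<in> tensor_algebra s\<rbrakk> \<Longrightarrow> tmult s t (tscale c u) = tscale c (tmult s t u)"
    and "t \<in> tensor_algebra s \<Longrightarrow> tmult s t 0 = 0"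
proof -
  show "tmult s t (u + u') = tmult s t u + tmult s t u'"
    if T: "t \<in> tensor_algebra s" "u \<in> tensor_algebra s" "u' \<in> tensor_algebra s"
  proof
    fix \<phi>
    show "tmult s t (u + u') \<phi> = (tmult s t u + tmult s t u') \<phi>"
    proof (cases "multilinear s (*) \<phi>")
      case True
      show ?thesis
        using tensor_linear(2)[OF T(1) multilinear_partial(2)[OF True T(2)] multilinear_partial(2)[OF True T(3)]] True
        by (simp add: tmult_def)
    qed (simp add: tmult_def)
  qed
  show "tmult s t (tscale c u) = tscale c (tmult s t u)"
    if T: "t \<in> tensor_algebra s" "u \<in> tensor_algebra s"
  proof
    fix \<phi>
    show "tmult s t (tscale c u) \<phi> = tscale c (tmult s t u) \<phi>"
    proof (cases "multilinear s (*) \<phi>")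
      case True
      show ?thesis
        using tensor_linear(3)[OF T(1) multilinear_partial(2)[OF True T(2)], of c] True
        by (simp add: tmult_def)
    qed (simp add: tmult_def)
  qed
qed (auto simp: fun_eq_iff tmult_def on_forms_def tensor_linear(1))

lemma tmult_closed:
  assumes "t \<in> tensor_algebra s" "u \<in> tensor_algebra s"
  shows "tmult s t u \<in> tensor_algebra s"
  using assms(1)
proof (induction rule: tensor_algebra_induct)
  case zero
  have "tmult s 0 u \<in> tensor_algebra s"
    by (simp add: tmult_bilinear tensor_algebra_closed)
  then show ?case .
next
  case (step c xs t)
  have "tmult s (tens s xs) u \<in> tensor_algebra s"
    using assms(2)
  proof (induction rule: tensor_algebra_induct)
    case zero
    have "tmult s (tens s xs) 0 \<in> tensor_algebra s"
      by (simp add: tmult_bilinear tensor_algebra_closed)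
    then show ?case .
  next
    case (step c ys u)
    then have "tmult s (tens s xs) (tscale c (tens s ys) + u) \<in> tensor_algebra s"
      by (simp add: tmult_bilinear tmult_tens tensor_algebra_closed)
    then show ?case .
  qed
  with step have "tmult s (tscale c (tens s xs) + t) u \<in> tensor_algebra s"
    by (simp add: tmult_bilinear tensor_algebra_closed)
  then show ?case .
qed

lemma tensor_ring_simps [simp]:
  "carrier (tensor_ring s) = tensor_algebra s"
  "x \<otimes>\<^bsub>tensor_ring s\<^esub> y = tmult s x y"
  "\<one>\<^bsub>tensor_ring s\<^esub> = tens s []"
  "\<zero>\<^bsub>tensor_ring s\<^esub> = 0"
  "x \<oplus>\<^bsub>tensor_ring s\<^esub> y = x + y"
  by (simp_all add: tensor_ring_def)

lemma ring_tensor_ring: "ring (tensor_ring s)"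
proof (rule ringI)
  show "abelian_group (tensor_ring s)"
    by (rule abelian_groupI)
      (auto simp: tensor_algebra_closed add_ac intro!: bexI[of _ "- _"])
  show "monoid (tensor_ring s)"
  proof (rule monoidI; simp)
    show "tmult s t u \<in> tensor_algebra s" if "t \<in> tensor_algebra s" "u \<in> tensor_algebra s" for t u
      using that by (simp add: tmult_closed)
    show "tens s [] \<in> tensor_algebra s"
      by (simp add: tensor_algebra_closed)
    show "tmult s (tmult s t u) v = tmult s t (tmult s u v)"
      if T: "t \<in> tensor_algebra s" "u \<in> tensor_algebra s" "v \<in> tensor_algebra s" for t u v
    proof
      fix \<phi>
      show "tmult s (tmult s t u) v \<phi> = tmult s t (tmult s u v) \<phi>"
        using T by (cases "multilinear s (*) \<phi>") (simp_all add: tmult_def multilinear_partial)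
    qed
    show "tmult s (tens s []) t = t" if T: "t \<in> tensor_algebra s" for t
    proof
      fix \<phi>
      show "tmult s (tens s []) t \<phi> = t \<phi>"
        using T by (cases "multilinear s (*) \<phi>")
          (simp_all add: tmult_def multilinear_partial(2) tensor_linear(4)[OF T])
    qed
    show "tmult s t (tens s []) = t" if T: "t \<in> tensor_algebra s" for t
    proof
      fix \<phi>
      show "tmult s t (tens s []) \<phi> = t \<phi>"
        using T by (cases "multilinear s (*) \<phi>")
          (simp_all add: tmult_def multilinear_partial(1) tensor_linear(4)[OF T])
    qed
  qed
qed (simp_all add: tmult_bilinear)

text \<open>The universal property of the tensor powers.\<close>

lemma tensor_algebra_universal:
  fixes s :: "'k::field \<Rightarrow> 'g::plus \<Rightarrow> 'g" and s' :: "'k \<Rightarrow> 'w::ab_group_add \<Rightarrow> 'w"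
  assumes "vector_space s'" and F: "multilinear s s' F"
  shows "\<exists>f. Vector_Spaces.linear tscale s' f \<and> (\<forall>xs. f (tens s xs) = F xs)"
proof -
  interpret W: vector_space s' by fact
  interpret TW: vector_space_pair tscale s' by standard
  interpret WK: vector_space_pair s' "(*)" by standard (auto simp: algebra_simps)
  obtain B where B: "B \<subseteq> range (tens s)" "tvs.independent B" "range (tens s) \<subseteq> tvs.span B"
    using tvs.maximal_independent_subset by blast
  obtain g where g: "Vector_Spaces.linear tscale s' g" "\<forall>b\<in>B. g b = F (SOME xs. tens s xs = b)"
    using TW.linear_independent_extend[OF B(2), of "\<lambda>b. F (SOME xs. tens s xs = b)"] by blast
  interpret g: Vector_Spaces.linear tscale s' g by fact
  have eq: "l (F xs) = l (g (tens s xs))" if l: "Vector_Spaces.linear s' (*) l" for l xs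
  proof -
    interpret l: Vector_Spaces.linear s' "(*)" l by fact
    have lF: "multilinear s (*) (\<lambda>xs. l (F xs))"
      using multilinearD[OF F] by (simp add: multilinear_def l.add l.scale)
    have "t (\<lambda>xs. l (F xs)) = l (g t)" if "t \<in> tvs.span B" for t
      using that
    proof (induction rule: tvs.span_induct_alt)
      case base
      have "(0 :: ('g, 'k) tensor) (\<lambda>xs. l (F xs)) = l (g 0)"
        by (simp add: g.zero l.zero)
      then show ?case .
    next
      case (step c b y)
      then have "tens s (SOME xs. tens s xs = b) = b"
        using B(1) by (auto intro: someI)
      then have "b (\<lambda>xs. l (F xs)) = l (g b)"
        using g(2) step(1) lF by (metis tens_simps(1))
      then have "(tscale c b + y) (\<lambda>xs. l (F xs)) = l (g (tscale c b + y))"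
        using step by (simp add: g.add g.scale l.add l.scale)
      then show ?case .
    qed
    from this[of "tens s xs"] show ?thesis
      using B(3) lF by auto
  qed
  have "g (tens s xs) = F xs" for xs
  proof (rule ccontr)
    let ?w = "F xs - g (tens s xs)"
    assume "g (tens s xs) \<noteq> F xs"
    then have "W.independent {?w}" by simp
    from WK.linear_independent_extend[OF this, of "\<lambda>_. 1"]
    obtain l where l: "Vector_Spaces.linear s' (*) l" "l ?w = 1" by auto
    interpret l: Vector_Spaces.linear s' "(*)" l by fact
    show False
      using l(2) eq[OF l(1), of xs] by (simp add: l.diff)
  qed
  with g(1) show ?thesis by blast
qed

text \<open>The symmetric tensors are the linear combinations of the products \<open>\<xi>\<^sub>1 \<cdots> \<xi>\<^sub>n\<close>.\<close>

lemma permute_list_update: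
  assumes "\<sigma> permutes {..<length xs}"
  shows "permute_list \<sigma> (xs[i := a]) = (permute_list \<sigma> xs)[inv_into UNIV \<sigma> i := a]"
proof (rule nth_equalityI)
  fix j assume "j < length (permute_list \<sigma> (xs[i := a]))"
  then have j: "j < length xs" by simp
  then have "\<sigma> j < length xs"
    using permutes_in_image[OF assms, of j] by simp
  moreover have "\<sigma> j = i \<longleftrightarrow> j = inv_into UNIV \<sigma> i"
    using permutes_inverses[OF assms] by metis
  ultimately show "permute_list \<sigma> (xs[i := a]) ! j = (permute_list \<sigma> xs)[inv_into UNIV \<sigma> i := a] ! j"
    using j assms by (auto simp: permute_list_nth nth_list_update)
qed simp

lemma multilinear_update:
  assumes "multilinear s s' \<phi>" "i < length xs"
  shows "\<phi> (xs[i := a + b]) = \<phi> (xs[i := a]) + \<phi> (xs[i := b])"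
    and "\<phi> (xs[i := s c a]) = s' c (\<phi> (xs[i := a]))"
  using assms(2) multilinearD[OF assms(1)] by (simp_all add: upd_conv_take_nth_drop)

lemma multilinear_permute:
  assumes \<phi>: "multilinear s s' \<phi>" and \<sigma>: "\<sigma> permutes {..<n}"
  shows "multilinear s s' (\<lambda>xs. if length xs = n then \<phi> (permute_list \<sigma> xs) else \<phi> xs)"
proof -
  have upd: "permute_list \<sigma> (xs @ a # ys) = (permute_list \<sigma> (xs @ a0 # ys))[inv_into UNIV \<sigma> (length xs) := a]"
    "inv_into UNIV \<sigma> (length xs) < length (permute_list \<sigma> (xs @ a0 # ys))"
    if "length (xs @ a0 # ys) = n" for xs ys and a a0 :: 'b
    using permute_list_update[of \<sigma> "xs @ a0 # ys" "length xs" a] that \<sigma>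
      permutes_in_image[OF permutes_inv[OF \<sigma>], of "length xs"] by auto
  show ?thesis
    unfolding multilinear_def
  proof (intro conjI allI)
    fix xs ys a b
    show "(if length (xs @ (a + b) # ys) = n then \<phi> (permute_list \<sigma> (xs @ (a + b) # ys)) else \<phi> (xs @ (a + b) # ys)) =
      (if length (xs @ a # ys) = n then \<phi> (permute_list \<sigma> (xs @ a # ys)) else \<phi> (xs @ a # ys)) +
      (if length (xs @ b # ys) = n then \<phi> (permute_list \<sigma> (xs @ b # ys)) else \<phi> (xs @ b # ys))"
      using upd(1)[of xs a ys "a + b"] upd(1)[of xs a ys b] upd(1)[of xs a ys a] upd(2)[of xs a ys]
        multilinear_update(1)[OF \<phi>] multilinearD(1)[OF \<phi>] by auto
  next
    fix xs c a ys
    show "(if length (xs @ s c a # ys) = n then \<phi> (permute_list \<sigma> (xs @ s c a # ys)) else \<phi> (xs @ s c a # ys)) =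
      s' c (if length (xs @ a # ys) = n then \<phi> (permute_list \<sigma> (xs @ a # ys)) else \<phi> (xs @ a # ys))"
      using upd(1)[of xs a ys "s c a"] upd(1)[of xs a ys a] upd(2)[of xs a ys]
        multilinear_update(2)[OF \<phi>] multilinearD(2)[OF \<phi>] by auto
  qed
qed

lemma sum_apply: "(sum f I) x = (\<Sum>i\<in>I. f i x)"
  by (induction I rule: infinite_finite_induct) auto

lemma sym_prod_mem_tensor_algebra: "sym_prod s xs \<in> tensor_algebra s"
  by (simp add: sym_prod_def tensor_algebra_closed)

lemma sym_prod_mem: "sym_prod s xs \<in> symmetric_algebra s"
proof -
  have "tperm s n \<sigma> (sym_prod s xs) \<phi> = sym_prod s xs \<phi>" if \<sigma>: "\<sigma> permutes {..<n}" for n \<sigma> \<phi>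
  proof (cases "multilinear s (*) \<phi>")
    case True
    show ?thesis
    proof (cases "length xs = n")
      case n: True
      have "(\<Sum>\<tau> | \<tau> permutes {..<n}. \<phi> (permute_list \<sigma> (permute_list \<tau> xs))) =
        (\<Sum>\<tau> | \<tau> permutes {..<n}. \<phi> (permute_list (\<tau> \<circ> \<sigma>) xs))"
        using \<sigma> n by (intro sum.cong refl) (simp add: permute_list_compose)
      also have "\<dots> = (\<Sum>\<tau> | \<tau> permutes {..<n}. \<phi> (permute_list \<tau> xs))"
        using sum_permutations_compose_right[OF \<sigma>, of "\<lambda>\<tau>. \<phi> (permute_list \<tau> xs)"]
        by (simp add: o_def)
      finally show ?thesis
        using True multilinear_permute[OF True \<sigma>] n
        by (simp add: tperm_def sym_prod_def sum_apply)
    next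
      case False
      then show ?thesis
        using True multilinear_permute[OF True \<sigma>]
        by (simp add: tperm_def sym_prod_def sum_apply)
    qed
  qed (simp add: tperm_def tensor_linear(4)[OF sym_prod_mem_tensor_algebra])
  then show ?thesis
    by (auto simp: symmetric_algebra_def sym_prod_mem_tensor_algebra)
qed

lemma multilinear_sum:
  assumes "\<And>i. i \<in> I \<Longrightarrow> multilinear s (*) (f i)"
  shows "multilinear s (*) (\<lambda>xs. \<Sum>i\<in>I. f i xs :: 'k::field)"
    and "t \<in> tensor_algebra s \<Longrightarrow> t (\<lambda>xs. \<Sum>i\<in>I. f i xs) = (\<Sum>i\<in>I. t (f i))"
proof -
  have "multilinear s (*) (\<lambda>xs. \<Sum>i\<in>I. f i xs) \<and>
      (t \<in> tensor_algebra s \<longrightarrow> t (\<lambda>xs. \<Sum>i\<in>I. f i xs) = (\<Sum>i\<in>I. t (f i)))"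
    using assms
    by (induction I rule: infinite_finite_induct)
      (auto simp: multilinear_combinations tensor_linear(1) tensor_linear(2)[of t s])
  then show "multilinear s (*) (\<lambda>xs. \<Sum>i\<in>I. f i xs)"
    and "t \<in> tensor_algebra s \<Longrightarrow> t (\<lambda>xs. \<Sum>i\<in>I. f i xs) = (\<Sum>i\<in>I. t (f i))"
    by blast+
qed

lemma multilinear_cutoff:
  "multilinear s (*) \<phi> \<Longrightarrow> multilinear s (*) (\<lambda>xs. if length xs = n then \<phi> xs else 0 :: 'k::field)"
  by (auto simp: multilinear_def)

lemma tensor_finite_degree:
  assumes "t \<in> tensor_algebra s"
  shows "\<exists>N. \<forall>M\<ge>N. \<forall>\<phi>. multilinear s (*) \<phi> \<longrightarrow>
    t \<phi> = (\<Sum>n<M. t (\<lambda>xs. if length xs = n then \<phi> xs else 0))"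
  using assms
proof (induction rule: tensor_algebra_induct)
  case (step c xs t)
  then obtain N where N: "\<forall>M\<ge>N. \<forall>\<phi>. multilinear s (*) \<phi> \<longrightarrow>
    t \<phi> = (\<Sum>n<M. t (\<lambda>xs. if length xs = n then \<phi> xs else 0))" by blast
  show ?case
  proof (intro exI[of _ "max N (Suc (length xs))"] allI impI)
    fix M \<phi> assume M: "max N (Suc (length xs)) \<le> M" and \<phi>: "multilinear s (*) \<phi>"
    have "(\<Sum>n<M. c * (if length xs = n then \<phi> xs else 0)) = c * \<phi> xs"
      using M by (simp add: sum.delta' flip: sum_distrib_left)
    moreover have "t \<phi> = (\<Sum>n<M. t (\<lambda>xs. if length xs = n then \<phi> xs else 0))"
      using N M \<phi> by simp
    ultimately show "(tscale c (tens s xs) + t) \<phi> =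
        (\<Sum>n<M. (tscale c (tens s xs) + t) (\<lambda>xs. if length xs = n then \<phi> xs else 0))"
      using \<phi> by (simp add: multilinear_cutoff sum.distrib)
  qed
qed simp

lemma symmetric_algebra_eq_span:
  fixes s :: "'k::field_char_0 \<Rightarrow> 'g::plus \<Rightarrow> 'g"
  shows "symmetric_algebra s = tvs.span (range (sym_prod s))"
proof
  have tperm: "tperm s n \<sigma> 0 = 0" "tperm s n \<sigma> (t + u) = tperm s n \<sigma> t + tperm s n \<sigma> u"
    "tperm s n \<sigma> (tscale c t) = tscale c (tperm s n \<sigma> t)" for n \<sigma> c t u
    by (auto simp: fun_eq_iff tperm_def on_forms_def)
  have "tvs.subspace (symmetric_algebra s)"
    unfolding tvs.subspace_def symmetric_algebra_def mem_Collect_eq tperm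
    by (auto intro: tensor_algebra_closed)
  then show "tvs.span (range (sym_prod s)) \<subseteq> symmetric_algebra s"
    by (intro tvs.span_minimal) (auto simp: sym_prod_mem)
next
  define Sy :: "('g list \<Rightarrow> 'k) \<Rightarrow> 'g list \<Rightarrow> 'k" where
    "Sy \<phi> = (\<lambda>xs. 1 / fact (length xs) * (\<Sum>\<sigma> | \<sigma> permutes {..<length xs}. \<phi> (permute_list \<sigma> xs)))" for \<phi>
  have Sy: "multilinear s (*) (Sy \<phi>)" if \<phi>: "multilinear s (*) \<phi>" for \<phi>
    unfolding multilinear_def
  proof (intro conjI allI)
    fix xs ys :: "'g list" and a b :: 'g and c :: 'k
    let ?n = "Suc (length xs + length ys)"
    have "\<phi> (permute_list \<sigma> (xs @ (a + b) # ys)) =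
        \<phi> (permute_list \<sigma> (xs @ a # ys)) + \<phi> (permute_list \<sigma> (xs @ b # ys))"
      and "\<phi> (permute_list \<sigma> (xs @ s c a # ys)) = c * \<phi> (permute_list \<sigma> (xs @ a # ys))"
      if "\<sigma> permutes {..<?n}" for \<sigma>
      using multilinearD[OF multilinear_permute[OF \<phi> that], where xs = xs and ys = ys] by simp_all
    then show "Sy \<phi> (xs @ (a + b) # ys) = Sy \<phi> (xs @ a # ys) + Sy \<phi> (xs @ b # ys)"
      and "Sy \<phi> (xs @ s c a # ys) = c * Sy \<phi> (xs @ a # ys)"
      by (simp_all add: Sy_def sum.distrib add_divide_distrib flip: sum_distrib_left)
  qed
  define sy where "sy t = on_forms s (\<lambda>\<phi>. t (Sy \<phi>))" for t :: "('g, 'k) tensor"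
  have span: "sy t \<in> tvs.span (range (sym_prod s))" if "t \<in> tensor_algebra s" for t
    using that
  proof (induction rule: tensor_algebra_induct)
    case zero
    have "sy 0 = 0"
      by (auto simp: sy_def on_forms_def fun_eq_iff)
    then have "sy 0 \<in> tvs.span (range (sym_prod s))"
      by (simp only: tvs.span_zero)
    then show ?case .
  next
    case (step c xs t)
    have "sy (tscale c (tens s xs) + t) \<phi> = (tscale c (sym_prod s xs) + sy t) \<phi>" for \<phi>
      by (cases "multilinear s (*) \<phi>")
        (simp_all add: sy_def Sy Sy_def[of \<phi>, THEN fun_cong, of xs] sym_prod_def sum_apply)
    then have "sy (tscale c (tens s xs) + t) = tscale c (sym_prod s xs) + sy t" by blast
    moreover have "tscale c (sym_prod s xs) + sy t \<in> tvs.span (range (sym_prod s))"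
      by (rule tvs.span_add[OF tvs.span_scale[OF tvs.span_base[OF rangeI]] step(2)])
    ultimately have "sy (tscale c (tens s xs) + t) \<in> tvs.span (range (sym_prod s))"
      by (simp only:)
    then show ?case .
  qed
  show "symmetric_algebra s \<subseteq> tvs.span (range (sym_prod s))"
  proof
    fix t assume "t \<in> symmetric_algebra s"
    then have T: "t \<in> tensor_algebra s"
      and inv: "\<And>n \<sigma>. \<sigma> permutes {..<n} \<Longrightarrow> tperm s n \<sigma> t = t"
      by (auto simp: symmetric_algebra_def)
    have "sy t \<phi> = t \<phi>" for \<phi>
    proof (cases "multilinear s (*) \<phi>")
      case \<phi>: True
      have deg: "t (\<lambda>xs. if length xs = n then Sy \<phi> xs else 0) =
          t (\<lambda>xs. if length xs = n then \<phi> xs else 0)" for n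
      proof -
        define c where "c = (\<lambda>xs. if length xs = n then \<phi> xs else 0)"
        define g where "g \<sigma> = (\<lambda>xs. if length xs = n then c (permute_list \<sigma> xs) else c xs)" for \<sigma>
        have c: "multilinear s (*) c"
          unfolding c_def by (rule multilinear_cutoff[OF \<phi>])
        have g: "multilinear s (*) (g \<sigma>)" if "\<sigma> \<in> {\<sigma>. \<sigma> permutes {..<n}}" for \<sigma>
          using that multilinear_permute[OF c] by (simp add: g_def)
        have "t (g \<sigma>) = t c" if "\<sigma> permutes {..<n}" for \<sigma>
          using fun_cong[OF inv[OF that], of c] c by (simp add: tperm_def g_def)
        then have "(\<Sum>\<sigma> | \<sigma> permutes {..<n}. t (g \<sigma>)) = fact n * t c"
          by (simp add: card_permutations[of "{..<n}" n])
        then have sum: "t (\<lambda>xs. \<Sum>\<sigma> | \<sigma> permutes {..<n}. g \<sigma> xs) = fact n * t c"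
          using multilinear_sum(2)[of "{\<sigma>. \<sigma> permutes {..<n}}" s g, OF g T] by simp
        have "(\<lambda>xs. if length xs = n then Sy \<phi> xs else 0) =
            (\<lambda>xs. 1 / fact n * (\<Sum>\<sigma> | \<sigma> permutes {..<n}. g \<sigma> xs))"
          by (auto simp: Sy_def fun_eq_iff g_def c_def)
        then have "t (\<lambda>xs. if length xs = n then Sy \<phi> xs else 0) = 1 / fact n * (fact n * t c)"
          using tensor_linear(3)[OF T multilinear_sum(1)[of "{\<sigma>. \<sigma> permutes {..<n}}" s g, OF g]]
          by (simp only: sum)
        then show ?thesis
          by (simp add: c_def)
      qed
      obtain N where N: "\<And>\<psi>. multilinear s (*) \<psi> \<Longrightarrow>
          t \<psi> = (\<Sum>n<N. t (\<lambda>xs. if length xs = n then \<psi> xs else 0))"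
        using tensor_finite_degree[OF T] by blast
      show ?thesis
        using N[OF \<phi>] N[OF Sy[OF \<phi>]] \<phi> by (simp add: sy_def deg)
    next
      case False
      then show ?thesis
        using tensor_linear(4)[OF T] by (simp add: sy_def)
    qed
    then have "sy t = t" by blast
    with span[OF T] show "t \<in> tvs.span (range (sym_prod s))" by simp
  qed
qed

text \<open>The defining formula of the symmetrisation map.\<close>

lemma ideal_env_ideal: "ideal (env_ideal s br) (tensor_ring s)"
  unfolding env_ideal_def
  by (rule ring.genideal_ideal[OF ring_tensor_ring]) (auto simp: tensor_algebra_closed)

lemma quantization_sym_prod:
  fixes s :: "'k::field_char_0 \<Rightarrow> 'g::plus \<Rightarrow> 'g"
  defines "U \<equiv> env_algebra s"
  shows "quantization s br (sym_prod s xs) =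
    quantization s br (tscale (1 / fact (length xs)) (tens s [])) \<otimes>\<^bsub>U br\<^esub>
    (\<Oplus>\<^bsub>U br\<^esub> \<sigma> \<in> {\<sigma>. \<sigma> permutes {..<length xs}}.
       foldr (\<lambda>x u. quantization s br (tens s [x]) \<otimes>\<^bsub>U br\<^esub> u) (permute_list \<sigma> xs) \<one>\<^bsub>U br\<^esub>)"
proof -
  interpret ideal "env_ideal s br" "tensor_ring s" by (rule ideal_env_ideal)
  interpret h: ring_hom_ring "tensor_ring s" "U br" "quantization s br"
    using rcos_ring_hom_ring by (simp add: U_def env_algebra_def quantization_def[abs_def])
  have prod: "quantization s br (tens s ys) =
      foldr (\<lambda>x u. quantization s br (tens s [x]) \<otimes>\<^bsub>U br\<^esub> u) ys \<one>\<^bsub>U br\<^esub>" for ys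
  proof (induction ys)
    case Nil
    show ?case using h.hom_one by simp
  next
    case (Cons y ys)
    have "quantization s br (tens s (y # ys)) = quantization s br (tmult s (tens s [y]) (tens s ys))"
      by (simp add: tmult_tens)
    then show ?case
      using Cons h.hom_mult[of "tens s [y]" "tens s ys"] by (simp add: tensor_algebra_closed)
  qed
  have sum: "quantization s br (\<Sum>i\<in>I. f i) = (\<Oplus>\<^bsub>U br\<^esub> i \<in> I. quantization s br (f i))"
    if "finite I" "\<And>i. i \<in> I \<Longrightarrow> f i \<in> tensor_algebra s" for I and f :: "_ \<Rightarrow> ('g, 'k) tensor"
    using that
  proof (induction rule: finite_induct)
    case empty
    have "quantization s br (\<Sum>i\<in>{}. f i) = (\<Oplus>\<^bsub>U br\<^esub> i \<in> {}. quantization s br (f i))"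
      using h.hom_zero by (simp only: sum.empty h.S.finsum_empty tensor_ring_simps)
    then show ?case .
  next
    case (insert i I)
    then have "quantization s br (f i + sum f I) = (\<Oplus>\<^bsub>U br\<^esub> i \<in> insert i I. quantization s br (f i))"
      using h.hom_add[of "f i" "sum f I"] h.hom_closed
      by (simp add: tensor_algebra_closed Pi_def)
    then have "quantization s br (\<Sum>i\<in>insert i I. f i) = (\<Oplus>\<^bsub>U br\<^esub> i \<in> insert i I. quantization s br (f i))"
      by (simp only: sum.insert[OF insert(1,2)])
    then show ?case .
  qed
  let ?P = "{\<sigma>. \<sigma> permutes {..<length xs}}"
  have "tmult s (tscale c (tens s [])) t = tscale c t" if "t \<in> tensor_algebra s" for c t
    using that ring.ring_simprules(12)[OF ring_tensor_ring, of t s]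
    by (simp add: tmult_bilinear)
  then have "sym_prod s xs = tmult s (tscale (1 / fact (length xs)) (tens s []))
      (\<Sum>\<sigma>\<in>?P. tens s (permute_list \<sigma> xs))"
    by (simp add: sym_prod_def tensor_algebra_closed)
  then have "quantization s br (sym_prod s xs) =
      quantization s br (tscale (1 / fact (length xs)) (tens s [])) \<otimes>\<^bsub>U br\<^esub>
      quantization s br (\<Sum>\<sigma>\<in>?P. tens s (permute_list \<sigma> xs))"
    using h.hom_mult[of "tscale (1 / fact (length xs)) (tens s [])" "\<Sum>\<sigma>\<in>?P. tens s (permute_list \<sigma> xs)"]
    by (simp only: tensor_ring_simps tensor_algebra_closed)
  also have "quantization s br (\<Sum>\<sigma>\<in>?P. tens s (permute_list \<sigma> xs)) =
      (\<Oplus>\<^bsub>U br\<^esub> \<sigma> \<in> ?P. quantization s br (tens s (permute_list \<sigma> xs)))"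
    by (rule sum) (auto simp: finite_permutations tensor_algebra_closed)
  also have "(\<lambda>\<sigma>. quantization s br (tens s (permute_list \<sigma> xs))) =
      (\<lambda>\<sigma>. foldr (\<lambda>x u. quantization s br (tens s [x]) \<otimes>\<^bsub>U br\<^esub> u) (permute_list \<sigma> xs) \<one>\<^bsub>U br\<^esub>)"
    by (rule ext) (rule prod)
  finally show ?thesis .
qed

end

theory Submission
  imports Defs "HOL-Computational_Algebra.Formal_Power_Series"
begin

text \<open>On symmetric tensors, left multiplication by \<open>\<xi>\<close> in the enveloping algebra is
  \<open>x\<^sup>n \<mapsto> \<Sum>\<^sub>j (n choose j) B\<^sub>j ad\<^sub>x\<^sup>j(\<xi>) x\<^sup>n\<^sup>-\<^sup>j\<close>: the invariant vector field \<open>(ad x / (e\<^sup>a\<^sup>d\<^sup>x - 1)) \<xi>\<close> in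
  exponential coordinates. The Maurer-Cartan identity says that these operators represent the Lie
  algebra, hence the symmetrisation map is bijective, and \<open>C\<^sub>n(x\<^sub>1\<cdots>x\<^sub>k, y\<^sub>1\<cdots>y\<^sub>l)\<close> is a combination of products
  of \<open>k + l - n\<close> bracket words in the letters, with coefficients bounded through
  \<open>\<bar>B\<^sub>j / j!\<bar> \<le> 2\<^sup>-\<^sup>j\<close>. An asymptotic estimate \<open>q\<close> bounds all these words. As the words have at most \<open>M\<close>
  letters, \<open>k + l \<le> M (k + l - n)\<close>, and so the factor of order \<open>n!\<^sup>1\<^sup>-\<^sup>R\<close> that remains is at most
  \<open>(k + l)!\<^sup>\<epsilon>\<close> up to exponentials. All estimates hold with \<open>R + \<epsilon> < 1\<close>, so that \<open>\<star>\<^sub>z\<close> and the \<open>C\<^sub>n\<close> extend to the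
  completion, and applied with a larger parameter they make the series converge geometrically.\<close>

section \<open>Bernoulli coefficients\<close>

text \<open>Multiplying by one letter at a time takes the place of the Baker-Campbell-Hausdorff
  series. Operator identities need to be checked only on the powers x^n, which span the symmetric
  tensors by polarization; there the Lie algebra enters through a single ad x and one further
  vector, and by nilpotency the power series in ad x are polynomials. Bijectivity rests on two facts
  about the same operators: modulo the ideal they are left multiplications, so every tensor has a
  symmetric representative; applied to the unit they reproduce every symmetric tensor, so the
  representative is unique. The projective seminorms are infima over representations by arbitrary
  tensors; they are compatible with the symmetric theory because such a representation of a
  symmetric tensor can be symmetrised without any cost. In the constants, e comes from m^n \<le> e^m
  n!, and 32 = 2 * 2 * 8 collects the cost of each letter multiplied on, the splitting of (k + l)!
  into k! l!, and the room for 2 * 8^n with n < k + l.\<close>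

text \<open>\<open>bern_fps\<close> is \<open>x / (e\<^sup>x - 1)\<close>, so \<open>bern n\<close> is the Bernoulli number \<open>B\<^sub>n\<close> divided by \<open>n!\<close>.\<close>

definition bern_fps :: "'k::field_char_0 fps" where
  "bern_fps = inverse (Abs_fps (\<lambda>n. 1 / fact (Suc n)))"

definition bern :: "nat \<Rightarrow> 'k::field_char_0" where
  "bern n = fps_nth bern_fps n"

lemma bern_fps_times: "bern_fps * Abs_fps (\<lambda>n. 1 / fact (Suc n)) = (1 :: 'k::field_char_0 fps)"
  unfolding bern_fps_def by (rule inverse_mult_eq_1) simp

lemma bern_convolution:
  "(\<Sum>i\<le>n. bern i / fact (Suc (n - i))) = (if n = 0 then 1 else 0 :: 'k::field_char_0)"
  using arg_cong[OF bern_fps_times, of "\<lambda>f. fps_nth f n"]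
  by (simp add: fps_mult_nth bern_def atLeast0AtMost split: if_splits)

lemma bern_simps: "bern 0 = (1 :: 'k::field_char_0)" "bern (Suc 0) = (- 1 / 2 :: 'k::field_char_0)"
proof -
  show "bern 0 = (1 :: 'k)"
    using bern_convolution[of 0, where 'k = 'k] by simp
  then have "1 / 2 + bern (Suc 0) = (0 :: 'k)"
    using bern_convolution[of "Suc 0", where 'k = 'k] by simp
  then show "bern (Suc 0) = (- 1 / 2 :: 'k)"
    by (simp add: add_eq_0_iff)
qed

text \<open>Obtained by differentiating b c = 1 and X c = e^X - 1 and eliminating c. The equation is
  quadratic in b, so its coefficients express \<open>bern n\<close> through earlier ones and admit
  an inductive bound.\<close>

lemma bern_fps_ode:
  "fps_X * fps_deriv bern_fps = bern_fps - bern_fps ^ 2 - fps_X * (bern_fps :: 'k::field_char_0 fps)"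
proof -
  define c :: "'k fps" where "c = Abs_fps (\<lambda>n. 1 / fact (Suc n))"
  define b :: "'k fps" where "b = bern_fps"
  have bc: "b * c = 1"
    unfolding b_def c_def by (rule bern_fps_times)
  have Xc: "fps_X * c = fps_exp 1 - 1"
  proof (rule fps_ext)
    fix n show "fps_nth (fps_X * c) n = fps_nth (fps_exp 1 - 1) n"
      by (cases n) (simp_all add: c_def distrib_right)
  qed
  have "c + fps_X * fps_deriv c = fps_exp 1"
    using arg_cong[OF Xc, of fps_deriv] by (simp add: add.commute)
  then have e: "fps_X * fps_deriv c = 1 + fps_X * c - c"
    unfolding Xc by (simp add: eq_diff_eq add.commute)
  have "fps_deriv b * c = - (b * fps_deriv c)"
    using arg_cong[OF bc, of fps_deriv] by (simp add: add_eq_0_iff)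
  \<comment> \<open>Multiplying by b leaves c only inside products b c, which are 1; no division by
    c is needed.\<close>
  then have "fps_X * fps_deriv b * (b * c) = - b * (fps_X * fps_deriv c) * b"
    by (metis (no_types, lifting) mult.assoc mult.commute mult_minus_left)
  also have "\<dots> = - b * b - fps_X * b * (b * c) + b * (b * c)"
    unfolding e by (simp only: ring_distribs mult_ac) simp
  finally show ?thesis
    unfolding bc by (simp add: b_def power2_eq_square)
qed

text \<open>Euler's convolution identity. The end terms i = 0 and i = n of the square contribute 2
  \<open>bern n\<close>, which raises the coefficient on the left to n + 1.\<close>

lemma bern_quadratic:
  assumes "n \<ge> 2"
  shows "of_nat (Suc n) * bern n = - bern (n - 1) - (\<Sum>i=1..<n. bern i * bern (n - i) :: 'k::field_char_0)"
proof -
  have "of_nat n * bern n = bern n - (\<Sum>i=0..n. bern i * bern (n - i)) - (bern (n - 1) :: 'k)"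
    using arg_cong[OF bern_fps_ode, of "\<lambda>f. fps_nth f n"] assms
    by (simp add: power2_eq_square fps_mult_nth[of bern_fps] bern_def)
  moreover have "(\<Sum>i=0..n. bern i * bern (n - i)) = bern n + (\<Sum>i=1..<n. bern i * bern (n - i)) + (bern n :: 'k)"
  proof -
    have "{0..n} = insert 0 (insert n {1..<n})" using assms by auto
    then show ?thesis using assms by (simp add: bern_simps)
  qed
  ultimately show ?thesis by (simp add: ring_distribs)
qed

text \<open>In the recursion the bound closes exactly: 2^-(n-1) + (n - 1) 2^-n = (n + 1) 2^-n. It is
  attained at n = 0 and n = 1, and its rate 1/2 makes the later sums over j geometric.\<close>

lemma norm_bern: "norm (bern n :: 'k::real_normed_field) \<le> 1 / 2 ^ n"
proof (induction n rule: less_induct)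
  case (less n)
  consider "n = 0" | "n = 1" | "n \<ge> 2" by linarith
  then show ?case
  proof cases
    case 3
    have "real (Suc n) * norm (bern n :: 'k) = norm (of_nat (Suc n) * bern n :: 'k)"
      by (simp only: norm_mult norm_of_nat)
    also have "\<dots> \<le> norm (bern (n - 1) :: 'k) + (\<Sum>i=1..<n. norm (bern i * bern (n - i) :: 'k))"
    proof -
      have "norm (of_nat (Suc n) * bern n :: 'k) \<le>
          norm (- bern (n - 1) :: 'k) + norm (\<Sum>i=1..<n. bern i * bern (n - i) :: 'k)"
        by (simp only: bern_quadratic[OF 3] norm_triangle_ineq4)
      then show ?thesis
        using norm_sum[of "\<lambda>i. bern i * bern (n - i) :: 'k" "{1..<n}"] by simp
    qed
    also have "\<dots> \<le> 1 / 2 ^ (n - 1) + (\<Sum>i=1..<n. 1 / 2 ^ n)"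
    proof (intro add_mono sum_mono)
      show "norm (bern (n - 1) :: 'k) \<le> 1 / 2 ^ (n - 1)" using 3 by (intro less) simp
      fix i assume i: "i \<in> {1..<n}"
      have "norm (bern i * bern (n - i) :: 'k) \<le> 1 / 2 ^ i * (1 / 2 ^ (n - i))"
        unfolding norm_mult using i by (intro mult_mono less) auto
      also have "\<dots> = 1 / 2 ^ n" using i by (simp flip: power_add)
      finally show "norm (bern i * bern (n - i) :: 'k) \<le> 1 / 2 ^ n" .
    qed
    also have "\<dots> = real (Suc n) * (1 / 2 ^ n)"
      using 3 by (cases n) (simp_all add: field_simps of_nat_diff)
    finally show ?thesis
      by (rule mult_left_le_imp_le) simp
  next
    case 1
    then show ?thesis by (simp only: bern_simps) simp
  next
    case 2
    then show ?thesis by (simp only: One_nat_def bern_simps) (simp add: norm_divide)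
  qed
qed

section \<open>Symmetric tensors\<close>

lemma multilinear_zero:
  fixes s' :: "'k \<Rightarrow> 'w::ab_group_add \<Rightarrow> 'w" and \<phi> :: "'g::ab_group_add list \<Rightarrow> 'w"
  assumes "multilinear s s' \<phi>"
  shows "\<phi> (as @ 0 # bs) = 0"
  using multilinearD(1)[OF assms, of as 0 0 bs] by simp

lemma multilinear_sum_slot:
  fixes s' :: "'k \<Rightarrow> 'w::ab_group_add \<Rightarrow> 'w" and \<phi> :: "'g::ab_group_add list \<Rightarrow> 'w"
  assumes "multilinear s s' \<phi>"
  shows "\<phi> (as @ (\<Sum>i\<in>A. x i) # bs) = (\<Sum>i\<in>A. \<phi> (as @ x i # bs))"
  by (induction A rule: infinite_finite_induct)
    (simp_all add: multilinear_zero[OF assms] multilinearD(1)[OF assms])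

lemma multilinear_sum_replicate:
  fixes s' :: "'k \<Rightarrow> 'w::ab_group_add \<Rightarrow> 'w" and \<phi> :: "'g::ab_group_add list \<Rightarrow> 'w"
  assumes "multilinear s s' \<phi>" and "finite A"
  shows "\<phi> (as @ replicate m (\<Sum>i\<in>A. x i)) =
    (\<Sum>js | set js \<subseteq> A \<and> length js = m. \<phi> (as @ map x js))"
proof (induction m arbitrary: as)
  case 0
  have "{js. set js \<subseteq> A \<and> js = []} = {[]}" by auto
  then show ?case by simp
next
  case (Suc m)
  have "\<phi> (as @ replicate (Suc m) (\<Sum>i\<in>A. x i)) =
      (\<Sum>i\<in>A. \<phi> ((as @ [x i]) @ replicate m (\<Sum>i\<in>A. x i)))"
    using multilinear_sum_slot[OF assms(1), of as x A] by simp
  also have "\<dots> = (\<Sum>i\<in>A. \<Sum>js | set js \<subseteq> A \<and> length js = m. \<phi> (as @ map x (i # js)))"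
    by (simp only: Suc.IH) simp
  also have "\<dots> = (\<Sum>js | set js \<subseteq> A \<and> length js = m. \<Sum>i\<in>A. \<phi> (as @ map x (i # js)))"
    by (rule sum.swap)
  also have "\<dots> = (\<Sum>(js, i)\<in>{js. set js \<subseteq> A \<and> length js = m} \<times> A. \<phi> (as @ map x (i # js)))"
    by (rule sum.cartesian_product)
  also have "\<dots> = (\<Sum>js\<in>(\<lambda>(js, i). i # js) ` ({js. set js \<subseteq> A \<and> length js = m} \<times> A). \<phi> (as @ map x js))"
    by (subst sum.reindex) (auto simp: inj_on_def split_def)
  finally show ?case
    by (simp only: lists_length_Suc_eq)
qed

text \<open>A word of length n in which all n indices occur is a permutation. In this form the sum
  is the top term of an inclusion-exclusion over the set of indices that occur.\<close>

lemma sum_permutes_eq_sum_lists: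
  fixes F :: "'g list \<Rightarrow> 'w::comm_monoid_add"
  assumes "length xs = n"
  shows "(\<Sum>\<sigma> | \<sigma> permutes {..<n}. F (permute_list \<sigma> xs)) =
    (\<Sum>js | set js = {..<n} \<and> length js = n. F (map ((!) xs) js))"
proof (rule sum.reindex_bij_witness[where i = "\<lambda>js i. if i < n then js ! i else i" and j = "\<lambda>\<sigma>. map \<sigma> [0..<n]"])
  fix \<sigma> assume "\<sigma> \<in> {\<sigma>. \<sigma> permutes {..<n}}"
  then have \<sigma>: "\<sigma> permutes {..<n}" by simp
  show "(\<lambda>i. if i < n then map \<sigma> [0..<n] ! i else i) = \<sigma>"
    using permutes_not_in[OF \<sigma>] by (auto simp: fun_eq_iff)
  show "map \<sigma> [0..<n] \<in> {js. set js = {..<n} \<and> length js = n}"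
    using permutes_image[OF \<sigma>] by (simp add: lessThan_atLeast0)
  show "F (map ((!) xs) (map \<sigma> [0..<n])) = F (permute_list \<sigma> xs)"
    using assms by (simp add: permute_list_def o_def)
next
  fix js assume "js \<in> {js. set js = {..<n} \<and> length js = n}"
  then have js: "set js = {..<n}" "length js = n" by auto
  then have "distinct js"
    by (simp add: card_distinct)
  then have "bij_betw ((!) js) {..<n} {..<n}"
    by (rule bij_betw_nth) (simp_all only: js)
  then have "bij_betw (\<lambda>i. if i < n then js ! i else i) {..<n} {..<n}"
    by (subst bij_betw_cong[where g = "(!) js"]) auto
  then show "(\<lambda>i. if i < n then js ! i else i) \<in> {\<sigma>. \<sigma> permutes {..<n}}"
    by (auto intro!: bij_imp_permutes split: if_splits)
  show "map (\<lambda>i. if i < n then js ! i else i) [0..<n] = js"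
    by (rule nth_equalityI) (use js in auto)
qed

text \<open>Expanding a power of the partial sum over A gives all words with indices in A. Sorting
  them by the set of indices that occur and inverting over subsets isolates the words that use every
  index.\<close>

theorem polarization:
  fixes \<phi> :: "'g::ab_group_add list \<Rightarrow> 'k::field"
  assumes \<phi>: "multilinear s (*) \<phi>"
  shows "(\<Sum>\<sigma> | \<sigma> permutes {..<length xs}. \<phi> (permute_list \<sigma> xs)) =
    (-1) ^ length xs * (\<Sum>A\<in>Pow {..<length xs}. (-1) ^ card A * \<phi> (replicate (length xs) (\<Sum>i\<in>A. xs ! i)))"
proof -
  let ?n = "length xs"
  define e where "e S = (\<Sum>js | set js = S \<and> length js = ?n. \<phi> (map ((!) xs) js))" for S
  \<comment> \<open>The sign brings the pair f, g into the self-inverse form of inclusion-exclusion,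
    where each is obtained from the other by the same formula.\<close>
  define f where "f S = (-1) ^ card S * e S" for S
  define g where "g A = \<phi> (replicate ?n (\<Sum>i\<in>A. xs ! i))" for A
  have "g S = (\<Sum>T\<in>Pow S. (-1) ^ card T * f T)" if "finite S" for S
  proof -
    have "g S = (\<Sum>js | set js \<subseteq> S \<and> length js = ?n. \<phi> (map ((!) xs) js))"
      using multilinear_sum_replicate[OF \<phi> that, of "[]" ?n "(!) xs"] by (simp add: g_def)
    also have "\<dots> = (\<Sum>T\<in>Pow S. \<Sum>js\<in>{js \<in> {js. set js \<subseteq> S \<and> length js = ?n}. set js = T}. \<phi> (map ((!) xs) js))"
      by (rule sum.group[symmetric]) (use that finite_lists_length_eq[OF that] in auto)
    also have "\<dots> = (\<Sum>T\<in>Pow S. e T)"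
      unfolding e_def by (intro sum.cong refl) auto
    finally show ?thesis
      by (simp add: f_def flip: mult.assoc power_add)
  qed
  then have "f {..<?n} = (\<Sum>T\<in>Pow {..<?n}. (-1) ^ card T * g T)"
    by (rule inclusion_exclusion_symmetric) auto
  then have "(-1) ^ ?n * ((-1) ^ ?n * e {..<?n}) = (-1) ^ ?n * (\<Sum>T\<in>Pow {..<?n}. (-1) ^ card T * g T)"
    by (simp only: f_def card_lessThan)
  then have "e {..<?n} = (-1) ^ ?n * (\<Sum>T\<in>Pow {..<?n}. (-1) ^ card T * g T)"
    by (simp flip: mult.assoc power_add)
  then show ?thesis
    by (simp add: e_def g_def sum_permutes_eq_sum_lists)
qed

lemma multilinear_tens:
  fixes s :: "'k::field \<Rightarrow> 'g::plus \<Rightarrow> 'g"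
  shows "multilinear s tscale (tens s)"
  unfolding multilinear_def
proof (intro conjI allI ext)
  fix xs ys a b c \<phi>
  show "tens s (xs @ (a + b) # ys) \<phi> = (tens s (xs @ a # ys) + tens s (xs @ b # ys)) \<phi>"
    by (cases "multilinear s (*) \<phi>") (simp_all add: multilinearD)
  show "tens s (xs @ s c a # ys) \<phi> = tscale c (tens s (xs @ a # ys)) \<phi>"
    by (cases "multilinear s (*) \<phi>") (simp_all add: multilinearD)
qed

lemma sym_prod_apply:
  "multilinear s (*) \<phi> \<Longrightarrow> sym_prod s xs \<phi> =
    1 / fact (length xs) * (\<Sum>\<sigma> | \<sigma> permutes {..<length xs}. \<phi> (permute_list \<sigma> xs))"
  "\<not> multilinear s (*) \<phi> \<Longrightarrow> sym_prod s xs \<phi> = 0"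
  by (simp_all add: sym_prod_def sum_apply)

lemma multilinear_sym_prod:
  fixes s :: "'k::field_char_0 \<Rightarrow> 'g::plus \<Rightarrow> 'g"
  shows "multilinear s tscale (sym_prod s)"
  unfolding multilinear_def
proof (intro conjI allI ext)
  fix xs ys :: "'g list" and a b c \<phi>
  let ?n = "Suc (length xs + length ys)"
  have *: "\<phi> (permute_list \<sigma> (xs @ (a + b) # ys)) =
      \<phi> (permute_list \<sigma> (xs @ a # ys)) + \<phi> (permute_list \<sigma> (xs @ b # ys))"
    "\<phi> (permute_list \<sigma> (xs @ s c a # ys)) = c * \<phi> (permute_list \<sigma> (xs @ a # ys))"
    if "\<sigma> permutes {..<?n}" "multilinear s (*) \<phi>" for \<sigma>
    using multilinearD[OF multilinear_permute[OF that(2,1)], where xs = xs and ys = ys] by simp_all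
  show "sym_prod s (xs @ (a + b) # ys) \<phi> = (sym_prod s (xs @ a # ys) + sym_prod s (xs @ b # ys)) \<phi>"
    using * by (cases "multilinear s (*) \<phi>") (simp_all add: sym_prod_apply sum.distrib add_divide_distrib)
  show "sym_prod s (xs @ s c a # ys) \<phi> = tscale c (sym_prod s (xs @ a # ys)) \<phi>"
    using * by (cases "multilinear s (*) \<phi>") (simp_all add: sym_prod_apply flip: sum_distrib_left)
qed

lemma sym_prod_cong_mset:
  assumes "mset xs = mset ys"
  shows "sym_prod s xs = sym_prod s ys"
proof -
  obtain \<pi> where \<pi>: "\<pi> permutes {..<length ys}" "permute_list \<pi> ys = xs"
    using mset_eq_permutation[OF assms] by blast
  have len: "length xs = length ys"
    using assms by (rule mset_eq_length)
  have "(\<Sum>\<sigma> | \<sigma> permutes {..<length ys}. tens s (permute_list \<sigma> ys)) =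
      (\<Sum>\<sigma> | \<sigma> permutes {..<length ys}. tens s (permute_list (\<pi> \<circ> \<sigma>) ys))"
    using setum_permutations_compose_left[OF \<pi>(1)] .
  also have "\<dots> = (\<Sum>\<sigma> | \<sigma> permutes {..<length ys}. tens s (permute_list \<sigma> xs))"
    using \<pi> by (intro sum.cong refl) (simp add: permute_list_compose)
  finally show ?thesis
    by (simp add: sym_prod_def len)
qed

lemma sym_prod_replicate: "sym_prod s (replicate n x) = tens s (replicate n x)"
proof -
  have "permute_list \<sigma> (replicate n x) = replicate n x" if "\<sigma> permutes {..<n}" for \<sigma>
    using that permutes_in_image[OF that] by (intro nth_equalityI) (auto simp: permute_list_nth)
  then have "sym_prod s (replicate n x) \<phi> = tens s (replicate n x) \<phi>" for \<phi>
    by (cases "multilinear s (*) \<phi>") (simp_all add: sym_prod_apply card_permutations[of "{..<n}" n])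
  then show ?thesis ..
qed

text \<open>The coefficients in the polarization formula do not depend on the form, so it is an
  identity between tensors; dividing by n! uses characteristic 0.\<close>

lemma symmetric_algebra_eq_span_powers:
  fixes s :: "'k::field_char_0 \<Rightarrow> 'g::ab_group_add \<Rightarrow> 'g"
  shows "symmetric_algebra s = tvs.span {tens s (replicate n x) | n x. True}" (is "_ = tvs.span ?P")
proof
  have "tens s (replicate n x) \<in> symmetric_algebra s" for n x
    using sym_prod_mem[of s "replicate n x"] by (simp add: sym_prod_replicate)
  then have "tvs.span ?P \<subseteq> tvs.span (symmetric_algebra s)"
    by (intro tvs.span_mono) auto
  then show "tvs.span ?P \<subseteq> symmetric_algebra s"
    by (simp add: symmetric_algebra_eq_span tvs.span_span)
next
  have "sym_prod s xs \<in> tvs.span ?P" for xs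
  proof -
    let ?n = "length xs"
    have "sym_prod s xs \<phi> = (\<Sum>A\<in>Pow {..<?n}.
        tscale ((-1) ^ ?n * (-1) ^ card A / fact ?n) (tens s (replicate ?n (\<Sum>i\<in>A. xs ! i)))) \<phi>" for \<phi>
    proof (cases "multilinear s (*) \<phi>")
      case True
      have "sym_prod s xs \<phi> = 1 / fact ?n *
          ((-1) ^ ?n * (\<Sum>A\<in>Pow {..<?n}. (-1) ^ card A * \<phi> (replicate ?n (\<Sum>i\<in>A. xs ! i))))"
        by (simp only: sym_prod_apply(1)[OF True] polarization[OF True])
      then show ?thesis
        using True by (simp add: sum_apply sum_distrib_left sum_divide_distrib mult.assoc)
    qed (simp add: sym_prod_apply sum_apply)
    then have "sym_prod s xs = (\<Sum>A\<in>Pow {..<?n}.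
        tscale ((-1) ^ ?n * (-1) ^ card A / fact ?n) (tens s (replicate ?n (\<Sum>i\<in>A. xs ! i))))" ..
    also have "\<dots> \<in> tvs.span ?P"
      by (intro tvs.span_sum tvs.span_scale tvs.span_base) auto
    finally show ?thesis .
  qed
  then show "symmetric_algebra s \<subseteq> tvs.span ?P"
    unfolding symmetric_algebra_eq_span by (intro tvs.span_minimal tvs.subspace_span) auto
qed

text \<open>The target is a subspace so that one rule serves equations (S = {0}), congruences (S the
  ideal of the enveloping algebra) and closure properties.\<close>

lemma symmetric_algebra_powers_induct:
  fixes s :: "'k::field_char_0 \<Rightarrow> 'g::ab_group_add \<Rightarrow> 'g"
  assumes "t \<in> symmetric_algebra s" and "Vector_Spaces.linear tscale tscale f" and "tvs.subspace S"
    and "\<And>n x. f (tens s (replicate n x)) \<in> S"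
  shows "f t \<in> S"
proof -
  interpret f: Vector_Spaces.linear tscale tscale f by fact
  have "tvs.subspace (f -` S)"
    using f.subspace_vimage[OF assms(3)] .
  then have "tvs.span {tens s (replicate n x) | n x. True} \<subseteq> f -` S"
    by (rule tvs.span_minimal[rotated]) (use assms(4) in auto)
  then show ?thesis
    using assms(1) symmetric_algebra_eq_span_powers by blast
qed

text \<open>The rearranged list depends only on the position of v, and each of the n + 1 positions
  is taken by n! permutations.\<close>

lemma sum_permutes_Cons_replicate:
  fixes h :: "'g list \<Rightarrow> 'w::field_char_0"
  shows "(\<Sum>\<sigma> | \<sigma> permutes {..<Suc n}. h (permute_list \<sigma> (v # replicate n x))) =
    fact n * (\<Sum>i\<le>n. h (replicate i x @ v # replicate (n - i) x))"
proof -
  let ?h = "\<lambda>i. h (replicate i x @ v # replicate (n - i) x)"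
  have "h (permute_list \<sigma> (v # replicate n x)) = ?h (inv_into UNIV \<sigma> 0)" if \<sigma>: "\<sigma> permutes {..<Suc n}" for \<sigma>
  proof -
    have i: "inv_into UNIV \<sigma> 0 < Suc n"
      using permutes_in_image[OF permutes_inv[OF \<sigma>], of 0] by simp
    have "permute_list \<sigma> (v # replicate n x) = replicate (inv_into UNIV \<sigma> 0) x @ v # replicate (n - inv_into UNIV \<sigma> 0) x"
    proof (rule nth_equalityI)
      fix j assume "j < length (permute_list \<sigma> (v # replicate n x))"
      then have j: "j < Suc n" by simp
      then have "\<sigma> j < Suc n" using permutes_in_image[OF \<sigma>, of j] by simp
      moreover have "\<sigma> j = 0 \<longleftrightarrow> j = inv_into UNIV \<sigma> 0" using permutes_inverses[OF \<sigma>] by metis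
      ultimately show "permute_list \<sigma> (v # replicate n x) ! j =
          (replicate (inv_into UNIV \<sigma> 0) x @ v # replicate (n - inv_into UNIV \<sigma> 0) x) ! j"
        using j i \<sigma> by (auto simp: permute_list_nth nth_append nth_Cons')
    qed (use i in simp)
    then show ?thesis by simp
  qed
  then have "(\<Sum>\<sigma> | \<sigma> permutes {..<Suc n}. h (permute_list \<sigma> (v # replicate n x))) =
      (\<Sum>\<sigma> | \<sigma> permutes {..<Suc n}. ?h (inv_into UNIV \<sigma> 0))"
    by simp
  \<comment> \<open>The position of v is the image of 0 under the inverse permutation. Summing over
    inverses turns it into the image of 0, by which the permutations are then split.\<close>
  also have "\<dots> = (\<Sum>\<sigma> | \<sigma> permutes {..<Suc n}. ?h (\<sigma> 0))"
    by (rule sum_permutations_inverse[symmetric])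
  also have "{..<Suc n} = insert 0 {1..n}" by auto
  also have "(\<Sum>\<sigma> | \<sigma> permutes insert 0 {1..n}. ?h (\<sigma> 0)) =
      (\<Sum>b\<in>insert 0 {1..n}. \<Sum>\<tau> | \<tau> permutes {1..n}. ?h ((Transposition.transpose 0 b \<circ> \<tau>) 0))"
    by (rule sum_over_permutations_insert) auto
  also have "\<dots> = (\<Sum>b\<in>insert 0 {1..n}. \<Sum>\<tau> | \<tau> permutes {1..n}. ?h b)"
    by (intro sum.cong refl) (simp add: permutes_not_in)
  also have "\<dots> = fact n * (\<Sum>b\<in>insert 0 {1..n}. ?h b)"
    using card_permutations[of "{1..n}" n] by (simp add: distrib_left sum_distrib_left)
  also have "insert 0 {1..n} = {..n}" by auto
  finally show ?thesis
    by (simp only: lessThan_Suc_atMost)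
qed

lemma sym_prod_Cons_replicate:
  fixes s :: "'k::field_char_0 \<Rightarrow> 'g::plus \<Rightarrow> 'g"
  shows "sym_prod s (v # replicate n x) =
    tscale (1 / of_nat (Suc n)) (\<Sum>i\<le>n. tens s (replicate i x @ v # replicate (n - i) x))"
proof
  fix \<phi>
  show "sym_prod s (v # replicate n x) \<phi> =
      tscale (1 / of_nat (Suc n)) (\<Sum>i\<le>n. tens s (replicate i x @ v # replicate (n - i) x)) \<phi>"
  proof (cases "multilinear s (*) \<phi>")
    case True
    then show ?thesis
      using sum_permutes_Cons_replicate[where h = \<phi> and n = n and v = v and x = x]
      by (simp add: sym_prod_apply sum_apply del: of_nat_Suc)
  qed (simp add: sym_prod_apply sum_apply)
qed

section \<open>The Maurer-Cartan identity in a nilpotent Lie algebra\<close>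

text \<open>A linear functional that is 1 on \<open>w r\<close> turns the sum into a polynomial in t
  with a coefficient 1, and such a polynomial cannot vanish on an infinite field.\<close>

lemma scaled_sum_eq_0_imp_0:
  fixes scale :: "'k::field_char_0 \<Rightarrow> 'b::ab_group_add \<Rightarrow> 'b"
  assumes "vector_space scale" and zero: "\<And>t. (\<Sum>r<n. scale (t ^ r) (w r)) = 0" and "r < n"
  shows "w r = 0"
proof (rule ccontr)
  interpret W: vector_space scale by fact
  interpret WK: vector_space_pair scale "(*)" by standard (auto simp: algebra_simps)
  assume "w r \<noteq> 0"
  then have "W.independent {w r}" by simp
  from WK.linear_independent_extend[OF this, of "\<lambda>_. 1"]
  obtain l where l: "Vector_Spaces.linear scale (*) l" "l (w r) = 1" by auto
  interpret l: Vector_Spaces.linear scale "(*)" l by fact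
  define P where "P = (\<Sum>r<n. monom (l (w r)) r)"
  have "poly P t = l (\<Sum>r<n. scale (t ^ r) (w r))" for t
    by (simp add: P_def poly_sum poly_monom l.sum l.scale mult.commute)
  then have "P = 0"
    using zero by (simp add: l.zero flip: poly_all_0_iff_0)
  moreover have "coeff P r = l (w r)"
    using \<open>r < n\<close> by (simp add: P_def coeff_sum)
  ultimately show False
    using l(2) by simp
qed

locale lie_algebra = vector_space scale
  for scale :: "'k::field_char_0 \<Rightarrow> 'g::ab_group_add \<Rightarrow> 'g" +
  fixes br :: "'g \<Rightarrow> 'g \<Rightarrow> 'g"
  assumes br_add_left: "br (x + y) u = br x u + br y u"
    and br_add_right: "br u (x + y) = br u x + br u y"
    and br_scale_left: "br (scale c x) y = scale c (br x y)"
    and br_scale_right: "br x (scale c y) = scale c (br x y)"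
    and br_self [simp]: "br x x = 0"
    and jacobi: "br x (br y u) + br y (br u x) + br u (br x y) = 0"
begin

lemma br_zero [simp]: "br 0 x = 0" "br x 0 = 0"
  using br_add_left[of 0 0 x] br_add_right[of x 0 0] by simp_all

lemma br_anticomm: "br x y = - br y x"
proof -
  have "br x x + br y x + (br x y + br y y) = 0"
    using br_self[of "x + y"] by (simp only: br_add_left br_add_right)
  then show ?thesis
    by (simp add: eq_neg_iff_add_eq_0 add.commute)
qed

lemma br_minus: "br (- x) y = - br x y" "br x (- y) = - br x y"
  using br_add_left[of x "- x" y] br_add_right[of x y "- y"] by (simp_all add: add_eq_0_iff)

lemma br_diff: "br (x - y) u = br x u - br y u" "br u (x - y) = br u x - br u y"
  by (simp_all only: diff_conv_add_uminus br_add_left br_add_right br_minus)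

lemma br_sum: "br (sum f I) y = (\<Sum>i\<in>I. br (f i) y)" "br y (sum f I) = (\<Sum>i\<in>I. br y (f i))"
  by (induction I rule: infinite_finite_induct) (simp_all add: br_add_left br_add_right)

lemma br_leibniz: "br x (br y u) = br (br x y) u + br y (br x u)"
proof -
  have "br x (br y u) = - br y (br u x) - br u (br x y)"
    using jacobi[of x y u] by (simp add: add_eq_0_iff2 eq_neg_iff_add_eq_0 add.assoc)
  then show ?thesis
    using br_anticomm[of u x] br_anticomm[of u "br x y"] by (simp add: br_minus)
qed

section \<open>Powers of ad, their directional derivatives and the lower central series\<close>

abbreviation ad_pow :: "'g \<Rightarrow> nat \<Rightarrow> 'g \<Rightarrow> 'g" where
  "ad_pow x n \<equiv> br x ^^ n"

lemma ad_pow_linear: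
  "ad_pow x n (u + v) = ad_pow x n u + ad_pow x n v"
  "ad_pow x n (scale c u) = scale c (ad_pow x n u)"
  "ad_pow x n 0 = 0"
  "ad_pow x n (- u) = - ad_pow x n u"
  "ad_pow x n (u - v) = ad_pow x n u - ad_pow x n v"
  by (induction n) (simp_all add: br_add_right br_scale_right br_minus br_diff)

lemma ad_pow_sum: "ad_pow x n (sum f I) = (\<Sum>i\<in>I. ad_pow x n (f i))"
  by (induction I rule: infinite_finite_induct) (simp_all add: ad_pow_linear)

lemma ad_pow_add: "ad_pow x (m + n) u = ad_pow x m (ad_pow x n u)"
  by (simp add: funpow_add)

lemma ad_pow_scale_base: "ad_pow (scale t x) n u = scale (t ^ n) (ad_pow x n u)"
  by (induction n) (simp_all add: br_scale_left br_scale_right mult_ac)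

lemma ad_pow_self: "n > 0 \<Longrightarrow> ad_pow x n x = 0"
  by (cases n) (simp_all add: ad_pow_linear funpow_swap1)

lemma foldr_br_replicate: "foldr br (replicate n x) u = ad_pow x n u"
  by (induction n) simp_all

lemma ad_pow_br:
  "ad_pow x n (br u v) = (\<Sum>i\<le>n. scale (of_nat (n choose i)) (br (ad_pow x i u) (ad_pow x (n - i) v)))"
proof (induction n)
  case (Suc n)
  let ?B = "\<lambda>i j. br (ad_pow x i u) (ad_pow x j v)"
  have *: "br x (?B i j) = ?B (Suc i) j + ?B i (Suc j)" for i j
    by (simp add: br_leibniz[of x "ad_pow x i u"])
  have "ad_pow x (Suc n) (br u v) =
      (\<Sum>i\<le>n. scale (of_nat (n choose i)) (?B (Suc i) (n - i))) + (\<Sum>i\<le>n. scale (of_nat (n choose i)) (?B i (Suc (n - i))))"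
    by (simp only: funpow.simps o_apply Suc br_sum br_scale_right * scale_right_distrib sum.distrib)
  also have "(\<Sum>i\<le>n. scale (of_nat (n choose i)) (?B i (Suc (n - i)))) =
      (\<Sum>i\<le>Suc n. scale (of_nat (n choose i)) (?B i (Suc n - i)))"
    by (simp add: Suc_diff_le)
  also have "\<dots> = ?B 0 (Suc n) + (\<Sum>i\<le>n. scale (of_nat (n choose Suc i)) (?B (Suc i) (n - i)))"
    by (subst sum.atMost_Suc_shift) simp
  also have "(\<Sum>i\<le>n. scale (of_nat (n choose i)) (?B (Suc i) (n - i))) + \<dots> =
      ?B 0 (Suc n) + (\<Sum>i\<le>n. scale (of_nat (Suc n choose Suc i)) (?B (Suc i) (n - i)))"
    by (simp add: scale_left_distrib sum.distrib algebra_simps)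
  also have "\<dots> = (\<Sum>i\<le>Suc n. scale (of_nat (Suc n choose i)) (?B i (Suc n - i)))"
    by (subst sum.atMost_Suc_shift) simp
  finally show ?case .
qed simp

text \<open>\<open>ad_deriv x n u v\<close> is the derivative of \<open>x \<mapsto> ad\<^sub>x\<^sup>n v\<close> in the direction \<open>u\<close>.\<close>

definition ad_deriv :: "'g \<Rightarrow> nat \<Rightarrow> 'g \<Rightarrow> 'g \<Rightarrow> 'g" where
  "ad_deriv x n u v = (\<Sum>a<n. ad_pow x a (br u (ad_pow x (n - 1 - a) v)))"

lemma ad_deriv_linear:
  "ad_deriv x n (u + u') v = ad_deriv x n u v + ad_deriv x n u' v"
  "ad_deriv x n (scale c u) v = scale c (ad_deriv x n u v)"
  "ad_deriv x n u (v + v') = ad_deriv x n u v + ad_deriv x n u v'"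
  "ad_deriv x n u (scale c v) = scale c (ad_deriv x n u v)"
  "ad_deriv x n 0 v = 0" "ad_deriv x n u 0 = 0" "ad_deriv x 0 u v = 0"
  by (simp_all add: ad_deriv_def ad_pow_linear br_add_left br_add_right br_scale_left br_scale_right
      sum.distrib scale_sum_right)

lemma ad_deriv_sum:
  "ad_deriv x n (sum f I) v = (\<Sum>i\<in>I. ad_deriv x n (f i) v)"
  "ad_deriv x n u (sum f I) = (\<Sum>i\<in>I. ad_deriv x n u (f i))"
  by (induction I rule: infinite_finite_induct) (simp_all add: ad_deriv_linear)

text \<open>The product rule: the factor that is differentiated lies either among the outer n or
  among the inner m copies of \<open>br x\<close>.\<close>

lemma ad_deriv_add:
  "ad_deriv x (n + m) u v = ad_deriv x n u (ad_pow x m v) + ad_pow x n (ad_deriv x m u v)"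
proof -
  have "(\<Sum>a<n + m. F a) = (\<Sum>a<n. F a) + (\<Sum>a<m. F (n + a))" for F :: "nat \<Rightarrow> 'g"
    by (induction m) (simp_all add: add.assoc)
  then have "(\<Sum>a<n + m. ad_pow x a (br u (ad_pow x (n + m - 1 - a) v))) =
      (\<Sum>a<n. ad_pow x a (br u (ad_pow x (n + m - 1 - a) v))) +
      (\<Sum>a<m. ad_pow x (n + a) (br u (ad_pow x (n + m - 1 - (n + a)) v)))" .
  moreover have "(\<Sum>a<n. ad_pow x a (br u (ad_pow x (n + m - 1 - a) v))) =
      (\<Sum>a<n. ad_pow x a (br u (ad_pow x (n - 1 - a) (ad_pow x m v))))"
    by (intro sum.cong refl) (simp flip: ad_pow_add)
  ultimately show ?thesis
    by (simp add: ad_deriv_def ad_pow_sum ad_pow_add diff_diff_eq)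
qed

text \<open>The derivative of an n-fold power has n - 1 factors x left. The extra t on the left
  completes them to t^n and also covers n = 0, where both sides vanish.\<close>

lemma ad_deriv_scale_base: "scale t (ad_deriv (scale t x) n u v) = scale (t ^ n) (ad_deriv x n u v)"
  unfolding ad_deriv_def scale_sum_right
  by (intro sum.cong refl) (simp add: ad_pow_scale_base br_scale_right ad_pow_linear flip: power_add power_Suc)

text \<open>The Leibniz rule distributes each outer power over the bracket; for fixed i the
  binomials (a choose i) with a \<le> r add up by the hockey-stick identity.\<close>

lemma ad_deriv_Suc:
  "ad_deriv x (Suc r) u v = (\<Sum>i\<le>r. scale (of_nat (Suc r choose Suc i)) (br (ad_pow x i u) (ad_pow x (r - i) v)))"
proof -
  let ?B = "\<lambda>i. br (ad_pow x i u) (ad_pow x (r - i) v)"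
  have "ad_deriv x (Suc r) u v = (\<Sum>a\<le>r. \<Sum>i\<le>a. scale (of_nat (a choose i)) (?B i))"
    unfolding ad_deriv_def lessThan_Suc_atMost
  proof (intro sum.cong refl)
    fix a assume "a \<in> {..r}"
    then show "ad_pow x a (br u (ad_pow x (Suc r - 1 - a) v)) = (\<Sum>i\<le>a. scale (of_nat (a choose i)) (?B i))"
      unfolding ad_pow_br by (intro sum.cong refl) (auto simp flip: ad_pow_add)
  qed
  also have "\<dots> = (\<Sum>a\<le>r. \<Sum>i\<le>r. scale (of_nat (a choose i)) (?B i))"
    by (intro sum.cong refl sum.mono_neutral_left) auto
  also have "\<dots> = (\<Sum>i\<le>r. \<Sum>a\<le>r. scale (of_nat (a choose i)) (?B i))"
    by (rule sum.swap)
  also have "\<dots> = (\<Sum>i\<le>r. scale (of_nat (Suc r choose Suc i)) (?B i))"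
    by (intro sum.cong refl) (simp only: scale_sum_left[symmetric] of_nat_sum[symmetric] sum_choose_upper)
  finally show ?thesis .
qed

text \<open>After reversing one of the two sums, antisymmetry of the bracket turns the difference
  into a sum, and Pascal's rule merges the binomials into (n + 1 choose i + 1). This is one
  homogeneous component of the Maurer-Cartan identity.\<close>

lemma ad_deriv_commutator:
  "scale (1 / fact (Suc n)) (ad_deriv x n u v - ad_deriv x n v u) =
    (\<Sum>i<n. scale (1 / fact (Suc i) * (1 / fact (Suc (n - 1 - i)))) (br (ad_pow x i u) (ad_pow x (n - 1 - i) v)))"
proof (cases n)
  case (Suc r)
  let ?B = "\<lambda>i. br (ad_pow x i u) (ad_pow x (r - i) v)"
  have "ad_deriv x n v u = (\<Sum>i\<le>r. scale (of_nat (Suc r choose Suc i)) (br (ad_pow x i v) (ad_pow x (r - i) u)))"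
    by (simp only: Suc ad_deriv_Suc)
  also have "\<dots> = (\<Sum>i\<le>r. scale (of_nat (Suc r choose Suc (r - i))) (br (ad_pow x (r - i) v) (ad_pow x i u)))"
    by (rule sum.reindex_bij_witness[of _ "\<lambda>i. r - i" "\<lambda>i. r - i"]) auto
  also have "\<dots> = (\<Sum>i\<le>r. - scale (of_nat (Suc r choose i)) (?B i))"
  proof (intro sum.cong refl)
    fix i assume "i \<in> {..r}"
    then have "Suc r choose Suc (r - i) = Suc r choose i"
      by (subst binomial_symmetric) (auto simp: Suc_diff_le)
    then show "scale (of_nat (Suc r choose Suc (r - i))) (br (ad_pow x (r - i) v) (ad_pow x i u)) =
        - scale (of_nat (Suc r choose i)) (?B i)"
      by (subst br_anticomm) simp
  qed
  finally have "ad_deriv x n u v - ad_deriv x n v u =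
      (\<Sum>i\<le>r. scale (of_nat (Suc r choose Suc i)) (?B i)) + (\<Sum>i\<le>r. scale (of_nat (Suc r choose i)) (?B i))"
    by (simp add: Suc ad_deriv_Suc sum_negf)
  also have "\<dots> = (\<Sum>i\<le>r. scale (of_nat (Suc (Suc r) choose Suc i)) (?B i))"
    by (simp add: scale_left_distrib sum.distrib algebra_simps)
  finally have "scale (1 / fact (Suc n)) (ad_deriv x n u v - ad_deriv x n v u) =
      (\<Sum>i\<le>r. scale (1 / fact (Suc n) * of_nat (Suc (Suc r) choose Suc i)) (?B i))"
    by (simp only: scale_sum_right scale_scale)
  also have "\<dots> = (\<Sum>i\<le>r. scale (1 / fact (Suc i) * (1 / fact (Suc (r - i)))) (?B i))"
  proof (intro sum.cong refl arg_cong2[where f = scale])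
    fix i assume "i \<in> {..r}"
    then have "Suc i \<le> Suc (Suc r)" "Suc (Suc r) - Suc i = Suc (r - i)" by auto
    then show "1 / fact (Suc n) * of_nat (Suc (Suc r) choose Suc i) = 1 / fact (Suc i) * (1 / fact (Suc (r - i)) :: 'k)"
      by (simp only: binomial_fact Suc) (simp add: field_simps del: fact_Suc)
  qed
  finally show ?thesis
    by (simp add: Suc lessThan_Suc_atMost)
qed (simp add: ad_deriv_linear)

text \<open>The Cauchy product of two truncated series: since F vanishes from K on, the square of
  indices can be cut down to the triangle i + j < K.\<close>

lemma convolution_sum:
  fixes F :: "nat \<Rightarrow> 'g"
  assumes "\<And>m. m \<ge> K \<Longrightarrow> F m = 0"
  shows "(\<Sum>i<K. \<Sum>j<K. scale (f i * g j) (F (i + j))) = (\<Sum>m<K. scale (\<Sum>i\<le>m. f i * g (m - i)) (F m))"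
proof -
  have "(\<Sum>i<K. \<Sum>j<K. scale (f i * g j) (F (i + j))) =
      (\<Sum>i<K. \<Sum>m\<in>{i..<K}. scale (f i * g (m - i)) (F m))"
  proof (rule sum.cong[OF refl])
    fix i assume "i \<in> {..<K}"
    have "(\<Sum>j<K. scale (f i * g j) (F (i + j))) = (\<Sum>j<K - i. scale (f i * g j) (F (i + j)))"
      by (intro sum.mono_neutral_right) (auto simp: not_less le_diff_conv add.commute assms)
    also have "\<dots> = (\<Sum>m\<in>{i..<K}. scale (f i * g (m - i)) (F m))"
      by (rule sum.reindex_bij_witness[of _ "\<lambda>m. m - i" "\<lambda>j. i + j"]) auto
    finally show "(\<Sum>j<K. scale (f i * g j) (F (i + j))) = (\<Sum>m\<in>{i..<K}. scale (f i * g (m - i)) (F m))" .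
  qed
  also have "\<dots> = (\<Sum>(i, m)\<in>Sigma {..<K} (\<lambda>i. {i..<K}). scale (f i * g (m - i)) (F m))"
    by (rule sum.Sigma) auto
  also have "\<dots> = (\<Sum>(m, i)\<in>Sigma {..<K} (\<lambda>m. {..m}). scale (f i * g (m - i)) (F m))"
    by (rule sum.reindex_bij_witness[of _ "\<lambda>(a, b). (b, a)" "\<lambda>(a, b). (b, a)"]) auto
  also have "\<dots> = (\<Sum>m<K. \<Sum>i\<le>m. scale (f i * g (m - i)) (F m))"
    by (rule sum.Sigma[symmetric]) auto
  finally show ?thesis
    by (simp only: scale_sum_left)
qed

text \<open>The lower central series, indexed by the number of nested brackets;
  \<open>nested 0\<close> is the whole algebra.\<close>

definition nested :: "nat \<Rightarrow> 'g set" where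
  "nested n = span {foldr br xs u | xs u. length xs = n}"

lemma br_nested:
  assumes "u \<in> nested m"
  shows "br x u \<in> nested (Suc m)"
  using assms unfolding nested_def
proof (induction rule: span_induct_alt)
  case (step c w u)
  then obtain xs v where w: "w = foldr br xs v" "length xs = m" by blast
  then have "br x w \<in> {foldr br xs u | xs u. length xs = Suc m}"
    by (auto intro!: exI[of _ "x # xs"] exI[of _ v])
  with step show ?case
    by (simp add: br_add_right br_scale_right span_add span_scale span_base)
qed (simp add: span_zero)

text \<open>Membership alone does not carry the induction: by the Jacobi identity, bracketing with a
  word of a letters raises the filtration by a. Thus arbitrary bracketings sit as deep as nested
  ones, and nilpotency passes from nested brackets to all words.\<close>

lemma lie_word_nested:
  assumes "lie_word br xs w"
  shows "xs \<noteq> [] \<and> w \<in> nested (length xs - 1) \<and> (\<forall>m. \<forall>u\<in>nested m. br w u \<in> nested (length xs + m))"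
  using assms
proof induction
  case (letter x)
  have "x \<in> {foldr br xs u | xs u. length xs = 0}" by auto
  then show ?case
    by (simp add: br_nested) (simp add: nested_def span_base)
next
  case (bracket xs u ys v)
  have "br (br u v) z \<in> nested (length (xs @ ys) + m)" if "z \<in> nested m" for z m
  proof -
    have "br u (br v z) \<in> nested (length xs + (length ys + m))" "br v (br u z) \<in> nested (length ys + (length xs + m))"
      using bracket that by blast+
    moreover have "br (br u v) z = br u (br v z) - br v (br u z)"
      using br_leibniz[of u v z] by simp
    ultimately show ?thesis
      by (simp add: nested_def span_diff add_ac)
  qed
  moreover have "br u v \<in> nested (length xs + (length ys - 1))" "ys \<noteq> []"
    using bracket by blast+
  ultimately show ?case
    using bracket by (cases ys) auto
qed

lemma lie_word_ad_pow: "lie_word br (replicate n x @ [u]) (ad_pow x n u)"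
proof (induction n)
  case (Suc n)
  then show ?case using lie_word.bracket[OF lie_word.letter[of br x] Suc] by simp
qed (simp add: lie_word.letter)

end

section \<open>Truncated power series in ad and the Maurer-Cartan identity\<close>

locale nilpotent_lie_algebra = lie_algebra scale br
  for scale :: "'k::field_char_0 \<Rightarrow> 'g::ab_group_add \<Rightarrow> 'g" and br +
  fixes K :: nat
  assumes nilpotent: "length xs \<ge> K \<Longrightarrow> foldr br xs u = 0"
begin

lemma ad_pow_eq_0: "n \<ge> K \<Longrightarrow> ad_pow x n u = 0"
  using nilpotent[of "replicate n x" u] by (simp add: foldr_br_replicate)

lemma ad_deriv_eq_0:
  assumes "n \<ge> K"
  shows "ad_deriv x n u v = 0"
  unfolding ad_deriv_def
proof (rule sum.neutral, rule ballI)
  fix a assume "a \<in> {..<n}"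
  then show "ad_pow x a (br u (ad_pow x (n - 1 - a) v)) = 0"
    using assms nilpotent[of "replicate a x @ u # replicate (n - 1 - a) x" v]
    by (simp add: foldr_br_replicate)
qed

text \<open>Truncated above the nilpotency index, \<open>lmap x = (e\<^sup>a\<^sup>d\<^sup>x - 1) / ad x\<close> is the logarithmic derivative of the
  exponential map, and \<open>vfield x \<xi> = (ad x / (e\<^sup>a\<^sup>d\<^sup>x - 1)) \<xi>\<close> is the value at \<open>x\<close> of the invariant vector
  field of \<open>\<xi>\<close> in exponential coordinates.\<close>

definition lmap :: "nat \<Rightarrow> 'g \<Rightarrow> 'g \<Rightarrow> 'g" where
  "lmap n x u = (\<Sum>i<n. scale (1 / fact (Suc i)) (ad_pow x i u))"

definition vfield :: "nat \<Rightarrow> 'g \<Rightarrow> 'g \<Rightarrow> 'g" where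
  "vfield n x u = (\<Sum>i<n. scale (bern i) (ad_pow x i u))"

lemma lmap_vfield:
  assumes "n \<ge> K"
  shows "lmap n x (vfield n x u) = u"
proof -
  have "lmap n x (vfield n x u) =
      (\<Sum>i<n. \<Sum>j<n. scale (1 / fact (Suc i) * bern j) (ad_pow x (i + j) u))"
    by (simp add: lmap_def vfield_def ad_pow_sum ad_pow_linear ad_pow_add scale_sum_right)
  also have "\<dots> = (\<Sum>m<n. scale (\<Sum>i\<le>m. 1 / fact (Suc i) * bern (m - i)) (ad_pow x m u))"
    by (rule convolution_sum) (use assms ad_pow_eq_0 in auto)
  also have "\<dots> = (\<Sum>m<n. scale (if m = 0 then 1 else 0) (ad_pow x m u))"
  proof (intro sum.cong refl arg_cong2[where f = scale])
    fix m
    have "(\<Sum>i\<le>m. 1 / fact (Suc i) * bern (m - i)) = (\<Sum>i\<le>m. bern i / fact (Suc (m - i)) :: 'k)"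
      by (rule sum.reindex_bij_witness[of _ "\<lambda>i. m - i" "\<lambda>i. m - i"]) auto
    then show "(\<Sum>i\<le>m. 1 / fact (Suc i) * bern (m - i)) = (if m = 0 then 1 else 0 :: 'k)"
      by (simp only: bern_convolution)
  qed
  also have "\<dots> = (if n = 0 then 0 else u)"
    by (simp add: if_distrib[of "\<lambda>c. scale c _"] sum.delta' cong: if_cong)
  \<comment> \<open>If n = 0, then K = 0 and the Lie algebra itself is zero.\<close>
  also have "\<dots> = u"
    using ad_pow_eq_0[of 0 x u] assms by auto
  finally show ?thesis .
qed

text \<open>This is the derivative, in the direction u, of the identity that
  \<open>vfield n x\<close> inverts \<open>lmap n x\<close>. In the product series only degree 0
  keeps a coefficient, and \<open>ad_deriv x 0\<close> vanishes.\<close>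

lemma vfield_lmap_deriv:
  assumes "n \<ge> K"
  shows "(\<Sum>i<n. scale (bern i) (ad_deriv x i u (lmap n x v))) =
    - vfield n x (\<Sum>i<n. scale (1 / fact (Suc i)) (ad_deriv x i u v))"
proof -
  have "(\<Sum>i<n. scale (bern i) (ad_deriv x i u (lmap n x v))) +
      vfield n x (\<Sum>i<n. scale (1 / fact (Suc i)) (ad_deriv x i u v)) =
      (\<Sum>i<n. \<Sum>j<n. scale (bern i * (1 / fact (Suc j))) (ad_deriv x (i + j) u v))"
    by (simp add: lmap_def vfield_def ad_deriv_sum ad_deriv_linear ad_deriv_add ad_pow_sum ad_pow_linear
        scale_sum_right scale_right_distrib sum.distrib)
  also have "\<dots> = (\<Sum>m<n. scale (\<Sum>i\<le>m. bern i * (1 / fact (Suc (m - i)))) (ad_deriv x m u v))"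
    by (rule convolution_sum) (use assms ad_deriv_eq_0 in auto)
  also have "\<dots> = (\<Sum>m<n. scale (if m = 0 then 1 else 0) (ad_deriv x m u v))"
    using bern_convolution[where 'k = 'k] by simp
  also have "\<dots> = 0"
    by (simp add: if_distrib[of "\<lambda>c. scale c _"] sum.delta' ad_deriv_linear cong: if_cong)
  finally show ?thesis
    by (simp add: eq_neg_iff_add_eq_0)
qed

lemma lie_word_eq_0:
  assumes "lie_word br xs w" "length xs > K"
  shows "w = 0"
proof -
  have "{foldr br ys u | ys u. length ys = length xs - 1} \<subseteq> {0}"
    using assms(2) nilpotent by auto
  then have "nested (length xs - 1) \<subseteq> {0}"
    unfolding nested_def by (rule span_minimal) (simp add: subspace_def)
  then show ?thesis
    using lie_word_nested[OF assms(1)] by blast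
qed

text \<open>Degree by degree this is \<open>ad_deriv_commutator\<close>. Both sides may be truncated
  at the same n, because a term with i + j + 1 \<ge> n is a word of i + j + 2 > K letters and
  vanishes.\<close>

lemma lmap_maurer_cartan:
  assumes "n \<ge> K"
  shows "(\<Sum>m<n. scale (1 / fact (Suc m)) (ad_deriv x m u v - ad_deriv x m v u)) = br (lmap n x u) (lmap n x v)"
proof -
  let ?F = "\<lambda>i j. scale (1 / fact (Suc i) * (1 / fact (Suc j))) (br (ad_pow x i u) (ad_pow x j v))"
  have F: "?F i j = 0" if "\<not> Suc (i + j) < n" for i j
    using lie_word_eq_0[OF lie_word.bracket[OF lie_word_ad_pow[of i x u] lie_word_ad_pow[of j x v]]] that assms
    by simp
  have "(\<Sum>m<n. scale (1 / fact (Suc m)) (ad_deriv x m u v - ad_deriv x m v u)) =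
      (\<Sum>m<n. \<Sum>i<m. ?F i (m - 1 - i))"
    by (simp only: ad_deriv_commutator)
  also have "\<dots> = (\<Sum>(m, i)\<in>Sigma {..<n} (\<lambda>m. {..<m}). ?F i (m - 1 - i))"
    by (rule sum.Sigma) auto
  also have "\<dots> = (\<Sum>(i, j)\<in>{(i, j). Suc (i + j) < n}. ?F i j)"
    by (rule sum.reindex_bij_witness[of _ "\<lambda>(i, j). (Suc (i + j), i)" "\<lambda>(m, i). (i, m - 1 - i)"]) auto
  also have "\<dots> = (\<Sum>(i, j)\<in>{..<n} \<times> {..<n}. ?F i j)"
    using F by (intro sum.mono_neutral_left) (auto simp del: scale_eq_0_iff)
  also have "\<dots> = (\<Sum>i<n. \<Sum>j<n. ?F i j)"
    by (rule sum.cartesian_product[symmetric])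
  also have "\<dots> = br (lmap n x u) (lmap n x v)"
    unfolding lmap_def br_sum(1) by (simp add: br_sum(2) br_scale_left br_scale_right scale_sum_right mult_ac)
  finally show ?thesis .
qed

text \<open>The Maurer-Cartan identity for those u and v which \<open>lmap\<close> sends to \<xi>
  and \<eta>. On the left stands the commutator of the two vector fields: the derivative of one
  along the other, antisymmetrised.\<close>

lemma vfield_bracket:
  assumes "n \<ge> K"
  shows "(\<Sum>i<n. scale (bern i) (ad_deriv x i (vfield n x \<xi>) \<eta> - ad_deriv x i (vfield n x \<eta>) \<xi>)) =
    - vfield n x (br \<xi> \<eta>)"
proof -
  define u v where "u = vfield n x \<xi>" and "v = vfield n x \<eta>"
  have "\<xi> = lmap n x u" "\<eta> = lmap n x v"
    using lmap_vfield[OF assms] by (simp_all add: u_def v_def)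
  then have "(\<Sum>i<n. scale (bern i) (ad_deriv x i u \<eta> - ad_deriv x i v \<xi>)) =
      - vfield n x (\<Sum>i<n. scale (1 / fact (Suc i)) (ad_deriv x i u v)) +
      vfield n x (\<Sum>i<n. scale (1 / fact (Suc i)) (ad_deriv x i v u))"
    using vfield_lmap_deriv[OF assms, of x u v] vfield_lmap_deriv[OF assms, of x v u]
    by (simp add: scale_right_diff_distrib sum_subtractf)
  also have "\<dots> = - vfield n x (\<Sum>i<n. scale (1 / fact (Suc i)) (ad_deriv x i u v - ad_deriv x i v u))"
    by (simp add: vfield_def ad_pow_linear scale_right_diff_distrib sum_subtractf)
  also have "\<dots> = - vfield n x (br \<xi> \<eta>)"
    using \<open>\<xi> = _\<close> \<open>\<eta> = _\<close> by (simp only: lmap_maurer_cartan[OF assms])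
  finally show ?thesis
    by (simp only: u_def v_def)
qed

text \<open>Replacing \<open>x\<close> by multiples \<open>t x\<close> separates the homogeneous components of \<open>vfield_bracket\<close>.\<close>

lemma bern_bracket:
  "(\<Sum>i\<le>r. scale (bern i * bern (r - i)) (ad_deriv x i (ad_pow x (r - i) \<xi>) \<eta> - ad_deriv x (r - i) (ad_pow x i \<eta>) \<xi>)) =
    (if r = 0 then 0 else - scale (bern (r - 1)) (ad_pow x (r - 1) (br \<xi> \<eta>)))"
proof -
  \<comment> \<open>The truncation has to reach beyond the nilpotency index as well as the degree r
    that is to be extracted.\<close>
  define n where "n = K + Suc r"
  have n: "n \<ge> K" "r < n" by (simp_all add: n_def)
  define G where "G i j = scale (bern i * bern j) (ad_deriv x i (ad_pow x j \<xi>) \<eta> - ad_deriv x j (ad_pow x i \<eta>) \<xi>)" for i j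
  \<comment> \<open>The coefficient of t^m in the difference of the two sides of
    \<open>vfield_bracket\<close>, multiplied by t as \<open>ad_deriv_scale_base\<close> demands.
    That factor t moves the bracket term from degree m - 1 to degree m.\<close>
  define w where "w m = (\<Sum>i\<le>m. G i (m - i)) + (if m = 0 then 0 else scale (bern (m - 1)) (ad_pow x (m - 1) (br \<xi> \<eta>)))" for m
  have G0: "G i j = 0" if "i \<ge> n \<or> j \<ge> n" for i j
    using that n(1) ad_deriv_eq_0 ad_pow_eq_0 by (auto simp: G_def ad_deriv_linear)
  then have G1: "i < n \<and> j < n" if "G i j \<noteq> 0" for i j
    using that not_less by blast
  have "(\<Sum>m<Suc (2 * n). scale (t ^ m) (w m)) = 0" for t
  proof -
    let ?x = "scale t x"
    have "(\<Sum>m<Suc (2 * n). scale (t ^ m) (\<Sum>i\<le>m. G i (m - i))) =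
        (\<Sum>(m, i)\<in>Sigma {..<Suc (2 * n)} (\<lambda>m. {..m}). scale (t ^ m) (G i (m - i)))"
      by (simp only: scale_sum_right) (rule sum.Sigma; auto)
    also have "\<dots> = (\<Sum>(i, j)\<in>{(i, j). i + j < Suc (2 * n)}. scale (t ^ (i + j)) (G i j))"
      by (rule sum.reindex_bij_witness[of _ "\<lambda>(i, j). (i + j, i)" "\<lambda>(m, i). (i, m - i)"]) auto
    also have "\<dots> = (\<Sum>(i, j)\<in>{..<n} \<times> {..<n}. scale (t ^ (i + j)) (G i j))"
    proof (rule sum.mono_neutral_right)
      show "finite {(i, j). i + j < Suc (2 * n)}"
        by (rule finite_subset[of _ "{..<Suc (2 * n)} \<times> {..<Suc (2 * n)}"]) auto
    qed (auto dest: G1)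
    also have "\<dots> = (\<Sum>i<n. \<Sum>j<n. scale (t ^ (i + j)) (G i j))"
      by (rule sum.cartesian_product[symmetric])
    also have "\<dots> = (\<Sum>i<n. scale t (scale (bern i) (ad_deriv ?x i (vfield n ?x \<xi>) \<eta>))) -
        (\<Sum>j<n. scale t (scale (bern j) (ad_deriv ?x j (vfield n ?x \<eta>) \<xi>)))"
    proof -
      have "(\<Sum>i<n. \<Sum>j<n. scale (t ^ (i + j)) (scale (bern i * bern j) (ad_deriv x i (ad_pow x j u) v))) =
          (\<Sum>i<n. scale t (scale (bern i) (ad_deriv ?x i (vfield n ?x u) v)))" for u v
      proof (rule sum.cong[OF refl])
        fix i
        have "scale t (scale (bern i) (ad_deriv ?x i (vfield n ?x u) v)) =
            scale (bern i) (scale (t ^ i) (ad_deriv x i (vfield n ?x u) v))"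
          by (simp only: scale_left_commute[of t "bern i"] ad_deriv_scale_base)
        then show "(\<Sum>j<n. scale (t ^ (i + j)) (scale (bern i * bern j) (ad_deriv x i (ad_pow x j u) v))) =
            scale t (scale (bern i) (ad_deriv ?x i (vfield n ?x u) v))"
          by (simp add: vfield_def ad_deriv_sum ad_deriv_linear ad_pow_scale_base
              scale_sum_right power_add mult_ac)
      qed
      note * = this[of \<xi> \<eta>] this[of \<eta> \<xi>]
      have "(\<Sum>i<n. \<Sum>j<n. scale (t ^ (i + j)) (scale (bern i * bern j) (ad_deriv x j (ad_pow x i \<eta>) \<xi>))) =
          (\<Sum>i<n. \<Sum>j<n. scale (t ^ (i + j)) (scale (bern i * bern j) (ad_deriv x i (ad_pow x j \<eta>) \<xi>)))"
        by (subst sum.swap) (simp add: add.commute mult.commute)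
      then show ?thesis
        by (simp only: G_def scale_right_diff_distrib sum_subtractf *)
    qed
    also have "\<dots> = scale t (- vfield n ?x (br \<xi> \<eta>))"
      unfolding vfield_bracket[OF n(1), symmetric]
      by (simp add: scale_right_diff_distrib sum_subtractf scale_sum_right)
    also have "\<dots> = - (\<Sum>m<n. scale (t ^ Suc m) (scale (bern m) (ad_pow x m (br \<xi> \<eta>))))"
      by (simp add: vfield_def ad_pow_scale_base scale_sum_right mult_ac)
    also have "(\<Sum>m<n. scale (t ^ Suc m) (scale (bern m) (ad_pow x m (br \<xi> \<eta>)))) =
        (\<Sum>m<2 * n. scale (t ^ Suc m) (scale (bern m) (ad_pow x m (br \<xi> \<eta>))))"
      using n(1) ad_pow_eq_0 by (intro sum.mono_neutral_left) auto
    also have "\<dots> = (\<Sum>m<Suc (2 * n). scale (t ^ m) (if m = 0 then 0 else scale (bern (m - 1)) (ad_pow x (m - 1) (br \<xi> \<eta>))))"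
      by (subst sum.lessThan_Suc_shift) simp
    finally show ?thesis
      by (simp only: w_def scale_right_distrib sum.distrib) simp
  qed
  then have "w r = 0"
    by (rule scaled_sum_eq_0_imp_0[OF vector_space_axioms]) (use n(2) in simp)
  then show ?thesis
    by (simp add: w_def G_def eq_neg_iff_add_eq_0 split: if_splits)
qed

end

section \<open>Left multiplication and the Poincare-Birkhoff-Witt theorem\<close>

lemma linear_tscaleD:
  assumes "Vector_Spaces.linear tscale tscale f"
  shows "f (t + u) = f t + f u" "f (t - u) = f t - f u" "f (- t) = - f t" "f (tscale c t) = tscale c (f t)"
    "f 0 = 0" "f (sum g I) = (\<Sum>i\<in>I. f (g i))"
proof -
  interpret f: Vector_Spaces.linear tscale tscale f by fact
  show "f (t + u) = f t + f u" "f (t - u) = f t - f u" "f (- t) = - f t" "f (tscale c t) = tscale c (f t)"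
    "f 0 = 0" "f (sum g I) = (\<Sum>i\<in>I. f (g i))"
    by (simp_all only: f.add f.diff f.neg f.scale f.zero f.sum)
qed

lemma linear_tscaleI:
  assumes "\<And>t u. f (t + u) = f t + f u" "\<And>c t. f (tscale c t) = tscale c (f t)"
  shows "Vector_Spaces.linear tscale tscale (f :: ('g, 'k::field) tensor \<Rightarrow> ('h, 'k) tensor)"
  by (intro Vector_Spaces.linear.intro module_hom.intro module_hom_axioms.intro
      tvs.vector_space_axioms tvs.module_axioms assms)

lemma symmetric_algebra_closed:
  fixes s :: "'k::field_char_0 \<Rightarrow> 'g::ab_group_add \<Rightarrow> 'g"
  shows "0 \<in> symmetric_algebra s"
  "tens s (replicate n x) \<in> symmetric_algebra s"
  "t \<in> symmetric_algebra s \<Longrightarrow> u \<in> symmetric_algebra s \<Longrightarrow> t + u \<in> symmetric_algebra s"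
  "t \<in> symmetric_algebra s \<Longrightarrow> - t \<in> symmetric_algebra s"
  "t \<in> symmetric_algebra s \<Longrightarrow> u \<in> symmetric_algebra s \<Longrightarrow> t - u \<in> symmetric_algebra s"
  "t \<in> symmetric_algebra s \<Longrightarrow> tscale c t \<in> symmetric_algebra s"
  "(\<And>i. i \<in> I \<Longrightarrow> f i \<in> symmetric_algebra s) \<Longrightarrow> sum f I \<in> symmetric_algebra s"
  using sym_prod_mem[of s "replicate n x"] unfolding sym_prod_replicate
  by (auto simp: symmetric_algebra_eq_span
      intro: tvs.span_zero tvs.span_add tvs.span_neg tvs.span_diff tvs.span_scale tvs.span_sum)

lemma symmetric_algebra_subset: "symmetric_algebra s \<subseteq> tensor_algebra s"
  by (auto simp: symmetric_algebra_def)

lemma sum_triangle: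
  fixes f :: "nat \<Rightarrow> nat \<Rightarrow> 'w::comm_monoid_add"
  shows "(\<Sum>j\<le>m. \<Sum>i\<le>m - j. f j i) = (\<Sum>n\<le>m. \<Sum>j\<le>n. f j (n - j))"
proof -
  have "(\<Sum>j\<le>m. \<Sum>i\<le>m - j. f j i) = (\<Sum>(j, i)\<in>Sigma {..m} (\<lambda>j. {..m - j}). f j i)"
    by (rule sum.Sigma) auto
  also have "\<dots> = (\<Sum>(n, j)\<in>Sigma {..m} (\<lambda>n. {..n}). f j (n - j))"
    by (rule sum.reindex_bij_witness[of _ "\<lambda>(n, j). (j, n - j)" "\<lambda>(j, i). (j + i, j)"]) auto
  also have "\<dots> = (\<Sum>n\<le>m. \<Sum>j\<le>n. f j (n - j))"
    by (rule sum.Sigma[symmetric]) auto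
  finally show ?thesis .
qed

lemma sum_swap_args:
  fixes f :: "nat \<Rightarrow> nat \<Rightarrow> 'w::comm_monoid_add"
  shows "(\<Sum>j\<le>n. f j (n - j)) = (\<Sum>j\<le>n. f (n - j) j)"
  by (rule sum.reindex_bij_witness[of _ "\<lambda>i. n - i" "\<lambda>i. n - i"]) auto

context lie_algebra
begin

lemma foldr_br_linear:
  "foldr br xs (u + v) = foldr br xs u + foldr br xs v"
  "foldr br xs (scale c u) = scale c (foldr br xs u)"
  by (induction xs) (simp_all add: br_add_right br_scale_right)

lemma sym_prod_hd_linear:
  "sym_prod scale ((u + v) # xs) = sym_prod scale (u # xs) + sym_prod scale (v # xs)"
  "sym_prod scale (scale c u # xs) = tscale c (sym_prod scale (u # xs))"
  using multilinearD[OF multilinear_sym_prod[of scale], of "[]"] by simp_all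

lemma sym_prod_hd_sum: "sym_prod scale ((\<Sum>i\<in>I. u i) # xs) = (\<Sum>i\<in>I. sym_prod scale (u i # xs))"
  using multilinear_sum_slot[OF multilinear_sym_prod[of scale], of "[]"] by simp

lemma sym_prod_hd_zero: "sym_prod scale (0 # xs) = 0"
  using multilinear_zero[OF multilinear_sym_prod[of scale], of "[]"] by simp

lemma sym_prod_hd_minus: "sym_prod scale ((- u) # xs) = - sym_prod scale (u # xs)"
  using sym_prod_hd_linear(2)[of "-1" u xs] by (simp add: scale_minus_left)

lemma sym_prod_hd_diff: "sym_prod scale ((u - v) # xs) = sym_prod scale (u # xs) - sym_prod scale (v # xs)"
  by (simp only: diff_conv_add_uminus sym_prod_hd_linear sym_prod_hd_minus)

text \<open>The invariant vector fields act on symmetric tensors, which yields the formula for the product of \<open>\<xi>\<close>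
  with a symmetric tensor in the enveloping algebra. On the tensor algebra only the values at symmetric
  tensors matter.\<close>

definition lmul_form :: "'g \<Rightarrow> 'g list \<Rightarrow> ('g, 'k) tensor" where
  "lmul_form \<xi> ys = (\<Sum>j\<le>length ys. tscale (bern j * (fact (length ys) / fact (length ys - j)))
     (sym_prod scale (foldr br (take j ys) \<xi> # drop j ys)))"

text \<open>For each j, the varied letter is either one of the factors left outside or one of the
  first j letters, where it enters through nested brackets; both dependences are linear.\<close>

lemma multilinear_lmul_form: "multilinear scale tscale (lmul_form \<xi>)"
proof -
  let ?G = "\<lambda>ys j. sym_prod scale (foldr br (take j ys) \<xi> # drop j ys)"
  have "?G (xs @ (a + b) # ys) j = ?G (xs @ a # ys) j + ?G (xs @ b # ys) j \<and>
      ?G (xs @ scale c a # ys) j = tscale c (?G (xs @ a # ys) j)" for xs ys a b c j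
  proof (cases "j \<le> length xs")
    case True
    then show ?thesis
      using multilinearD[OF multilinear_sym_prod[of scale], of "foldr br (take j xs) \<xi> # drop j xs"] by simp
  next
    case False
    then obtain i where "j = Suc (length xs + i)"
      by (metis add_Suc_right less_iff_Suc_add not_le)
    then show ?thesis
      by (simp add: br_add_left br_scale_left foldr_br_linear sym_prod_hd_linear)
  qed
  then show ?thesis
    unfolding multilinear_def lmul_form_def
    by (simp add: tvs.scale_right_distrib sum.distrib tvs.scale_sum_right mult.commute del: tscale_apply)
qed

text \<open>The chosen map is linear on the whole function type, but only its values on
  \<open>tensor_algebra scale\<close> are determined; hence the membership assumption in
  \<open>lmul_add_base\<close>.\<close>

definition lmul :: "'g \<Rightarrow> ('g, 'k) tensor \<Rightarrow> ('g, 'k) tensor" where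
  "lmul \<xi> = (SOME f. Vector_Spaces.linear tscale tscale f \<and> (\<forall>ys. f (tens scale ys) = lmul_form \<xi> ys))"

lemma linear_lmul: "Vector_Spaces.linear tscale tscale (lmul \<xi>)"
  and lmul_tens: "lmul \<xi> (tens scale ys) = lmul_form \<xi> ys"
  using someI_ex[OF tensor_algebra_universal[OF tvs.vector_space_axioms multilinear_lmul_form, of \<xi>]]
  unfolding lmul_def by blast+

lemmas lmul_linear = linear_tscaleD[OF linear_lmul]

lemma lmul_closed:
  assumes "t \<in> tensor_algebra scale"
  shows "lmul \<xi> t \<in> symmetric_algebra scale"
  using assms
proof (induction rule: tensor_algebra_induct)
  case zero
  show ?case unfolding lmul_linear by (rule symmetric_algebra_closed)
next
  case (step c xs t)
  then show ?case
    unfolding lmul_linear lmul_tens lmul_form_def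
    by (intro symmetric_algebra_closed sym_prod_mem) simp
qed

lemma lmul_add_base:
  assumes "t \<in> tensor_algebra scale"
  shows "lmul (\<xi> + \<eta>) t = lmul \<xi> t + lmul \<eta> t" "lmul (scale c \<xi>) t = tscale c (lmul \<xi> t)"
proof -
  have "lmul (\<xi> + \<eta>) t = lmul \<xi> t + lmul \<eta> t \<and> lmul (scale c \<xi>) t = tscale c (lmul \<xi> t)"
    using assms
  proof (induction rule: tensor_algebra_induct)
    case zero
    show ?case unfolding lmul_linear by simp
  next
    case (step d xs t)
    have "lmul_form (\<xi> + \<eta>) xs = lmul_form \<xi> xs + lmul_form \<eta> xs"
      "lmul_form (scale c \<xi>) xs = tscale c (lmul_form \<xi> xs)"
      unfolding lmul_form_def foldr_br_linear sym_prod_hd_linear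
      by (simp_all only: tvs.scale_right_distrib sum.distrib tvs.scale_sum_right tvs.scale_left_commute)
    with step show ?case
      unfolding lmul_linear lmul_tens
      by (simp only: tvs.scale_right_distrib add_ac tvs.scale_left_commute)
  qed
  then show "lmul (\<xi> + \<eta>) t = lmul \<xi> t + lmul \<eta> t" "lmul (scale c \<xi>) t = tscale c (lmul \<xi> t)" by auto
qed

abbreviation spow :: "'g \<Rightarrow> nat \<Rightarrow> 'g \<Rightarrow> ('g, 'k) tensor" where
  "spow w n x \<equiv> sym_prod scale (w # replicate n x)"

lemma lmul_power:
  "lmul \<xi> (tens scale (replicate m x)) =
    (\<Sum>j\<le>m. tscale (bern j * (fact m / fact (m - j))) (spow (ad_pow x j \<xi>) (m - j) x))"
  unfolding lmul_tens lmul_form_def length_replicate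
  by (intro sum.cong refl) (simp add: min_def foldr_br_replicate)

text \<open>Only j = 0 survives, since ad x annihilates x. Thus n such steps build x^n from the
  unit, which is how a symmetric tensor will be recovered from its action.\<close>

lemma lmul_power_self: "lmul x (tens scale (replicate m x)) = tens scale (replicate (Suc m) x)"
proof -
  have "lmul x (tens scale (replicate m x)) = (\<Sum>j\<le>m. if j = 0 then tens scale (replicate (Suc m) x) else 0)"
    unfolding lmul_power
  proof (intro sum.cong refl)
    fix j
    show "tscale (bern j * (fact m / fact (m - j))) (spow (ad_pow x j x) (m - j) x) =
        (if j = 0 then tens scale (replicate (Suc m) x) else 0)"
    proof (cases "j = 0")
      case True
      then show ?thesis
        using sym_prod_replicate[of scale "Suc m" x] by (simp add: bern_simps del: tscale_apply)
    next
      case False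
      then have "ad_pow x j x = 0" by (intro ad_pow_self) simp
      then show ?thesis
        by (simp only: sym_prod_hd_zero tvs.scale_zero_right False if_False)
    qed
  qed
  then show ?thesis
    by (simp only: sum.delta finite_atMost) simp
qed

text \<open>On average over its position, v is either among the j letters swallowed by the brackets,
  which gives the derivative of \<open>ad_pow x j \<eta>\<close> in the direction v, or it remains a
  factor, which happens for n + 1 - j positions.\<close>

lemma lmul_spow:
  "lmul \<eta> (spow v n x) = (\<Sum>j\<le>Suc n. tscale (bern j * (fact n / fact (Suc n - j)))
     (spow (ad_deriv x j v \<eta>) (Suc n - j) x +
      tscale (of_nat (Suc n - j)) (sym_prod scale (ad_pow x j \<eta> # v # replicate (n - j) x))))"
proof -
  let ?l = "\<lambda>i. replicate i x @ v # replicate (n - i) x"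
  let ?G = "\<lambda>i j. sym_prod scale (foldr br (take j (?l i)) \<eta> # drop j (?l i))"
  let ?H = "\<lambda>j. spow (ad_deriv x j v \<eta>) (Suc n - j) x +
      tscale (of_nat (Suc n - j)) (sym_prod scale (ad_pow x j \<eta> # v # replicate (n - j) x))"
  have G: "(\<Sum>i\<le>n. ?G i j) = ?H j" if "j \<le> Suc n" for j
  proof -
    have 1: "?G i j = spow (ad_pow x i (br v (ad_pow x (j - 1 - i) \<eta>))) (Suc n - j) x" if "i < j" for i
    proof -
      obtain k where k: "j = Suc (i + k)"
        using \<open>i < j\<close> by (metis less_iff_Suc_add add_Suc_right)
      then have "min (n - i) k = k"
        using \<open>j \<le> Suc n\<close> by simp
      then show ?thesis
        using k \<open>j \<le> Suc n\<close> by (simp add: foldr_br_replicate)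
    qed
    have 2: "?G i j = sym_prod scale (ad_pow x j \<eta> # v # replicate (n - j) x)" if "j \<le> i" "i \<le> n" for i
      using that by (intro sym_prod_cong_mset) (simp add: min_def foldr_br_replicate multiset_eq_iff)
    have "{..n} = {..<j} \<union> {j..n}" using that by auto
    then have "(\<Sum>i\<le>n. ?G i j) = (\<Sum>i<j. ?G i j) + (\<Sum>i=j..n. ?G i j)"
      by (simp only:) (rule sum.union_disjoint; auto)
    also have "(\<Sum>i<j. ?G i j) = (\<Sum>i<j. spow (ad_pow x i (br v (ad_pow x (j - 1 - i) \<eta>))) (Suc n - j) x)"
      using 1 by (intro sum.cong refl) simp
    also have "(\<Sum>i=j..n. ?G i j) = (\<Sum>i=j..n. sym_prod scale (ad_pow x j \<eta> # v # replicate (n - j) x))"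
      using 2 by (intro sum.cong refl) simp
    also have "\<dots> = tscale (of_nat (Suc n - j)) (sym_prod scale (ad_pow x j \<eta> # v # replicate (n - j) x))"
      using that by (simp add: fun_eq_iff sum_apply)
    finally show ?thesis
      by (simp only: ad_deriv_def sym_prod_hd_sum)
  qed
  have "lmul \<eta> (spow v n x) = tscale (1 / of_nat (Suc n)) (\<Sum>i\<le>n. \<Sum>j\<le>Suc n.
      tscale (bern j * (fact (Suc n) / fact (Suc n - j))) (?G i j))"
    unfolding sym_prod_Cons_replicate[of scale v n x] lmul_linear lmul_tens lmul_form_def
    by (rule arg_cong2[where f = tscale, OF refl], rule sum.cong[OF refl]) simp
  also have "\<dots> = (\<Sum>j\<le>Suc n. tscale (1 / of_nat (Suc n)) (tscale (bern j * (fact (Suc n) / fact (Suc n - j))) (\<Sum>i\<le>n. ?G i j)))"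
    by (subst sum.swap) (simp only: tvs.scale_sum_right)
  also have "\<dots> = (\<Sum>j\<le>Suc n. tscale (bern j * (fact n / fact (Suc n - j))) (?H j))"
  proof (intro sum.cong refl)
    fix j assume "j \<in> {..Suc n}"
    then have "(\<Sum>i\<le>n. ?G i j) = ?H j" using G by simp
    moreover have "1 / of_nat (Suc n) * (bern j * (fact (Suc n) / fact (Suc n - j))) =
        bern j * (fact n / fact (Suc n - j) :: 'k)"
      by (simp del: of_nat_Suc)
    ultimately show "tscale (1 / of_nat (Suc n)) (tscale (bern j * (fact (Suc n) / fact (Suc n - j))) (\<Sum>i\<le>n. ?G i j)) =
        tscale (bern j * (fact n / fact (Suc n - j))) (?H j)"
      by (simp only: tvs.scale_scale)
  qed
  finally show ?thesis .
qed

text \<open>In X the vector produced by the first operator is absorbed into the brackets of the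
  second; in Y both vectors remain separate factors. Y is symmetric in the two operators and will
  cancel in the commutator.\<close>

lemma lmul_lmul_power:
  fixes x :: 'g and m :: nat
  defines "X \<equiv> \<lambda>\<xi> \<eta> j i. tscale (bern j * bern i / fact (Suc m - (j + i)))
      (spow (ad_deriv x i (ad_pow x j \<xi>) \<eta>) (Suc m - (j + i)) x)"
    and "Y \<equiv> \<lambda>\<xi> \<eta> j i. tscale (bern j * bern i / fact (m - (j + i)))
      (sym_prod scale (ad_pow x i \<eta> # ad_pow x j \<xi> # replicate (m - (j + i)) x))"
  shows "lmul \<eta> (lmul \<xi> (tens scale (replicate m x))) = tscale (fact m)
    ((\<Sum>n\<le>Suc m. \<Sum>j\<le>n. X \<xi> \<eta> j (n - j)) + (\<Sum>n\<le>m. \<Sum>j\<le>n. Y \<xi> \<eta> j (n - j)))"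
proof -
  have inner: "tscale (bern j * (fact m / fact (m - j))) (lmul \<eta> (spow (ad_pow x j \<xi>) (m - j) x)) =
      tscale (fact m) ((\<Sum>i\<le>Suc m - j. X \<xi> \<eta> j i) + (\<Sum>i\<le>m - j. Y \<xi> \<eta> j i))" if j: "j \<le> m" for j
  proof -
    have "tscale (bern j * (fact m / fact (m - j))) (lmul \<eta> (spow (ad_pow x j \<xi>) (m - j) x)) =
        (\<Sum>i\<le>Suc (m - j). tscale (fact m) (X \<xi> \<eta> j i + (if i \<le> m - j then Y \<xi> \<eta> j i else 0)))"
      unfolding lmul_spow tvs.scale_sum_right
    proof (intro sum.cong refl)
      fix i assume i: "i \<in> {..Suc (m - j)}"
      have e: "Suc (m - j) - i = Suc m - (j + i)" "m - j - i = m - (j + i)"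
        using j i by auto
      let ?S = "sym_prod scale (ad_pow x i \<eta> # ad_pow x j \<xi> # replicate (m - (j + i)) x)"
      let ?T = "spow (ad_deriv x i (ad_pow x j \<xi>) \<eta>) (Suc m - (j + i)) x"
      let ?f = "fact (Suc m - (j + i)) :: 'k"
      have 1: "bern j * (fact m / fact (m - j)) * (bern i * (fact (m - j) / ?f)) = fact m * (bern j * bern i / ?f :: 'k)"
        by simp
      have 2: "tscale (bern j * bern i / ?f) (tscale (of_nat (Suc m - (j + i))) ?S) = (if i \<le> m - j then Y \<xi> \<eta> j i else 0)"
      proof (cases "i \<le> m - j")
        case True
        then have "Suc m - (j + i) = Suc (m - (j + i))" using j by auto
        then have "bern j * bern i / ?f * of_nat (Suc m - (j + i)) = (bern j * bern i / fact (m - (j + i)) :: 'k)"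
          by (simp del: of_nat_Suc)
        then show ?thesis
          using True by (simp only: Y_def tvs.scale_scale if_True)
      next
        case False
        then show ?thesis using i by (simp add: le_Suc_eq)
      qed
      show "tscale (bern j * (fact m / fact (m - j))) (tscale (bern i * (fact (m - j) / fact (Suc (m - j) - i)))
          (spow (ad_deriv x i (ad_pow x j \<xi>) \<eta>) (Suc (m - j) - i) x +
           tscale (of_nat (Suc (m - j) - i)) (sym_prod scale (ad_pow x i \<eta> # ad_pow x j \<xi> # replicate (m - j - i) x)))) =
        tscale (fact m) (X \<xi> \<eta> j i + (if i \<le> m - j then Y \<xi> \<eta> j i else 0))"
        unfolding e 2[symmetric] X_def
        by (simp only: tvs.scale_scale[of "bern j * (fact m / fact (m - j))"] 1 tvs.scale_right_distrib)
          (simp only: tvs.scale_scale[symmetric, of "fact m"])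
    qed
    also have "\<dots> = tscale (fact m) ((\<Sum>i\<le>Suc (m - j). X \<xi> \<eta> j i) + (\<Sum>i\<le>Suc (m - j). if i \<le> m - j then Y \<xi> \<eta> j i else 0))"
      by (simp only: tvs.scale_sum_right[symmetric] sum.distrib)
    also have "(\<Sum>i\<le>Suc (m - j). if i \<le> m - j then Y \<xi> \<eta> j i else 0) = (\<Sum>i\<le>m - j. Y \<xi> \<eta> j i)"
      by simp
    finally show ?thesis
      using j by (simp only: Suc_diff_le)
  qed
  have "lmul \<eta> (lmul \<xi> (tens scale (replicate m x))) =
      tscale (fact m) ((\<Sum>j\<le>m. \<Sum>i\<le>Suc m - j. X \<xi> \<eta> j i) + (\<Sum>j\<le>m. \<Sum>i\<le>m - j. Y \<xi> \<eta> j i))"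
    unfolding lmul_power lmul_linear sum.distrib[symmetric] tvs.scale_sum_right
    using inner by (intro sum.cong refl) simp
  \<comment> \<open>The additional index j = m + 1 admits only i = 0, where
    \<open>ad_deriv x 0\<close> vanishes. It completes the index set to a triangle.\<close>
  also have "(\<Sum>j\<le>m. \<Sum>i\<le>Suc m - j. X \<xi> \<eta> j i) = (\<Sum>j\<le>Suc m. \<Sum>i\<le>Suc m - j. X \<xi> \<eta> j i)"
    by (simp add: X_def ad_deriv_linear sym_prod_hd_zero)
  finally show ?thesis
    by (simp only: sum_triangle)
qed

end

context nilpotent_lie_algebra
begin

text \<open>Only the X terms survive. In each degree n, their difference is
  \<open>bern_bracket\<close>, multiplied by the common power of x.\<close>

lemma lmul_commutator_power:
  "lmul \<eta> (lmul \<xi> (tens scale (replicate m x))) - lmul \<xi> (lmul \<eta> (tens scale (replicate m x))) =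
    - lmul (br \<xi> \<eta>) (tens scale (replicate m x))"
proof -
  define X where "X \<xi> \<eta> j i = tscale (bern j * bern i / fact (Suc m - (j + i)))
      (spow (ad_deriv x i (ad_pow x j \<xi>) \<eta>) (Suc m - (j + i)) x)" for \<xi> \<eta> j i
  define Y where "Y \<xi> \<eta> j i = tscale (bern j * bern i / fact (m - (j + i)))
      (sym_prod scale (ad_pow x i \<eta> # ad_pow x j \<xi> # replicate (m - (j + i)) x))" for \<xi> \<eta> j i
  have Y: "Y \<eta> \<xi> j i = Y \<xi> \<eta> i j" for i j
    unfolding Y_def by (intro arg_cong2[where f = tscale] sym_prod_cong_mset) (simp_all add: add.commute mult.commute)
  have X: "(\<Sum>j\<le>n. X \<xi> \<eta> j (n - j)) - (\<Sum>j\<le>n. X \<eta> \<xi> j (n - j)) =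
      (if n = 0 then 0 else - tscale (bern (n - 1) / fact (Suc m - n)) (spow (ad_pow x (n - 1) (br \<xi> \<eta>)) (Suc m - n) x))" for n
  proof -
    have "(\<Sum>j\<le>n. X \<xi> \<eta> j (n - j)) = (\<Sum>i\<le>n. X \<xi> \<eta> (n - i) i)"
      by (rule sum_swap_args)
    then have "(\<Sum>j\<le>n. X \<xi> \<eta> j (n - j)) - (\<Sum>j\<le>n. X \<eta> \<xi> j (n - j)) =
        (\<Sum>i\<le>n. tscale (1 / fact (Suc m - n)) (spow (scale (bern i * bern (n - i))
          (ad_deriv x i (ad_pow x (n - i) \<xi>) \<eta> - ad_deriv x (n - i) (ad_pow x i \<eta>) \<xi>)) (Suc m - n) x))"
    proof (simp only: sum_subtractf[symmetric], intro sum.cong refl)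
      fix i assume "i \<in> {..n}"
      then have i: "n - i + i = n" "i + (n - i) = n" by auto
      have c: "bern (n - i) * bern i / fact (Suc m - n) = 1 / fact (Suc m - n) * (bern i * bern (n - i) :: 'k)"
        "bern i * bern (n - i) / fact (Suc m - n) = 1 / fact (Suc m - n) * (bern i * bern (n - i) :: 'k)"
        by simp_all
      show "X \<xi> \<eta> (n - i) i - X \<eta> \<xi> i (n - i) = tscale (1 / fact (Suc m - n)) (spow (scale (bern i * bern (n - i))
          (ad_deriv x i (ad_pow x (n - i) \<xi>) \<eta> - ad_deriv x (n - i) (ad_pow x i \<eta>) \<xi>)) (Suc m - n) x)"
        unfolding X_def i sym_prod_hd_linear(2) sym_prod_hd_diff c
        by (simp only: tvs.scale_right_diff_distrib tvs.scale_scale)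
    qed
    also have "\<dots> = tscale (1 / fact (Suc m - n)) (spow (\<Sum>i\<le>n. scale (bern i * bern (n - i))
          (ad_deriv x i (ad_pow x (n - i) \<xi>) \<eta> - ad_deriv x (n - i) (ad_pow x i \<eta>) \<xi>)) (Suc m - n) x)"
      by (simp only: sym_prod_hd_sum tvs.scale_sum_right)
    finally show ?thesis
      unfolding bern_bracket
      by (simp add: sym_prod_hd_zero sym_prod_hd_minus sym_prod_hd_linear mult.commute del: tscale_apply)
  qed
  let ?P = "tens scale (replicate m x)"
  have "lmul \<eta> (lmul \<xi> ?P) - lmul \<xi> (lmul \<eta> ?P) = tscale (fact m)
      (((\<Sum>n\<le>Suc m. \<Sum>j\<le>n. X \<xi> \<eta> j (n - j)) + (\<Sum>n\<le>m. \<Sum>j\<le>n. Y \<xi> \<eta> j (n - j))) -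
       ((\<Sum>n\<le>Suc m. \<Sum>j\<le>n. X \<eta> \<xi> j (n - j)) + (\<Sum>n\<le>m. \<Sum>j\<le>n. Y \<eta> \<xi> j (n - j))))"
    unfolding lmul_lmul_power X_def Y_def by (simp only: tvs.scale_right_diff_distrib)
  also have "(\<Sum>n\<le>m. \<Sum>j\<le>n. Y \<eta> \<xi> j (n - j)) = (\<Sum>n\<le>m. \<Sum>j\<le>n. Y \<xi> \<eta> j (n - j))"
    unfolding Y by (rule sum.cong[OF refl], rule sum_swap_args[symmetric])
  also have "tscale (fact m)
      (((\<Sum>n\<le>Suc m. \<Sum>j\<le>n. X \<xi> \<eta> j (n - j)) + (\<Sum>n\<le>m. \<Sum>j\<le>n. Y \<xi> \<eta> j (n - j))) -
       ((\<Sum>n\<le>Suc m. \<Sum>j\<le>n. X \<eta> \<xi> j (n - j)) + (\<Sum>n\<le>m. \<Sum>j\<le>n. Y \<xi> \<eta> j (n - j)))) =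
      tscale (fact m) (\<Sum>n\<le>Suc m. (\<Sum>j\<le>n. X \<xi> \<eta> j (n - j)) - (\<Sum>j\<le>n. X \<eta> \<xi> j (n - j)))"
    by (simp only: sum_subtractf add_diff_cancel_right)
  also have "\<dots> = tscale (fact m) (\<Sum>n\<le>m. - tscale (bern n / fact (m - n)) (spow (ad_pow x n (br \<xi> \<eta>)) (m - n) x))"
    unfolding X by (subst sum.atMost_Suc_shift) simp
  also have "\<dots> = - lmul (br \<xi> \<eta>) ?P"
    unfolding lmul_power sum_negf tvs.scale_minus_right tvs.scale_sum_right tvs.scale_scale
    by (simp add: mult.commute)
  finally show ?thesis .
qed

text \<open>By linearity from the powers: \<open>lmul\<close> represents the Lie algebra on
  symmetric tensors, so the defining relations of the enveloping algebra act as zero.\<close>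

lemma lmul_commutator:
  assumes "t \<in> symmetric_algebra scale"
  shows "lmul x (lmul y t) - lmul y (lmul x t) = lmul (br x y) t"
proof -
  define f where "f t = lmul x (lmul y t) - lmul y (lmul x t) + lmul (br y x) t" for t
  have "f t \<in> {0}"
  proof (rule symmetric_algebra_powers_induct[OF assms])
    show "Vector_Spaces.linear tscale tscale f"
      by (rule linear_tscaleI)
        (simp_all add: f_def lmul_linear tvs.scale_right_distrib tvs.scale_right_diff_distrib del: tscale_apply)
    show "tvs.subspace {0}" by (simp add: tvs.subspace_def)
    show "f (tens scale (replicate n z)) \<in> {0}" for n z
      by (simp add: f_def lmul_commutator_power)
  qed
  moreover have "lmul (br y x) t = - lmul (br x y) t"
    using lmul_add_base(2)[of t "-1" "br x y"] assms symmetric_algebra_subset[of scale]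
    by (simp add: br_anticomm[of y x] subset_iff)
  ultimately show ?thesis
    by (simp add: f_def)
qed

end

section \<open>The action of the tensor algebra on symmetric tensors\<close>

context lie_algebra
begin

lemma multilinear_foldr_lmul:
  assumes u: "u \<in> tensor_algebra scale"
  shows "multilinear scale tscale (\<lambda>xs. foldr lmul xs u)"
proof -
  have T: "foldr lmul xs u \<in> tensor_algebra scale" for xs
    using u lmul_closed symmetric_algebra_subset by (induction xs) auto
  have "foldr lmul xs (t + t') = foldr lmul xs t + foldr lmul xs t'"
    "foldr lmul xs (tscale c t) = tscale c (foldr lmul xs t)" for xs t t' c
    by (induction xs) (simp_all only: foldr.simps o_apply id_apply lmul_linear)
  then show ?thesis
    unfolding multilinear_def by (simp only: foldr_append foldr.simps o_apply lmul_add_base[OF T] simp_thms)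
qed

text \<open>In \<open>act u t\<close> the tensor \<open>t\<close> is read as a composite of
  operators \<open>lmul\<close> and applied to \<open>u\<close>. The operand comes first because the
  universal property provides linearity in \<open>t\<close>.\<close>

definition act :: "('g, 'k) tensor \<Rightarrow> ('g, 'k) tensor \<Rightarrow> ('g, 'k) tensor" where
  "act u = (SOME f. Vector_Spaces.linear tscale tscale f \<and> (\<forall>xs. f (tens scale xs) = foldr lmul xs u))"

lemma
  assumes "u \<in> tensor_algebra scale"
  shows linear_act: "Vector_Spaces.linear tscale tscale (act u)"
    and act_tens: "act u (tens scale xs) = foldr lmul xs u"
  using someI_ex[OF tensor_algebra_universal[OF tvs.vector_space_axioms multilinear_foldr_lmul[OF assms]]]
  unfolding act_def by blast+

lemmas act_linear = linear_tscaleD[OF linear_act]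

lemma act_closed:
  assumes "t \<in> tensor_algebra scale" "u \<in> symmetric_algebra scale"
  shows "act u t \<in> symmetric_algebra scale"
  using assms(1)
proof (induction rule: tensor_algebra_induct)
  have u: "u \<in> tensor_algebra scale" using assms(2) symmetric_algebra_subset by blast
  case zero
  show ?case unfolding act_linear[OF u] by (rule symmetric_algebra_closed)
next
  have u: "u \<in> tensor_algebra scale" using assms(2) symmetric_algebra_subset by blast
  case (step c xs t)
  have "foldr lmul xs u \<in> symmetric_algebra scale"
    using assms(2) lmul_closed symmetric_algebra_subset by (induction xs) auto
  with step show ?case
    unfolding act_linear[OF u] act_tens[OF u] by (intro symmetric_algebra_closed)
qed

lemma act_tmult:
  assumes t: "t \<in> tensor_algebra scale" and t': "t' \<in> tensor_algebra scale" and u: "u \<in> symmetric_algebra scale"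
  shows "act u (tmult scale t t') = act (act u t') t"
  using t
proof (induction rule: tensor_algebra_induct)
  have T: "u \<in> tensor_algebra scale" "act u t' \<in> tensor_algebra scale"
    using u act_closed[OF t' u] symmetric_algebra_subset by blast+
  case zero
  show ?case by (simp only: tmult_bilinear act_linear[OF T(1)] act_linear[OF T(2)])
next
  have T: "u \<in> tensor_algebra scale" "act u t' \<in> tensor_algebra scale"
    using u act_closed[OF t' u] symmetric_algebra_subset by blast+
  have lin: "foldr lmul xs (t + t') = foldr lmul xs t + foldr lmul xs t'"
    "foldr lmul xs (tscale c t) = tscale c (foldr lmul xs t)" "foldr lmul xs 0 = 0" for xs t t' c
    by (induction xs) (simp_all only: foldr.simps o_apply id_apply lmul_linear)
  case (step c xs t)
  have "act u (tmult scale (tens scale xs) t') = foldr lmul xs (act u t')"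
    using t'
  proof (induction rule: tensor_algebra_induct)
    case zero
    show ?case by (simp only: tmult_bilinear(6) tensor_algebra_closed act_linear[OF T(1)] lin)
  next
    case (step d ys t'')
    then show ?case
      by (simp only: tmult_bilinear(4,5) tensor_algebra_closed act_linear[OF T(1)] lin tmult_tens act_tens[OF T(1)]
          foldr_append o_apply)
  qed
  with step show ?case
    by (simp only: tmult_bilinear(1,2) act_linear[OF T(1)] act_linear[OF T(2)] act_tens[OF T(2)])
qed

text \<open>Repeated use of \<open>lmul_power_self\<close> shows this for powers, and these
  span.\<close>

lemma act_one:
  assumes "t \<in> symmetric_algebra scale"
  shows "act (tens scale []) t = t"
proof -
  note one = tensor_algebra_closed(2)[of scale "[]"]
  have "foldr lmul (replicate n x) (tens scale []) = tens scale (replicate n x)" for n x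
  proof (induction n)
    case (Suc n)
    have "foldr lmul (replicate (Suc n) x) (tens scale []) = lmul x (foldr lmul (replicate n x) (tens scale []))"
      by (simp only: replicate_Suc foldr.simps o_apply)
    then show ?case
      by (simp only: Suc lmul_power_self)
  qed simp
  note powers = this
  define f where "f t = act (tens scale []) t - t" for t
  have "f t \<in> {0}"
  proof (rule symmetric_algebra_powers_induct[OF assms])
    show "Vector_Spaces.linear tscale tscale f"
      by (rule linear_tscaleI)
        (simp_all add: f_def act_linear[OF one] tvs.scale_right_diff_distrib del: tscale_apply)
    show "tvs.subspace {0}" by (simp add: tvs.subspace_def)
    show "f (tens scale (replicate n x)) \<in> {0}" for n x
      by (simp only: f_def act_tens[OF one] powers diff_self singleton_iff)
  qed
  then show ?thesis by (simp add: f_def)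
qed

lemma act_zero:
  assumes "t \<in> tensor_algebra scale"
  shows "act 0 t = 0"
  using assms
proof (induction rule: tensor_algebra_induct)
  note z = tensor_algebra_closed(1)[of scale]
  case zero
  show ?case by (rule act_linear[OF z])
next
  note z = tensor_algebra_closed(1)[of scale]
  case (step c xs t)
  have "foldr lmul xs 0 = 0"
    by (induction xs) (simp_all only: foldr.simps o_apply id_apply lmul_linear)
  with step show ?case
    by (simp only: act_linear[OF z] act_tens[OF z] tvs.scale_zero_right add_0)
qed

definition act_kernel :: "('g, 'k) tensor set" where
  "act_kernel = {t \<in> tensor_algebra scale. \<forall>u\<in>symmetric_algebra scale. act u t = 0}"

text \<open>The annihilator of a module is two-sided: t a kills u because a does, and a t kills u
  because a kills the result of t on u.\<close>

lemma ideal_act_kernel: "ideal act_kernel (tensor_ring scale)"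
proof (rule idealI[OF ring_tensor_ring])
  note lin = act_linear[OF subsetD[OF symmetric_algebra_subset]]
  interpret R: ring "tensor_ring scale" by (rule ring_tensor_ring)
  have minus: "inv\<^bsub>add_monoid (tensor_ring scale)\<^esub> t = - t" if "t \<in> tensor_algebra scale" for t
    unfolding a_inv_def[symmetric]
    by (rule R.minus_equality) (use that in \<open>simp_all add: tensor_algebra_closed\<close>)
  show "subgroup act_kernel (add_monoid (tensor_ring scale))"
  proof (rule group.subgroupI[OF R.a_group])
    show "act_kernel \<noteq> {}"
      using act_zero by (auto simp: act_kernel_def tensor_algebra_closed lin intro!: exI[of _ 0])
    show "inv\<^bsub>add_monoid (tensor_ring scale)\<^esub> a \<in> act_kernel" if "a \<in> act_kernel" for a
    proof -
      have "a \<in> tensor_algebra scale"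
        using that by (simp add: act_kernel_def)
      then show ?thesis
        using that unfolding minus[OF \<open>a \<in> tensor_algebra scale\<close>]
        by (simp add: act_kernel_def tensor_algebra_closed lin)
    qed
  qed (auto simp: act_kernel_def tensor_algebra_closed lin)
  fix a t assume "a \<in> act_kernel" "t \<in> carrier (tensor_ring scale)"
  then have a: "a \<in> tensor_algebra scale" "\<And>u. u \<in> symmetric_algebra scale \<Longrightarrow> act u a = 0" and t: "t \<in> tensor_algebra scale"
    by (auto simp: act_kernel_def)
  show "t \<otimes>\<^bsub>tensor_ring scale\<^esub> a \<in> act_kernel" "a \<otimes>\<^bsub>tensor_ring scale\<^esub> t \<in> act_kernel"
    using a t act_closed[OF t] by (auto simp: act_kernel_def tmult_closed act_tmult act_zero)
qed

end

context nilpotent_lie_algebra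
begin

lemma env_ideal_subset_act_kernel: "env_ideal scale br \<subseteq> act_kernel"
  unfolding env_ideal_def
proof (rule ring.genideal_minimal[OF ring_tensor_ring ideal_act_kernel])
  have "act u (tens scale [x, y] - tens scale [y, x] - tens scale [br x y]) = 0" if "u \<in> symmetric_algebra scale" for u x y
  proof -
    have u: "u \<in> tensor_algebra scale"
      using that symmetric_algebra_subset by blast
    show ?thesis
      using lmul_commutator[OF that, of x y] by (simp add: act_linear[OF u] act_tens[OF u])
  qed
  then show "{tens scale [x, y] - tens scale [y, x] - tens scale [br x y] | x y. True} \<subseteq> act_kernel"
    by (auto simp: act_kernel_def tensor_algebra_closed)
qed

text \<open>The half of the Poincare-Birkhoff-Witt theorem that needs the action: elements of the
  ideal act as zero, whereas a symmetric tensor applied to the unit gives itself.\<close>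

theorem symmetric_env_ideal_eq_0:
  assumes "t \<in> symmetric_algebra scale" "t \<in> env_ideal scale br"
  shows "t = 0"
proof -
  have "tens scale [] \<in> symmetric_algebra scale"
    using symmetric_algebra_closed(2)[of scale 0] by simp
  then have "act (tens scale []) t = 0"
    using assms(2) env_ideal_subset_act_kernel by (auto simp: act_kernel_def)
  then show ?thesis
    using act_one[OF assms(1)] by simp
qed

end

section \<open>Congruence modulo the defining ideal of the enveloping algebra\<close>

context lie_algebra
begin

lemma env_ideal_closed:
  shows "0 \<in> env_ideal scale br"
    and "t \<in> env_ideal scale br \<Longrightarrow> u \<in> env_ideal scale br \<Longrightarrow> t + u \<in> env_ideal scale br"
    and "t \<in> env_ideal scale br \<Longrightarrow> tscale c t \<in> env_ideal scale br"
    and "t \<in> env_ideal scale br \<Longrightarrow> - t \<in> env_ideal scale br"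
    and "t \<in> env_ideal scale br \<Longrightarrow> u \<in> env_ideal scale br \<Longrightarrow> t - u \<in> env_ideal scale br"
    and "t \<in> env_ideal scale br \<Longrightarrow> u \<in> tensor_algebra scale \<Longrightarrow> tmult scale t u \<in> env_ideal scale br"
    and "t \<in> env_ideal scale br \<Longrightarrow> u \<in> tensor_algebra scale \<Longrightarrow> tmult scale u t \<in> env_ideal scale br"
    and "env_ideal scale br \<subseteq> tensor_algebra scale"
    and "tens scale [x, y] - tens scale [y, x] - tens scale [br x y] \<in> env_ideal scale br"
proof -
  interpret I: ideal "env_ideal scale br" "tensor_ring scale" by (rule ideal_env_ideal)
  show sub: "env_ideal scale br \<subseteq> tensor_algebra scale"
    using I.a_subset by simp
  show "0 \<in> env_ideal scale br"
    using additive_subgroup.zero_closed[OF I.is_additive_subgroup] by simp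
  show "t + u \<in> env_ideal scale br" if "t \<in> env_ideal scale br" "u \<in> env_ideal scale br" for t u
    using additive_subgroup.a_closed[OF I.is_additive_subgroup, OF that] by simp
  show "tmult scale t u \<in> env_ideal scale br" "tmult scale u t \<in> env_ideal scale br"
    if "t \<in> env_ideal scale br" "u \<in> tensor_algebra scale" for t u
    using I.I_r_closed[of t u] I.I_l_closed[of t u] that by simp_all
  show sc: "tscale c t \<in> env_ideal scale br" if "t \<in> env_ideal scale br" for c t
  proof -
    have t: "t \<in> tensor_algebra scale" using that sub by blast
    \<comment> \<open>The ideal is one of a ring; a scalar acts as multiplication by a multiple of
      the unit.\<close>
    have "tmult scale (tscale c (tens scale [])) t = tscale c t"
      using ring.ring_simprules(12)[OF ring_tensor_ring, of t scale] t by (simp add: tmult_bilinear)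
    then show ?thesis
      using I.I_l_closed[of t "tscale c (tens scale [])"] that by (simp add: tensor_algebra_closed)
  qed
  show m: "- t \<in> env_ideal scale br" if "t \<in> env_ideal scale br" for t
    using sc[OF that, of "-1"] by simp
  show "t - u \<in> env_ideal scale br" if "t \<in> env_ideal scale br" "u \<in> env_ideal scale br" for t u
    using additive_subgroup.a_closed[OF I.is_additive_subgroup, OF that(1) m[OF that(2)]] by simp
  have "{tens scale [x, y] - tens scale [y, x] - tens scale [br x y] | x y. True} \<subseteq> env_ideal scale br"
    unfolding env_ideal_def
    by (rule ring.genideal_self[OF ring_tensor_ring]) (auto simp: tensor_algebra_closed)
  then show "tens scale [x, y] - tens scale [y, x] - tens scale [br x y] \<in> env_ideal scale br"
    by blast
qed

lemma subspace_env_ideal: "tvs.subspace (env_ideal scale br)"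
  unfolding tvs.subspace_def by (simp add: env_ideal_closed)

definition env_eq :: "('g, 'k) tensor \<Rightarrow> ('g, 'k) tensor \<Rightarrow> bool" (infix "\<doteq>" 50) where
  "t \<doteq> u \<longleftrightarrow> t - u \<in> env_ideal scale br"

lemma env_eq_refl: "t \<doteq> t"
  by (simp add: env_eq_def env_ideal_closed)

lemma env_eq_trans [trans]: "t \<doteq> u \<Longrightarrow> u \<doteq> v \<Longrightarrow> t \<doteq> v"
  using env_ideal_closed(2)[of "t - u" "u - v"] by (simp add: env_eq_def)

lemma env_eq_sym: "t \<doteq> u \<Longrightarrow> u \<doteq> t"
  using env_ideal_closed(4)[of "t - u"] by (simp add: env_eq_def)

lemma env_eq_add: "t \<doteq> u \<Longrightarrow> t' \<doteq> u' \<Longrightarrow> t + t' \<doteq> u + u'"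
  using env_ideal_closed(2)[of "t - u" "t' - u'"] by (simp add: env_eq_def algebra_simps)

lemma env_eq_scale: "t \<doteq> u \<Longrightarrow> tscale c t \<doteq> tscale c u"
  using env_ideal_closed(3)[of "t - u" c] by (simp add: env_eq_def tvs.scale_right_diff_distrib)

lemma env_eq_sum: "(\<And>i. i \<in> I \<Longrightarrow> f i \<doteq> g i) \<Longrightarrow> sum f I \<doteq> sum g I"
  by (induction I rule: infinite_finite_induct) (simp_all add: env_eq_refl env_eq_add)

lemma env_eq_tmult_left:
  assumes "t \<doteq> u" "t \<in> tensor_algebra scale" "u \<in> tensor_algebra scale" "v \<in> tensor_algebra scale"
  shows "tmult scale v t \<doteq> tmult scale v u"
proof -
  have "tmult scale v (t - u) + tmult scale v u = tmult scale v t"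
    using tmult_bilinear(4)[of v scale "t - u" u] assms by (simp add: tensor_algebra_closed)
  then have "tmult scale v (t - u) = tmult scale v t - tmult scale v u"
    by (simp add: eq_diff_eq)
  then show ?thesis
    using env_ideal_closed(7)[of "t - u" v] assms by (simp add: env_eq_def)
qed

lemma env_eq_commutator: "tens scale (as @ x # y # bs) \<doteq> tens scale (as @ y # x # bs) + tens scale (as @ br x y # bs)"
proof -
  let ?d = "tens scale [x, y] - tens scale [y, x] - tens scale [br x y]"
  have T: "tens scale zs \<in> tensor_algebra scale" for zs by (rule tensor_algebra_closed)
  have m: "tmult scale t (- u) = - tmult scale t u" if "t \<in> tensor_algebra scale" "u \<in> tensor_algebra scale" for t u
    using tmult_bilinear(5)[OF that, of "-1"] by simp
  have "tmult scale (tens scale as) (tmult scale ?d (tens scale bs)) \<in> env_ideal scale br"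
    by (intro env_ideal_closed T)
  also have "tmult scale ?d (tens scale bs) =
      tens scale (x # y # bs) + (- tens scale (y # x # bs)) + (- tens scale (br x y # bs))"
    using tmult_bilinear(2)[of scale "-1" _ "tens scale bs"]
    by (simp only: diff_conv_add_uminus tmult_bilinear(1)) (simp add: tmult_tens)
  also have "tmult scale (tens scale as) \<dots> =
      tens scale (as @ x # y # bs) - tens scale (as @ y # x # bs) - tens scale (as @ br x y # bs)"
    by (simp only: tmult_bilinear(4) tensor_algebra_closed m tmult_tens append_Cons) simp
  finally show ?thesis
    by (simp only: env_eq_def diff_diff_eq)
qed

text \<open>Each exchange of neighbours creates a term with one bracket more and one letter x less;
  Pascal's rule counts the ways to reach j brackets.\<close>

lemma env_eq_move_left:
  assumes "i \<le> k"
  shows "tens scale (replicate i x @ \<xi> # replicate (k - i) x) \<doteq>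
    (\<Sum>j\<le>i. tscale (of_nat (i choose j)) (tens scale (ad_pow x j \<xi> # replicate (k - j) x)))"
  using assms
proof (induction i arbitrary: k \<xi>)
  case 0
  show ?case by (simp add: env_eq_refl)
next
  case (Suc i)
  let ?P = "\<lambda>j. tens scale (ad_pow x j \<xi> # replicate (k - j) x)"
  obtain k' where k: "k = Suc k'" using Suc.prems by (cases k) auto
  have "tens scale (replicate i x @ x # \<xi> # replicate (k' - i) x) \<doteq>
      tens scale (replicate i x @ \<xi> # x # replicate (k' - i) x) + tens scale (replicate i x @ br x \<xi> # replicate (k' - i) x)"
    by (rule env_eq_commutator)
  also have "tens scale (replicate i x @ x # \<xi> # replicate (k' - i) x) = tens scale (replicate (Suc i) x @ \<xi> # replicate (k - Suc i) x)"
    by (simp add: k replicate_app_Cons_same)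
  also have "\<xi> # x # replicate (k' - i) x = \<xi> # replicate (k - i) x"
    using Suc.prems by (simp add: k Suc_diff_le)
  also have "tens scale (replicate i x @ \<xi> # replicate (k - i) x) + tens scale (replicate i x @ br x \<xi> # replicate (k' - i) x) \<doteq>
      (\<Sum>j\<le>i. tscale (of_nat (i choose j)) (?P j)) +
      (\<Sum>j\<le>i. tscale (of_nat (i choose j)) (tens scale (ad_pow x j (br x \<xi>) # replicate (k' - j) x)))"
    using Suc.prems k by (intro env_eq_add Suc.IH) auto
  also have "(\<Sum>j\<le>i. tscale (of_nat (i choose j)) (tens scale (ad_pow x j (br x \<xi>) # replicate (k' - j) x))) =
      (\<Sum>j\<le>i. tscale (of_nat (i choose j)) (?P (Suc j)))"
    by (simp only: k funpow_Suc_right o_apply diff_Suc_Suc)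
  also have "(\<Sum>j\<le>i. tscale (of_nat (i choose j)) (?P j)) + \<dots> =
      (\<Sum>j\<le>Suc i. tscale (of_nat (Suc i choose j)) (?P j))"
  proof -
    have "(\<Sum>j\<le>i. tscale (of_nat (i choose j)) (?P j)) = (\<Sum>j\<le>Suc i. tscale (of_nat (i choose j)) (?P j))"
      by simp
    also have "\<dots> = ?P 0 + (\<Sum>j\<le>i. tscale (of_nat (i choose Suc j)) (?P (Suc j)))"
      by (subst sum.atMost_Suc_shift) simp
    moreover have "(\<Sum>j\<le>Suc i. tscale (of_nat (Suc i choose j)) (?P j)) =
        ?P 0 + (\<Sum>j\<le>i. tscale (of_nat (Suc i choose Suc j)) (?P (Suc j)))"
      by (subst sum.atMost_Suc_shift) simp
    ultimately show ?thesis
      by (simp only: binomial_Suc_Suc of_nat_add tvs.scale_left_distrib sum.distrib add_ac)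
  qed
  finally show ?case .
qed

text \<open>Averaging \<open>env_eq_move_left\<close> over the position of \<xi>, the binomials add
  up by the hockey-stick identity. Up to falling factorials the coefficients are those of (e^t - 1)
  / t, applied to ad x on a front letter.\<close>

lemma env_eq_spow:
  "spow \<xi> k x \<doteq> (\<Sum>j\<le>k. tscale (fact k / (fact (k - j) * fact (Suc j))) (tens scale (ad_pow x j \<xi> # replicate (k - j) x)))"
proof -
  let ?P = "\<lambda>j. tens scale (ad_pow x j \<xi> # replicate (k - j) x)"
  have "spow \<xi> k x \<doteq> tscale (1 / of_nat (Suc k)) (\<Sum>i\<le>k. \<Sum>j\<le>i. tscale (of_nat (i choose j)) (?P j))"
    unfolding sym_prod_Cons_replicate[of scale]
    by (intro env_eq_scale env_eq_sum env_eq_move_left) simp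
  also have "(\<Sum>i\<le>k. \<Sum>j\<le>i. tscale (of_nat (i choose j)) (?P j)) = (\<Sum>i\<le>k. \<Sum>j\<le>k. tscale (of_nat (i choose j)) (?P j))"
    by (intro sum.cong refl sum.mono_neutral_left) auto
  also have "\<dots> = (\<Sum>j\<le>k. \<Sum>i\<le>k. tscale (of_nat (i choose j)) (?P j))"
    by (rule sum.swap)
  also have "\<dots> = (\<Sum>j\<le>k. tscale (of_nat (Suc k choose Suc j)) (?P j))"
    by (simp only: tvs.scale_sum_left[symmetric] of_nat_sum[symmetric] sum_choose_upper)
  also have "tscale (1 / of_nat (Suc k)) \<dots> = (\<Sum>j\<le>k. tscale (fact k / (fact (k - j) * fact (Suc j))) (?P j))"
    unfolding tvs.scale_sum_right tvs.scale_scale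
  proof (intro sum.cong refl arg_cong2[where f = tscale])
    fix j assume "j \<in> {..k}"
    then have "of_nat (Suc k choose Suc j) = (fact (Suc k) / (fact (Suc j) * fact (Suc k - Suc j)) :: 'k)"
      by (intro binomial_fact) simp
    then show "1 / of_nat (Suc k) * of_nat (Suc k choose Suc j) = (fact k / (fact (k - j) * fact (Suc j)) :: 'k)"
      by (simp add: mult.commute del: of_nat_Suc)
  qed
  finally show ?thesis .
qed

text \<open>The Bernoulli coefficients of \<open>lmul\<close> are inverse to the coefficients in
  \<open>env_eq_spow\<close>, so only the term without brackets is left in the double sum.\<close>

lemma env_eq_lmul_power:
  "lmul \<xi> (tens scale (replicate m x)) \<doteq> tens scale (\<xi> # replicate m x)"
proof -
  let ?P = "\<lambda>n. tens scale (ad_pow x n \<xi> # replicate (m - n) x)"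
  have "lmul \<xi> (tens scale (replicate m x)) \<doteq> (\<Sum>j\<le>m. tscale (bern j * (fact m / fact (m - j)))
      (\<Sum>i\<le>m - j. tscale (fact (m - j) / (fact (m - j - i) * fact (Suc i))) (tens scale (ad_pow x i (ad_pow x j \<xi>) # replicate (m - j - i) x))))"
    unfolding lmul_power by (intro env_eq_sum env_eq_scale env_eq_spow)
  also have "\<dots> = (\<Sum>j\<le>m. \<Sum>i\<le>m - j. tscale (bern j / fact (Suc i) * (fact m / fact (m - (j + i)))) (?P (j + i)))"
    unfolding tvs.scale_sum_right tvs.scale_scale
  proof (intro sum.cong refl arg_cong2[where f = tscale])
    fix j i
    show "bern j * (fact m / fact (m - j)) * (fact (m - j) / (fact (m - j - i) * fact (Suc i))) =
        (bern j / fact (Suc i) * (fact m / fact (m - (j + i))) :: 'k)"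
      by (simp del: fact_Suc)
    show "tens scale (ad_pow x i (ad_pow x j \<xi>) # replicate (m - j - i) x) = ?P (j + i)"
      by (simp only: ad_pow_add[symmetric] add.commute[of i] diff_diff_left)
  qed
  also have "\<dots> = (\<Sum>n\<le>m. \<Sum>j\<le>n. tscale (bern j / fact (Suc (n - j)) * (fact m / fact (m - (j + (n - j))))) (?P (j + (n - j))))"
    by (rule sum_triangle)
  also have "\<dots> = (\<Sum>n\<le>m. tscale ((\<Sum>j\<le>n. bern j / fact (Suc (n - j))) * (fact m / fact (m - n))) (?P n))"
    unfolding sum_distrib_right tvs.scale_sum_left by (intro sum.cong refl) simp
  also have "\<dots> = (\<Sum>n\<le>m. if n = 0 then tens scale (\<xi> # replicate m x) else 0)"
    unfolding bern_convolution by (intro sum.cong refl) (simp del: tscale_apply)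
  also have "\<dots> = tens scale (\<xi> # replicate m x)"
    by (simp only: sum.delta finite_atMost) simp
  finally show ?thesis .
qed

theorem env_eq_lmul:
  assumes "t \<in> symmetric_algebra scale"
  shows "lmul \<xi> t \<doteq> tmult scale (tens scale [\<xi>]) t"
proof -
  \<comment> \<open>\<open>tmult\<close> is linear in its second argument on the tensor algebra
    only. T is a globally linear substitute, as the induction over powers requires.\<close>
  obtain T where T: "Vector_Spaces.linear tscale tscale T" "\<And>ys. T (tens scale ys) = tens scale (\<xi> # ys)"
  proof -
    have "multilinear scale tscale (\<lambda>ys. tens scale (\<xi> # ys))"
      unfolding multilinear_def
      using multilinearD[OF multilinear_tens[of scale], of "\<xi> # _"] by simp
    then show ?thesis
      using tensor_algebra_universal[OF tvs.vector_space_axioms] that by blast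
  qed
  have "t \<in> tensor_algebra scale"
    using assms symmetric_algebra_subset by blast
  then have "T t = tmult scale (tens scale [\<xi>]) t"
  proof (induction rule: tensor_algebra_induct)
    case zero
    show ?case by (simp only: linear_tscaleD[OF T(1)] tmult_bilinear(6) tensor_algebra_closed)
  next
    case (step c xs t)
    then show ?case
      by (simp only: linear_tscaleD[OF T(1)] tmult_bilinear(4,5) tensor_algebra_closed T(2) tmult_tens append.simps)
  qed
  moreover define f where "f t = lmul \<xi> t - T t" for t
  have "f t \<in> env_ideal scale br"
  proof (rule symmetric_algebra_powers_induct[OF assms _ subspace_env_ideal])
    show "Vector_Spaces.linear tscale tscale f"
      by (rule linear_tscaleI)
        (simp_all add: f_def lmul_linear linear_tscaleD[OF T(1)] tvs.scale_right_diff_distrib del: tscale_apply)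
    show "f (tens scale (replicate n x)) \<in> env_ideal scale br" for n x
      using env_eq_lmul_power by (simp add: f_def T(2) env_eq_def)
  qed
  ultimately show ?thesis
    by (simp only: f_def env_eq_def)
qed

end

section \<open>Products in the enveloping algebra as combinations of bracket words\<close>

declare plus_fun_apply [simp del] zero_fun_apply [simp del] minus_apply [simp del] uminus_apply [simp del]
  tscale_apply [simp del]

context lie_algebra
begin

lemma sym_prod_average:
  assumes "Vector_Spaces.linear tscale tscale f"
  shows "f (sym_prod scale ws) =
    (\<Sum>\<sigma> | \<sigma> permutes {..<length ws}. tscale (1 / fact (length ws)) (f (tens scale (permute_list \<sigma> ws))))"
  unfolding sym_prod_def linear_tscaleD[OF assms] tvs.scale_sum_right ..

text \<open>The other half of the Poincare-Birkhoff-Witt theorem, by induction on words: the next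
  letter is multiplied on by \<open>lmul\<close>, which does not leave the symmetric
  tensors.\<close>

lemma env_eq_symmetric_exists:
  assumes "t \<in> tensor_algebra scale"
  shows "\<exists>u\<in>symmetric_algebra scale. u \<doteq> t"
  using assms
proof (induction rule: tensor_algebra_induct)
  case zero
  show ?case using symmetric_algebra_closed(1)[of scale] env_eq_refl by blast
next
  case (step c xs t)
  have "\<exists>u\<in>symmetric_algebra scale. u \<doteq> tens scale xs"
  proof (induction xs)
    case Nil
    show ?case
      using symmetric_algebra_closed(2)[of scale 0] env_eq_refl by (auto intro: bexI[of _ "tens scale []"])
  next
    case (Cons x xs)
    then obtain u where u: "u \<in> symmetric_algebra scale" "u \<doteq> tens scale xs" by blast
    then have T: "u \<in> tensor_algebra scale" using symmetric_algebra_subset by blast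
    have "lmul x u \<doteq> tmult scale (tens scale [x]) u"
      by (rule env_eq_lmul[OF u(1)])
    also have "\<dots> \<doteq> tmult scale (tens scale [x]) (tens scale xs)"
      by (intro env_eq_tmult_left u T tensor_algebra_closed)
    finally show ?case
      using lmul_closed[OF T] by (auto simp: tmult_tens)
  qed
  with step obtain u v where "u \<in> symmetric_algebra scale" "u \<doteq> tens scale xs" "v \<in> symmetric_algebra scale" "v \<doteq> t"
    by blast
  then show ?case
    by (intro bexI[of _ "tscale c u + v"] env_eq_add env_eq_scale symmetric_algebra_closed)
qed

end

lemma tproj_linear:
  "tproj s n (t + u) = tproj s n t + tproj s n u"
  "tproj s n (tscale c t) = tscale c (tproj s n t)"
  "tproj s n 0 = 0"
  "tproj s n (sum f I) = (\<Sum>i\<in>I. tproj s n (f i))"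
proof -
  show add: "tproj s n (t + u) = tproj s n t + tproj s n u" for t u
    by (auto simp: tproj_def on_forms_def fun_eq_iff plus_fun_apply zero_fun_apply tscale_apply)
  show "tproj s n (tscale c t) = tscale c (tproj s n t)"
    by (auto simp: tproj_def on_forms_def fun_eq_iff plus_fun_apply zero_fun_apply tscale_apply)
  show zero: "tproj s n 0 = 0"
    by (auto simp: tproj_def on_forms_def fun_eq_iff plus_fun_apply zero_fun_apply tscale_apply)
  show "tproj s n (sum f I) = (\<Sum>i\<in>I. tproj s n (f i))"
    by (induction I rule: infinite_finite_induct)
      (simp_all only: sum.infinite sum.empty sum.insert add zero simp_thms if_True)
qed

lemma tproj_tens: "tproj s n (tens s xs) = (if length xs = n then tens s xs else 0)"
proof
  fix \<phi>
  show "tproj s n (tens s xs) \<phi> = (if length xs = n then tens s xs else 0) \<phi>"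
    using multilinear_cutoff[of s \<phi> n] by (cases "multilinear s (*) \<phi>") (simp_all add: tproj_def zero_fun_apply)
qed

lemma tproj_sym_prod: "tproj s n (sym_prod s xs) = (if length xs = n then sym_prod s xs else 0)"
  unfolding sym_prod_def tproj_linear tproj_tens
  by (cases "length xs = n") (simp_all add: tvs.scale_zero_right)

lemma tproj_symmetric:
  fixes s :: "'k::field_char_0 \<Rightarrow> 'g::ab_group_add \<Rightarrow> 'g"
  assumes "t \<in> symmetric_algebra s"
  shows "tproj s n t \<in> symmetric_algebra s"
proof (rule symmetric_algebra_powers_induct[OF assms, where f = "tproj s n"])
  show "Vector_Spaces.linear tscale tscale (tproj s n)"
    by (intro linear_tscaleI tproj_linear)
  show "tvs.subspace (symmetric_algebra s)"
    by (simp add: tvs.subspace_def symmetric_algebra_closed)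
  show "tproj s n (tens s (replicate m x)) \<in> symmetric_algebra s" for m x
    by (simp add: tproj_tens symmetric_algebra_closed)
qed

lemma sum_average_permutes:
  "(\<Sum>\<sigma> | \<sigma> permutes {..<n}. norm (1 / fact n :: 'k::real_normed_field) * c) = c"
  using card_permutations[of "{..<n}" n] by (simp add: norm_divide)

locale nilpotent_lie_algebra_normed = nilpotent_lie_algebra scale br K
  for scale :: "'k::real_normed_field \<Rightarrow> 'g::ab_group_add \<Rightarrow> 'g" and br K
begin

text \<open>\<open>bracket_comb xs d a t\<close>: \<open>t\<close> is a linear combination, with coefficients of total size at most \<open>a\<close>, of
  symmetric products of \<open>d\<close> bracket words which together use each letter of \<open>xs\<close> once.\<close>

inductive bracket_comb :: "'g list \<Rightarrow> nat \<Rightarrow> real \<Rightarrow> ('g, 'k) tensor \<Rightarrow> bool" for xs d where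
  "0 \<le> a \<Longrightarrow> t = 0 \<Longrightarrow> bracket_comb xs d a t"
| "\<lbrakk>list_all2 (lie_word br) xss ws; mset (concat xss) = mset xs; length ws = d; bracket_comb xs d a t;
     u = tscale c (sym_prod scale ws) + t\<rbrakk> \<Longrightarrow> bracket_comb xs d (norm c + a) u"

lemma bracket_comb_zero: "0 \<le> a \<Longrightarrow> bracket_comb xs d a 0"
  by (rule bracket_comb.intros(1)) auto

lemma bracket_comb_step: "\<lbrakk>list_all2 (lie_word br) xss ws; mset (concat xss) = mset xs; length ws = d; bracket_comb xs d a t\<rbrakk>
    \<Longrightarrow> bracket_comb xs d (norm c + a) (tscale c (sym_prod scale ws) + t)"
  by (rule bracket_comb.intros(2)) auto

lemma bracket_comb_induct [consumes 1, case_names zero step]: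
  assumes "bracket_comb xs d a t"
    and "\<And>a. 0 \<le> a \<Longrightarrow> P a 0"
    and "\<And>xss ws a t c. \<lbrakk>list_all2 (lie_word br) xss ws; mset (concat xss) = mset xs; length ws = d;
      bracket_comb xs d a t; P a t\<rbrakk> \<Longrightarrow> P (norm c + a) (tscale c (sym_prod scale ws) + t)"
  shows "P a t"
  using assms(1)
proof (induction rule: bracket_comb.induct)
  case (1 a t)
  then show ?case using assms(2) by (simp only:)
next
  case (2 xss ws a t u c)
  then show ?case using assms(3)[OF 2(1-4) 2(6)] by (simp only:)
qed

lemma bracket_comb_mono: "bracket_comb xs d a t \<Longrightarrow> a \<le> b \<Longrightarrow> bracket_comb xs d b t"
proof (induction arbitrary: b rule: bracket_comb_induct)
  case (zero a)
  then show ?case by (intro bracket_comb_zero) simp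
next
  case (step xss ws a t c)
  then have "bracket_comb xs d (norm c + (b - norm c)) (tscale c (sym_prod scale ws) + t)"
    by (intro bracket_comb_step step.IH) auto
  then show ?case by simp
qed

lemma bracket_comb_add:
  assumes "bracket_comb xs d a t" "bracket_comb xs d b u"
  shows "bracket_comb xs d (a + b) (t + u)"
  using assms(1)
proof (induction rule: bracket_comb_induct)
  case (zero a)
  then show ?case using bracket_comb_mono[OF assms(2)] by simp
next
  case (step xss ws a t c)
  then show ?case
    using bracket_comb_step[OF step(1-3,5), of c] by (simp add: add.assoc)
qed

lemma bracket_comb_scale:
  assumes "bracket_comb xs d a t"
  shows "bracket_comb xs d (norm c * a) (tscale c t)"
  using assms
proof (induction rule: bracket_comb_induct)
  case (zero a)
  then have "bracket_comb xs d (norm c * a) 0"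
    by (intro bracket_comb_zero) simp
  then show ?case by (simp only: tvs.scale_zero_right)
next
  case (step xss ws a t c')
  then show ?case
    using bracket_comb_step[OF step(1-3,5), of "c * c'"]
    by (simp add: tvs.scale_right_distrib norm_mult distrib_left)
qed

lemma bracket_comb_sum:
  assumes "\<And>i. i \<in> I \<Longrightarrow> bracket_comb xs d (a i) (t i)"
  shows "bracket_comb xs d (sum a I) (sum t I)"
  using assms
  by (induction I rule: infinite_finite_induct)
    (simp_all add: bracket_comb_add bracket_comb_zero)

lemma bracket_comb_sym_prod:
  assumes "list_all2 (lie_word br) xss ws" "mset (concat xss) = mset xs" "length ws = d"
  shows "bracket_comb xs d 1 (sym_prod scale ws)"
  using bracket_comb_step[OF assms bracket_comb_zero[of 0], of 1] by simp

lemma bracket_comb_cong_mset: "bracket_comb xs d a t \<Longrightarrow> mset xs = mset ys \<Longrightarrow> bracket_comb ys d a t"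
  by (induction rule: bracket_comb_induct) (auto intro: bracket_comb_zero bracket_comb_step)

lemma bracket_comb_symmetric: "bracket_comb xs d a t \<Longrightarrow> t \<in> symmetric_algebra scale"
  by (induction rule: bracket_comb_induct) (auto intro: symmetric_algebra_closed sym_prod_mem)

lemma bracket_comb_tproj: "bracket_comb xs d a t \<Longrightarrow> tproj scale n t = (if n = d then t else 0)"
  by (induction rule: bracket_comb_induct) (auto simp: tproj_linear tproj_sym_prod tvs.scale_zero_right )

text \<open>If d words share more than d K letters, one of them has more than K letters and
  vanishes.\<close>

lemma bracket_comb_eq_0:
  assumes "bracket_comb xs d a t" "d * K < length xs"
  shows "t = 0"
  using assms
proof (induction rule: bracket_comb_induct)
  case (step xss ws a t c)
  have "\<exists>i<length xss. length (xss ! i) > K"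
  proof (rule ccontr)
    assume "\<not> (\<exists>i<length xss. length (xss ! i) > K)"
    then have "\<forall>x\<in>set (map length xss). x \<le> K"
      by (force simp: in_set_conv_nth)
    then have "sum_list (map length xss) \<le> length xss * K"
      by (induction xss) auto
    moreover have "sum_list (map length xss) = length xs"
      using step(2) by (metis length_concat mset_eq_length)
    ultimately show False
      using step list_all2_lengthD[OF step(1)] by simp
  qed
  then obtain i where i: "i < length xss" "length (xss ! i) > K" by blast
  then have "ws ! i = 0" "i < length ws"
    using lie_word_eq_0 list_all2_nthD[OF step(1)] list_all2_lengthD[OF step(1)] by auto
  then have "sym_prod scale (take i ws @ ws ! i # drop (Suc i) ws) = 0"
    using multilinear_zero[OF multilinear_sym_prod[of scale]] by (simp only:)
  then have "sym_prod scale ws = 0"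
    using id_take_nth_drop[OF \<open>i < length ws\<close>] by (simp only:)
  then show ?case
    using step by (simp add: tvs.scale_zero_right)
qed simp

lemma lie_word_foldr:
  assumes "list_all2 (lie_word br) xss ws" "lie_word br ys v"
  shows "lie_word br (concat xss @ ys) (foldr br ws v)"
  using assms(1)
  by (induction rule: list_all2_induct) (auto intro: lie_word.bracket assms(2) simp: assms(2))

text \<open>For each j, the letter \<xi> merges with j of the d words into one, which leaves d + 1 -
  j words. The falling factorial comes from \<open>lmul_form\<close>; averaging over permutations
  does not increase the size of the coefficients.\<close>

lemma bracket_comb_lmul:
  assumes "bracket_comb xs d a t"
  shows "\<exists>Z. lmul \<xi> t = (\<Sum>j\<le>d. Z j) \<and>
    (\<forall>j\<le>d. bracket_comb (\<xi> # xs) (Suc d - j) (norm (bern j * (fact d / fact (d - j)) :: 'k) * a) (Z j))"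
  using assms
proof (induction rule: bracket_comb_induct)
  case (zero a)
  show ?case
    by (intro exI[of _ "\<lambda>_. 0"]) (simp add: lmul_linear bracket_comb_zero zero)
next
  case (step xss ws a t c)
  then obtain Z where Z: "lmul \<xi> t = (\<Sum>j\<le>d. Z j)"
    "\<And>j. j \<le> d \<Longrightarrow> bracket_comb (\<xi> # xs) (Suc d - j) (norm (bern j * (fact d / fact (d - j)) :: 'k) * a) (Z j)"
    by blast
  define g where "g j ws = sym_prod scale (foldr br (take j ws) \<xi> # drop j ws)" for j ws
  define Y where "Y j = (\<Sum>\<sigma> | \<sigma> permutes {..<d}. tscale (1 / fact d) (tscale (bern j * (fact d / fact (d - j))) (g j (permute_list \<sigma> ws))))" for j
  have "lmul \<xi> (sym_prod scale ws) = (\<Sum>\<sigma> | \<sigma> permutes {..<d}. \<Sum>j\<le>d. tscale (1 / fact d) (tscale (bern j * (fact d / fact (d - j))) (g j (permute_list \<sigma> ws))))"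
    unfolding sym_prod_average[OF linear_lmul] lmul_tens lmul_form_def length_permute_list \<open>length ws = d\<close> tvs.scale_sum_right g_def ..
  also have "\<dots> = (\<Sum>j\<le>d. Y j)"
    unfolding Y_def by (rule sum.swap)
  finally have 1: "lmul \<xi> (tscale c (sym_prod scale ws) + t) = (\<Sum>j\<le>d. tscale c (Y j) + Z j)"
    by (simp only: lmul_linear Z sum.distrib tvs.scale_sum_right)
  have g: "bracket_comb (\<xi> # xs) (Suc d - j) 1 (g j (permute_list \<sigma> ws))" if \<sigma>: "\<sigma> permutes {..<d}" and j: "j \<le> d" for j \<sigma>
  proof -
    have len: "length xss = d"
      using list_all2_lengthD[OF step(1)] step(3) by simp
    have la: "list_all2 (lie_word br) (permute_list \<sigma> xss) (permute_list \<sigma> ws)"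
      using list_all2_permute_list_iff[of \<sigma> xss "lie_word br" ws] step(1) \<sigma> by (simp add: len)
    have "lie_word br (concat (take j (permute_list \<sigma> xss)) @ [\<xi>]) (foldr br (take j (permute_list \<sigma> ws)) \<xi>)"
      by (intro lie_word_foldr list_all2_takeI la lie_word.letter)
    then have "list_all2 (lie_word br) ((concat (take j (permute_list \<sigma> xss)) @ [\<xi>]) # drop j (permute_list \<sigma> xss))
        (foldr br (take j (permute_list \<sigma> ws)) \<xi> # drop j (permute_list \<sigma> ws))"
      using list_all2_dropI[OF la] by simp
    moreover have "mset (concat ((concat (take j (permute_list \<sigma> xss)) @ [\<xi>]) # drop j (permute_list \<sigma> xss))) = mset (\<xi> # xs)"
    proof -
      have "mset (concat (take j (permute_list \<sigma> xss))) + mset (concat (drop j (permute_list \<sigma> xss))) =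
          mset (concat (permute_list \<sigma> xss))"
        by (metis append_take_drop_id concat_append mset_append)
      also have "\<dots> = mset (concat xss)"
      proof -
        have *: "mset (concat yss) = sum_mset (image_mset mset (mset yss))" for yss :: "'g list list"
          by (induction yss) auto
        show ?thesis
          using \<sigma> len by (simp only: * mset_permute_list)
      qed
      finally show ?thesis
        using step(2) by simp
    qed
    ultimately show ?thesis
      unfolding g_def using step(3) j by (intro bracket_comb_sym_prod) auto
  qed
  have Y: "bracket_comb (\<xi> # xs) (Suc d - j) (norm (bern j * (fact d / fact (d - j)) :: 'k)) (Y j)" if j: "j \<le> d" for j
  proof -
    let ?b = "norm (bern j * (fact d / fact (d - j)) :: 'k)"
    have "bracket_comb (\<xi> # xs) (Suc d - j) (\<Sum>\<sigma> | \<sigma> permutes {..<d}. norm (1 / fact d :: 'k) * (?b * 1)) (Y j)"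
      unfolding Y_def using g[OF _ j] by (intro bracket_comb_sum bracket_comb_scale) auto
    then show ?thesis by (simp only: sum_average_permutes mult_1_right)
  qed
  have "bracket_comb (\<xi> # xs) (Suc d - j) (norm (bern j * (fact d / fact (d - j)) :: 'k) * (norm c + a)) (tscale c (Y j) + Z j)"
    if "j \<le> d" for j
    using bracket_comb_add[OF bracket_comb_scale[OF Y[OF that], of c] Z(2)[OF that]]
    by (simp add: algebra_simps)
  with 1 show ?case by blast
qed

text \<open>The letters of \<open>xs\<close> are multiplied on one by one, beginning with the last.
  Order N collects the orders n of the previous step with j = N - n new brackets: falling factorials
  are at most m^j, where m is the previous number of letters, and \<open>norm_bern\<close> makes the
  sum over j cost a factor 2 for each letter.\<close>

lemma env_eq_product_tens:
  "\<exists>s. tmult scale (tens scale xs) (sym_prod scale ys) \<doteq> (\<Sum>n\<le>length xs + length ys. s n) \<and>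
    (\<forall>n\<le>length xs + length ys. bracket_comb (xs @ ys) (length xs + length ys - n)
      (2 ^ length xs * real (length xs + length ys) ^ n) (s n))"
proof (induction xs)
  case Nil
  let ?s = "\<lambda>n. if n = 0 then sym_prod scale ys else 0"
  have "tmult scale (tens scale []) (sym_prod scale ys) = (\<Sum>n\<le>length ys. ?s n)"
    using ring.ring_simprules(12)[OF ring_tensor_ring, of "sym_prod scale ys" scale] by (simp add: sym_prod_mem_tensor_algebra)
  moreover have "bracket_comb ys (length ys - n) (real (length ys) ^ n) (?s n)" for n
  proof (cases "n = 0")
    case True
    have "list_all2 (lie_word br) (map (\<lambda>x. [x]) ys) ys"
      by (simp add: list_all2_conv_all_nth lie_word.letter)
    then have "bracket_comb ys (length ys) 1 (sym_prod scale ys)"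
      by (rule bracket_comb_sym_prod) (simp_all add: concat_map_singleton)
    then show ?thesis using True by simp
  qed (simp add: bracket_comb_zero)
  ultimately show ?case
    by (intro exI[of _ ?s]) (simp add: env_eq_refl)
next
  case (Cons \<xi> xs)
  let ?m = "length xs + length ys" and ?k = "length xs"
  obtain s where s: "tmult scale (tens scale xs) (sym_prod scale ys) \<doteq> (\<Sum>n\<le>?m. s n)"
    "\<And>n. n \<le> ?m \<Longrightarrow> bracket_comb (xs @ ys) (?m - n) (2 ^ ?k * real ?m ^ n) (s n)"
    using Cons.IH by blast
  have "\<exists>Z. lmul \<xi> (s n) = (\<Sum>j\<le>?m - n. Z j) \<and> (\<forall>j\<le>?m - n. bracket_comb (\<xi> # xs @ ys) (Suc (?m - n) - j)
      (norm (bern j * (fact (?m - n) / fact (?m - n - j)) :: 'k) * (2 ^ ?k * real ?m ^ n)) (Z j))" if "n \<le> ?m" for n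
    by (rule bracket_comb_lmul[OF s(2)[OF that]])
  then obtain Z where Z: "\<And>n. n \<le> ?m \<Longrightarrow> lmul \<xi> (s n) = (\<Sum>j\<le>?m - n. Z n j)"
    "\<And>n j. n \<le> ?m \<Longrightarrow> j \<le> ?m - n \<Longrightarrow> bracket_comb (\<xi> # xs @ ys) (Suc (?m - n) - j)
      (norm (bern j * (fact (?m - n) / fact (?m - n - j)) :: 'k) * (2 ^ ?k * real ?m ^ n)) (Z n j)"
    by metis
  have S: "(\<Sum>n\<le>?m. s n) \<in> symmetric_algebra scale"
    using s(2) by (intro symmetric_algebra_closed bracket_comb_symmetric) auto
  have T: "tens scale xs \<in> tensor_algebra scale" "sym_prod scale ys \<in> tensor_algebra scale"
    "tmult scale (tens scale xs) (sym_prod scale ys) \<in> tensor_algebra scale" "(\<Sum>n\<le>?m. s n) \<in> tensor_algebra scale"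
    using S symmetric_algebra_subset by (auto intro: tensor_algebra_closed sym_prod_mem_tensor_algebra tmult_closed)
  have assoc: "tmult scale (tens scale (\<xi> # xs)) (sym_prod scale ys) =
      tmult scale (tens scale [\<xi>]) (tmult scale (tens scale xs) (sym_prod scale ys))"
    using ring.ring_simprules(11)[OF ring_tensor_ring, of "tens scale [\<xi>]" scale "tens scale xs" "sym_prod scale ys"] T
    by (simp add: tmult_tens tensor_algebra_closed)
  have "tmult scale (tens scale [\<xi>]) (tmult scale (tens scale xs) (sym_prod scale ys)) \<doteq>
      tmult scale (tens scale [\<xi>]) (\<Sum>n\<le>?m. s n)"
    by (intro env_eq_tmult_left s T tensor_algebra_closed)
  also have "\<dots> \<doteq> lmul \<xi> (\<Sum>n\<le>?m. s n)"
    by (rule env_eq_sym[OF env_eq_lmul[OF S]])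
  also have "lmul \<xi> (\<Sum>n\<le>?m. s n) = (\<Sum>n\<le>?m. \<Sum>j\<le>?m - n. Z n j)"
    unfolding lmul_linear using Z(1) by (intro sum.cong refl) auto
  also have "\<dots> = (\<Sum>N\<le>?m. \<Sum>n\<le>N. Z n (N - n))"
    by (rule sum_triangle)
  finally have 1: "tmult scale (tens scale (\<xi> # xs)) (sym_prod scale ys) \<doteq> (\<Sum>N\<le>?m. \<Sum>n\<le>N. Z n (N - n))"
    by (simp only: assoc)
  \<comment> \<open>The top order, where no word would be left, gets 0: multiplication by \<xi>
    always leaves at least one word.\<close>
  define s' where "s' N = (if N \<le> ?m then \<Sum>n\<le>N. Z n (N - n) else 0)" for N
  have "bracket_comb (\<xi> # xs @ ys) (Suc ?m - N) (2 ^ Suc ?k * real (Suc ?m) ^ N) (s' N)" for N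
  proof (cases "N \<le> ?m")
    case True
    have "bracket_comb (\<xi> # xs @ ys) (Suc ?m - N) (\<Sum>n\<le>N. (1 / 2) ^ (N - n) * (2 ^ ?k * real ?m ^ N)) (\<Sum>n\<le>N. Z n (N - n))"
    proof (rule bracket_comb_sum)
      fix n assume "n \<in> {..N}"
      then have n: "n \<le> ?m" "N - n \<le> ?m - n" "Suc (?m - n) - (N - n) = Suc ?m - N" "n + (N - n) = N"
        using True by auto
      let ?c = "norm (bern (N - n) * (fact (?m - n) / fact (?m - n - (N - n))) :: 'k) * (2 ^ ?k * real ?m ^ n)"
      have "(fact (?m - n) / fact (?m - n - (N - n)) :: real) = real (fact (?m - n) div fact (?m - n - (N - n)))"
        by (simp add: real_of_nat_div fact_dvd)
      also have "\<dots> \<le> real (?m - n) ^ (N - n)"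
        using fact_div_fact_le_pow[OF n(2)] by (metis of_nat_le_iff of_nat_power)
      also have "\<dots> \<le> real ?m ^ (N - n)"
        by (intro power_mono) auto
      finally have "?c \<le> (1 / 2) ^ (N - n) * real ?m ^ (N - n) * (2 ^ ?k * real ?m ^ n)"
        using norm_bern[of "N - n", where 'k = 'k] unfolding norm_mult norm_divide norm_fact
        by (intro mult_right_mono mult_mono) (auto simp: power_one_over)
      also have "\<dots> = (1 / 2) ^ (N - n) * (2 ^ ?k * real ?m ^ (n + (N - n)))"
        by (simp add: power_add)
      finally have "?c \<le> (1 / 2) ^ (N - n) * (2 ^ ?k * real ?m ^ N)"
        by (simp only: n)
      then show "bracket_comb (\<xi> # xs @ ys) (Suc ?m - N) ((1 / 2) ^ (N - n) * (2 ^ ?k * real ?m ^ N)) (Z n (N - n))"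
        using bracket_comb_mono[OF Z(2)[OF n(1,2)]] by (simp only: n(3))
    qed
    moreover have "(\<Sum>n\<le>N. (1 / 2) ^ (N - n) * (2 ^ ?k * real ?m ^ N)) \<le> 2 ^ Suc ?k * real (Suc ?m) ^ N"
    proof -
      have "(\<Sum>n\<le>N. (1 / 2 :: real) ^ (N - n)) = (\<Sum>n<Suc N. (1 / 2) ^ n)"
        unfolding lessThan_Suc_atMost by (rule sum.reindex_bij_witness[of _ "\<lambda>n. N - n" "\<lambda>n. N - n"]) auto
      also have "\<dots> \<le> 2"
        by (subst sum_gp_strict) (simp add: field_simps)
      finally have "(\<Sum>n\<le>N. (1 / 2 :: real) ^ (N - n)) * (2 ^ ?k * real ?m ^ N) \<le> 2 * (2 ^ ?k * real (Suc ?m) ^ N)"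
        by (intro mult_mono power_mono) auto
      then show ?thesis
        by (simp add: sum_distrib_right)
    qed
    ultimately show ?thesis
      using True bracket_comb_mono by (simp add: s'_def)
  qed (simp add: s'_def bracket_comb_zero)
  moreover have "(\<Sum>N\<le>?m. \<Sum>n\<le>N. Z n (N - n)) = (\<Sum>N\<le>Suc ?m. s' N)"
    by (simp add: s'_def)
  ultimately show ?case
    using 1 by (intro exI[of _ s']) simp
qed

lemma env_eq_product:
  "\<exists>s. tmult scale (sym_prod scale xs) (sym_prod scale ys) \<doteq> (\<Sum>n\<le>length xs + length ys. s n) \<and>
    (\<forall>n\<le>length xs + length ys. bracket_comb (xs @ ys) (length xs + length ys - n)
      (2 ^ length xs * real (length xs + length ys) ^ n) (s n))"
proof -
  let ?m = "length xs + length ys" and ?k = "length xs"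
  let ?P = "{\<sigma>. \<sigma> permutes {..<?k}}"
  have "\<exists>s. tmult scale (tens scale (permute_list \<sigma> xs)) (sym_prod scale ys) \<doteq> (\<Sum>n\<le>?m. s n) \<and>
    (\<forall>n\<le>?m. bracket_comb (permute_list \<sigma> xs @ ys) (?m - n) (2 ^ ?k * real ?m ^ n) (s n))" for \<sigma>
    using env_eq_product_tens[of "permute_list \<sigma> xs" ys] by simp
  then obtain s where s: "\<And>\<sigma>. tmult scale (tens scale (permute_list \<sigma> xs)) (sym_prod scale ys) \<doteq> (\<Sum>n\<le>?m. s \<sigma> n)"
    "\<And>\<sigma> n. n \<le> ?m \<Longrightarrow> bracket_comb (permute_list \<sigma> xs @ ys) (?m - n) (2 ^ ?k * real ?m ^ n) (s \<sigma> n)"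
    by metis
  have sum: "tmult scale (\<Sum>\<sigma>\<in>I. t \<sigma>) u = (\<Sum>\<sigma>\<in>I. tmult scale (t \<sigma>) u)" for I u and t :: "(nat \<Rightarrow> nat) \<Rightarrow> ('g, 'k) tensor"
    by (induction I rule: infinite_finite_induct) (simp_all add: tmult_bilinear)
  have 1: "tmult scale (sym_prod scale xs) (sym_prod scale ys) =
      tscale (1 / fact ?k) (\<Sum>\<sigma>\<in>?P. tmult scale (tens scale (permute_list \<sigma> xs)) (sym_prod scale ys))"
    by (simp only: sym_prod_def[of scale xs] tmult_bilinear sum)
  have 2: "(\<Sum>n\<le>?m. \<Sum>\<sigma>\<in>?P. tscale (1 / fact ?k) (s \<sigma> n)) = tscale (1 / fact ?k) (\<Sum>\<sigma>\<in>?P. \<Sum>n\<le>?m. s \<sigma> n)"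
    unfolding tvs.scale_sum_right by (rule sum.swap)
  have "tmult scale (sym_prod scale xs) (sym_prod scale ys) \<doteq> (\<Sum>n\<le>?m. \<Sum>\<sigma>\<in>?P. tscale (1 / fact ?k) (s \<sigma> n))"
    unfolding 1 2 by (rule env_eq_scale, rule env_eq_sum, rule s(1))
  moreover have "bracket_comb (xs @ ys) (?m - n) (2 ^ ?k * real ?m ^ n) (\<Sum>\<sigma>\<in>?P. tscale (1 / fact ?k) (s \<sigma> n))" if "n \<le> ?m" for n
  proof -
    have "bracket_comb (xs @ ys) (?m - n) (\<Sum>\<sigma>\<in>?P. norm (1 / fact ?k :: 'k) * (2 ^ ?k * real ?m ^ n)) (\<Sum>\<sigma>\<in>?P. tscale (1 / fact ?k) (s \<sigma> n))"
      by (intro bracket_comb_sum bracket_comb_scale bracket_comb_cong_mset[OF s(2)[OF that]]) auto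
    then show ?thesis by (simp only: sum_average_permutes)
  qed
  ultimately show ?thesis by blast
qed

section \<open>The product of the enveloping algebra carried over to symmetric tensors\<close>

definition gutt_prod :: "('g, 'k) tensor \<Rightarrow> ('g, 'k) tensor \<Rightarrow> ('g, 'k) tensor" where
  "gutt_prod f g = inv_into (symmetric_algebra scale) (quantization scale br)
    (quantization scale br f \<otimes>\<^bsub>env_algebra scale br\<^esub> quantization scale br g)"

lemma quantization_eq_iff:
  assumes "t \<in> tensor_algebra scale" "u \<in> tensor_algebra scale"
  shows "quantization scale br t = quantization scale br u \<longleftrightarrow> t \<doteq> u"
proof -
  interpret I: ideal "env_ideal scale br" "tensor_ring scale" by (rule ideal_env_ideal)
  have "a_minus (tensor_ring scale) t u = t - u"
  proof -
    have "\<ominus>\<^bsub>tensor_ring scale\<^esub> u = - u"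
      by (rule I.minus_equality) (use assms in \<open>simp_all add: tensor_algebra_closed\<close>)
    then show ?thesis by (simp add: a_minus_def)
  qed
  then show ?thesis
    using I.quotient_eq_iff_same_a_r_cos[OF ideal_env_ideal, of t u] assms
    unfolding quantization_def env_eq_def by simp
qed

text \<open>The symmetrisation map is injective on symmetric tensors, so \<open>inv_into\<close>
  returns a true inverse image. From here on \<open>gutt_prod f g\<close> is used only as the
  symmetric tensor congruent to the product.\<close>

lemma gutt_prod_unique:
  assumes "u \<in> symmetric_algebra scale" "f \<in> tensor_algebra scale" "g \<in> tensor_algebra scale" "u \<doteq> tmult scale f g"
  shows "gutt_prod f g = u"
proof -
  interpret I: ideal "env_ideal scale br" "tensor_ring scale" by (rule ideal_env_ideal)
  interpret h: ring_hom_ring "tensor_ring scale" "env_algebra scale br" "quantization scale br"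
    using I.rcos_ring_hom_ring by (simp add: env_algebra_def quantization_def[abs_def])
  have inj: "inj_on (quantization scale br) (symmetric_algebra scale)"
  proof (rule inj_onI)
    fix t u assume *: "t \<in> symmetric_algebra scale" "u \<in> symmetric_algebra scale" "quantization scale br t = quantization scale br u"
    then have "t \<doteq> u"
      using quantization_eq_iff[of t u] symmetric_algebra_subset[of scale] by auto
    then show "t = u"
      using symmetric_env_ideal_eq_0[of "t - u"] * by (simp add: env_eq_def symmetric_algebra_closed)
  qed
  have "quantization scale br f \<otimes>\<^bsub>env_algebra scale br\<^esub> quantization scale br g = quantization scale br (tmult scale f g)"
    using h.hom_mult[of f g] assms by simp
  also have "\<dots> = quantization scale br u"
    using quantization_eq_iff[of u "tmult scale f g"] assms symmetric_algebra_subset[of scale] tmult_closed by auto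
  finally show ?thesis
    unfolding gutt_prod_def using inv_into_f_f[OF inj assms(1)] by simp
qed

lemma gutt_prod:
  assumes "f \<in> tensor_algebra scale" "g \<in> tensor_algebra scale"
  shows gutt_prod_symmetric: "gutt_prod f g \<in> symmetric_algebra scale"
    and gutt_prod_env_eq: "gutt_prod f g \<doteq> tmult scale f g"
  using env_eq_symmetric_exists[OF tmult_closed[OF assms]] gutt_prod_unique[OF _ assms] by metis+

lemma gutt_prod_bilinear:
  assumes "f \<in> tensor_algebra scale" "f' \<in> tensor_algebra scale" "g \<in> tensor_algebra scale"
  shows "gutt_prod (f + f') g = gutt_prod f g + gutt_prod f' g"
    and "gutt_prod g (f + f') = gutt_prod g f + gutt_prod g f'"
    and "gutt_prod (tscale c f) g = tscale c (gutt_prod f g)"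
    and "gutt_prod g (tscale c f) = tscale c (gutt_prod g f)"
proof -
  note cl = assms tensor_algebra_closed gutt_prod_symmetric symmetric_algebra_closed env_eq_add env_eq_scale gutt_prod_env_eq
  have *: "tmult scale (f + f') g = tmult scale f g + tmult scale f' g"
    "tmult scale g (f + f') = tmult scale g f + tmult scale g f'"
    "tmult scale (tscale c f) g = tscale c (tmult scale f g)"
    "tmult scale g (tscale c f) = tscale c (tmult scale g f)"
    using assms by (simp_all add: tmult_bilinear)
  show "gutt_prod (f + f') g = gutt_prod f g + gutt_prod f' g"
    by (rule gutt_prod_unique; (unfold *)?; intro cl)
  show "gutt_prod g (f + f') = gutt_prod g f + gutt_prod g f'"
    by (rule gutt_prod_unique; (unfold *)?; intro cl)
  show "gutt_prod (tscale c f) g = tscale c (gutt_prod f g)"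
    by (rule gutt_prod_unique; (unfold *)?; intro cl)
  show "gutt_prod g (tscale c f) = tscale c (gutt_prod g f)"
    by (rule gutt_prod_unique; (unfold *)?; intro cl)
qed

text \<open>The n-th term of \<open>env_eq_product\<close> is homogeneous of degree k + l - n, so
  the projection selects exactly this term.\<close>

lemma gutt_prod_sym_prod:
  assumes "n \<le> length xs + length ys"
  shows "bracket_comb (xs @ ys) (length xs + length ys - n) (2 ^ length xs * real (length xs + length ys) ^ n)
    (tproj scale (length xs + length ys - n) (gutt_prod (sym_prod scale xs) (sym_prod scale ys)))"
proof -
  let ?m = "length xs + length ys"
  obtain s where s: "tmult scale (sym_prod scale xs) (sym_prod scale ys) \<doteq> (\<Sum>n\<le>?m. s n)"
    "\<And>n. n \<le> ?m \<Longrightarrow> bracket_comb (xs @ ys) (?m - n) (2 ^ length xs * real ?m ^ n) (s n)"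
    using env_eq_product[of xs ys] by blast
  have "gutt_prod (sym_prod scale xs) (sym_prod scale ys) = (\<Sum>n\<le>?m. s n)"
    using s by (intro gutt_prod_unique env_eq_sym[OF s(1)] sym_prod_mem_tensor_algebra symmetric_algebra_closed
        bracket_comb_symmetric) auto
  then have "tproj scale (?m - n) (gutt_prod (sym_prod scale xs) (sym_prod scale ys)) = (\<Sum>j\<le>?m. tproj scale (?m - n) (s j))"
    by (simp only: tproj_linear)
  also have "\<dots> = (\<Sum>j\<le>?m. if j = n then s n else 0)"
    using assms by (intro sum.cong refl) (auto simp: bracket_comb_tproj[OF s(2)])
  also have "\<dots> = s n"
    using assms by simp
  finally show ?thesis
    using s(2)[OF assms] by simp
qed

end

section \<open>Projective tensor powers of seminorms\<close>

text \<open>Symmetrisation fixes powers, hence all symmetric tensors. So the representations over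
  which the projective seminorms take their infimum may be symmetrised term by term, with the same
  coefficients and letters.\<close>

lemma symmetric_rep:
  fixes s :: "'k::field_char_0 \<Rightarrow> 'g::ab_group_add \<Rightarrow> 'g"
  assumes "(\<Sum>(c, xs)\<leftarrow>L. tscale c (tens s xs)) \<in> symmetric_algebra s"
  shows "(\<Sum>(c, xs)\<leftarrow>L. tscale c (tens s xs)) = (\<Sum>(c, xs)\<leftarrow>L. tscale c (sym_prod s xs))"
proof -
  obtain Y where Y: "Vector_Spaces.linear tscale tscale Y" "\<And>xs. Y (tens s xs) = sym_prod s xs"
    using tensor_algebra_universal[OF tvs.vector_space_axioms multilinear_sym_prod[of s]] by blast
  define f where "f t = Y t - t" for t
  have "f (\<Sum>(c, xs)\<leftarrow>L. tscale c (tens s xs)) \<in> {0}"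
  proof (rule symmetric_algebra_powers_induct[OF assms])
    show "Vector_Spaces.linear tscale tscale f"
      by (rule linear_tscaleI) (simp_all add: f_def linear_tscaleD[OF Y(1)] tvs.scale_right_diff_distrib)
    show "tvs.subspace {0}" by (simp add: tvs.subspace_def)
    show "f (tens s (replicate n x)) \<in> {0}" for n x
      by (simp add: f_def Y(2) sym_prod_replicate)
  qed
  moreover have "Y (\<Sum>(c, xs)\<leftarrow>L. tscale c (tens s xs)) = (\<Sum>(c, xs)\<leftarrow>L. tscale c (sym_prod s xs))"
    by (induction L) (auto simp: linear_tscaleD[OF Y(1)] Y(2))
  ultimately show ?thesis by (simp add: f_def)
qed

definition tensor_power :: "('k \<Rightarrow> 'g \<Rightarrow> 'g) \<Rightarrow> nat \<Rightarrow> ('g::plus, 'k::field) tensor set" where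
  "tensor_power s n = tvs.span {tens s xs | xs. length xs = n}"

lemma tensor_power_closed:
  "0 \<in> tensor_power s n"
  "t \<in> tensor_power s n \<Longrightarrow> u \<in> tensor_power s n \<Longrightarrow> t + u \<in> tensor_power s n"
  "t \<in> tensor_power s n \<Longrightarrow> tscale c t \<in> tensor_power s n"
  "(\<And>i. i \<in> I \<Longrightarrow> f i \<in> tensor_power s n) \<Longrightarrow> sum f I \<in> tensor_power s n"
  "length xs = n \<Longrightarrow> tens s xs \<in> tensor_power s n"
  unfolding tensor_power_def
  by (auto intro: tvs.span_zero tvs.span_add tvs.span_scale tvs.span_sum tvs.span_base)

lemma sym_prod_tensor_power:
  "length xs = n \<Longrightarrow> sym_prod s xs \<in> tensor_power s n"
  unfolding sym_prod_def by (intro tensor_power_closed) simp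

lemma tensor_power_rep:
  assumes "t \<in> tensor_power s n"
  shows "\<exists>L. (\<forall>(c, xs)\<in>set L. length xs = n) \<and> t = (\<Sum>(c, xs)\<leftarrow>L. tscale c (tens s xs))"
  using assms unfolding tensor_power_def
proof (rule tvs.span_induct_alt)
  show "\<exists>L. (\<forall>(c, xs)\<in>set L. length xs = n) \<and> 0 = (\<Sum>(c, xs)\<leftarrow>L. tscale c (tens s xs))"
    by (intro exI[of _ "[]"]) simp
next
  fix c x t
  assume "x \<in> {tens s xs | xs. length xs = n}"
    and "\<exists>L. (\<forall>(c, xs)\<in>set L. length xs = n) \<and> t = (\<Sum>(c, xs)\<leftarrow>L. tscale c (tens s xs))"
  then obtain xs L where "x = tens s xs" "length xs = n"
    "\<forall>(c, xs)\<in>set L. length xs = n" "t = (\<Sum>(c, xs)\<leftarrow>L. tscale c (tens s xs))" by blast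
  then show "\<exists>L. (\<forall>(c, xs)\<in>set L. length xs = n) \<and> tscale c x + t = (\<Sum>(c, xs)\<leftarrow>L. tscale c (tens s xs))"
    by (intro exI[of _ "(c, xs) # L"]) auto
qed

lemma tproj_tensor_power:
  assumes "t \<in> tensor_algebra s"
  shows "tproj s n t \<in> tensor_power s n"
  using assms
proof (induction rule: tensor_algebra_induct)
  case (step c xs t)
  then show ?case
    unfolding tproj_linear tproj_tens by (intro tensor_power_closed) (auto intro: tensor_power_closed)
qed (simp add: tproj_linear tensor_power_closed)

lemma tproj_tproj:
  assumes "t \<in> tensor_power s n"
  shows "tproj s m t = (if m = n then t else 0)"
  using assms unfolding tensor_power_def
proof (rule tvs.span_induct_alt)
  fix c x t assume "x \<in> {tens s xs | xs. length xs = n}" "tproj s m t = (if m = n then t else 0)"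
  then show "tproj s m (tscale c x + t) = (if m = n then tscale c x + t else 0)"
    by (auto simp: tproj_linear tproj_tens tvs.scale_zero_right)
qed (simp add: tproj_linear)

lemma finite_tproj_support:
  assumes "t \<in> tensor_algebra s"
  shows "finite {n. tproj s n t \<noteq> 0}"
  using assms
proof (induction rule: tensor_algebra_induct)
  case (step c xs t)
  have "{n. tproj s n (tscale c (tens s xs) + t) \<noteq> 0} \<subseteq> insert (length xs) {n. tproj s n t \<noteq> 0}"
    by (auto simp: tproj_linear tproj_tens tvs.scale_zero_right)
  then show ?case
    using finite_subset[of _ "insert (length xs) {n. tproj s n t \<noteq> 0}"] step by simp
qed (simp add: tproj_linear)

definition is_seminorm :: "('k::real_normed_field \<Rightarrow> 'g \<Rightarrow> 'g) \<Rightarrow> ('g::plus \<Rightarrow> real) \<Rightarrow> bool" where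
  "is_seminorm s p \<longleftrightarrow> (\<forall>x y. p (x + y) \<le> p x + p y) \<and> (\<forall>c x. p (s c x) = norm c * p x)"

lemma continuous_seminorm_is_seminorm: "continuous_seminorm s p \<Longrightarrow> is_seminorm s p"
  by (simp add: continuous_seminorm_def is_seminorm_def)

locale normed_field_vector_space = vector_space scale
  for scale :: "'k::real_normed_field \<Rightarrow> 'g::ab_group_add \<Rightarrow> 'g"
begin

lemma seminorm:
  assumes "is_seminorm scale p"
  shows "p (x + y) \<le> p x + p y" "p (scale c x) = norm c * p x" "p 0 = 0" "p (- x) = p x" "0 \<le> p x"
    "p x \<le> p (x - y) + p y" "p (x - y) \<le> p x + p y"
proof -
  show add: "p (x + y) \<le> p x + p y" and sc: "p (scale c x) = norm c * p x" for x y c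
    using assms by (auto simp: is_seminorm_def)
  show z: "p 0 = 0"
    using sc[of 0 0] by simp
  show m: "p (- x) = p x" for x
    using sc[of "-1" x] by simp
  show "0 \<le> p x"
    using add[of x "- x"] by (simp add: z m)
  show "p x \<le> p (x - y) + p y" "p (x - y) \<le> p x + p y"
    using add[of "x - y" y] add[of x "- y"] by (simp_all add: m)
qed

lemma prod_list_seminorm_nonneg: "is_seminorm scale p \<Longrightarrow> 0 \<le> prod_list (map p xs)"
  by (induction xs) (simp_all add: seminorm)

lemma rep_value_nonneg:
  "is_seminorm scale p \<Longrightarrow> 0 \<le> (\<Sum>(c, xs)\<leftarrow>L. norm (c :: 'k) * prod_list (map p xs))"
  by (intro sum_list_nonneg) (auto simp: prod_list_seminorm_nonneg)

lemma proj_power_le: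
  assumes "is_seminorm scale p" "\<forall>(c, xs)\<in>set L. length xs = n" "t = (\<Sum>(c, xs)\<leftarrow>L. tscale c (tens scale xs))"
  shows "proj_power scale p n t \<le> (\<Sum>(c, xs)\<leftarrow>L. norm c * prod_list (map p xs))"
  unfolding proj_power_def
proof (rule cInf_lower)
  show "bdd_below {\<Sum>(c, xs)\<leftarrow>L. norm c * prod_list (map p xs) | L.
     (\<forall>(c, xs)\<in>set L. length xs = n) \<and> t = (\<Sum>(c, xs)\<leftarrow>L. tscale c (tens scale xs))}"
    using rep_value_nonneg[OF assms(1)] by (intro bdd_belowI[of _ 0]) blast
qed (use assms in blast)

text \<open>The factor b permits taking infima in two variables in turn, b then containing the value
  of the other representation. That value may be 0, a case which needs some representation to
  exist.\<close>

lemma proj_power_greatest: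
  assumes "is_seminorm scale p" "t \<in> tensor_power scale n" "0 \<le> b"
    and "\<And>L. \<lbrakk>\<forall>(c, xs)\<in>set L. length xs = n; t = (\<Sum>(c, xs)\<leftarrow>L. tscale c (tens scale xs))\<rbrakk>
      \<Longrightarrow> a \<le> b * (\<Sum>(c, xs)\<leftarrow>L. norm c * prod_list (map p xs))"
  shows "a \<le> b * proj_power scale p n t"
proof (cases "b = 0")
  case True
  then show ?thesis
    using tensor_power_rep[OF assms(2)] assms(4) by fastforce
next
  case False
  then have "b > 0" using assms(3) by simp
  have "a / b \<le> proj_power scale p n t"
    unfolding proj_power_def
  proof (rule cInf_greatest)
    show "{\<Sum>(c, xs)\<leftarrow>L. norm c * prod_list (map p xs) | L.
     (\<forall>(c, xs)\<in>set L. length xs = n) \<and> t = (\<Sum>(c, xs)\<leftarrow>L. tscale c (tens scale xs))} \<noteq> {}"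
      using tensor_power_rep[OF assms(2)] by blast
  qed (use assms(4) \<open>b > 0\<close> in \<open>auto simp: field_simps\<close>)
  then show ?thesis
    using \<open>b > 0\<close> by (simp add: field_simps)
qed

lemma proj_power_nonneg:
  assumes "is_seminorm scale p" "t \<in> tensor_power scale n"
  shows "0 \<le> proj_power scale p n t"
  using proj_power_greatest[OF assms, of 1 0] rep_value_nonneg[OF assms(1)] by simp

lemma proj_power_add:
  assumes "is_seminorm scale p" "t \<in> tensor_power scale n" "u \<in> tensor_power scale n"
  shows "proj_power scale p n (t + u) \<le> proj_power scale p n t + proj_power scale p n u"
proof -
  let ?v = "\<lambda>L. \<Sum>(c, xs)\<leftarrow>L. norm (c :: 'k) * prod_list (map p xs)"
  let ?r = "\<lambda>L t. (\<forall>(c, xs)\<in>set L. length xs = n) \<and> t = (\<Sum>(c, xs)\<leftarrow>L. tscale c (tens scale xs))"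
  \<comment> \<open>The infimum over the representations of t is taken first, with one of u held
    fixed.\<close>
  have "proj_power scale p n (t + u) - ?v L \<le> 1 * proj_power scale p n t" if L: "?r L u" for L
  proof (rule proj_power_greatest[OF assms(1,2)])
    fix L' assume "\<forall>(c, xs)\<in>set L'. length xs = n" "t = (\<Sum>(c, xs)\<leftarrow>L'. tscale c (tens scale xs))"
    then have "\<forall>(c, xs)\<in>set (L' @ L). length xs = n" "t + u = (\<Sum>(c, xs)\<leftarrow>L' @ L. tscale c (tens scale xs))"
      using L by auto
    from proj_power_le[OF assms(1) this] have "proj_power scale p n (t + u) \<le> ?v L' + ?v L"
      by (simp only: map_append sum_list_append)
    then show "proj_power scale p n (t + u) - ?v L \<le> 1 * ?v L'"
      by simp
  qed simp
  then have "proj_power scale p n (t + u) - proj_power scale p n t \<le> 1 * ?v L" if "?r L u" for L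
    using that by fastforce
  then have "proj_power scale p n (t + u) - proj_power scale p n t \<le> 1 * proj_power scale p n u"
    by (intro proj_power_greatest[OF assms(1,3)]) auto
  then show ?thesis by simp
qed

lemma proj_power_zero:
  assumes "is_seminorm scale p"
  shows "proj_power scale p n 0 = 0"
  using proj_power_le[OF assms, of "[]" n 0] proj_power_nonneg[OF assms tensor_power_closed(1)]
  by (simp add: order_antisym)

lemma proj_power_scale:
  assumes "is_seminorm scale p" "t \<in> tensor_power scale n"
  shows "proj_power scale p n (tscale c t) = norm c * proj_power scale p n t"
proof -
  have le: "proj_power scale p n (tscale c t) \<le> norm c * proj_power scale p n t" if "t \<in> tensor_power scale n" for c t
  proof (rule proj_power_greatest[OF assms(1) that])
    fix L assume L: "\<forall>(c, xs)\<in>set L. length xs = n" "t = (\<Sum>(c, xs)\<leftarrow>L. tscale c (tens scale xs))"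
    let ?L = "map (\<lambda>(d, xs). (c * d, xs)) L"
    have "tscale c t = (\<Sum>(c, xs)\<leftarrow>?L. tscale c (tens scale xs))"
      unfolding L(2) by (induction L) (auto simp: tvs.scale_right_distrib tvs.scale_zero_right)
    moreover have "(\<Sum>(c, xs)\<leftarrow>?L. norm c * prod_list (map p xs)) = norm c * (\<Sum>(c, xs)\<leftarrow>L. norm c * prod_list (map p xs))"
      by (induction L) (auto simp: norm_mult distrib_left)
    moreover have "\<forall>(c, xs)\<in>set ?L. length xs = n"
      using L(1) by auto
    ultimately show "proj_power scale p n (tscale c t) \<le> norm c * (\<Sum>(c, xs)\<leftarrow>L. norm c * prod_list (map p xs))"
      using proj_power_le[OF assms(1)] by metis
  qed simp
  show ?thesis
  proof (cases "c = 0")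
    case True
    then show ?thesis using proj_power_zero[OF assms(1)] by simp
  next
    case False
    then have "proj_power scale p n t \<le> norm (inverse c) * proj_power scale p n (tscale c t)"
      using le[OF tensor_power_closed(3)[OF assms(2)], of "inverse c" c] by simp
    then have "norm c * proj_power scale p n t \<le> proj_power scale p n (tscale c t)"
      using False by (simp add: norm_divide norm_inverse field_simps)
    then show ?thesis using le[OF assms(2), of c] by simp
  qed
qed

lemma proj_power_sum:
  assumes "is_seminorm scale p" "\<And>i. i \<in> I \<Longrightarrow> t i \<in> tensor_power scale n"
  shows "proj_power scale p n (sum t I) \<le> (\<Sum>i\<in>I. proj_power scale p n (t i))"
  using assms(2)
proof (induction I rule: infinite_finite_induct)
  case (insert i I)
  then have "proj_power scale p n (t i + sum t I) \<le> proj_power scale p n (t i) + proj_power scale p n (sum t I)"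
    by (intro proj_power_add assms(1) tensor_power_closed) auto
  with insert show ?case by fastforce
qed (simp_all add: proj_power_zero assms(1))

lemma proj_power_tens:
  assumes "is_seminorm scale p"
  shows "proj_power scale p (length xs) (tens scale xs) \<le> prod_list (map p xs)"
  using proj_power_le[OF assms, of "[(1, xs)]" "length xs" "tens scale xs"] by simp

lemma proj_power_sym_prod:
  assumes "is_seminorm scale p"
  shows "proj_power scale p (length xs) (sym_prod scale xs) \<le> prod_list (map p xs)"
proof -
  let ?n = "length xs"
  let ?P = "{\<sigma>. \<sigma> permutes {..<?n}}"
  have "proj_power scale p ?n (sym_prod scale xs) =
      norm (1 / fact ?n :: 'k) * proj_power scale p ?n (\<Sum>\<sigma>\<in>?P. tens scale (permute_list \<sigma> xs))"
    unfolding sym_prod_def by (intro proj_power_scale assms tensor_power_closed) simp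
  also have "\<dots> \<le> norm (1 / fact ?n :: 'k) * (\<Sum>\<sigma>\<in>?P. prod_list (map p xs))"
  proof (rule mult_left_mono)
    have "proj_power scale p ?n (\<Sum>\<sigma>\<in>?P. tens scale (permute_list \<sigma> xs)) \<le>
        (\<Sum>\<sigma>\<in>?P. proj_power scale p ?n (tens scale (permute_list \<sigma> xs)))"
      by (intro proj_power_sum assms tensor_power_closed) simp
    also have "\<dots> \<le> (\<Sum>\<sigma>\<in>?P. prod_list (map p xs))"
    proof (rule sum_mono)
      fix \<sigma> assume "\<sigma> \<in> ?P"
      then have "mset (permute_list \<sigma> xs) = mset xs" by simp
      then have "prod_list (map p (permute_list \<sigma> xs)) = prod_list (map p xs)"
        by (metis mset_map prod_mset_prod_list)
      then show "proj_power scale p ?n (tens scale (permute_list \<sigma> xs)) \<le> prod_list (map p xs)"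
        using proj_power_tens[OF assms, of "permute_list \<sigma> xs"] by simp
    qed
    finally show "proj_power scale p ?n (\<Sum>\<sigma>\<in>?P. tens scale (permute_list \<sigma> xs)) \<le> (\<Sum>\<sigma>\<in>?P. prod_list (map p xs))" .
  qed simp
  also have "\<dots> = prod_list (map p xs)"
    unfolding sum_distrib_left by (rule sum_average_permutes)
  finally show ?thesis .
qed

lemma proj_power_mono:
  assumes "is_seminorm scale p" "is_seminorm scale q" "\<And>x. p x \<le> q x" "t \<in> tensor_power scale n"
  shows "proj_power scale p n t \<le> proj_power scale q n t"
proof -
  have "proj_power scale p n t \<le> 1 * proj_power scale q n t"
  proof (rule proj_power_greatest[OF assms(2,4)])
    fix L assume L: "\<forall>(c, xs)\<in>set L. length xs = n" "t = (\<Sum>(c, xs)\<leftarrow>L. tscale c (tens scale xs))"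
    have m: "prod_list (map p xs) \<le> prod_list (map q xs)" for xs
      by (induction xs) (auto intro!: mult_mono assms(3) simp: seminorm[OF assms(1)] seminorm[OF assms(2)]
          prod_list_seminorm_nonneg[OF assms(1)])
    have "proj_power scale p n t \<le> (\<Sum>(c, xs)\<leftarrow>L. norm c * prod_list (map p xs))"
      by (rule proj_power_le[OF assms(1) L])
    also have "\<dots> \<le> (\<Sum>(c, xs)\<leftarrow>L. norm c * prod_list (map q xs))"
      by (intro sum_list_mono) (auto intro: mult_left_mono m)
    finally show "proj_power scale p n t \<le> 1 * (\<Sum>(c, xs)\<leftarrow>L. norm c * prod_list (map q xs))" by simp
  qed simp
  then show ?thesis by simp
qed

lemma is_seminorm_mult:
  assumes "is_seminorm scale p" "0 \<le> c"
  shows "is_seminorm scale (\<lambda>v. c * p v)"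
  using assms mult_left_mono[OF seminorm(1)[OF assms(1)] assms(2)]
  by (auto simp: is_seminorm_def distrib_left)

text \<open>A representation in degree n is multiplied by exactly c^n. This direction of the
  inequality is the one that absorbs the exponential factors of the estimates into the seminorms on
  the right.\<close>

lemma proj_power_mult:
  assumes "is_seminorm scale p" "0 < c" "t \<in> tensor_power scale n"
  shows "c ^ n * proj_power scale p n t \<le> proj_power scale (\<lambda>v. c * p v) n t"
proof -
  have cp: "is_seminorm scale (\<lambda>v. c * p v)"
    using assms by (intro is_seminorm_mult) auto
  have m: "prod_list (map (\<lambda>v. c * p v) xs) = c ^ length xs * prod_list (map p xs)" for xs
    by (induction xs) auto
  have "c ^ n * proj_power scale p n t \<le> 1 * proj_power scale (\<lambda>v. c * p v) n t"
  proof (rule proj_power_greatest[OF cp assms(3)])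
    fix L assume L: "\<forall>(c, xs)\<in>set L. length xs = n" "t = (\<Sum>(c, xs)\<leftarrow>L. tscale c (tens scale xs))"
    have "c ^ n * (\<Sum>(c, xs)\<leftarrow>L. norm c * prod_list (map p xs)) = (\<Sum>(a, xs)\<leftarrow>L. norm a * prod_list (map (\<lambda>v. c * p v) xs))"
      using L(1) by (induction L) (auto simp: m distrib_left)
    then show "c ^ n * proj_power scale p n t \<le> 1 * (\<Sum>(a, xs)\<leftarrow>L. norm a * prod_list (map (\<lambda>v. c * p v) xs))"
      using mult_left_mono[OF proj_power_le[OF assms(1) L], of "c ^ n"] assms(2) by simp
  qed simp
  then show ?thesis by simp
qed

section \<open>The weighted sums of projective powers\<close>

lemma tensor_seminorm_eq_sum:
  assumes "is_seminorm scale p" "t \<in> tensor_algebra scale" "finite I" "\<And>n. n \<notin> I \<Longrightarrow> tproj scale n t = 0"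
  shows "tensor_seminorm scale p R t = (\<Sum>n\<in>I. fact n powr R * proj_power scale p n (tproj scale n t))"
  unfolding tensor_seminorm_def
  by (rule suminf_finite[OF assms(3)]) (simp add: assms(4) proj_power_zero[OF assms(1)])

lemma tensor_seminorm_eq_sum_support:
  assumes "is_seminorm scale p" "t \<in> tensor_algebra scale"
  shows "tensor_seminorm scale p R t =
    (\<Sum>n | tproj scale n t \<noteq> 0. fact n powr R * proj_power scale p n (tproj scale n t))"
  by (rule tensor_seminorm_eq_sum[OF assms finite_tproj_support[OF assms(2)]]) simp

lemma tensor_seminorm_nonneg:
  assumes "is_seminorm scale p" "t \<in> tensor_algebra scale"
  shows "0 \<le> tensor_seminorm scale p R t"
  unfolding tensor_seminorm_eq_sum_support[OF assms]
  by (simp add: sum_nonneg proj_power_nonneg assms tproj_tensor_power)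

lemma tensor_seminorm_add:
  assumes p: "is_seminorm scale p" and t: "t \<in> tensor_algebra scale" and u: "u \<in> tensor_algebra scale"
  shows "tensor_seminorm scale p R (t + u) \<le> tensor_seminorm scale p R t + tensor_seminorm scale p R u"
proof -
  define I where "I = {n. tproj scale n t \<noteq> 0} \<union> {n. tproj scale n u \<noteq> 0}"
  have I: "finite I" "\<And>n. n \<notin> I \<Longrightarrow> tproj scale n t = 0" "\<And>n. n \<notin> I \<Longrightarrow> tproj scale n u = 0"
    "\<And>n. n \<notin> I \<Longrightarrow> tproj scale n (t + u) = 0"
    using finite_tproj_support t u by (auto simp: I_def tproj_linear)
  have "(\<Sum>n\<in>I. fact n powr R * proj_power scale p n (tproj scale n (t + u))) \<le>
      (\<Sum>n\<in>I. fact n powr R * (proj_power scale p n (tproj scale n t) + proj_power scale p n (tproj scale n u)))"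
    unfolding tproj_linear by (intro sum_mono mult_left_mono proj_power_add p tproj_tensor_power t u) simp
  then show ?thesis
    using tensor_seminorm_eq_sum[OF p t I(1,2)] tensor_seminorm_eq_sum[OF p u I(1,3)]
      tensor_seminorm_eq_sum[OF p tensor_algebra_closed(3)[OF t u] I(1,4)]
    by (simp add: distrib_left sum.distrib)
qed

lemma tensor_seminorm_scale:
  assumes p: "is_seminorm scale p" and t: "t \<in> tensor_algebra scale"
  shows "tensor_seminorm scale p R (tscale c t) = norm c * tensor_seminorm scale p R t"
proof -
  let ?I = "{n. tproj scale n t \<noteq> 0}"
  have "tensor_seminorm scale p R (tscale c t) = (\<Sum>n\<in>?I. fact n powr R * proj_power scale p n (tproj scale n (tscale c t)))"
    by (rule tensor_seminorm_eq_sum[OF p tensor_algebra_closed(6)[OF t] finite_tproj_support[OF t]])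
      (simp add: tproj_linear tvs.scale_zero_right)
  also have "\<dots> = (\<Sum>n\<in>?I. norm c * (fact n powr R * proj_power scale p n (tproj scale n t)))"
    unfolding tproj_linear by (intro sum.cong refl) (simp add: proj_power_scale[OF p tproj_tensor_power[OF t]])
  also have "\<dots> = norm c * tensor_seminorm scale p R t"
    by (simp only: tensor_seminorm_eq_sum_support[OF p t] sum_distrib_left)
  finally show ?thesis .
qed

lemma tensor_seminorm_sum:
  assumes "is_seminorm scale p" "\<And>i. i \<in> I \<Longrightarrow> t i \<in> tensor_algebra scale"
  shows "tensor_seminorm scale p R (sum t I) \<le> (\<Sum>i\<in>I. tensor_seminorm scale p R (t i))"
  using assms(2)
proof (induction I rule: infinite_finite_induct)
  case (insert i I)
  then have "tensor_seminorm scale p R (t i + sum t I) \<le> tensor_seminorm scale p R (t i) + tensor_seminorm scale p R (sum t I)"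
    by (intro tensor_seminorm_add assms(1) tensor_algebra_closed) auto
  with insert show ?case by fastforce
qed (simp_all add: tensor_seminorm_def tproj_linear proj_power_zero assms(1))

lemma tensor_seminorm_homogeneous:
  assumes "is_seminorm scale p" "t \<in> tensor_power scale n"
  shows "tensor_seminorm scale p R t = fact n powr R * proj_power scale p n t"
proof -
  have "tensor_seminorm scale p R t = (\<Sum>m\<in>{n}. fact m powr R * proj_power scale p m (tproj scale m t))"
    unfolding tensor_seminorm_def
    by (rule suminf_finite) (simp_all add: tproj_tproj[OF assms(2)] proj_power_zero[OF assms(1)])
  then show ?thesis by (simp add: tproj_tproj[OF assms(2)])
qed

lemma tensor_seminorm_mono:
  assumes p: "is_seminorm scale p" and q: "is_seminorm scale q" and le: "\<And>x. p x \<le> q x" and R: "R \<le> S"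
    and t: "t \<in> tensor_algebra scale"
  shows "tensor_seminorm scale p R t \<le> tensor_seminorm scale q S t"
  unfolding tensor_seminorm_eq_sum_support[OF p t] tensor_seminorm_eq_sum_support[OF q t]
  by (intro sum_mono mult_mono powr_mono R fact_ge_1 proj_power_mono p q le tproj_tensor_power t proj_power_nonneg) auto

end

section \<open>Estimates for the Gutt star product\<close>

text \<open>The Gutt star product of monomials of degrees \<open>k\<close> and \<open>l\<close> has a component of order \<open>n\<close> of size at most
  \<open>gutt_weight M R n k l\<close>; it vanishes if the \<open>k + l - n\<close> words are too few for words of at most \<open>M\<close> letters.\<close>

definition gutt_weight :: "nat \<Rightarrow> real \<Rightarrow> nat \<Rightarrow> nat \<Rightarrow> nat \<Rightarrow> real" where
  "gutt_weight M R n k l = (if n \<le> k + l \<and> k + l \<le> (k + l - n) * M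
     then fact (k + l - n) powr R * (2 ^ k * real (k + l) ^ n) else 0)"

lemma gutt_weight_nonneg: "0 \<le> gutt_weight M R n k l"
  by (simp add: gutt_weight_def)

text \<open>One term of the exponential series is at most the whole series.\<close>

lemma power_le_exp_fact: "real m ^ n \<le> exp (real m) * fact n"
proof -
  have "(\<Sum>i\<in>{n}. real m ^ i / fact i) \<le> (\<Sum>i. real m ^ i / fact i)"
    using summable_exp[of "real m"] by (intro sum_le_suminf) (simp_all add: inverse_eq_divide)
  then have "real m ^ n / fact n \<le> exp (real m)"
    by (simp add: exp_def divideR_right scaleR_conv_of_real divide_inverse mult.commute)
  then show ?thesis by (simp add: field_simps)
qed

lemma fact_mult_fact_le: "fact k * fact l \<le> (fact (k + l) :: real)"
  "fact (k + l) \<le> 2 ^ (k + l) * (fact k * fact l :: real)"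
proof -
  have "fact k * fact l * ((k + l) choose k) = fact (k + l)"
    using binomial_fact_lemma[of k "k + l"] by simp
  then have e: "fact k * fact l * real ((k + l) choose k) = fact (k + l)"
    by (metis of_nat_fact of_nat_mult)
  have "1 \<le> (k + l) choose k"
    using zero_less_binomial[of k "k + l"] by linarith
  then have "fact k * fact l * 1 \<le> fact k * fact l * real ((k + l) choose k)"
    by (intro mult_left_mono) auto
  then show "fact k * fact l \<le> (fact (k + l) :: real)"
    by (simp only: e mult_1_right)
  have "real ((k + l) choose k) \<le> 2 ^ (k + l)"
    using binomial_le_pow2[of "k + l" k] by (metis of_nat_le_iff of_nat_numeral of_nat_power)
  then show "fact (k + l) \<le> 2 ^ (k + l) * (fact k * fact l :: real)"
    unfolding e[symmetric] by (simp add: mult.commute mult_left_mono)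
qed

text \<open>The geometric mean n!^(1/n) increases with n, since each new factor exceeds all earlier
  ones.\<close>

lemma fact_power_le_fact_power:
  assumes "n \<le> m"
  shows "fact n ^ m \<le> (fact m ^ n :: real)"
  using assms
proof (induction m rule: dec_induct)
  case (step m)
  have "fact n ^ Suc m = fact n ^ m * (fact n :: real)" by simp
  also have "\<dots> \<le> fact m ^ n * real (Suc m) ^ n"
  proof (rule mult_mono)
    have "fact n \<le> real n ^ n" using fact_le_power[of n, where 'a = real] by simp
    also have "\<dots> \<le> real (Suc m) ^ n" using step by (intro power_mono) auto
    finally show "fact n \<le> real (Suc m) ^ n" .
  qed (use step in auto)
  also have "\<dots> = fact (Suc m) ^ n"
    by (simp add: power_mult_distrib mult.commute)
  finally show ?case .
qed simp

text \<open>The origin of \<epsilon>: if m letters fill m - n words of at most M letters, then n / m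
  \<le> (M - 1) / M, and the growth of n!^(1/n) gives n! \<le> m!^(n/m).\<close>

lemma fact_powr_bound:
  assumes "n \<le> m" "m \<le> (m - n) * M" "M \<ge> 1" "0 \<le> r"
  shows "fact n powr r \<le> (fact m :: real) powr ((real M - 1) / real M * r)"
proof (cases "m = 0")
  case False
  have "real m \<le> (real m - real n) * real M"
    using assms(1,2) by (metis of_nat_diff of_nat_le_iff of_nat_mult)
  then have *: "real n / real m \<le> (real M - 1) / real M"
    using False assms(3) by (simp add: field_simps)
  have "fact n = (fact n ^ m) powr (1 / real m)"
    using False by (simp add: powr_powr flip: powr_realpow)
  also have "\<dots> \<le> (fact m ^ n) powr (1 / real m)"
    by (intro powr_mono2 fact_power_le_fact_power assms) auto
  also have "\<dots> = fact m powr (real n / real m)"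
    by (simp add: powr_powr flip: powr_realpow)
  also have "\<dots> \<le> fact m powr ((real M - 1) / real M)"
    using * by (intro powr_mono fact_ge_1)
  finally have "fact n powr r \<le> (fact m powr ((real M - 1) / real M)) powr r"
    using assms(4) by (intro powr_mono2) auto
  then show ?thesis by (simp add: powr_powr)
qed (use assms in simp)

lemma fact_powr_split:
  assumes "0 \<le> S" "S \<le> 1"
  shows "fact (k + l) powr S \<le> 2 ^ (k + l) * (fact k powr S * fact l powr S :: real)"
proof -
  have "fact (k + l) powr S \<le> (2 ^ (k + l) * (fact k * fact l :: real)) powr S"
    using assms fact_mult_fact_le(2) by (intro powr_mono2) auto
  also have "\<dots> = (2 ^ (k + l)) powr S * (fact k powr S * fact l powr S)"
    by (simp add: powr_mult)
  also have "\<dots> \<le> (2 ^ (k + l)) powr 1 * (fact k powr S * fact l powr S)"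
    using assms by (intro mult_right_mono powr_mono) auto
  finally show ?thesis by simp
qed

text \<open>Of the factor n! from \<open>power_le_exp_fact\<close>, the part n!^R combines with (k +
  l - n)!^R into at most (k + l)!^R. The rest, n!^(1-R), is what the further bounds have to deal
  with.\<close>

lemma gutt_weight_le:
  assumes "0 \<le> R" "R < 1"
  shows "gutt_weight M R n k l \<le> fact n powr (1 - R) * (2 ^ k * exp 1 ^ (k + l)) * fact (k + l) powr R"
proof (cases "n \<le> k + l \<and> k + l \<le> (k + l - n) * M")
  case True
  then have n: "n \<le> k + l" by simp
  let ?m = "k + l"
  have "fact (?m - n) powr R * (2 ^ k * real ?m ^ n) \<le> fact (?m - n) powr R * (2 ^ k * (exp (real ?m) * fact n))"
    by (intro mult_left_mono power_le_exp_fact) auto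
  also have "\<dots> = (fact (?m - n) powr R * fact n powr R) * (fact n powr (1 - R) * (2 ^ k * exp 1 ^ ?m))"
  proof -
    have "a * (b * (d * f)) = (a * f1) * (f2 * (b * d'))" if "f = f1 * f2" "d = d'" for a b d d' f f1 f2 :: real
      using that by (simp add: mult_ac)
    moreover have "fact n = fact n powr R * (fact n powr (1 - R) :: real)"
      by (simp flip: powr_add)
    moreover have "exp (real ?m) = exp 1 ^ ?m"
      using exp_of_nat_mult[of ?m 1] by simp
    ultimately show ?thesis by blast
  qed
  also have "\<dots> \<le> fact ?m powr R * (fact n powr (1 - R) * (2 ^ k * exp 1 ^ ?m))"
  proof (rule mult_right_mono)
    have "fact (?m - n) powr R * fact n powr R = (fact (?m - n) * fact n) powr (R :: real)"
      by (simp add: powr_mult)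
    also have "\<dots> \<le> fact ?m powr R"
      using fact_mult_fact_le(1)[of "?m - n" n] n assms by (intro powr_mono2) auto
    finally show "fact (?m - n) powr R * fact n powr R \<le> (fact ?m powr R :: real)" .
  qed simp
  finally show ?thesis
    using True by (simp add: gutt_weight_def mult_ac)
qed (auto simp: gutt_weight_def)

text \<open>For a single n the factor n!^(1-R) is a constant, so the exponent R is not enlarged. The
  number 4 joins the 2 for each letter multiplied on with the 2 from splitting (k + l)!.\<close>

lemma gutt_weight_bound_fixed_order:
  assumes "0 \<le> R" "R < 1"
  shows "gutt_weight M R n k l \<le> fact n powr (1 - R) * (4 * exp 1) ^ (k + l) * (fact k powr R * fact l powr R)"
proof -
  have "gutt_weight M R n k l \<le> fact n powr (1 - R) * (2 ^ k * exp 1 ^ (k + l)) * fact (k + l) powr R"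
    by (rule gutt_weight_le[OF assms])
  also have "\<dots> \<le> fact n powr (1 - R) * (2 ^ (k + l) * exp 1 ^ (k + l)) * (2 ^ (k + l) * (fact k powr R * fact l powr R))"
    using assms by (intro mult_mono fact_powr_split mult_left_mono power_increasing) auto
  also have "\<dots> = fact n powr (1 - R) * (4 * exp 1) ^ (k + l) * (fact k powr R * fact l powr R)"
  proof -
    have "(4 * exp 1 :: real) = 2 * exp 1 * 2" by simp
    then have "(4 * exp 1 :: real) ^ (k + l) = 2 ^ (k + l) * exp 1 ^ (k + l) * 2 ^ (k + l)"
      by (simp only: power_mult_distrib)
    then show ?thesis by (simp only: mult_ac)
  qed
  finally show ?thesis .
qed

text \<open>Here n!^(1-R) is traded for (k + l)!^\<epsilon>. Beyond the 2 * 2 * e of the fixed-order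
  bound, a factor 8^(k+l) is spent on 2 * 8^n \<le> 8^(n+1) \<le> 8^(k+l). This needs n < k + l, so
  degree k + l = 0 is treated apart.\<close>

lemma gutt_weight_bound:
  assumes R: "0 \<le> R" "R < 1" and M: "M \<ge> 1"
    and S: "S = R + (real M - 1) / real M * (1 - R)"
  shows "gutt_weight M R n k l \<le>
    (if k + l = 0 then if n = 0 then 1 else 0 else if n < k + l then 1 / (2 * 8 ^ n) else 0) *
    (32 * exp 1) ^ (k + l) * (fact k powr S * fact l powr S)"
proof (cases "n \<le> k + l \<and> k + l \<le> (k + l - n) * M")
  case True
  let ?m = "k + l"
  have n: "n \<le> ?m" "?m \<le> (?m - n) * M" using True by auto
  have S1: "0 \<le> S" "S \<le> 1"
  proof -
    have "(real M - 1) / real M * (1 - R) \<le> 1 * (1 - R)"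
      using M R by (intro mult_right_mono) auto
    then show "S \<le> 1" by (simp add: S)
    show "0 \<le> S" using M R by (simp add: S)
  qed
  have main: "gutt_weight M R n k l \<le> 2 ^ k * (2 * exp 1) ^ ?m * (fact k powr S * fact l powr S)"
  proof -
    have "gutt_weight M R n k l \<le> fact n powr (1 - R) * (2 ^ k * exp 1 ^ ?m) * fact ?m powr R"
      by (rule gutt_weight_le[OF R])
    also have "\<dots> \<le> fact ?m powr ((real M - 1) / real M * (1 - R)) * (2 ^ k * exp 1 ^ ?m) * fact ?m powr R"
      using R by (intro mult_right_mono fact_powr_bound n M) auto
    also have "\<dots> = (2 ^ k * exp 1 ^ ?m) * fact ?m powr S"
      by (simp add: S powr_add)
    also have "\<dots> \<le> (2 ^ k * exp 1 ^ ?m) * (2 ^ ?m * (fact k powr S * fact l powr S))"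
      by (intro mult_left_mono fact_powr_split S1) auto
    finally show ?thesis by (simp add: power_mult_distrib mult_ac)
  qed
  show ?thesis
  proof (cases "?m = 0")
    case True
    then show ?thesis using main n by simp
  next
    case False
    \<comment> \<open>With n = k + l no word would be left for the k + l > 0 letters.\<close>
    then have "n < ?m" using n by (cases "n = ?m") auto
    have "2 ^ k \<le> (2 :: real) ^ ?m" by (intro power_increasing) auto
    moreover have "2 * 8 ^ n \<le> (8 :: real) ^ ?m"
    proof -
      have "2 * 8 ^ n \<le> (8 :: real) ^ Suc n" by simp
      also have "\<dots> \<le> 8 ^ ?m" using \<open>n < ?m\<close> by (intro power_increasing) auto
      finally show ?thesis .
    qed
    ultimately have "2 ^ k * (2 * 8 ^ n) \<le> (2 :: real) ^ ?m * 8 ^ ?m"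
      by (intro mult_mono) auto
    also have "\<dots> = 16 ^ ?m" by (simp flip: power_mult_distrib)
    finally have "2 ^ k \<le> 1 / (2 * 8 ^ n) * (16 :: real) ^ ?m"
      by (simp add: field_simps)
    then have "2 ^ k * (2 * exp 1) ^ ?m * (fact k powr S * fact l powr S) \<le>
        1 / (2 * 8 ^ n) * 16 ^ ?m * (2 * exp 1) ^ ?m * (fact k powr S * fact l powr S)"
      by (intro mult_right_mono) auto
    also have "\<dots> = 1 / (2 * 8 ^ n) * (32 * exp 1) ^ ?m * (fact k powr S * fact l powr S)"
    proof -
      have "32 * exp 1 = 16 * (2 * exp 1 :: real)" by simp
      then have "16 ^ ?m * (2 * exp 1) ^ ?m = (32 * exp 1 :: real) ^ ?m"
        by (simp only: power_mult_distrib)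
      then show ?thesis by (simp only: mult.assoc[of "1 / (2 * 8 ^ n)" "16 ^ ?m"])
    qed
    finally have "gutt_weight M R n k l \<le> 1 / (2 * 8 ^ n) * (32 * exp 1) ^ ?m * (fact k powr S * fact l powr S)"
      using main by linarith
    then show ?thesis using False \<open>n < ?m\<close> by (simp only: if_True if_False)
  qed
qed (auto simp: gutt_weight_def)

text \<open>Unless both degrees are 0, only n < k + l contributes, so z^n \<le> (z + 1)^(k+l); the
  factors 1 / (2 * 8^n) sum to at most 4/7.\<close>

lemma gutt_weight_sum_bound:
  assumes R: "0 \<le> R" "R < 1" and M: "M \<ge> 1"
    and S: "S = R + (real M - 1) / real M * (1 - R)" and z: "0 \<le> z" and F: "finite F"
  shows "(\<Sum>n\<in>F. z ^ n * gutt_weight M R n k l) \<le> (32 * exp 1 * (z + 1)) ^ (k + l) * (fact k powr S * fact l powr S)"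
proof -
  let ?m = "k + l"
  let ?\<kappa> = "\<lambda>n. if ?m = 0 then if n = 0 then 1 else 0 else if n < ?m then 1 / (2 * 8 ^ n) else (0 :: real)"
  have "(\<Sum>n\<in>F. z ^ n * ?\<kappa> n) \<le> (z + 1) ^ ?m"
  proof (cases "?m = 0")
    case True
    have "(\<Sum>n\<in>F. z ^ n * ?\<kappa> n) = (\<Sum>n\<in>F. if n = 0 then 1 else 0)"
      using True by (intro sum.cong) auto
    also have "\<dots> \<le> 1" using F by simp
    finally show ?thesis using True by simp
  next
    case False
    have "(\<Sum>n\<in>F. z ^ n * ?\<kappa> n) \<le> (\<Sum>n\<in>F. (z + 1) ^ ?m * (1 / 2 * (1 / 8) ^ n))"
    proof (rule sum_mono)
      fix n
      have "z ^ n \<le> (z + 1) ^ ?m" if "n < ?m"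
      proof -
        have "z ^ n \<le> (z + 1) ^ n" using z by (intro power_mono) auto
        also have "\<dots> \<le> (z + 1) ^ ?m" using z that by (intro power_increasing) auto
        finally show ?thesis .
      qed
      then show "z ^ n * ?\<kappa> n \<le> (z + 1) ^ ?m * (1 / 2 * (1 / 8) ^ n)"
        using False z by (auto simp: power_one_over divide_right_mono)
    qed
    also have "\<dots> = (z + 1) ^ ?m * (1 / 2 * (\<Sum>n\<in>F. (1 / 8) ^ n))"
      by (simp add: sum_distrib_left)
    also have "\<dots> \<le> (z + 1) ^ ?m * (1 / 2 * (\<Sum>n. (1 / 8) ^ n))"
      using z F by (intro mult_left_mono sum_le_suminf summable_geometric) auto
    also have "\<dots> \<le> (z + 1) ^ ?m * 1"
      using z by (intro mult_left_mono) (auto simp: suminf_geometric)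
    finally show ?thesis by simp
  qed
  then have "(\<Sum>n\<in>F. z ^ n * ?\<kappa> n) * ((32 * exp 1) ^ ?m * (fact k powr S * fact l powr S)) \<le>
      (z + 1) ^ ?m * ((32 * exp 1) ^ ?m * (fact k powr S * fact l powr S))"
    by (intro mult_right_mono) auto
  moreover have "(\<Sum>n\<in>F. z ^ n * gutt_weight M R n k l) \<le> (\<Sum>n\<in>F. z ^ n * ?\<kappa> n) * ((32 * exp 1) ^ ?m * (fact k powr S * fact l powr S))"
    unfolding sum_distrib_right
    using mult_left_mono[OF gutt_weight_bound[OF R M S, of _ k l] zero_le_power[OF z]]
    by (intro sum_mono) (simp add: mult.assoc)
  ultimately have "(\<Sum>n\<in>F. z ^ n * gutt_weight M R n k l) \<le> (z + 1) ^ ?m * ((32 * exp 1) ^ ?m * (fact k powr S * fact l powr S))"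
    by (rule order_trans[rotated])
  then show ?thesis
    by (simp only: power_mult_distrib mult_ac)
qed

context nilpotent_lie_algebra_normed
begin

sublocale normed_field_vector_space scale ..

lemma bracket_comb_tensor_power: "bracket_comb xs d a t \<Longrightarrow> t \<in> tensor_power scale d"
  by (induction rule: bracket_comb_induct) (auto intro: tensor_power_closed sym_prod_tensor_power)

text \<open>The asymptotic estimate applies to each word of a product, and since every letter of
  \<open>xs\<close> is used once, the bounds multiply to the same value for all terms.\<close>

lemma bracket_comb_proj_power:
  assumes p: "is_seminorm scale p" and q: "is_seminorm scale q"
    and pq: "\<And>xs w. lie_word br xs w \<Longrightarrow> p w \<le> prod_list (map q xs)"
    and t: "bracket_comb xs d a t"
  shows "proj_power scale p d t \<le> a * prod_list (map q xs)"
  using t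
proof (induction rule: bracket_comb_induct)
  case (zero a)
  then show ?case by (simp add: proj_power_zero[OF p] prod_list_seminorm_nonneg[OF q])
next
  case (step xss ws a t c)
  have "prod_list (map p ws) \<le> prod_list (map q (concat xss))"
    using step(1)
  proof (induction rule: list_all2_induct)
    case (Cons ys xss w ws)
    then show ?case
      by (auto intro!: mult_mono pq prod_list_seminorm_nonneg[OF p] prod_list_seminorm_nonneg[OF q])
  qed simp
  also have "\<dots> = prod_list (map q xs)"
    using step(2) by (metis mset_map prod_mset_prod_list)
  finally have w: "proj_power scale p d (sym_prod scale ws) \<le> prod_list (map q xs)"
    using proj_power_sym_prod[OF p, of ws] step(3) by simp
  have "proj_power scale p d (tscale c (sym_prod scale ws) + t) \<le> norm c * proj_power scale p d (sym_prod scale ws) + proj_power scale p d t"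
    using proj_power_add[OF p tensor_power_closed(3)[OF sym_prod_tensor_power[OF step(3)]] bracket_comb_tensor_power[OF step(4)], of c]
      proj_power_scale[OF p sym_prod_tensor_power[OF step(3)], of c] by simp
  also have "\<dots> \<le> norm c * prod_list (map q xs) + a * prod_list (map q xs)"
    using w step by (intro add_mono mult_left_mono) auto
  finally show ?case by (simp add: distrib_right)
qed

lemma gutt_prod_zero:
  assumes "g \<in> tensor_algebra scale"
  shows "gutt_prod 0 g = 0" "gutt_prod g 0 = 0"
  using gutt_prod_bilinear(3,4)[OF tensor_algebra_closed(1) tensor_algebra_closed(1) assms, of 0] by simp_all

lemma gutt_prod_scale:
  assumes "f \<in> tensor_algebra scale" "g \<in> tensor_algebra scale"
  shows "gutt_prod (tscale c f) g = tscale c (gutt_prod f g)" "gutt_prod g (tscale c f) = tscale c (gutt_prod g f)"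
  using gutt_prod_bilinear(3,4)[OF assms(1) assms] by auto

lemma gutt_prod_sum_list:
  assumes "g \<in> tensor_algebra scale"
  shows "gutt_prod (\<Sum>(c, xs)\<leftarrow>L. tscale c (sym_prod scale xs)) g = (\<Sum>(c, xs)\<leftarrow>L. tscale c (gutt_prod (sym_prod scale xs) g))"
    and "gutt_prod g (\<Sum>(c, xs)\<leftarrow>L. tscale c (sym_prod scale xs)) = (\<Sum>(c, xs)\<leftarrow>L. tscale c (gutt_prod g (sym_prod scale xs)))"
proof -
  have T: "(\<Sum>(c, xs)\<leftarrow>L. tscale c (sym_prod scale xs)) \<in> tensor_algebra scale" for L
    by (induction L) (auto intro: tensor_algebra_closed sym_prod_mem_tensor_algebra)
  note cl = T tensor_algebra_closed(6)[OF sym_prod_mem_tensor_algebra] sym_prod_mem_tensor_algebra assms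
  show "gutt_prod (\<Sum>(c, xs)\<leftarrow>L. tscale c (sym_prod scale xs)) g = (\<Sum>(c, xs)\<leftarrow>L. tscale c (gutt_prod (sym_prod scale xs) g))"
    by (induction L) (auto simp: gutt_prod_zero assms gutt_prod_bilinear(1,2) gutt_prod_scale cl)
  show "gutt_prod g (\<Sum>(c, xs)\<leftarrow>L. tscale c (sym_prod scale xs)) = (\<Sum>(c, xs)\<leftarrow>L. tscale c (gutt_prod g (sym_prod scale xs)))"
    by (induction L) (auto simp: gutt_prod_zero assms gutt_prod_bilinear(1,2) gutt_prod_scale cl)
qed

lemma proj_power_sum_list_le:
  assumes p: "is_seminorm scale p" and h: "\<And>c xs. (c, xs) \<in> set L \<Longrightarrow> h xs \<in> tensor_algebra scale"
    and b: "\<And>c xs. (c, xs) \<in> set L \<Longrightarrow> proj_power scale p d (tproj scale d (h xs)) \<le> b * f xs"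
  shows "proj_power scale p d (tproj scale d (\<Sum>(c, xs)\<leftarrow>L. tscale c (h xs))) \<le> b * (\<Sum>(c, xs)\<leftarrow>L. norm c * f xs)"
  using h b
proof (induction L)
  case (Cons cx L)
  obtain c xs where cx: "cx = (c, xs)" by (cases cx)
  have T: "(\<Sum>(c, xs)\<leftarrow>L. tscale c (h xs)) \<in> tensor_algebra scale"
    using Cons.prems(1) by (induction L) (auto intro!: tensor_algebra_closed)
  have h: "h xs \<in> tensor_algebra scale" using Cons.prems(1) cx by auto
  have "proj_power scale p d (tproj scale d (tscale c (h xs) + (\<Sum>(c, xs)\<leftarrow>L. tscale c (h xs)))) \<le>
      norm c * proj_power scale p d (tproj scale d (h xs)) + proj_power scale p d (tproj scale d (\<Sum>(c, xs)\<leftarrow>L. tscale c (h xs)))"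
    unfolding tproj_linear
    using proj_power_add[OF p tensor_power_closed(3)[OF tproj_tensor_power[OF h]] tproj_tensor_power[OF T]]
      proj_power_scale[OF p tproj_tensor_power[OF h]] by simp
  also have "\<dots> \<le> norm c * (b * f xs) + b * (\<Sum>(c, xs)\<leftarrow>L. norm c * f xs)"
    using Cons.prems cx by (intro add_mono mult_left_mono Cons.IH) auto
  finally show ?case by (simp add: cx algebra_simps)
qed (simp add: tproj_linear proj_power_zero[OF p])

text \<open>The infima over the representations of g and of f are taken in turn. By
  \<open>symmetric_rep\<close> both representations consist of symmetric products, for which
  \<open>gutt_prod_sym_prod\<close> gives words and coefficients; if the words are too few,
  \<open>bracket_comb_eq_0\<close> gives 0.\<close>

lemma gutt_prod_estimate:
  assumes p: "is_seminorm scale p" and q: "is_seminorm scale q"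
    and pq: "\<And>xs w. lie_word br xs w \<Longrightarrow> p w \<le> prod_list (map q xs)"
    and f: "f \<in> symmetric_algebra scale" "f \<in> tensor_power scale k"
    and g: "g \<in> symmetric_algebra scale" "g \<in> tensor_power scale l"
    and n: "n \<le> k + l"
  shows "fact (k + l - n) powr R * proj_power scale p (k + l - n) (tproj scale (k + l - n) (gutt_prod f g)) \<le>
    gutt_weight K R n k l * (proj_power scale q k f * proj_power scale q l g)"
proof -
  let ?d = "k + l - n"
  define a where "a = (if k + l \<le> ?d * K then 2 ^ k * real (k + l) ^ n else 0)"
  have a: "0 \<le> a" by (simp add: a_def)
  have sym: "proj_power scale p ?d (tproj scale ?d (gutt_prod (sym_prod scale xs) (sym_prod scale ys))) \<le>
      a * (prod_list (map q xs) * prod_list (map q ys))" if "length xs = k" "length ys = l" for xs ys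
  proof (cases "k + l \<le> ?d * K")
    case True
    then show ?thesis
      using bracket_comb_proj_power[OF p q pq gutt_prod_sym_prod[of n xs ys]] n that by (simp add: a_def)
  next
    case False
    then show ?thesis
      using bracket_comb_eq_0[OF gutt_prod_sym_prod[of n xs ys]] n that by (simp add: a_def proj_power_zero[OF p])
  qed
  have "proj_power scale p ?d (tproj scale ?d (gutt_prod f g)) \<le> a * proj_power scale q k f * proj_power scale q l g"
  proof (rule proj_power_greatest[OF q g(2)])
    show "0 \<le> a * proj_power scale q k f"
      using a proj_power_nonneg[OF q f(2)] by simp
    fix L assume L: "\<forall>(c, ys)\<in>set L. length ys = l" "g = (\<Sum>(c, ys)\<leftarrow>L. tscale c (tens scale ys))"
    let ?v = "\<Sum>(c, ys)\<leftarrow>L. norm c * prod_list (map q ys)"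
    have "proj_power scale p ?d (tproj scale ?d (gutt_prod f g)) \<le> (a * ?v) * proj_power scale q k f"
    proof (rule proj_power_greatest[OF q f(2)])
      show "0 \<le> a * ?v" using a rep_value_nonneg[OF q] by simp
      fix L' assume L': "\<forall>(c, xs)\<in>set L'. length xs = k" "f = (\<Sum>(c, xs)\<leftarrow>L'. tscale c (tens scale xs))"
      have fs: "f = (\<Sum>(c, xs)\<leftarrow>L'. tscale c (sym_prod scale xs))" and gs: "g = (\<Sum>(c, ys)\<leftarrow>L. tscale c (sym_prod scale ys))"
        using symmetric_rep[where s = scale and L = L'] symmetric_rep[where s = scale and L = L] L L' f g by auto
      have gT: "g \<in> tensor_algebra scale" using g(1) symmetric_algebra_subset by blast
      have T: "gutt_prod (sym_prod scale xs) (sym_prod scale ys) \<in> tensor_algebra scale"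
        "gutt_prod (sym_prod scale xs) g \<in> tensor_algebra scale" for xs ys
        using gutt_prod_symmetric[OF sym_prod_mem_tensor_algebra sym_prod_mem_tensor_algebra]
          gutt_prod_symmetric[OF sym_prod_mem_tensor_algebra gT] symmetric_algebra_subset by blast+
      have "proj_power scale p ?d (tproj scale ?d (gutt_prod (sym_prod scale xs) g)) \<le> (a * ?v) * prod_list (map q xs)"
        if xs: "length xs = k" for xs
      proof -
        have "gutt_prod (sym_prod scale xs) g = (\<Sum>(c, ys)\<leftarrow>L. tscale c (gutt_prod (sym_prod scale xs) (sym_prod scale ys)))"
          unfolding gs by (rule gutt_prod_sum_list(2)[OF sym_prod_mem_tensor_algebra])
        then have "proj_power scale p ?d (tproj scale ?d (gutt_prod (sym_prod scale xs) g)) \<le>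
            (a * prod_list (map q xs)) * ?v"
          using sym[OF xs] L(1) by (simp only:, intro proj_power_sum_list_le[OF p T(1)]) (auto simp: mult.assoc)
        then show ?thesis by (simp add: mult_ac)
      qed
      moreover have "gutt_prod f g = (\<Sum>(c, xs)\<leftarrow>L'. tscale c (gutt_prod (sym_prod scale xs) g))"
        unfolding fs by (rule gutt_prod_sum_list(1)[OF gT])
      ultimately show "proj_power scale p ?d (tproj scale ?d (gutt_prod f g)) \<le> (a * ?v) * (\<Sum>(c, xs)\<leftarrow>L'. norm c * prod_list (map q xs))"
        using L'(1) by (simp only:, intro proj_power_sum_list_le[OF p T(2)]) auto
    qed
    then show "proj_power scale p ?d (tproj scale ?d (gutt_prod f g)) \<le> a * proj_power scale q k f * ?v"
      by (simp add: mult_ac)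
  qed
  then have "fact ?d powr R * proj_power scale p ?d (tproj scale ?d (gutt_prod f g)) \<le>
      fact ?d powr R * (a * proj_power scale q k f * proj_power scale q l g)"
    by (intro mult_left_mono) auto
  also have "\<dots> = gutt_weight K R n k l * (proj_power scale q k f * proj_power scale q l g)"
    using n by (simp add: gutt_weight_def a_def)
  finally show ?thesis .
qed

end

section \<open>The operators C_n and the star product by homogeneous components\<close>

context nilpotent_lie_algebra_normed
begin

text \<open>The guard excludes n > k + l, where truncated subtraction would select degree 0.\<close>

definition gutt_comp :: "nat \<Rightarrow> ('g, 'k) tensor \<Rightarrow> ('g, 'k) tensor \<Rightarrow> nat \<Rightarrow> nat \<Rightarrow> ('g, 'k) tensor" where
  "gutt_comp n x y k l =
    (if n \<le> k + l then tproj scale (k + l - n) (gutt_prod (tproj scale k x) (tproj scale l y)) else 0)"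

lemma symmetric_in_tensor_algebra: "x \<in> symmetric_algebra scale \<Longrightarrow> x \<in> tensor_algebra scale"
  using symmetric_algebra_subset by blast

text \<open>Index sets larger than the supports are allowed so that several arguments can share them
  in the proofs of linearity.\<close>

lemma gutt_C_eq_sum:
  assumes x: "x \<in> symmetric_algebra scale" and y: "y \<in> symmetric_algebra scale"
    and I: "finite I" "{k. tproj scale k x \<noteq> 0} \<subseteq> I" and J: "finite J" "{l. tproj scale l y \<noteq> 0} \<subseteq> J"
  shows "gutt_C scale br n x y = (\<Sum>k\<in>I. \<Sum>l\<in>J. gutt_comp n x y k l)"
proof -
  note T = symmetric_in_tensor_algebra[OF tproj_symmetric[OF x]] symmetric_in_tensor_algebra[OF tproj_symmetric[OF y]]
  let ?S = "{(k, l). tproj scale k x \<noteq> 0 \<and> tproj scale l y \<noteq> 0 \<and> n \<le> k + l}"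
  have "gutt_C scale br n x y = (\<Sum>(k, l)\<in>?S. gutt_comp n x y k l)"
    unfolding gutt_C_def gutt_prod_def[symmetric] by (intro sum.cong refl) (auto simp: gutt_comp_def)
  also have "\<dots> = (\<Sum>(k, l)\<in>I \<times> J. gutt_comp n x y k l)"
    using I J by (intro sum.mono_neutral_left)
      (auto simp: gutt_comp_def gutt_prod_zero T tproj_linear)
  also have "\<dots> = (\<Sum>k\<in>I. \<Sum>l\<in>J. gutt_comp n x y k l)"
    by (rule sum.cartesian_product[symmetric])
  finally show ?thesis .
qed

lemma finite_support_symmetric:
  "x \<in> symmetric_algebra scale \<Longrightarrow> finite {k. tproj scale k x \<noteq> 0}"
  by (intro finite_tproj_support symmetric_in_tensor_algebra)

lemma gutt_C_eq_sum_support: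
  assumes "x \<in> symmetric_algebra scale" "y \<in> symmetric_algebra scale"
  shows "gutt_C scale br n x y = (\<Sum>k | tproj scale k x \<noteq> 0. \<Sum>l | tproj scale l y \<noteq> 0. gutt_comp n x y k l)"
  by (rule gutt_C_eq_sum[OF assms]) (use assms in \<open>auto intro: finite_support_symmetric\<close>)

lemma gutt_comp_symmetric:
  assumes "x \<in> symmetric_algebra scale" "y \<in> symmetric_algebra scale"
  shows "gutt_comp n x y k l \<in> symmetric_algebra scale"
  unfolding gutt_comp_def
  by (auto intro!: tproj_symmetric gutt_prod_symmetric symmetric_algebra_closed assms
      intro: symmetric_in_tensor_algebra)

lemma gutt_C_symmetric:
  assumes "x \<in> symmetric_algebra scale" "y \<in> symmetric_algebra scale"
  shows "gutt_C scale br n x y \<in> symmetric_algebra scale"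
  unfolding gutt_C_eq_sum_support[OF assms]
  by (intro symmetric_algebra_closed gutt_comp_symmetric assms)

lemma gutt_C_add:
  assumes x: "x \<in> symmetric_algebra scale" and x': "x' \<in> symmetric_algebra scale" and y: "y \<in> symmetric_algebra scale"
  shows "gutt_C scale br n (x + x') y = gutt_C scale br n x y + gutt_C scale br n x' y"
    and "gutt_C scale br n y (x + x') = gutt_C scale br n y x + gutt_C scale br n y x'"
proof -
  note T = symmetric_in_tensor_algebra[OF tproj_symmetric]
  define I where "I = {k. tproj scale k x \<noteq> 0} \<union> {k. tproj scale k x' \<noteq> 0}"
  have I: "finite I" "{k. tproj scale k x \<noteq> 0} \<subseteq> I" "{k. tproj scale k x' \<noteq> 0} \<subseteq> I"
    "{k. tproj scale k (x + x') \<noteq> 0} \<subseteq> I"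
    using finite_support_symmetric x x' by (auto simp: I_def tproj_linear)
  note J = finite_support_symmetric[OF y] subset_refl
  note xx = symmetric_algebra_closed(3)[OF x x']
  have comp: "gutt_comp n (x + x') y k l = gutt_comp n x y k l + gutt_comp n x' y k l"
    "gutt_comp n y (x + x') l k = gutt_comp n y x l k + gutt_comp n y x' l k" for k l
    using assms by (auto simp: gutt_comp_def tproj_linear gutt_prod_bilinear(1,2) T)
  show "gutt_C scale br n (x + x') y = gutt_C scale br n x y + gutt_C scale br n x' y"
    unfolding gutt_C_eq_sum[OF x y I(1,2) J] gutt_C_eq_sum[OF x' y I(1,3) J] gutt_C_eq_sum[OF xx y I(1,4) J]
    unfolding sum.distrib[symmetric] by (intro sum.cong refl comp)
  show "gutt_C scale br n y (x + x') = gutt_C scale br n y x + gutt_C scale br n y x'"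
    unfolding gutt_C_eq_sum[OF y x J I(1,2)] gutt_C_eq_sum[OF y x' J I(1,3)] gutt_C_eq_sum[OF y xx J I(1,4)]
    unfolding sum.distrib[symmetric] by (intro sum.cong refl comp)
qed

lemma gutt_C_scale:
  assumes x: "x \<in> symmetric_algebra scale" and y: "y \<in> symmetric_algebra scale"
  shows "gutt_C scale br n (tscale c x) y = tscale c (gutt_C scale br n x y)"
    and "gutt_C scale br n y (tscale c x) = tscale c (gutt_C scale br n y x)"
proof -
  note T = symmetric_in_tensor_algebra[OF tproj_symmetric]
  note I = finite_support_symmetric[OF x] subset_refl
  have I': "{k. tproj scale k (tscale c x) \<noteq> 0} \<subseteq> {k. tproj scale k x \<noteq> 0}"
    by (auto simp: tproj_linear tvs.scale_zero_right)
  note J = finite_support_symmetric[OF y] subset_refl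
  note xx = symmetric_algebra_closed(6)[OF x, of c]
  have comp: "gutt_comp n (tscale c x) y k l = tscale c (gutt_comp n x y k l)"
    "gutt_comp n y (tscale c x) l k = tscale c (gutt_comp n y x l k)" for k l
    using assms by (auto simp: gutt_comp_def tproj_linear gutt_prod_scale T tvs.scale_zero_right)
  show "gutt_C scale br n (tscale c x) y = tscale c (gutt_C scale br n x y)"
    unfolding gutt_C_eq_sum[OF x y I J] gutt_C_eq_sum[OF xx y I(1) I' J]
    unfolding tvs.scale_sum_right by (intro sum.cong refl comp)
  show "gutt_C scale br n y (tscale c x) = tscale c (gutt_C scale br n y x)"
    unfolding gutt_C_eq_sum[OF y x J I] gutt_C_eq_sum[OF y xx J I(1) I']
    unfolding tvs.scale_sum_right by (intro sum.cong refl comp)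
qed

text \<open>Weighted sums over orders make a single C_n, with or without loss in the exponent, and
  the whole star product instances of one estimate. The assumption w is purely numerical, and it is
  required only in degrees that occur, which matters for the constant terms.\<close>

theorem gutt_C_sum_estimate:
  assumes p: "is_seminorm scale p" and q: "is_seminorm scale q"
    and pq: "\<And>xs w. lie_word br xs w \<Longrightarrow> p w \<le> prod_list (map q xs)"
    and x: "x \<in> symmetric_algebra scale" and y: "y \<in> symmetric_algebra scale"
    and \<zeta>: "\<And>n. n \<in> F \<Longrightarrow> 0 \<le> \<zeta> n" and B: "0 \<le> B" and a: "0 < a"
    and w: "\<And>k l. tproj scale k x \<noteq> 0 \<Longrightarrow> tproj scale l y \<noteq> 0 \<Longrightarrow>
      (\<Sum>n\<in>F. \<zeta> n * gutt_weight K R n k l) \<le> B * a ^ (k + l) * (fact k powr S * fact l powr S)"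
  shows "(\<Sum>n\<in>F. \<zeta> n * tensor_seminorm scale p R (gutt_C scale br n x y)) \<le>
    B * tensor_seminorm scale (\<lambda>v. a * q v) S x * tensor_seminorm scale (\<lambda>v. a * q v) S y"
proof -
  let ?I = "{k. tproj scale k x \<noteq> 0}" and ?J = "{l. tproj scale l y \<noteq> 0}"
  let ?q = "\<lambda>k x. proj_power scale q k (tproj scale k x)"
  have aq: "is_seminorm scale (\<lambda>v. a * q v)"
    using a by (intro is_seminorm_mult q) auto
  note xT = symmetric_in_tensor_algebra[OF x] and yT = symmetric_in_tensor_algebra[OF y]
  have qx: "0 \<le> ?q k x" and qy: "0 \<le> ?q k y" for k
    by (intro proj_power_nonneg q tproj_tensor_power xT yT)+
  have comp: "tensor_seminorm scale p R (gutt_comp n x y k l) \<le> gutt_weight K R n k l * (?q k x * ?q l y)" for n k l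
  proof (cases "n \<le> k + l")
    case True
    have "gutt_prod (tproj scale k x) (tproj scale l y) \<in> tensor_algebra scale"
      by (intro symmetric_in_tensor_algebra gutt_prod_symmetric symmetric_in_tensor_algebra[OF tproj_symmetric] x y)
    then have "tensor_seminorm scale p R (gutt_comp n x y k l) = fact (k + l - n) powr R *
        proj_power scale p (k + l - n) (tproj scale (k + l - n) (gutt_prod (tproj scale k x) (tproj scale l y)))"
      using True by (simp add: gutt_comp_def tensor_seminorm_homogeneous[OF p tproj_tensor_power])
    also have "\<dots> \<le> gutt_weight K R n k l * (?q k x * ?q l y)"
      by (intro gutt_prod_estimate[OF p q pq] tproj_symmetric x y tproj_tensor_power xT yT True)
    finally show ?thesis .
  next
    case False
    then show ?thesis
      using gutt_weight_nonneg[of K R n k l] qx[of k] qy[of l]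
      by (simp add: gutt_comp_def tensor_seminorm_def tproj_linear proj_power_zero[OF p])
  qed
  have C: "tensor_seminorm scale p R (gutt_C scale br n x y) \<le> (\<Sum>k\<in>?I. \<Sum>l\<in>?J. gutt_weight K R n k l * (?q k x * ?q l y))" for n
  proof -
    note cT = symmetric_in_tensor_algebra[OF gutt_comp_symmetric[OF x y]]
    have "tensor_seminorm scale p R (gutt_C scale br n x y) \<le> (\<Sum>k\<in>?I. tensor_seminorm scale p R (\<Sum>l\<in>?J. gutt_comp n x y k l))"
      unfolding gutt_C_eq_sum_support[OF x y]
      by (intro tensor_seminorm_sum p tensor_algebra_closed cT)
    also have "\<dots> \<le> (\<Sum>k\<in>?I. \<Sum>l\<in>?J. tensor_seminorm scale p R (gutt_comp n x y k l))"
      by (intro sum_mono tensor_seminorm_sum p cT)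
    also have "\<dots> \<le> (\<Sum>k\<in>?I. \<Sum>l\<in>?J. gutt_weight K R n k l * (?q k x * ?q l y))"
      by (intro sum_mono comp)
    finally show ?thesis .
  qed
  have "(\<Sum>n\<in>F. \<zeta> n * tensor_seminorm scale p R (gutt_C scale br n x y)) \<le>
      (\<Sum>n\<in>F. \<zeta> n * (\<Sum>k\<in>?I. \<Sum>l\<in>?J. gutt_weight K R n k l * (?q k x * ?q l y)))"
    by (intro sum_mono mult_left_mono C \<zeta>)
  also have "\<dots> = (\<Sum>k\<in>?I. \<Sum>l\<in>?J. (\<Sum>n\<in>F. \<zeta> n * gutt_weight K R n k l) * (?q k x * ?q l y))"
  proof -
    have "(\<Sum>n\<in>F. \<zeta> n * (\<Sum>k\<in>?I. \<Sum>l\<in>?J. gutt_weight K R n k l * (?q k x * ?q l y))) =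
        (\<Sum>n\<in>F. \<Sum>k\<in>?I. \<Sum>l\<in>?J. \<zeta> n * gutt_weight K R n k l * (?q k x * ?q l y))"
      by (simp add: sum_distrib_left mult.assoc)
    also have "\<dots> = (\<Sum>k\<in>?I. \<Sum>n\<in>F. \<Sum>l\<in>?J. \<zeta> n * gutt_weight K R n k l * (?q k x * ?q l y))"
      by (rule sum.swap)
    also have "\<dots> = (\<Sum>k\<in>?I. \<Sum>l\<in>?J. \<Sum>n\<in>F. \<zeta> n * gutt_weight K R n k l * (?q k x * ?q l y))"
      by (intro sum.cong refl sum.swap)
    finally show ?thesis
      by (simp only: sum_distrib_right)
  qed
  also have "\<dots> \<le> (\<Sum>k\<in>?I. \<Sum>l\<in>?J. B * a ^ (k + l) * (fact k powr S * fact l powr S) * (?q k x * ?q l y))"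
    using w qx qy by (intro sum_mono mult_right_mono) auto
  also have "\<dots> = B * (\<Sum>k\<in>?I. fact k powr S * (a ^ k * ?q k x)) * (\<Sum>l\<in>?J. fact l powr S * (a ^ l * ?q l y))"
    by (simp add: sum_distrib_left sum_distrib_right power_add mult_ac)
  also have "\<dots> \<le> B * tensor_seminorm scale (\<lambda>v. a * q v) S x * tensor_seminorm scale (\<lambda>v. a * q v) S y"
  proof -
    have *: "(\<Sum>k | tproj scale k t \<noteq> 0. fact k powr S * (a ^ k * ?q k t)) \<le> tensor_seminorm scale (\<lambda>v. a * q v) S t"
      if "t \<in> tensor_algebra scale" for t
      unfolding tensor_seminorm_eq_sum_support[OF aq that]
      by (intro sum_mono mult_left_mono proj_power_mult q a tproj_tensor_power that) simp
    show ?thesis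
      using B a qx qy by (intro mult_mono mult_left_mono * xT yT mult_nonneg_nonneg tensor_seminorm_nonneg[OF aq] sum_nonneg) auto
  qed
  finally show ?thesis .
qed

lemma gutt_C_eventually_zero:
  assumes x: "x \<in> symmetric_algebra scale" and y: "y \<in> symmetric_algebra scale"
  shows "\<exists>N. \<forall>n\<ge>N. gutt_C scale br n x y = 0"
proof -
  obtain a b where a: "\<And>k. tproj scale k x \<noteq> 0 \<Longrightarrow> k < a" and b: "\<And>l. tproj scale l y \<noteq> 0 \<Longrightarrow> l < b"
    using finite_support_symmetric[OF x] finite_support_symmetric[OF y]
    unfolding finite_nat_set_iff_bounded by auto
  have "gutt_C scale br n x y = 0" if "n \<ge> a + b" for n
    unfolding gutt_C_eq_sum_support[OF x y]
    using that by (intro sum.neutral ballI) (auto simp: gutt_comp_def dest!: a b)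
  then show ?thesis by blast
qed

lemma gutt_star_eq_sum:
  assumes "\<And>n. n \<ge> N \<Longrightarrow> gutt_C scale br n x y = 0"
  shows "gutt_star scale br z x y = (\<Sum>n<N. tscale (z ^ n) (gutt_C scale br n x y))"
  unfolding gutt_star_def
proof (rule sum.mono_neutral_left)
  show "{n. gutt_C scale br n x y \<noteq> 0} \<subseteq> {..<N}"
    using assms by (metis (mono_tags) lessThan_iff mem_Collect_eq not_le subsetI)
qed (auto simp: tvs.scale_zero_right)

lemma gutt_star_symmetric:
  assumes "x \<in> symmetric_algebra scale" "y \<in> symmetric_algebra scale"
  shows "gutt_star scale br z x y \<in> symmetric_algebra scale"
  unfolding gutt_star_def by (intro symmetric_algebra_closed gutt_C_symmetric assms)

lemma gutt_star_bilinear: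
  assumes x: "x \<in> symmetric_algebra scale" and x': "x' \<in> symmetric_algebra scale" and y: "y \<in> symmetric_algebra scale"
  shows "gutt_star scale br z (x + x') y = gutt_star scale br z x y + gutt_star scale br z x' y"
    and "gutt_star scale br z y (x + x') = gutt_star scale br z y x + gutt_star scale br z y x'"
    and "gutt_star scale br z (tscale c x) y = tscale c (gutt_star scale br z x y)"
    and "gutt_star scale br z y (tscale c x) = tscale c (gutt_star scale br z y x)"
proof -
  obtain N1 N2 N3 N4 where "\<forall>n\<ge>N1. gutt_C scale br n x y = 0" "\<forall>n\<ge>N2. gutt_C scale br n x' y = 0"
    "\<forall>n\<ge>N3. gutt_C scale br n y x = 0" "\<forall>n\<ge>N4. gutt_C scale br n y x' = 0"
    using gutt_C_eventually_zero x x' y by metis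
  moreover define N where "N = max (max N1 N2) (max N3 N4)"
  ultimately have N: "gutt_C scale br n x y = 0" "gutt_C scale br n x' y = 0"
      "gutt_C scale br n y x = 0" "gutt_C scale br n y x' = 0" if "n \<ge> N" for n
    using that by auto
  note eqs = gutt_C_add[OF x x' y] gutt_C_scale[OF x y, where c = c]
  have N': "gutt_C scale br n (x + x') y = 0" "gutt_C scale br n y (x + x') = 0"
    "gutt_C scale br n (tscale c x) y = 0" "gutt_C scale br n y (tscale c x) = 0" if "n \<ge> N" for n
    using that by (simp_all add: eqs N tvs.scale_zero_right)
  show "gutt_star scale br z (x + x') y = gutt_star scale br z x y + gutt_star scale br z x' y"
    and "gutt_star scale br z y (x + x') = gutt_star scale br z y x + gutt_star scale br z y x'"
    and "gutt_star scale br z (tscale c x) y = tscale c (gutt_star scale br z x y)"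
    and "gutt_star scale br z y (tscale c x) = tscale c (gutt_star scale br z y x)"
    by (simp_all only: gutt_star_eq_sum[OF N(1)] gutt_star_eq_sum[OF N(2)] gutt_star_eq_sum[OF N(3)] gutt_star_eq_sum[OF N(4)]
        gutt_star_eq_sum[OF N'(1)] gutt_star_eq_sum[OF N'(2)] gutt_star_eq_sum[OF N'(3)] gutt_star_eq_sum[OF N'(4)]
        eqs tvs.scale_right_distrib sum.distrib tvs.scale_sum_right tvs.scale_left_commute)
qed

lemma tensor_seminorm_series:
  assumes p: "is_seminorm scale p" and x: "x \<in> symmetric_algebra scale" and y: "y \<in> symmetric_algebra scale"
  shows "tensor_seminorm scale p R (\<Sum>n\<in>F. tscale (z ^ n) (gutt_C scale br n x y)) \<le>
    (\<Sum>n\<in>F. norm z ^ n * tensor_seminorm scale p R (gutt_C scale br n x y))"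
proof -
  note T = symmetric_in_tensor_algebra[OF gutt_C_symmetric[OF x y]]
  have "tensor_seminorm scale p R (\<Sum>n\<in>F. tscale (z ^ n) (gutt_C scale br n x y)) \<le>
      (\<Sum>n\<in>F. tensor_seminorm scale p R (tscale (z ^ n) (gutt_C scale br n x y)))"
    by (intro tensor_seminorm_sum p tensor_algebra_closed T)
  then show ?thesis
    by (simp add: tensor_seminorm_scale[OF p T] norm_power)
qed

end

locale gutt_estimate = nilpotent_lie_algebra_normed +
  fixes p q :: "'b \<Rightarrow> real" and R S :: real
  assumes p: "is_seminorm scale p" and q: "is_seminorm scale q"
    and pq: "\<And>xs w. lie_word br xs w \<Longrightarrow> p w \<le> prod_list (map q xs)"
    and R: "0 \<le> R" "R < 1" and K: "K \<ge> 1"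
    and S: "S = R + (real K - 1) / real K * (1 - R)"
begin

text \<open>The factor 1 belongs to two constant terms at order 0: there C_0(1, 1) = 1, and a
  positive degree that could absorb 1/2 is missing.\<close>

lemma gutt_C_estimate:
  assumes x: "x \<in> symmetric_algebra scale" and y: "y \<in> symmetric_algebra scale"
  shows "tensor_seminorm scale p R (gutt_C scale br n x y) \<le>
    (if n = 0 \<and> tproj scale 0 x \<noteq> 0 \<and> tproj scale 0 y \<noteq> 0 then 1 else 1 / (2 * 8 ^ n)) *
      tensor_seminorm scale (\<lambda>v. 32 * exp 1 * q v) S x * tensor_seminorm scale (\<lambda>v. 32 * exp 1 * q v) S y"
proof -
  let ?B = "if n = 0 \<and> tproj scale 0 x \<noteq> 0 \<and> tproj scale 0 y \<noteq> 0 then 1 else 1 / (2 * 8 ^ n) :: real"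
  have "(\<Sum>n\<in>{n}. 1 * gutt_weight K R n k l) \<le> ?B * (32 * exp 1) ^ (k + l) * (fact k powr S * fact l powr S)"
    if kl: "tproj scale k x \<noteq> 0" "tproj scale l y \<noteq> 0" for k l
  proof -
    let ?\<kappa> = "if k + l = 0 then if n = 0 then 1 else 0 else if n < k + l then 1 / (2 * 8 ^ n) else 0 :: real"
    have "?\<kappa> \<le> ?B" using kl by auto
    then have "?\<kappa> * (32 * exp 1) ^ (k + l) * (fact k powr S * fact l powr S) \<le> ?B * (32 * exp 1) ^ (k + l) * (fact k powr S * fact l powr S)"
      by (intro mult_right_mono) auto
    then have "gutt_weight K R n k l \<le> ?B * (32 * exp 1) ^ (k + l) * (fact k powr S * fact l powr S)"
      by (rule order_trans[OF gutt_weight_bound[OF R K S]])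
    then show ?thesis
      by (simp only: sum.insert sum.empty finite.emptyI empty_iff not_False_eq_True add_0_right mult_1)
  qed
  then have "(\<Sum>n\<in>{n}. 1 * tensor_seminorm scale p R (gutt_C scale br n x y)) \<le> ?B *
      tensor_seminorm scale (\<lambda>v. 32 * exp 1 * q v) S x * tensor_seminorm scale (\<lambda>v. 32 * exp 1 * q v) S y"
    by (intro gutt_C_sum_estimate[OF p q pq x y]) auto
  then show ?thesis by simp
qed

lemma gutt_C_estimate_fixed_order:
  assumes x: "x \<in> symmetric_algebra scale" and y: "y \<in> symmetric_algebra scale"
  shows "tensor_seminorm scale p R (gutt_C scale br n x y) \<le> fact n powr (1 - R) *
      tensor_seminorm scale (\<lambda>v. 4 * exp 1 * q v) R x * tensor_seminorm scale (\<lambda>v. 4 * exp 1 * q v) R y"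
proof -
  have "(\<Sum>n\<in>{n}. 1 * tensor_seminorm scale p R (gutt_C scale br n x y)) \<le> fact n powr (1 - R) *
      tensor_seminorm scale (\<lambda>v. 4 * exp 1 * q v) R x * tensor_seminorm scale (\<lambda>v. 4 * exp 1 * q v) R y"
    using gutt_weight_bound_fixed_order[OF R] by (intro gutt_C_sum_estimate[OF p q pq x y]) auto
  then show ?thesis by simp
qed

lemma gutt_series_estimate:
  assumes x: "x \<in> symmetric_algebra scale" and y: "y \<in> symmetric_algebra scale" and z: "0 \<le> z" and F: "finite F"
  shows "(\<Sum>n\<in>F. z ^ n * tensor_seminorm scale p R (gutt_C scale br n x y)) \<le>
      tensor_seminorm scale (\<lambda>v. 32 * exp 1 * (z + 1) * q v) S x * tensor_seminorm scale (\<lambda>v. 32 * exp 1 * (z + 1) * q v) S y"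
proof -
  have "(\<Sum>n\<in>F. z ^ n * tensor_seminorm scale p R (gutt_C scale br n x y)) \<le> 1 *
      tensor_seminorm scale (\<lambda>v. 32 * exp 1 * (z + 1) * q v) S x * tensor_seminorm scale (\<lambda>v. 32 * exp 1 * (z + 1) * q v) S y"
    using gutt_weight_sum_bound[OF R K S z F] z by (intro gutt_C_sum_estimate[OF p q pq x y]) auto
  then show ?thesis by simp
qed

lemma gutt_star_estimate:
  assumes x: "x \<in> symmetric_algebra scale" and y: "y \<in> symmetric_algebra scale"
  shows "tensor_seminorm scale p R (gutt_star scale br z x y) \<le>
      tensor_seminorm scale (\<lambda>v. 32 * exp 1 * (norm z + 1) * q v) S x *
      tensor_seminorm scale (\<lambda>v. 32 * exp 1 * (norm z + 1) * q v) S y"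
proof -
  obtain N where "\<forall>n\<ge>N. gutt_C scale br n x y = 0"
    using gutt_C_eventually_zero[OF x y] by blast
  then have "gutt_star scale br z x y = (\<Sum>n<N. tscale (z ^ n) (gutt_C scale br n x y))"
    by (intro gutt_star_eq_sum) auto
  then show ?thesis
    using tensor_seminorm_series[OF p x y, of R z "{..<N}"] gutt_series_estimate[OF x y, of "norm z" "{..<N}"] by simp
qed

text \<open>The surplus factor \<open>2\<^sup>n\<close> gives a geometric rate of convergence.\<close>

lemma gutt_star_remainder:
  assumes x: "x \<in> symmetric_algebra scale" and y: "y \<in> symmetric_algebra scale"
  shows "norm z ^ m * tensor_seminorm scale p R (gutt_C scale br m x y) \<le> (1 / 2) ^ m *
      (tensor_seminorm scale (\<lambda>v. 32 * exp 1 * (2 * norm z + 1) * q v) S x *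
       tensor_seminorm scale (\<lambda>v. 32 * exp 1 * (2 * norm z + 1) * q v) S y)"
    and "tensor_seminorm scale p R (gutt_star scale br z x y - (\<Sum>n<m. tscale (z ^ n) (gutt_C scale br n x y))) \<le> (1 / 2) ^ m *
      (tensor_seminorm scale (\<lambda>v. 32 * exp 1 * (2 * norm z + 1) * q v) S x *
       tensor_seminorm scale (\<lambda>v. 32 * exp 1 * (2 * norm z + 1) * q v) S y)"
proof -
  let ?A = "tensor_seminorm scale (\<lambda>v. 32 * exp 1 * (2 * norm z + 1) * q v) S x *
       tensor_seminorm scale (\<lambda>v. 32 * exp 1 * (2 * norm z + 1) * q v) S y"
  let ?t = "\<lambda>n. tensor_seminorm scale p R (gutt_C scale br n x y)"
  have t: "0 \<le> ?t n" for n
    by (intro tensor_seminorm_nonneg p symmetric_in_tensor_algebra gutt_C_symmetric x y)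
  have sum: "(\<Sum>n\<in>F. norm z ^ n * ?t n) \<le> (1 / 2) ^ m * ?A" if F: "finite F" "\<And>n. n \<in> F \<Longrightarrow> m \<le> n" for F
  proof -
    have "(\<Sum>n\<in>F. norm z ^ n * ?t n) \<le> (\<Sum>n\<in>F. (1 / 2) ^ m * ((2 * norm z) ^ n * ?t n))"
    proof (rule sum_mono)
      fix n assume "n \<in> F"
      then have "(1 / 2) ^ n \<le> (1 / 2 :: real) ^ m" using F by (intro power_decreasing) auto
      then have "(1 / 2) ^ n * ((2 * norm z) ^ n * ?t n) \<le> (1 / 2) ^ m * ((2 * norm z) ^ n * ?t n)"
        using t by (intro mult_right_mono) auto
      moreover have "(1 / 2) ^ n * ((2 * norm z) ^ n * ?t n) = norm z ^ n * ?t n"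
        by (simp add: power_mult_distrib power_one_over)
      ultimately show "norm z ^ n * ?t n \<le> (1 / 2) ^ m * ((2 * norm z) ^ n * ?t n)"
        by (simp only:)
    qed
    also have "\<dots> = (1 / 2) ^ m * (\<Sum>n\<in>F. (2 * norm z) ^ n * ?t n)"
      by (simp add: sum_distrib_left)
    also have "\<dots> \<le> (1 / 2) ^ m * ?A"
      using gutt_series_estimate[OF x y _ F(1), of "2 * norm z"] by (intro mult_left_mono) auto
    finally show ?thesis .
  qed
  show "norm z ^ m * ?t m \<le> (1 / 2) ^ m * ?A"
    using sum[of "{m}"] by simp
  obtain N where "\<forall>n\<ge>N. gutt_C scale br n x y = 0"
    using gutt_C_eventually_zero[OF x y] by blast
  then have "gutt_star scale br z x y = (\<Sum>n<m + N. tscale (z ^ n) (gutt_C scale br n x y))"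
    by (intro gutt_star_eq_sum) auto
  moreover have "(\<Sum>n<m + N. tscale (z ^ n) (gutt_C scale br n x y)) =
      (\<Sum>n<m. tscale (z ^ n) (gutt_C scale br n x y)) + (\<Sum>n=m..<m + N. tscale (z ^ n) (gutt_C scale br n x y))"
    by (simp add: lessThan_atLeast0 sum.atLeastLessThan_concat)
  ultimately have "gutt_star scale br z x y - (\<Sum>n<m. tscale (z ^ n) (gutt_C scale br n x y)) =
      (\<Sum>n=m..<m + N. tscale (z ^ n) (gutt_C scale br n x y))"
    by simp
  then show "tensor_seminorm scale p R (gutt_star scale br z x y - (\<Sum>n<m. tscale (z ^ n) (gutt_C scale br n x y))) \<le> (1 / 2) ^ m * ?A"
    using tensor_seminorm_series[OF p x y, of R z "{m..<m + N}"] sum[of "{m..<m + N}"] by simp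
qed

end

section \<open>Existence of asymptotic estimates\<close>

context locally_convex_space
begin

lemma continuous_scale_affine:
  "continuous_on UNIV (\<lambda>y. scale c (y - x))" "continuous_on UNIV (\<lambda>c. scale c x)"
proof -
  have "continuous_on UNIV (\<lambda>y. (c, y - x))" "continuous_on UNIV (\<lambda>c. (c, x))"
    by (intro continuous_intros)+
  from this[THEN continuous_on_compose2[OF continuous_scale]]
  show "continuous_on UNIV (\<lambda>y. scale c (y - x))" "continuous_on UNIV (\<lambda>c. scale c x)"
    by auto
qed

lemma absorbing:
  assumes "open U" "0 \<in> U"
  shows "\<exists>a>0. scale (of_real a) x \<in> U"
proof -
  have "open ((\<lambda>c. scale c x) -` U)"
    using continuous_scale_affine(2) assms(1) by (simp add: continuous_on_open_vimage)
  moreover have "0 \<in> (\<lambda>c. scale c x) -` U" using assms(2) by simp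
  ultimately obtain d where "d > 0" "ball 0 d \<subseteq> (\<lambda>c. scale c x) -` U"
    using open_contains_ball by blast
  moreover have "of_real (d / 2) \<in> ball (0 :: 'k) d" using \<open>d > 0\<close> by (simp add: norm_divide)
  ultimately have "d / 2 > 0 \<and> scale (of_real (d / 2)) x \<in> U"
    by (meson half_gt_zero subsetD vimageD)
  then show ?thesis by blast
qed

sublocale normed_field_vector_space scale ..

text \<open>Equality in the scaling rule follows from the inequality for c and for its
  inverse.\<close>

lemma is_seminormI:
  assumes "\<And>x y. r (x + y) \<le> r x + r y" "\<And>c x. r (scale c x) \<le> norm c * r x" "\<And>x. 0 \<le> r x"
  shows "is_seminorm scale r"
  unfolding is_seminorm_def
proof (intro conjI allI)
  fix c x
  show "r (scale c x) = norm c * r x"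
  proof (cases "c = 0")
    case True
    then show ?thesis using assms(2)[of 0 x] assms(3)[of 0] by simp
  next
    case False
    then have "r x \<le> norm (inverse c) * r (scale c x)"
      using assms(2)[of "inverse c" "scale c x"] by simp
    then have "norm c * r x \<le> r (scale c x)"
      using False by (simp add: norm_divide norm_inverse field_simps)
    then show ?thesis using assms(2)[of c x] by simp
  qed
qed (rule assms(1))

lemma continuous_seminormI:
  assumes r: "is_seminorm scale r" and U: "open U" "0 \<in> U" and C: "\<And>x. x \<in> U \<Longrightarrow> r x \<le> C"
  shows "continuous_seminorm scale r"
proof -
  have "(r \<longlongrightarrow> r x) (at x)" for x
    unfolding tendsto_iff
  proof (intro allI impI)
    fix e :: real assume e: "e > 0"
    \<comment> \<open>If a (y - x) lies in U, then r (y - x) \<le> C / a < e; the added 1 keeps a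
      positive.\<close>
    define a where "a = (\<bar>C\<bar> + 1) / e"
    have a: "a > 0" using e by (simp add: a_def)
    have "open ((\<lambda>y. scale (of_real a) (y - x)) -` U)"
      using continuous_scale_affine(1) U(1) by (simp add: continuous_on_open_vimage)
    moreover have "x \<in> (\<lambda>y. scale (of_real a) (y - x)) -` U" using U(2) by simp
    moreover have "dist (r y) (r x) < e" if "y \<in> (\<lambda>y. scale (of_real a) (y - x)) -` U" for y
    proof -
      have "a * r (y - x) \<le> C"
        using C[of "scale (of_real a) (y - x)"] that seminorm(2)[OF r, of "of_real a" "y - x"] a by simp
      then have "r (y - x) \<le> C / a" using a by (simp add: field_simps)
      also have "\<dots> < e"
      proof -
        have "C * e \<le> \<bar>C\<bar> * e" using e by (intro mult_right_mono) auto
        then have "C * e < \<bar>C\<bar> * e + e" using e by linarith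
        also have "\<dots> = e * (\<bar>C\<bar> + 1)" by (simp add: algebra_simps)
        finally have "C * e / (\<bar>C\<bar> + 1) < e" by (subst pos_divide_less_eq) auto
        then show ?thesis by (simp add: a_def)
      qed
      finally have "r (y - x) < e" .
      moreover have "r (x - y) = r (y - x)"
        using seminorm(4)[OF r, of "x - y"] by simp
      ultimately show ?thesis
        using seminorm(6)[OF r, of x y] seminorm(6)[OF r, of y x] by (simp add: dist_real_def)
    qed
    ultimately show "\<forall>\<^sub>F y in at x. dist (r y) (r x) < e"
      unfolding eventually_at_topological by blast
  qed
  then show ?thesis
    using r by (simp add: continuous_seminorm_def is_seminorm_def continuous_on_def)
qed

lemma continuous_seminorm_add:
  assumes "continuous_seminorm scale p" "continuous_seminorm scale q"
  shows "continuous_seminorm scale (\<lambda>x. p x + q x)"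
proof -
  have "p (x + y) + q (x + y) \<le> (p x + q x) + (p y + q y)" for x y
    using assms add_mono[of "p (x + y)" "p x + p y" "q (x + y)" "q x + q y"]
    by (simp add: continuous_seminorm_def algebra_simps)
  then show ?thesis
    using assms unfolding continuous_seminorm_def by (auto intro!: continuous_intros simp: distrib_left)
qed

lemma continuous_seminorm_mult:
  assumes "continuous_seminorm scale p" "0 \<le> c"
  shows "continuous_seminorm scale (\<lambda>x. c * p x)"
  using assms is_seminorm_mult[OF continuous_seminorm_is_seminorm[OF assms(1)] assms(2)]
  unfolding continuous_seminorm_def is_seminorm_def by (auto intro!: continuous_intros)

end

context locally_convex_lie_algebra
begin

lemma lie_algebra: "lie_algebra scale br"
  by unfold_locales (simp_all add: br_add_left br_add_right br_scale_left br_scale_right br_self jacobi)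

text \<open>The supremum of \<open>p (br x y)\<close> over \<open>y\<close> in a neighbourhood of \<open>0\<close> is a continuous seminorm in \<open>x\<close>.\<close>

lemma bracket_estimate:
  assumes p: "continuous_seminorm scale p"
  shows "\<exists>q. continuous_seminorm scale q \<and> (\<forall>x y. p (br x y) \<le> q x * q y)"
proof -
  interpret L: lie_algebra scale br by (rule lie_algebra)
  note ps = continuous_seminorm_is_seminorm[OF p]
  have "continuous_on UNIV (\<lambda>z. p (case z of (x, y) \<Rightarrow> br x y))"
    using p continuous_br by (auto simp: continuous_seminorm_def intro: continuous_on_compose2)
  then have "open ((\<lambda>z. p (case z of (x, y) \<Rightarrow> br x y)) -` {..<1})"
    by (simp add: continuous_on_open_vimage)
  moreover have "(0, 0) \<in> (\<lambda>z. p (case z of (x, y) \<Rightarrow> br x y)) -` {..<1}"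
    using seminorm(3)[OF ps] by simp
  ultimately obtain V W where VW: "open V" "open W" "0 \<in> V" "0 \<in> W"
    "V \<times> W \<subseteq> (\<lambda>z. p (case z of (x, y) \<Rightarrow> br x y)) -` {..<1}"
    by (rule open_prod_elim) auto
  then have lt: "p (br x y) < 1" if "x \<in> V" "y \<in> W" for x y using that by auto
  define q1 where "q1 x = (SUP y\<in>W. p (br x y))" for x
  have bdd1: "bdd_above ((\<lambda>y. p (br x y)) ` W)" for x
  proof -
    obtain a where a: "a > 0" "scale (of_real a) x \<in> V"
      using absorbing[OF VW(1,3)] by blast
    have "p (br x y) \<le> 1 / a" if "y \<in> W" for y
      using lt[OF a(2) that] a(1) by (simp add: br_scale_left seminorm(2)[OF ps] field_simps)
    then show ?thesis by (intro bdd_aboveI2)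
  qed
  have le1: "p (br x y) \<le> q1 x" if "y \<in> W" for x y
    unfolding q1_def by (rule cSUP_upper[OF that bdd1])
  have least1: "q1 x \<le> C" if "\<And>y. y \<in> W \<Longrightarrow> p (br x y) \<le> C" for x C
    unfolding q1_def using VW(4) that by (intro cSUP_least) auto
  have s1: "is_seminorm scale q1"
  proof (rule is_seminormI)
    show "q1 (x + y) \<le> q1 x + q1 y" for x y
    proof (rule least1)
      fix z assume "z \<in> W"
      then show "p (br (x + y) z) \<le> q1 x + q1 y"
        using seminorm(1)[OF ps, of "br x z" "br y z"] le1[of z x] le1[of z y] by (simp add: br_add_left)
    qed
    show "q1 (scale c x) \<le> norm c * q1 x" for c x
      using le1 by (intro least1) (simp add: br_scale_left seminorm(2)[OF ps] mult_left_mono)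
    show "0 \<le> q1 x" for x
      using le1[OF VW(4), of x] seminorm(5)[OF ps, of "br x 0"] by linarith
  qed
  have c1: "continuous_seminorm scale q1"
    by (rule continuous_seminormI[OF s1 VW(1,3), of 1]) (intro least1 less_imp_le lt)
  \<comment> \<open>The second supremum runs over the unit ball of q1 instead of V: then x divided
    by q1 x is an admissible argument, which yields the product bound for all x.\<close>
  define B where "B = {x. q1 x \<le> 1}"
  have B0: "0 \<in> B" using seminorm(3)[OF s1] by (simp add: B_def)
  define q2 where "q2 y = (SUP x\<in>B. p (br x y))" for y
  have bdd2: "bdd_above ((\<lambda>x. p (br x y)) ` B)" for y
  proof -
    obtain a where a: "a > 0" "scale (of_real a) y \<in> W"
      using absorbing[OF VW(2,4)] by blast
    have "p (br x y) \<le> 1 / a" if "x \<in> B" for x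
      using le1[OF a(2), of x] that a(1) by (simp add: B_def br_scale_right seminorm(2)[OF ps] field_simps)
    then show ?thesis by (intro bdd_aboveI2)
  qed
  have le2: "p (br x y) \<le> q2 y" if "x \<in> B" for x y
    unfolding q2_def by (rule cSUP_upper[OF that bdd2])
  have least2: "q2 y \<le> C" if "\<And>x. x \<in> B \<Longrightarrow> p (br x y) \<le> C" for y C
    unfolding q2_def using B0 that by (intro cSUP_least) auto
  have s2: "is_seminorm scale q2"
  proof (rule is_seminormI)
    show "q2 (x + y) \<le> q2 x + q2 y" for x y
    proof (rule least2)
      fix z assume "z \<in> B"
      then show "p (br z (x + y)) \<le> q2 x + q2 y"
        using seminorm(1)[OF ps, of "br z x" "br z y"] le2[of z x] le2[of z y] by (simp add: br_add_right)
    qed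
    show "q2 (scale c x) \<le> norm c * q2 x" for c x
      using le2 by (intro least2) (simp add: br_scale_right seminorm(2)[OF ps] mult_left_mono)
    show "0 \<le> q2 x" for x
      using le2[OF B0, of x] seminorm(5)[OF ps, of "br 0 x"] by linarith
  qed
  have c2: "continuous_seminorm scale q2"
  proof (rule continuous_seminormI[OF s2 VW(2,4), of 1], rule least2)
    fix x y assume "y \<in> W" "x \<in> B"
    then show "p (br x y) \<le> 1" using le1[of y x] by (simp add: B_def)
  qed
  have est: "p (br x y) \<le> q1 x * q2 y" for x y
  proof -
    \<comment> \<open>Since q1 x may be 0, x is divided by q1 x + e and e tends to 0
      afterwards.\<close>
    have "p (br x y) \<le> (q1 x + e) * q2 y" if "e > 0" for e
    proof -
      define t where "t = q1 x + e"
      have t: "t > 0" "q1 x \<le> t" using that seminorm(5)[OF s1, of x] by (auto simp: t_def)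
      have n: "norm (of_real (inverse t) :: 'k) = inverse t"
        using t(1) by (simp only: norm_of_real) simp
      have "scale (of_real (inverse t)) x \<in> B"
        using t by (simp only: B_def mem_Collect_eq seminorm(2)[OF s1] n) (simp add: field_simps)
      from le2[OF this, of y] have "inverse t * p (br x y) \<le> q2 y"
        by (simp only: br_scale_left seminorm(2)[OF ps] n)
      then show ?thesis using t(1) by (simp add: t_def field_simps)
    qed
    moreover have "((\<lambda>e. (q1 x + e) * q2 y) \<longlongrightarrow> (q1 x + 0) * q2 y) (at_right 0)"
      by (intro tendsto_intros)
    ultimately have "p (br x y) \<le> (q1 x + 0) * q2 y"
      by (intro tendsto_lowerbound[where F = "at_right 0"]) (auto simp: eventually_at_right_less eventually_at_filter)
    then show ?thesis by simp
  qed
  have "p (br x y) \<le> (q1 x + q2 x) * (q1 y + q2 y)" for x y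
  proof -
    have "q1 x * q2 y \<le> (q1 x + q2 x) * (q1 y + q2 y)"
      by (intro mult_mono) (auto simp: seminorm(5)[OF s1] seminorm(5)[OF s2])
    then show ?thesis using est[of x y] by linarith
  qed
  then show ?thesis
    using continuous_seminorm_add[OF c1 c2] by blast
qed

lemma lie_word_nonempty: "lie_word br xs w \<Longrightarrow> xs \<noteq> []"
  by (induction rule: lie_word.induct) auto

text \<open>The outermost bracket splits a word into two strictly shorter ones, to which the
  induction hypothesis for the seminorm from \<open>bracket_estimate\<close> applies. Adding p
  covers words of one letter.\<close>

lemma asymptotic_estimate_short_words:
  assumes "continuous_seminorm scale p"
  shows "\<exists>q. continuous_seminorm scale q \<and> (\<forall>xs w. lie_word br xs w \<longrightarrow> length xs \<le> n \<longrightarrow> p w \<le> prod_list (map q xs))"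
  using assms
proof (induction n arbitrary: p)
  case 0
  then show ?case using lie_word_nonempty by auto
next
  case (Suc n)
  obtain q1 where q1: "continuous_seminorm scale q1" "\<And>x y. p (br x y) \<le> q1 x * q1 y"
    using bracket_estimate[OF Suc.prems] by blast
  obtain q2 where q2: "continuous_seminorm scale q2"
    "\<And>xs w. lie_word br xs w \<Longrightarrow> length xs \<le> n \<Longrightarrow> q1 w \<le> prod_list (map q2 xs)"
    using Suc.IH[OF q1(1)] by blast
  note ps = continuous_seminorm_is_seminorm[OF Suc.prems] and q1s = continuous_seminorm_is_seminorm[OF q1(1)]
    and q2s = continuous_seminorm_is_seminorm[OF q2(1)]
  let ?q = "\<lambda>x. p x + q2 x"
  have q: "continuous_seminorm scale ?q" by (rule continuous_seminorm_add[OF Suc.prems q2(1)])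
  have mono: "prod_list (map q2 xs) \<le> prod_list (map ?q xs)" for xs
    by (induction xs) (auto intro!: mult_mono prod_list_seminorm_nonneg[OF q2s] simp: seminorm(5)[OF ps] seminorm(5)[OF q2s])
  have "p w \<le> prod_list (map ?q xs)" if "lie_word br xs w" "length xs \<le> Suc n" for xs w
    using that(1)
  proof cases
    case letter
    then show ?thesis by (simp add: seminorm(5)[OF q2s])
  next
    case (bracket ys u zs v)
    have "ys \<noteq> []" "zs \<noteq> []"
      using bracket(3,4) lie_word_nonempty by blast+
    then have "length ys \<le> n" "length zs \<le> n"
      using bracket(1) that(2) by (auto simp: Suc_le_eq neq_Nil_conv)
    then have "q1 u * q1 v \<le> prod_list (map q2 ys) * prod_list (map q2 zs)"
      using bracket(3,4) by (intro mult_mono q2 prod_list_seminorm_nonneg[OF q2s]) (auto simp: seminorm(5)[OF q1s])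
    also have "\<dots> = prod_list (map q2 xs)" using bracket(1) by simp
    finally show ?thesis
      using q1(2)[of u v] mono[of xs] bracket(2) by simp
  qed
  then show ?case using q by blast
qed

lemma nilpotent_lie_algebra_normed:
  assumes "ad_vanish br M"
  shows "nilpotent_lie_algebra_normed scale br M"
proof -
  interpret L: lie_algebra scale br by (rule lie_algebra)
  have "foldr (\<circ>) (map br xs) id = foldr br xs" for xs
    by (induction xs) (auto simp: fun_eq_iff)
  then have M: "foldr br xs u = 0" if "length xs = M" for xs u
    using assms that unfolding ad_vanish_def by metis
  have zero: "foldr br ys 0 = 0" for ys
    by (induction ys) auto
  have "foldr br xs u = 0" if "M \<le> length xs" for xs u
  proof -
    have "foldr br xs u = foldr br (take (length xs - M) xs) (foldr br (drop (length xs - M) xs) u)"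
      by (metis append_take_drop_id foldr_append o_apply)
    also have "\<dots> = 0" using M[of "drop (length xs - M) xs" u] that zero by simp
    finally show ?thesis .
  qed
  then show ?thesis
    by unfold_locales auto
qed

text \<open>Words of more than M letters vanish, so the estimate for words of bounded length is
  enough.\<close>

theorem asymptotic_estimate_exists:
  assumes "ad_vanish br M" "continuous_seminorm scale p"
  shows "\<exists>q. asymptotic_estimate scale br p q"
proof -
  interpret N: nilpotent_lie_algebra_normed scale br M
    by (rule nilpotent_lie_algebra_normed[OF assms(1)])
  obtain q where q: "continuous_seminorm scale q"
    "\<And>xs w. lie_word br xs w \<Longrightarrow> length xs \<le> M \<Longrightarrow> p w \<le> prod_list (map q xs)"
    using asymptotic_estimate_short_words[OF assms(2)] by blast
  have "p w \<le> prod_list (map q xs)" if "lie_word br xs w" for xs w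
  proof (cases "length xs \<le> M")
    case False
    then have "w = 0" using N.lie_word_eq_0[OF that] by simp
    then show ?thesis
      using seminorm(3)[OF continuous_seminorm_is_seminorm[OF assms(2)]]
        prod_list_seminorm_nonneg[OF continuous_seminorm_is_seminorm[OF q(1)], of xs] by simp
  qed (use q(2) that in blast)
  then show ?thesis
    using q(1) by (auto simp: asymptotic_estimate_def)
qed

end

section \<open>Seminorm topologies and bilinear maps\<close>

text \<open>The seminorms are controlled on V only, because their values at functions that are not
  tensors carry no meaning. Directedness replaces finite maxima, so that the balls of single
  seminorms form a base.\<close>

locale seminormed_subspace = vector_space sc
  for sc :: "'k::real_normed_field \<Rightarrow> 'v::ab_group_add \<Rightarrow> 'v" +
  fixes V :: "'v set" and P :: "('v \<Rightarrow> real) set"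
  assumes subspace_V: "subspace V" and P_nonempty: "P \<noteq> {}"
    and P_add: "\<lbrakk>\<rho> \<in> P; x \<in> V; y \<in> V\<rbrakk> \<Longrightarrow> \<rho> (x + y) \<le> \<rho> x + \<rho> y"
    and P_scale: "\<lbrakk>\<rho> \<in> P; x \<in> V\<rbrakk> \<Longrightarrow> \<rho> (sc c x) = norm c * \<rho> x"
    and P_directed: "\<lbrakk>\<rho> \<in> P; \<sigma> \<in> P\<rbrakk> \<Longrightarrow> \<exists>\<tau>\<in>P. \<forall>x\<in>V. \<rho> x \<le> \<tau> x \<and> \<sigma> x \<le> \<tau> x"
begin

lemma V_closed:
  "0 \<in> V" "x \<in> V \<Longrightarrow> y \<in> V \<Longrightarrow> x + y \<in> V" "x \<in> V \<Longrightarrow> y \<in> V \<Longrightarrow> x - y \<in> V" "x \<in> V \<Longrightarrow> - x \<in> V"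
  "x \<in> V \<Longrightarrow> sc c x \<in> V" "(\<And>i. i \<in> I \<Longrightarrow> f i \<in> V) \<Longrightarrow> sum f I \<in> V"
  using subspace_V by (auto intro: subspace_0 subspace_add subspace_diff subspace_neg subspace_scale subspace_sum)

lemma P_simps:
  assumes "\<rho> \<in> P"
  shows "\<rho> 0 = 0" "x \<in> V \<Longrightarrow> \<rho> (- x) = \<rho> x" "x \<in> V \<Longrightarrow> 0 \<le> \<rho> x"
    "x \<in> V \<Longrightarrow> y \<in> V \<Longrightarrow> \<rho> x \<le> \<rho> (x - y) + \<rho> y"
proof -
  show z: "\<rho> 0 = 0"
    using P_scale[OF assms V_closed(1), of 0] by simp
  show m: "\<rho> (- x) = \<rho> x" if "x \<in> V" for x
    using P_scale[OF assms that, of "-1"] by simp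
  show "0 \<le> \<rho> x" if "x \<in> V" for x
    using P_add[OF assms that V_closed(4)[OF that]] m[OF that] z by simp
  show "\<rho> x \<le> \<rho> (x - y) + \<rho> y" if "x \<in> V" "y \<in> V" for x y
    using P_add[OF assms V_closed(3)[OF that] that(2)] by simp
qed

abbreviation pball :: "('v \<Rightarrow> real) \<Rightarrow> 'v \<Rightarrow> real \<Rightarrow> 'v set" where
  "pball \<rho> x e \<equiv> {y \<in> V. \<rho> (y - x) < e}"

lemma openin_seminorm_topology:
  "openin (seminorm_topology V P) U \<longleftrightarrow> U \<subseteq> V \<and> (\<forall>x\<in>U. \<exists>\<rho>\<in>P. \<exists>e>0. pball \<rho> x e \<subseteq> U)"
proof
  assume "openin (seminorm_topology V P) U"
  then have "generate_topology_on {pball \<rho> x e | \<rho> x e. \<rho> \<in> P \<and> x \<in> V \<and> 0 < e} U"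
    unfolding seminorm_topology_def by (rule openin_topology_generated_by)
  then show "U \<subseteq> V \<and> (\<forall>x\<in>U. \<exists>\<rho>\<in>P. \<exists>e>0. pball \<rho> x e \<subseteq> U)"
  proof induction
    case (Int a b)
    have "\<exists>\<rho>\<in>P. \<exists>e>0. pball \<rho> x e \<subseteq> a \<inter> b" if x: "x \<in> a \<inter> b" for x
    proof -
      obtain \<rho> d \<sigma> e where *: "\<rho> \<in> P" "\<sigma> \<in> P" "d > 0" "e > 0" "pball \<rho> x d \<subseteq> a" "pball \<sigma> x e \<subseteq> b"
        using Int x by blast
      obtain \<tau> where \<tau>: "\<tau> \<in> P" "\<And>x. x \<in> V \<Longrightarrow> \<rho> x \<le> \<tau> x \<and> \<sigma> x \<le> \<tau> x"
        using P_directed[OF *(1,2)] by blast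
      have "x \<in> V" using Int x by blast
      have "y \<in> pball \<rho> x d \<inter> pball \<sigma> x e" if "y \<in> pball \<tau> x (min d e)" for y
        using that \<tau>(2)[of "y - x"] V_closed(3)[of y x] \<open>x \<in> V\<close> by auto
      then have "pball \<tau> x (min d e) \<subseteq> a \<inter> b" using *(5,6) by blast
      moreover have "min d e > 0" using *(3,4) by simp
      ultimately show ?thesis using \<tau>(1) by blast
    qed
    moreover have "a \<inter> b \<subseteq> V" using Int by blast
    ultimately show ?case by blast
  next
    case (UN K)
    show ?case
    proof (intro conjI ballI)
      show "\<Union>K \<subseteq> V" using UN by blast
      fix x assume "x \<in> \<Union>K"
      then obtain k where k: "k \<in> K" "x \<in> k" by blast
      then obtain \<rho> e where "\<rho> \<in> P" "e > 0" "pball \<rho> x e \<subseteq> k" using UN by blast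
      then show "\<exists>\<rho>\<in>P. \<exists>e>0. pball \<rho> x e \<subseteq> \<Union>K" using k(1) by blast
    qed
  next
    case (Basis s)
    then obtain \<rho> x0 e where s: "s = pball \<rho> x0 e" "\<rho> \<in> P" "x0 \<in> V" by blast
    have "pball \<rho> x (e - \<rho> (x - x0)) \<subseteq> s" if x: "x \<in> s" for x
    proof
      fix y assume y: "y \<in> pball \<rho> x (e - \<rho> (x - x0))"
      then have "\<rho> (y - x0) \<le> \<rho> (y - x) + \<rho> (x - x0)"
        using P_add[OF s(2), of "y - x" "x - x0"] x s V_closed(3) by auto
      then show "y \<in> s" using y s by auto
    qed
    moreover have "e - \<rho> (x - x0) > 0" if "x \<in> s" for x using that s by simp
    ultimately show ?case using s by blast
  qed auto
next
  assume U: "U \<subseteq> V \<and> (\<forall>x\<in>U. \<exists>\<rho>\<in>P. \<exists>e>0. pball \<rho> x e \<subseteq> U)"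
  let ?B = "{pball \<rho> x e | \<rho> x e. \<rho> \<in> P \<and> x \<in> V \<and> 0 < e \<and> pball \<rho> x e \<subseteq> U}"
  have "x \<in> \<Union>?B" if xU: "x \<in> U" for x
  proof -
    have x: "x \<in> V" using U xU by blast
    obtain \<rho> e where \<rho>: "\<rho> \<in> P" "e > 0" "pball \<rho> x e \<subseteq> U"
      using bspec[OF conjunct2[OF U] xU] by (elim bexE exE conjE)
    then have "pball \<rho> x e \<in> ?B"
      using x by (intro CollectI exI[of _ \<rho>] exI[of _ x] exI[of _ e] conjI refl)
    moreover have "x \<in> pball \<rho> x e" using x \<rho>(2) P_simps(1)[OF \<rho>(1)] by simp
    ultimately show ?thesis by (rule UnionI)
  qed
  then have "U \<subseteq> \<Union>?B" by blast
  moreover have "\<Union>?B \<subseteq> U" by blast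
  ultimately have "U = \<Union>?B" by (rule subset_antisym)
  moreover have "openin (seminorm_topology V P) (\<Union>?B)"
    unfolding seminorm_topology_def by (intro openin_Union topology_generated_by_Basis) blast
  ultimately show "openin (seminorm_topology V P) U" by simp
qed

lemma openin_pball: "\<rho> \<in> P \<Longrightarrow> x \<in> V \<Longrightarrow> 0 < e \<Longrightarrow> openin (seminorm_topology V P) (pball \<rho> x e)"
  unfolding seminorm_topology_def by (intro topology_generated_by_Basis) auto

lemma topspace_seminorm_topology: "topspace (seminorm_topology V P) = V"
proof
  show "topspace (seminorm_topology V P) \<subseteq> V"
    using openin_seminorm_topology openin_topspace by blast
  obtain \<rho> where "\<rho> \<in> P" using P_nonempty by blast
  then have "openin (seminorm_topology V P) V"
    unfolding openin_seminorm_topology using zero_less_one by blast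
  then show "V \<subseteq> topspace (seminorm_topology V P)"
    by (rule openin_subset)
qed

end

locale bounded_bilinear_map = seminormed_subspace sc V P
  for sc :: "'k::real_normed_field \<Rightarrow> 'v::ab_group_add \<Rightarrow> 'v" and V P +
  fixes B :: "'v \<Rightarrow> 'v \<Rightarrow> 'v"
  assumes B_closed: "x \<in> V \<Longrightarrow> y \<in> V \<Longrightarrow> B x y \<in> V"
    and B_add_left: "\<lbrakk>x \<in> V; x' \<in> V; y \<in> V\<rbrakk> \<Longrightarrow> B (x + x') y = B x y + B x' y"
    and B_add_right: "\<lbrakk>x \<in> V; y \<in> V; y' \<in> V\<rbrakk> \<Longrightarrow> B x (y + y') = B x y + B x y'"
    and B_bound: "\<rho> \<in> P \<Longrightarrow> \<exists>\<sigma>\<in>P. \<exists>C. \<forall>x\<in>V. \<forall>y\<in>V. \<rho> (B x y) \<le> C * (\<sigma> x * \<sigma> y)"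
begin

text \<open>B x' y' - B x y = B (x' - x) y' + B x (y' - y), so bounds on x and y' suffice. The
  seminorm \<sigma> is chosen before the bound c, because near a point of the completion c is known
  only after \<sigma>.\<close>

lemma B_locally_close:
  assumes \<rho>: "\<rho> \<in> P" and e: "0 < e"
  shows "\<exists>\<sigma>\<in>P. \<forall>c\<ge>0. \<exists>d>0. \<forall>x\<in>V. \<forall>x'\<in>V. \<forall>y\<in>V. \<forall>y'\<in>V.
    \<sigma> x \<le> c \<longrightarrow> \<sigma> y' \<le> c \<longrightarrow> \<sigma> (x' - x) < d \<longrightarrow> \<sigma> (y' - y) < d \<longrightarrow> \<rho> (B x' y' - B x y) < e"
proof -
  obtain \<sigma> C where \<sigma>: "\<sigma> \<in> P" "\<And>x y. x \<in> V \<Longrightarrow> y \<in> V \<Longrightarrow> \<rho> (B x y) \<le> C * (\<sigma> x * \<sigma> y)"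
    using B_bound[OF \<rho>] by blast
  have "\<exists>d>0. \<forall>x\<in>V. \<forall>x'\<in>V. \<forall>y\<in>V. \<forall>y'\<in>V.
    \<sigma> x \<le> c \<longrightarrow> \<sigma> y' \<le> c \<longrightarrow> \<sigma> (x' - x) < d \<longrightarrow> \<sigma> (y' - y) < d \<longrightarrow> \<rho> (B x' y' - B x y) < e" if c: "c \<ge> 0" for c
  proof -
    define d where "d = e / ((\<bar>C\<bar> + 1) * (2 * c + 1))"
    have d: "0 < d" using e c by (simp add: d_def)
    have de: "(\<bar>C\<bar> + 1) * (d * c) + (\<bar>C\<bar> + 1) * (c * d) < e"
    proof -
      have "0 < (\<bar>C\<bar> + 1) * d" using d by simp
      then have "(\<bar>C\<bar> + 1) * (d * c) + (\<bar>C\<bar> + 1) * (c * d) < (\<bar>C\<bar> + 1) * d * (2 * c + 1)"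
        by (simp add: algebra_simps)
      also have "\<dots> = e" using c by (simp add: d_def)
      finally show ?thesis .
    qed
    show ?thesis
    proof (intro exI[of _ d] conjI ballI impI d)
    fix x x' y y' assume xy: "x \<in> V" "x' \<in> V" "y \<in> V" "y' \<in> V"
      and s: "\<sigma> x \<le> c" "\<sigma> y' \<le> c" "\<sigma> (x' - x) < d" "\<sigma> (y' - y) < d"
    have "B x' y' = B (x' - x) y' + (B x (y' - y) + B x y)"
      using B_add_left[of "x' - x" x y'] B_add_right[of x "y' - y" y] xy V_closed(3) by simp
    then have "\<rho> (B x' y' - B x y) = \<rho> (B (x' - x) y' + B x (y' - y))" by simp
    also have "\<dots> \<le> \<rho> (B (x' - x) y') + \<rho> (B x (y' - y))"
      by (intro P_add \<rho> B_closed V_closed xy)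
    also have "\<dots> \<le> (\<bar>C\<bar> + 1) * (d * c) + (\<bar>C\<bar> + 1) * (c * d)"
    proof (intro add_mono)
      have le: "\<rho> (B u v) \<le> (\<bar>C\<bar> + 1) * (\<sigma> u * \<sigma> v)" if "u \<in> V" "v \<in> V" for u v
      proof -
        have "C * (\<sigma> u * \<sigma> v) \<le> (\<bar>C\<bar> + 1) * (\<sigma> u * \<sigma> v)"
          using P_simps(3)[OF \<sigma>(1)] that by (intro mult_right_mono) auto
        then show ?thesis using \<sigma>(2)[OF that] by linarith
      qed
      have "\<sigma> (x' - x) * \<sigma> y' \<le> d * c" "\<sigma> x * \<sigma> (y' - y) \<le> c * d"
        using s xy V_closed(3) P_simps(3)[OF \<sigma>(1)] c d by (auto intro!: mult_mono intro: less_imp_le)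
      then have m: "(\<bar>C\<bar> + 1) * (\<sigma> (x' - x) * \<sigma> y') \<le> (\<bar>C\<bar> + 1) * (d * c)"
        "(\<bar>C\<bar> + 1) * (\<sigma> x * \<sigma> (y' - y)) \<le> (\<bar>C\<bar> + 1) * (c * d)"
        by (auto intro!: mult_left_mono)
      show "\<rho> (B (x' - x) y') \<le> (\<bar>C\<bar> + 1) * (d * c)"
        using le[of "x' - x" y'] m(1) xy V_closed(3) by fastforce
      show "\<rho> (B x (y' - y)) \<le> (\<bar>C\<bar> + 1) * (c * d)"
        using le[of x "y' - y"] m(2) xy V_closed(3) by fastforce
    qed
    also have "\<dots> < e" by (rule de)
    finally show "\<rho> (B x' y' - B x y) < e" .
    qed
  qed
  then show ?thesis using \<sigma>(1) by blast
qed

theorem continuous_map_B: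
  "continuous_map (prod_topology (seminorm_topology V P) (seminorm_topology V P)) (seminorm_topology V P) (\<lambda>(x, y). B x y)"
  unfolding continuous_map_def topspace_prod_topology topspace_seminorm_topology
proof (intro conjI allI impI)
  show "(\<lambda>(x, y). B x y) \<in> V \<times> V \<rightarrow> V"
    using B_closed by auto
  fix U assume U: "openin (seminorm_topology V P) U"
  let ?S = "{z \<in> V \<times> V. (case z of (x, y) \<Rightarrow> B x y) \<in> U}"
  show "openin (prod_topology (seminorm_topology V P) (seminorm_topology V P)) ?S"
    unfolding openin_prod_topology_alt
  proof (intro allI impI)
    fix x y assume "(x, y) \<in> ?S"
    then have xy: "x \<in> V" "y \<in> V" "B x y \<in> U" by auto
    then obtain \<rho> e where \<rho>: "\<rho> \<in> P" "e > 0" "pball \<rho> (B x y) e \<subseteq> U"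
      using U unfolding openin_seminorm_topology by blast
    obtain \<sigma> where \<sigma>: "\<sigma> \<in> P" and close: "\<And>c. c \<ge> 0 \<Longrightarrow> \<exists>d>0. \<forall>x\<in>V. \<forall>x'\<in>V. \<forall>y\<in>V. \<forall>y'\<in>V.
      \<sigma> x \<le> c \<longrightarrow> \<sigma> y' \<le> c \<longrightarrow> \<sigma> (x' - x) < d \<longrightarrow> \<sigma> (y' - y) < d \<longrightarrow> \<rho> (B x' y' - B x y) < e"
      using B_locally_close[OF \<rho>(1,2)] by blast
    \<comment> \<open>The 1 allows for y', whose distance from y is below 1.\<close>
    let ?c = "\<sigma> x + \<sigma> y + 1"
    have nn: "0 \<le> \<sigma> x" "0 \<le> \<sigma> y" using P_simps(3)[OF \<sigma>] xy by auto
    then have "?c \<ge> 0" "\<sigma> x \<le> ?c" by auto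
    then obtain d where d: "d > 0" "\<And>x' y'. \<lbrakk>x' \<in> V; y' \<in> V; \<sigma> y' \<le> ?c; \<sigma> (x' - x) < d; \<sigma> (y' - y) < d\<rbrakk> \<Longrightarrow> \<rho> (B x' y' - B x y) < e"
      using close[of ?c] xy(1,2) by blast
    let ?d = "min d 1"
    have "\<rho> (B x' y' - B x y) < e" if "x' \<in> pball \<sigma> x ?d" "y' \<in> pball \<sigma> y ?d" for x' y'
      using that P_simps(4)[OF \<sigma>, of y' y] xy nn by (intro d) auto
    then have "pball \<sigma> x ?d \<times> pball \<sigma> y ?d \<subseteq> ?S"
      using \<rho>(3) B_closed by auto
    moreover have "x \<in> pball \<sigma> x ?d" "y \<in> pball \<sigma> y ?d"
      using xy d P_simps(1)[OF \<sigma>] by auto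
    moreover have "openin (seminorm_topology V P) (pball \<sigma> x ?d)" "openin (seminorm_topology V P) (pball \<sigma> y ?d)"
    proof -
      have "0 < ?d" using d(1) by simp
      note openin_pball[OF \<sigma> _ this]
      then show "openin (seminorm_topology V P) (pball \<sigma> x ?d)" "openin (seminorm_topology V P) (pball \<sigma> y ?d)"
        using xy(1,2) by blast+
    qed
    ultimately show "\<exists>Ua Va. openin (seminorm_topology V P) Ua \<and> openin (seminorm_topology V P) Va \<and>
        x \<in> Ua \<and> y \<in> Va \<and> Ua \<times> Va \<subseteq> ?S"
      by blast
  qed
qed

end

section \<open>Extension to the completion\<close>

text \<open>Topological groups are regular: if c + A + B lies in U, so does the closure of c + A.
  Closed neighbourhoods are needed because passing to a limit preserves membership in closed sets
  only.\<close>

lemma group_topology_regular: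
  fixes c :: "'h::topological_ab_group_add"
  assumes "open U" "c \<in> U"
  obtains W C where "open W" "closed C" "c \<in> W" "W \<subseteq> C" "C \<subseteq> U"
proof -
  have "open ((\<lambda>z. c + (fst z + snd z)) -` U)"
    using assms(1) by (intro open_vimage continuous_intros)
  moreover have "(0, 0) \<in> (\<lambda>z. c + (fst z + snd z)) -` U"
    using assms(2) by simp
  ultimately obtain A B where AB: "open A" "open B" "0 \<in> A" "0 \<in> B" "A \<times> B \<subseteq> (\<lambda>z. c + (fst z + snd z)) -` U"
    by (rule open_prod_elim) auto
  define W where "W = (\<lambda>z. z - c) -` A"
  have W: "open W" "c \<in> W"
    using AB by (auto simp: W_def intro!: open_vimage continuous_intros)
  have "closure W \<subseteq> U"
  proof
    fix v assume v: "v \<in> closure W"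
    have "open ((\<lambda>z. v - z) -` B)" "v \<in> (\<lambda>z. v - z) -` B"
      using AB by (auto intro!: open_vimage continuous_intros)
    then obtain w where "w \<in> W" "v - w \<in> B"
      using v unfolding closure_iff_nhds_not_empty by (metis IntE ex_in_conv order_refl vimageE)
    then have "(w - c, v - w) \<in> A \<times> B" by (simp add: W_def)
    then have "c + ((w - c) + (v - w)) \<in> U" using AB(5) by fastforce
    then show "v \<in> U" by (simp add: algebra_simps)
  qed
  then show ?thesis
    using that[OF W(1) closed_closure W(2) closure_subset] by blast
qed

text \<open>Uniform continuity of addition provides an entourage Q all of whose translates lie in E.
  Hence E holds for all pairs whose difference is close to 0.\<close>

lemma group_uniformity:
  fixes E :: "'h::{topological_ab_group_add,uniform_topological_group_add} \<times> 'h \<Rightarrow> bool"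
  assumes "eventually E uniformity"
  obtains U where "open U" "0 \<in> U" "\<And>a b. b - a \<in> U \<Longrightarrow> E (a, b)"
proof -
  obtain Q where Q: "eventually Q uniformity" "\<And>a b c. Q (a, b) \<Longrightarrow> E (a + c, b + c)"
    using uniformity_of_uniform_continuous_invariant[OF uniformly_continuous_add' assms] by metis
  have "eventually (\<lambda>y. Q (0, y)) (nhds 0)"
    unfolding eventually_nhds_uniformity by (rule eventually_mono[OF Q(1)]) auto
  then obtain U where U: "open U" "0 \<in> U" "\<And>y. y \<in> U \<Longrightarrow> Q (0, y)"
    unfolding eventually_nhds by blast
  have "E (a, b)" if "b - a \<in> U" for a b
    using Q(2)[OF U(3)[OF that], of a] by simp
  then show ?thesis using that U by blast
qed

text \<open>Completion in the Hausdorff sense: the kernel of \<open>\<iota>\<close> consists of the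
  vectors on which all seminorms in \<open>P\<close> vanish.\<close>

locale seminormed_completion = seminormed_subspace sc V P
  for sc :: "'k::real_normed_field \<Rightarrow> 'v::ab_group_add \<Rightarrow> 'v" and V P +
  fixes sh :: "'k \<Rightarrow> 'h \<Rightarrow> 'h::{topological_ab_group_add,uniform_topological_group_add,complete_uniform_space,t2_space}"
    and \<iota> :: "'v \<Rightarrow> 'h"
  assumes sh: "locally_convex_space sh"
    and \<iota>_add: "\<lbrakk>x \<in> V; y \<in> V\<rbrakk> \<Longrightarrow> \<iota> (x + y) = \<iota> x + \<iota> y"
    and \<iota>_scale: "x \<in> V \<Longrightarrow> \<iota> (sc c x) = sh c (\<iota> x)"
    and dense: "closure (\<iota> ` V) = UNIV"
    and pullback: "seminorm_topology V P = pullback_topology V \<iota> euclidean"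
begin

lemma \<iota>_zero: "\<iota> 0 = 0"
  using \<iota>_add[OF V_closed(1) V_closed(1)] by simp

lemma \<iota>_diff: "x \<in> V \<Longrightarrow> y \<in> V \<Longrightarrow> \<iota> (x - y) = \<iota> x - \<iota> y"
  using \<iota>_add[OF V_closed(3), of x y y] by (simp add: eq_diff_eq)

lemma \<iota>_sum: "(\<And>i. i \<in> I \<Longrightarrow> f i \<in> V) \<Longrightarrow> \<iota> (sum f I) = (\<Sum>i\<in>I. \<iota> (f i))"
  by (induction I rule: infinite_finite_induct) (simp_all add: \<iota>_zero \<iota>_add V_closed)

lemma \<iota>_small:
  assumes "open U" "0 \<in> U"
  obtains \<rho> e where "\<rho> \<in> P" "0 < e" "\<And>x. x \<in> V \<Longrightarrow> \<rho> x < e \<Longrightarrow> \<iota> x \<in> U"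
proof -
  have "openin (seminorm_topology V P) (\<iota> -` U \<inter> V)"
    unfolding pullback openin_pullback_topology using assms(1) by auto
  moreover have "0 \<in> \<iota> -` U \<inter> V" using assms(2) \<iota>_zero V_closed(1) by simp
  ultimately obtain \<rho> e where "\<rho> \<in> P" "0 < e" "pball \<rho> 0 e \<subseteq> \<iota> -` U \<inter> V"
    unfolding openin_seminorm_topology by blast
  then show ?thesis using that[of \<rho> e] by auto
qed

lemma seminorm_small:
  assumes "\<rho> \<in> P" "0 < e"
  obtains U where "open U" "0 \<in> U" "\<And>x. x \<in> V \<Longrightarrow> \<iota> x \<in> U \<Longrightarrow> \<rho> x < e"
proof -
  have "openin (pullback_topology V \<iota> euclidean) (pball \<rho> 0 e)"
    using openin_pball[OF assms(1) V_closed(1) assms(2)] by (simp only: pullback)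
  then obtain U where U: "open U" "pball \<rho> 0 e = \<iota> -` U \<inter> V"
    unfolding openin_pullback_topology by auto
  have "0 \<in> pball \<rho> 0 e" using assms P_simps(1)[OF assms(1)] V_closed(1) by simp
  then have "0 \<in> \<iota> -` U \<inter> V" by (simp only: U(2))
  then have "0 \<in> U" using \<iota>_zero by simp
  moreover have "\<rho> x < e" if "x \<in> V" "\<iota> x \<in> U" for x
  proof -
    have "x \<in> pball \<rho> 0 e" using that U(2) by auto
    then show ?thesis by simp
  qed
  ultimately show ?thesis using that U(1) by blast
qed

text \<open>The filter of those elements of V whose images are close to a. Filters take the place of
  sequences because the topology may have no countable base.\<close>

definition approach :: "'h \<Rightarrow> 'v filter" where
  "approach a = inf (filtercomap \<iota> (nhds a)) (principal V)"

lemma eventually_approach: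
  "eventually Q (approach a) \<longleftrightarrow> (\<exists>U. open U \<and> a \<in> U \<and> (\<forall>x\<in>V. \<iota> x \<in> U \<longrightarrow> Q x))"
  unfolding approach_def eventually_inf_principal eventually_filtercomap_nhds by auto

lemma approach_nontrivial: "approach a \<noteq> bot"
proof
  assume "approach a = bot"
  then have "eventually (\<lambda>_. False) (approach a)" by simp
  then obtain U where U: "open U" "a \<in> U" "\<forall>x\<in>V. \<iota> x \<notin> U"
    unfolding eventually_approach by blast
  moreover have "a \<in> closure (\<iota> ` V)" using dense by simp
  ultimately show False
    unfolding closure_iff_nhds_not_empty by blast
qed

lemma approach_prod_nontrivial: "approach a \<times>\<^sub>F approach b \<noteq> bot"
  by (simp add: prod_filter_eq_bot approach_nontrivial)

lemma eventually_approach_prod: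
  assumes "eventually Q (approach a)" "eventually R (approach b)"
  shows "eventually (\<lambda>(x, y). x \<in> V \<and> y \<in> V \<and> Q x \<and> R y) (approach a \<times>\<^sub>F approach b)"
proof -
  have V: "eventually (\<lambda>x. x \<in> V) (approach c)" for c
    unfolding eventually_approach by (intro exI[of _ UNIV]) auto
  show ?thesis
    unfolding eventually_prod_filter
    by (intro exI[of _ "\<lambda>x. x \<in> V \<and> Q x"] exI[of _ "\<lambda>y. y \<in> V \<and> R y"] conjI eventually_conj assms V) auto
qed

lemma approach_close:
  assumes "\<sigma> \<in> P" "0 < d"
  obtains Q where "eventually Q (approach a)" "\<And>x x'. \<lbrakk>x \<in> V; x' \<in> V; Q x; Q x'\<rbrakk> \<Longrightarrow> \<sigma> (x' - x) < d"
proof -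
  obtain U where U: "open U" "0 \<in> U" "\<And>x. x \<in> V \<Longrightarrow> \<iota> x \<in> U \<Longrightarrow> \<sigma> x < d"
    using seminorm_small[OF assms] by blast
  have "open ((\<lambda>z. fst z - snd z) -` U)"
    using U(1) by (intro open_vimage continuous_intros)
  moreover have "(a, a) \<in> (\<lambda>z. fst z - snd z) -` U" using U(2) by simp
  ultimately obtain A B where AB: "open A" "open B" "a \<in> A" "a \<in> B" "A \<times> B \<subseteq> (\<lambda>z. fst z - snd z) -` U"
    by (rule open_prod_elim) auto
  let ?Q = "\<lambda>x. \<iota> x \<in> A \<inter> B"
  have "eventually ?Q (approach a)"
    unfolding eventually_approach using AB by (intro exI[of _ "A \<inter> B"]) auto
  moreover have "\<sigma> (x' - x) < d" if "x \<in> V" "x' \<in> V" "?Q x" "?Q x'" for x x'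
  proof -
    have "(\<iota> x', \<iota> x) \<in> A \<times> B" using that by simp
    then have "\<iota> x' - \<iota> x \<in> U" using AB(5) by fastforce
    then show ?thesis using U(3)[OF V_closed(3)] that by (simp add: \<iota>_diff)
  qed
  ultimately show ?thesis using that by blast
qed

lemma approach_bounded:
  assumes "\<sigma> \<in> P"
  obtains c where "0 \<le> c" "eventually (\<lambda>x. \<sigma> x \<le> c) (approach a)"
proof -
  obtain Q where Q: "eventually Q (approach a)" "\<And>x x'. \<lbrakk>x \<in> V; x' \<in> V; Q x; Q x'\<rbrakk> \<Longrightarrow> \<sigma> (x' - x) < 1"
    using approach_close[OF assms zero_less_one] by blast
  obtain U where U: "open U" "a \<in> U" "\<And>x. x \<in> V \<Longrightarrow> \<iota> x \<in> U \<Longrightarrow> Q x"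
    using Q(1) unfolding eventually_approach by blast
  have "a \<in> closure (\<iota> ` V)" using dense by simp
  then obtain x0 where x0: "x0 \<in> V" "Q x0"
    using U unfolding closure_iff_nhds_not_empty by blast
  have "\<sigma> x \<le> 1 + \<sigma> x0" if "x \<in> V" "\<iota> x \<in> U" for x
    using Q(2)[OF x0(1) that(1) x0(2) U(3)[OF that]] P_simps(4)[OF assms that(1) x0(1)] by linarith
  then have "eventually (\<lambda>x. \<sigma> x \<le> 1 + \<sigma> x0) (approach a)"
    unfolding eventually_approach using U by blast
  moreover have "0 \<le> 1 + \<sigma> x0" using P_simps(3)[OF assms x0(1)] by simp
  ultimately show ?thesis using that by blast
qed

end

section \<open>Extension of a bounded bilinear map\<close>

locale bilinear_completion = seminormed_completion sc V P sh \<iota> + bounded_bilinear_map sc V P B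
  for sc :: "'k::real_normed_field \<Rightarrow> 'v::ab_group_add \<Rightarrow> 'v" and V P
    and sh :: "'k \<Rightarrow> 'h \<Rightarrow> 'h::{topological_ab_group_add,uniform_topological_group_add,complete_uniform_space,t2_space}"
    and \<iota> B
begin

lemma approach_B_close:
  assumes \<rho>: "\<rho> \<in> P" and e: "0 < e"
  obtains Q R where "eventually Q (approach a)" "eventually R (approach b)"
    "\<And>x x' y y'. \<lbrakk>x \<in> V; x' \<in> V; y \<in> V; y' \<in> V; Q x; Q x'; R y; R y'\<rbrakk> \<Longrightarrow> \<rho> (B x' y' - B x y) < e"
proof -
  obtain \<sigma> where \<sigma>: "\<sigma> \<in> P" and close: "\<And>c. c \<ge> 0 \<Longrightarrow> \<exists>d>0. \<forall>x\<in>V. \<forall>x'\<in>V. \<forall>y\<in>V. \<forall>y'\<in>V.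
    \<sigma> x \<le> c \<longrightarrow> \<sigma> y' \<le> c \<longrightarrow> \<sigma> (x' - x) < d \<longrightarrow> \<sigma> (y' - y) < d \<longrightarrow> \<rho> (B x' y' - B x y) < e"
    using B_locally_close[OF assms] by blast
  obtain c1 c2 where c: "0 \<le> c1" "eventually (\<lambda>x. \<sigma> x \<le> c1) (approach a)" "0 \<le> c2" "eventually (\<lambda>x. \<sigma> x \<le> c2) (approach b)"
    using approach_bounded[OF \<sigma>] by metis
  obtain d where d: "d > 0" "\<And>x x' y y'. \<lbrakk>x \<in> V; x' \<in> V; y \<in> V; y' \<in> V; \<sigma> x \<le> max c1 c2; \<sigma> y' \<le> max c1 c2;
      \<sigma> (x' - x) < d; \<sigma> (y' - y) < d\<rbrakk> \<Longrightarrow> \<rho> (B x' y' - B x y) < e"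
    using close[of "max c1 c2"] c(1) by (metis max.coboundedI1)
  obtain Q where Q: "eventually Q (approach a)" "\<And>x x'. \<lbrakk>x \<in> V; x' \<in> V; Q x; Q x'\<rbrakk> \<Longrightarrow> \<sigma> (x' - x) < d"
    using approach_close[OF \<sigma> d(1)] by blast
  obtain R where R: "eventually R (approach b)" "\<And>x x'. \<lbrakk>x \<in> V; x' \<in> V; R x; R x'\<rbrakk> \<Longrightarrow> \<sigma> (x' - x) < d"
    using approach_close[OF \<sigma> d(1)] by blast
  show ?thesis
  proof (rule that[of "\<lambda>x. Q x \<and> \<sigma> x \<le> c1" "\<lambda>y. R y \<and> \<sigma> y \<le> c2"])
    fix x x' y y' assume "x \<in> V" "x' \<in> V" "y \<in> V" "y' \<in> V" "Q x \<and> \<sigma> x \<le> c1" "Q x' \<and> \<sigma> x' \<le> c1" "R y \<and> \<sigma> y \<le> c2" "R y' \<and> \<sigma> y' \<le> c2"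
    then show "\<rho> (B x' y' - B x y) < e" by (intro d Q R) auto
  qed (intro eventually_conj Q R c)+
qed

definition extension :: "'h \<Rightarrow> 'h \<Rightarrow> 'h" where
  "extension a b = (SOME c. ((\<lambda>(x, y). \<iota> (B x y)) \<longlongrightarrow> c) (approach a \<times>\<^sub>F approach b))"

text \<open>By \<open>approach_B_close\<close> the values at approximations of (a, b) form a Cauchy
  filter, and completeness supplies its limit.\<close>

lemma tendsto_extension: "((\<lambda>(x, y). \<iota> (B x y)) \<longlongrightarrow> extension a b) (approach a \<times>\<^sub>F approach b)"
proof -
  let ?G = "filtermap (\<lambda>(x, y). \<iota> (B x y)) (approach a \<times>\<^sub>F approach b)"
  have "cauchy_filter ?G"
    unfolding cauchy_filter_iff
  proof (intro allI impI)
    fix E :: "'h \<times> 'h \<Rightarrow> bool" assume "eventually E uniformity"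
    then obtain U where U: "open U" "0 \<in> U" "\<And>a b. b - a \<in> U \<Longrightarrow> E (a, b)"
      by (rule group_uniformity) blast
    obtain \<rho> e where \<rho>: "\<rho> \<in> P" "0 < e" "\<And>x. x \<in> V \<Longrightarrow> \<rho> x < e \<Longrightarrow> \<iota> x \<in> U"
      using \<iota>_small[OF U(1,2)] by blast
    obtain Q R where QR: "eventually Q (approach a)" "eventually R (approach b)"
      "\<And>x x' y y'. \<lbrakk>x \<in> V; x' \<in> V; y \<in> V; y' \<in> V; Q x; Q x'; R y; R y'\<rbrakk> \<Longrightarrow> \<rho> (B x' y' - B x y) < e"
      using approach_B_close[OF \<rho>(1,2)] by blast
    let ?X = "{\<iota> (B x y) | x y. x \<in> V \<and> y \<in> V \<and> Q x \<and> R y}"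
    have "eventually (\<lambda>z. z \<in> ?X) ?G"
      unfolding eventually_filtermap
      by (rule eventually_mono[OF eventually_approach_prod[OF QR(1,2)]]) auto
    moreover have "E (u, v)" if uv: "u \<in> ?X" "v \<in> ?X" for u v
    proof -
      obtain x y where u: "u = \<iota> (B x y)" "x \<in> V" "y \<in> V" "Q x" "R y" using uv(1) by blast
      obtain x' y' where v: "v = \<iota> (B x' y')" "x' \<in> V" "y' \<in> V" "Q x'" "R y'" using uv(2) by blast
      have "\<iota> (B x' y' - B x y) \<in> U"
        using u v by (intro \<rho>(3) QR(3) V_closed(3) B_closed)
      then show ?thesis
        using u v by (intro U(3)) (simp add: \<iota>_diff B_closed)
    qed
    ultimately show "\<exists>X. eventually (\<lambda>z. z \<in> X) ?G \<and> (\<forall>z\<in>X \<times> X. E z)"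
      by blast
  qed
  then have "convergent_filter ?G" by (rule cauchy_filter_convergent)
  then obtain c where "?G \<le> nhds c" unfolding convergent_filter_iff by blast
  then have "((\<lambda>(x, y). \<iota> (B x y)) \<longlongrightarrow> c) (approach a \<times>\<^sub>F approach b)"
    by (simp add: filterlim_def)
  then show ?thesis
    unfolding extension_def by (rule someI)
qed

lemma extension_\<iota>:
  assumes "x0 \<in> V" "y0 \<in> V"
  shows "extension (\<iota> x0) (\<iota> y0) = \<iota> (B x0 y0)"
proof (rule tendsto_unique[OF approach_prod_nontrivial tendsto_extension])
  show "((\<lambda>(x, y). \<iota> (B x y)) \<longlongrightarrow> \<iota> (B x0 y0)) (approach (\<iota> x0) \<times>\<^sub>F approach (\<iota> y0))"
  proof (rule topological_tendstoI)
    fix O' assume O': "open O'" "\<iota> (B x0 y0) \<in> O'"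
    let ?U = "(\<lambda>u. u + \<iota> (B x0 y0)) -` O'"
    have "open ?U" "0 \<in> ?U" using O' by (auto intro!: open_vimage continuous_intros)
    then obtain \<rho> e where \<rho>: "\<rho> \<in> P" "0 < e" "\<And>x. x \<in> V \<Longrightarrow> \<rho> x < e \<Longrightarrow> \<iota> x \<in> ?U"
      using \<iota>_small by blast
    obtain Q R where QR: "eventually Q (approach (\<iota> x0))" "eventually R (approach (\<iota> y0))"
      "\<And>x x' y y'. \<lbrakk>x \<in> V; x' \<in> V; y \<in> V; y' \<in> V; Q x; Q x'; R y; R y'\<rbrakk> \<Longrightarrow> \<rho> (B x' y' - B x y) < e"
      using approach_B_close[OF \<rho>(1,2)] by blast
    \<comment> \<open>An element of V is among the approximations of its own image.\<close>
    have "Q x0" "R y0"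
      using QR(1,2) assms unfolding eventually_approach by blast+
    have "\<iota> (B x y) \<in> O'" if "x \<in> V" "y \<in> V" "Q x" "R y" for x y
    proof -
      have "\<iota> (B x y - B x0 y0) \<in> ?U"
        using that assms \<open>Q x0\<close> \<open>R y0\<close> by (intro \<rho>(3) QR(3) V_closed(3) B_closed)
      then show ?thesis using that assms by (simp add: \<iota>_diff B_closed)
    qed
    then show "\<forall>\<^sub>F z in approach (\<iota> x0) \<times>\<^sub>F approach (\<iota> y0). (case z of (x, y) \<Rightarrow> \<iota> (B x y)) \<in> O'"
      by (intro eventually_mono[OF eventually_approach_prod[OF QR(1,2)]]) auto
  qed
qed

text \<open>A closed neighbourhood of the limit at (a, b) contains the values at all approximations
  with images in S and T. These are neighbourhoods of each of their points a' and b' too, so the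
  limits there lie in the same closed set.\<close>

lemma continuous_extension: "continuous_on UNIV (\<lambda>(a, b). extension a b)"
proof -
  have "((\<lambda>(a, b). extension a b) \<longlongrightarrow> extension a b) (nhds (a, b))" for a b
  proof (rule topological_tendstoI)
    fix O' assume O': "open O'" "extension a b \<in> O'"
    obtain W C where WC: "open W" "closed C" "extension a b \<in> W" "W \<subseteq> C" "C \<subseteq> O'"
      using group_topology_regular[OF O'] by blast
    have "eventually (\<lambda>z. (case z of (x, y) \<Rightarrow> \<iota> (B x y)) \<in> W) (approach a \<times>\<^sub>F approach b)"
      using topological_tendstoD[OF tendsto_extension WC(1,3)] .
    then obtain Q R where QR: "eventually Q (approach a)" "eventually R (approach b)" "\<And>x y. Q x \<Longrightarrow> R y \<Longrightarrow> \<iota> (B x y) \<in> W"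
      unfolding eventually_prod_filter by auto
    obtain S T where ST: "open S" "a \<in> S" "\<And>x. x \<in> V \<Longrightarrow> \<iota> x \<in> S \<Longrightarrow> Q x" "open T" "b \<in> T" "\<And>y. y \<in> V \<Longrightarrow> \<iota> y \<in> T \<Longrightarrow> R y"
      using QR(1,2) unfolding eventually_approach by blast
    have "extension a' b' \<in> O'" if "a' \<in> S" "b' \<in> T" for a' b'
    proof -
      have "eventually Q (approach a')" "eventually R (approach b')"
        using ST that unfolding eventually_approach by blast+
      then have "eventually (\<lambda>z. (case z of (x, y) \<Rightarrow> \<iota> (B x y)) \<in> C) (approach a' \<times>\<^sub>F approach b')"
        using QR(3) WC(4) by (intro eventually_mono[OF eventually_approach_prod]) auto
      then have "extension a' b' \<in> C"
        using Lim_in_closed_set[OF WC(2) _ approach_prod_nontrivial tendsto_extension] by blast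
      then show ?thesis using WC(5) by blast
    qed
    then have "\<forall>z\<in>S \<times> T. (case z of (a, b) \<Rightarrow> extension a b) \<in> O'" by auto
    moreover have "open (S \<times> T)" "(a, b) \<in> S \<times> T" using ST by (auto intro: open_Times)
    ultimately show "\<forall>\<^sub>F z in nhds (a, b). (case z of (a, b) \<Rightarrow> extension a b) \<in> O'"
      unfolding eventually_nhds by blast
  qed
  then show ?thesis
    unfolding continuous_on_def by (auto intro: tendsto_mono[OF at_le[OF subset_UNIV]] tendsto_mono[OF at_within_le_nhds])
qed

end

section \<open>Extension of a series of bilinear maps\<close>

context seminormed_completion
begin

lemma tendsto_sh: "(f \<longlongrightarrow> l) F \<Longrightarrow> ((\<lambda>z. sh c (f z)) \<longlongrightarrow> sh c l) F"
  using continuous_on_tendsto_compose[OF locally_convex_space.continuous_scale_affine(1)[OF sh, of c 0], of f l F]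
  by simp

context
  fixes B :: "'v \<Rightarrow> 'v \<Rightarrow> 'v" and C :: "nat \<Rightarrow> 'v \<Rightarrow> 'v \<Rightarrow> 'v" and z :: 'k
  assumes B: "bilinear_completion sc V P sh \<iota> B" and C: "\<And>n. bilinear_completion sc V P sh \<iota> (C n)"
    and est: "\<And>\<rho>. \<rho> \<in> P \<Longrightarrow> \<exists>\<sigma>\<in>P. \<forall>m. \<forall>x\<in>V. \<forall>y\<in>V. \<rho> (sc (z ^ m) (C m x y)) \<le> (1 / 2) ^ m * (\<sigma> x * \<sigma> y) \<and>
      \<rho> (B x y - (\<Sum>n<m. sc (z ^ n) (C n x y))) \<le> (1 / 2) ^ m * (\<sigma> x * \<sigma> y)"
begin

interpretation B: bilinear_completion sc V P sh \<iota> B by (rule B)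
interpretation C: bilinear_completion sc V P sh \<iota> "C n" for n by (rule C)

lemma eventually_estimate:
  assumes "\<rho> \<in> P"
  obtains c where "0 \<le> c" "\<And>m. eventually (\<lambda>(x, y). x \<in> V \<and> y \<in> V \<and> \<rho> (sc (z ^ m) (C m x y)) \<le> (1 / 2) ^ m * c \<and>
      \<rho> (B x y - (\<Sum>n<m. sc (z ^ n) (C n x y))) \<le> (1 / 2) ^ m * c) (approach a \<times>\<^sub>F approach b)"
proof -
  obtain \<sigma> where \<sigma>: "\<sigma> \<in> P" "\<And>m x y. x \<in> V \<Longrightarrow> y \<in> V \<Longrightarrow> \<rho> (sc (z ^ m) (C m x y)) \<le> (1 / 2) ^ m * (\<sigma> x * \<sigma> y)"
    "\<And>m x y. x \<in> V \<Longrightarrow> y \<in> V \<Longrightarrow> \<rho> (B x y - (\<Sum>n<m. sc (z ^ n) (C n x y))) \<le> (1 / 2) ^ m * (\<sigma> x * \<sigma> y)"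
    using est[OF assms] by blast
  obtain c1 where c1: "0 \<le> c1" "eventually (\<lambda>x. \<sigma> x \<le> c1) (approach a)"
    using approach_bounded[OF \<sigma>(1)] by blast
  obtain c2 where c2: "0 \<le> c2" "eventually (\<lambda>x. \<sigma> x \<le> c2) (approach b)"
    using approach_bounded[OF \<sigma>(1)] by blast
  show ?thesis
  proof (rule that[of "c1 * c2"])
    fix m
    have "(1 / 2) ^ m * (\<sigma> x * \<sigma> y) \<le> (1 / 2) ^ m * (c1 * c2)" if "x \<in> V" "y \<in> V" "\<sigma> x \<le> c1" "\<sigma> y \<le> c2" for x y
      using that c1 c2 P_simps(3)[OF \<sigma>(1)] by (intro mult_left_mono mult_mono) auto
    then have "\<rho> (sc (z ^ m) (C m x y)) \<le> (1 / 2) ^ m * (c1 * c2) \<and>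
        \<rho> (B x y - (\<Sum>n<m. sc (z ^ n) (C n x y))) \<le> (1 / 2) ^ m * (c1 * c2)"
      if "x \<in> V" "y \<in> V" "\<sigma> x \<le> c1" "\<sigma> y \<le> c2" for x y
      using \<sigma>(2,3)[OF that(1,2), of m] that by (meson order_trans)
    then show "eventually (\<lambda>(x, y). x \<in> V \<and> y \<in> V \<and> \<rho> (sc (z ^ m) (C m x y)) \<le> (1 / 2) ^ m * (c1 * c2) \<and>
      \<rho> (B x y - (\<Sum>n<m. sc (z ^ n) (C n x y))) \<le> (1 / 2) ^ m * (c1 * c2)) (approach a \<times>\<^sub>F approach b)"
      by (intro eventually_mono[OF eventually_approach_prod[OF c1(2) c2(2)]]) auto
  qed (use c1 c2 in simp)
qed

text \<open>Close to (a, b) the seminorms of the arguments are bounded, so the remainder estimate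
  holds there with one constant for all m. For fixed m it passes to the limit in the arguments, and
  only then m tends to infinity.\<close>

lemma extension_sums: "(\<lambda>n. sh (z ^ n) (C.extension n a b)) sums B.extension a b"
proof -
  let ?D = "\<lambda>m. B.extension a b - (\<Sum>n<m. sh (z ^ n) (C.extension n a b))"
  let ?f = "\<lambda>m (x, y). \<iota> (B x y) - (\<Sum>n<m. sh (z ^ n) (\<iota> (C n x y)))"
  have lim: "(?f m \<longlongrightarrow> ?D m) (approach a \<times>\<^sub>F approach b)" for m
    using tendsto_diff[OF B.tendsto_extension[of a b] tendsto_sum[of "{..<m}", OF tendsto_sh[OF C.tendsto_extension[of _ a b]]]]
    by (simp add: split_def)
  have f: "?f m (x, y) = \<iota> (B x y - (\<Sum>n<m. sc (z ^ n) (C n x y)))" if "x \<in> V" "y \<in> V" for m x y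
    using that by (simp add: \<iota>_diff \<iota>_sum \<iota>_scale V_closed B.B_closed C.B_closed)
  have "?D \<longlonglongrightarrow> 0"
  proof (rule topological_tendstoI)
    fix U :: "'h set" assume U: "open U" "0 \<in> U"
    obtain W K where WK: "open W" "closed K" "0 \<in> W" "W \<subseteq> K" "K \<subseteq> U"
      using group_topology_regular[OF U] by blast
    obtain \<rho> e where \<rho>: "\<rho> \<in> P" "0 < e" "\<And>x. x \<in> V \<Longrightarrow> \<rho> x < e \<Longrightarrow> \<iota> x \<in> W"
      using \<iota>_small[OF WK(1,3)] by blast
    obtain c where c: "0 \<le> c" "\<And>m. eventually (\<lambda>(x, y). x \<in> V \<and> y \<in> V \<and> \<rho> (sc (z ^ m) (C m x y)) \<le> (1 / 2) ^ m * c \<and>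
      \<rho> (B x y - (\<Sum>n<m. sc (z ^ n) (C n x y))) \<le> (1 / 2) ^ m * c) (approach a \<times>\<^sub>F approach b)"
      using eventually_estimate[OF \<rho>(1)] by blast
    have "(\<lambda>m. (1 / 2) ^ m * c) \<longlonglongrightarrow> 0 * c"
      by (intro tendsto_intros LIMSEQ_realpow_zero) auto
    then have "eventually (\<lambda>m. (1 / 2) ^ m * c < e) sequentially"
      using \<rho>(2) by (intro order_tendstoD) auto
    then show "eventually (\<lambda>m. ?D m \<in> U) sequentially"
    proof eventually_elim
      case (elim m)
      have "eventually (\<lambda>xy. ?f m xy \<in> K) (approach a \<times>\<^sub>F approach b)"
        using c(2)[of m]
      proof (rule eventually_mono)
        fix xy assume "case xy of (x, y) \<Rightarrow> x \<in> V \<and> y \<in> V \<and> \<rho> (sc (z ^ m) (C m x y)) \<le> (1 / 2) ^ m * c \<and>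
          \<rho> (B x y - (\<Sum>n<m. sc (z ^ n) (C n x y))) \<le> (1 / 2) ^ m * c"
        then obtain x y where xy: "xy = (x, y)" "x \<in> V" "y \<in> V" "\<rho> (B x y - (\<Sum>n<m. sc (z ^ n) (C n x y))) < e"
          using elim by (cases xy) auto
        have "\<iota> (B x y - (\<Sum>n<m. sc (z ^ n) (C n x y))) \<in> W"
          using xy by (intro \<rho>(3) V_closed B.B_closed C.B_closed) auto
        then show "?f m xy \<in> K"
          using f[OF xy(2,3)] WK(4) xy(1) by auto
      qed
      then have "?D m \<in> K"
        using Lim_in_closed_set[OF WK(2) _ approach_prod_nontrivial lim[of m]] by blast
      then show ?case using WK(5) by blast
    qed
  qed
  then have "(\<lambda>m. B.extension a b - ?D m) \<longlonglongrightarrow> B.extension a b - 0"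
    by (intro tendsto_intros)
  then show ?thesis
    by (simp add: sums_def)
qed

lemma extension_summable:
  assumes r: "continuous_seminorm sh r"
  shows "summable (\<lambda>n. r (sh (z ^ n) (C.extension n a b)))"
proof -
  interpret H: locally_convex_space sh by (rule sh)
  note rs = continuous_seminorm_is_seminorm[OF r]
  have cont: "continuous_on UNIV r" using r by (simp add: continuous_seminorm_def)
  have "open (r -` {..<1})"
    using cont by (simp add: continuous_on_open_vimage)
  moreover have "0 \<in> r -` {..<1}" using H.seminorm(3)[OF rs] by simp
  ultimately obtain \<rho> e where \<rho>: "\<rho> \<in> P" "0 < e" "\<And>x. x \<in> V \<Longrightarrow> \<rho> x < e \<Longrightarrow> \<iota> x \<in> r -` {..<1}"
    using \<iota>_small by blast
  \<comment> \<open>On the image of the \<rho>-ball of radius e the seminorm r is below 1;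
    homogeneity turns this into a bound by a multiple of \<rho>.\<close>
  have bound: "r (\<iota> x) \<le> d / e" if "x \<in> V" "\<rho> x < d" for x d
  proof -
    have d: "d > 0" using that P_simps(3)[OF \<rho>(1) that(1)] by linarith
    have n: "norm (of_real (e / d) :: 'k) = e / d"
      unfolding norm_of_real using d \<rho>(2) by simp
    have "\<rho> (sc (of_real (e / d)) x) < e"
      unfolding P_scale[OF \<rho>(1) that(1)] n using that(2) d \<rho>(2) by (simp add: field_simps)
    then have "r (sh (of_real (e / d)) (\<iota> x)) < 1"
      using \<rho>(3)[OF V_closed(5)[OF that(1)]] \<iota>_scale[OF that(1)] by simp
    then show ?thesis
      unfolding H.seminorm(2)[OF rs] n using d \<rho>(2) by (simp add: field_simps)
  qed
  obtain c where c: "0 \<le> c" "\<And>m. eventually (\<lambda>(x, y). x \<in> V \<and> y \<in> V \<and> \<rho> (sc (z ^ m) (C m x y)) \<le> (1 / 2) ^ m * c \<and>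
      \<rho> (B x y - (\<Sum>n<m. sc (z ^ n) (C n x y))) \<le> (1 / 2) ^ m * c) (approach a \<times>\<^sub>F approach b)"
    using eventually_estimate[OF \<rho>(1)] by blast
  have "r (sh (z ^ m) (C.extension m a b)) \<le> (1 / 2) ^ m * (c + 1) / e" for m
  proof -
    let ?S = "r -` {..(1 / 2) ^ m * (c + 1) / e}"
    have "closed ?S" using cont by (simp add: continuous_on_closed_vimage)
    moreover have "eventually (\<lambda>xy. sh (z ^ m) (case xy of (x, y) \<Rightarrow> \<iota> (C m x y)) \<in> ?S) (approach a \<times>\<^sub>F approach b)"
      using c(2)[of m]
    proof (rule eventually_mono)
      fix xy assume "case xy of (x, y) \<Rightarrow> x \<in> V \<and> y \<in> V \<and> \<rho> (sc (z ^ m) (C m x y)) \<le> (1 / 2) ^ m * c \<and>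
        \<rho> (B x y - (\<Sum>n<m. sc (z ^ n) (C n x y))) \<le> (1 / 2) ^ m * c"
      then obtain x y where xy: "xy = (x, y)" "x \<in> V" "y \<in> V" "\<rho> (sc (z ^ m) (C m x y)) \<le> (1 / 2) ^ m * c"
        by (cases xy) auto
      \<comment> \<open>\<open>bound\<close> asks for a strict inequality; c + 1 provides it even if
        c = 0.\<close>
      have "(1 / 2 :: real) ^ m * c < (1 / 2) ^ m * (c + 1)" by simp
      then have "\<rho> (sc (z ^ m) (C m x y)) < (1 / 2) ^ m * (c + 1)" using xy(4) by linarith
      then have "r (\<iota> (sc (z ^ m) (C m x y))) \<le> (1 / 2) ^ m * (c + 1) / e"
        using xy by (intro bound V_closed C.B_closed)
      then show "sh (z ^ m) (case xy of (x, y) \<Rightarrow> \<iota> (C m x y)) \<in> ?S"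
        using xy by (simp add: \<iota>_scale C.B_closed)
    qed
    ultimately have "sh (z ^ m) (C.extension m a b) \<in> ?S"
      by (rule Lim_in_closed_set[OF _ _ approach_prod_nontrivial tendsto_sh[OF C.tendsto_extension]])
    then show ?thesis by simp
  qed
  then have le: "norm (r (sh (z ^ m) (C.extension m a b))) \<le> (1 / 2) ^ m * (c + 1) / e" for m
    by (simp only: real_norm_def abs_of_nonneg[OF H.seminorm(5)[OF rs]])
  have "summable (\<lambda>m. (1 / 2) ^ m * (c + 1) / e)"
    by (intro summable_divide summable_mult2 summable_geometric) auto
  then show ?thesis
    by (rule summable_comparison_test'[where N = 0]) (rule le)
qed

end

end

section \<open>The Gutt star product on the symmetric algebra\<close>

context locally_convex_lie_algebra
begin

lemma continuous_seminorm_zero: "continuous_seminorm scale (\<lambda>_. 0)"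
  by (simp add: continuous_seminorm_def)

definition seminorms_at :: "real \<Rightarrow> (('g, 'k) tensor \<Rightarrow> real) set" where
  "seminorms_at R = {tensor_seminorm scale p R | p. continuous_seminorm scale p}"

definition seminorms_below_1 :: "(('g, 'k) tensor \<Rightarrow> real) set" where
  "seminorms_below_1 = {tensor_seminorm scale p R | p R. continuous_seminorm scale p \<and> R < 1}"

lemma seminorms_atI: "continuous_seminorm scale p \<Longrightarrow> tensor_seminorm scale p R \<in> seminorms_at R"
  unfolding seminorms_at_def by blast

lemma seminorms_below_1I: "continuous_seminorm scale p \<Longrightarrow> R < 1 \<Longrightarrow> tensor_seminorm scale p R \<in> seminorms_below_1"
  unfolding seminorms_below_1_def by blast

lemma seminorms_atE:
  assumes "\<rho> \<in> seminorms_at R"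
  obtains p where "\<rho> = tensor_seminorm scale p R" "continuous_seminorm scale p"
  using assms unfolding seminorms_at_def by blast

lemma seminorms_below_1E:
  assumes "\<rho> \<in> seminorms_below_1"
  obtains p R where "\<rho> = tensor_seminorm scale p R" "continuous_seminorm scale p" "R < 1"
  using assms unfolding seminorms_below_1_def by blast

lemma tensor_seminorm_symmetric:
  assumes "continuous_seminorm scale p" "x \<in> symmetric_algebra scale" "y \<in> symmetric_algebra scale"
  shows "tensor_seminorm scale p R (x + y) \<le> tensor_seminorm scale p R x + tensor_seminorm scale p R y"
    and "tensor_seminorm scale p R (tscale c x) = norm c * tensor_seminorm scale p R x"
    and "0 \<le> tensor_seminorm scale p R x"
  using assms symmetric_algebra_subset[of scale] continuous_seminorm_is_seminorm[OF assms(1)]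
  by (auto intro: tensor_seminorm_add tensor_seminorm_scale tensor_seminorm_nonneg)

lemma tensor_seminorm_directed:
  assumes "continuous_seminorm scale p" "continuous_seminorm scale q" "R \<le> T" "S \<le> T" "x \<in> symmetric_algebra scale"
  shows "tensor_seminorm scale p R x \<le> tensor_seminorm scale (\<lambda>v. p v + q v) T x"
    and "tensor_seminorm scale q S x \<le> tensor_seminorm scale (\<lambda>v. p v + q v) T x"
proof -
  note pq = continuous_seminorm_is_seminorm[OF assms(1)] continuous_seminorm_is_seminorm[OF assms(2)]
    continuous_seminorm_is_seminorm[OF continuous_seminorm_add[OF assms(1,2)]]
  have x: "x \<in> tensor_algebra scale" using assms(5) symmetric_algebra_subset by blast
  show "tensor_seminorm scale p R x \<le> tensor_seminorm scale (\<lambda>v. p v + q v) T x"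
    by (rule tensor_seminorm_mono[OF pq(1,3) _ assms(3) x]) (simp add: seminorm(5)[OF pq(2)])
  show "tensor_seminorm scale q S x \<le> tensor_seminorm scale (\<lambda>v. p v + q v) T x"
    by (rule tensor_seminorm_mono[OF pq(2,3) _ assms(4) x]) (simp add: seminorm(5)[OF pq(1)])
qed

lemma subspace_symmetric_algebra: "tvs.subspace (symmetric_algebra scale)"
  by (simp add: tvs.subspace_def symmetric_algebra_closed)

lemma seminormed_subspace_fixed: "seminormed_subspace tscale (symmetric_algebra scale) (seminorms_at R)"
proof (intro seminormed_subspace.intro seminormed_subspace_axioms.intro tvs.vector_space_axioms subspace_symmetric_algebra)
  show "seminorms_at R \<noteq> {}"
    using seminorms_atI[OF continuous_seminorm_zero] by blast
next
  fix \<rho> \<sigma> assume "\<rho> \<in> seminorms_at R" "\<sigma> \<in> seminorms_at R"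
  then obtain p q where pq: "\<rho> = tensor_seminorm scale p R" "\<sigma> = tensor_seminorm scale q R"
    "continuous_seminorm scale p" "continuous_seminorm scale q" by (metis seminorms_atE)
  show "\<exists>\<tau>\<in>seminorms_at R. \<forall>x\<in>symmetric_algebra scale. \<rho> x \<le> \<tau> x \<and> \<sigma> x \<le> \<tau> x"
    unfolding pq(1,2) using tensor_seminorm_directed[OF pq(3,4) order_refl order_refl]
    by (intro bexI[OF _ seminorms_atI[OF continuous_seminorm_add[OF pq(3,4)]]]) blast
qed (auto elim!: seminorms_atE simp: tensor_seminorm_symmetric)

lemma seminormed_subspace_limit: "seminormed_subspace tscale (symmetric_algebra scale) seminorms_below_1"
proof (intro seminormed_subspace.intro seminormed_subspace_axioms.intro tvs.vector_space_axioms subspace_symmetric_algebra)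
  show "seminorms_below_1 \<noteq> {}"
    using seminorms_below_1I[OF continuous_seminorm_zero zero_less_one] by blast
next
  fix \<rho> \<sigma> assume "\<rho> \<in> seminorms_below_1" "\<sigma> \<in> seminorms_below_1"
  then obtain p q R S where pq: "\<rho> = tensor_seminorm scale p R" "\<sigma> = tensor_seminorm scale q S"
    "continuous_seminorm scale p" "continuous_seminorm scale q" "R < 1" "S < 1" by (metis seminorms_below_1E)
  have "max R S < 1" using pq by simp
  then show "\<exists>\<tau>\<in>seminorms_below_1. \<forall>x\<in>symmetric_algebra scale. \<rho> x \<le> \<tau> x \<and> \<sigma> x \<le> \<tau> x"
    unfolding pq(1,2) using tensor_seminorm_directed[OF pq(3,4) max.cobounded1 max.cobounded2]
    by (intro bexI[OF _ seminorms_below_1I[OF continuous_seminorm_add[OF pq(3,4)]]]) blast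
qed (auto elim!: seminorms_below_1E simp: tensor_seminorm_symmetric)

lemma gutt_estimate:
  assumes "ad_vanish br M" "M \<ge> 1" "continuous_seminorm scale p" "asymptotic_estimate scale br p q" "0 \<le> R" "R < 1"
  shows "gutt_estimate scale br M p q R (R + (real M - 1) / real M * (1 - R))"
proof -
  interpret N: nilpotent_lie_algebra_normed scale br M
    by (rule nilpotent_lie_algebra_normed[OF assms(1)])
  show ?thesis
    using assms by unfold_locales (auto simp: asymptotic_estimate_def continuous_seminorm_is_seminorm)
qed

text \<open>The seminorms on the right of the estimates thus remain among those that define the
  limit topology.\<close>

lemma gutt_exponent_less_1:
  assumes "M \<ge> 1" "R < 1"
  shows "R + (real M - 1) / real M * (1 - R) < 1"
proof -
  have "(real M - 1) / real M * (1 - R) < 1 * (1 - R)"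
    using assms by (intro mult_strict_right_mono) auto
  then show ?thesis by simp
qed

text \<open>The limit topology is given by all real R < 1, while the estimates assume 0 \<le> R.
  Since n! \<ge> 1, negative exponents are dominated by the exponent 0.\<close>

lemma tensor_seminorm_max_0:
  assumes "continuous_seminorm scale p" "x \<in> symmetric_algebra scale"
  shows "tensor_seminorm scale p R x \<le> tensor_seminorm scale p (max R 0) x"
  using assms symmetric_algebra_subset[of scale] continuous_seminorm_is_seminorm[OF assms(1)]
  by (intro tensor_seminorm_mono) auto

text \<open>Continuity in the topology of one fixed R needs the same R on both sides. The
  fixed-order estimate has it, with n!^(1-R) as the constant C; an estimate through R + \<epsilon>
  would not show this when \<epsilon> > 0.\<close>

lemma bounded_bilinear_gutt_C_fixed:
  assumes M: "ad_vanish br M" "M \<ge> 1" and R: "0 \<le> R" "R < 1"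
  shows "bounded_bilinear_map tscale (symmetric_algebra scale) (seminorms_at R) (gutt_C scale br n)"
proof -
  interpret N: nilpotent_lie_algebra_normed scale br M
    by (rule nilpotent_lie_algebra_normed[OF M(1)])
  show ?thesis
  proof (intro bounded_bilinear_map.intro bounded_bilinear_map_axioms.intro seminormed_subspace_fixed)
    fix \<rho> assume "\<rho> \<in> seminorms_at R"
    then obtain p where p: "\<rho> = tensor_seminorm scale p R" "continuous_seminorm scale p" by (rule seminorms_atE)
    obtain q where q: "asymptotic_estimate scale br p q"
      using asymptotic_estimate_exists[OF M(1) p(2)] by blast
    interpret E: gutt_estimate scale br M p q R "R + (real M - 1) / real M * (1 - R)"
      by (rule gutt_estimate[OF M p(2) q R])
    have "continuous_seminorm scale (\<lambda>v. 4 * exp 1 * q v)"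
      using q by (intro continuous_seminorm_mult) (auto simp: asymptotic_estimate_def)
    then show "\<exists>\<sigma>\<in>seminorms_at R. \<exists>C. \<forall>x\<in>symmetric_algebra scale. \<forall>y\<in>symmetric_algebra scale.
        \<rho> (gutt_C scale br n x y) \<le> C * (\<sigma> x * \<sigma> y)"
      unfolding p(1) using E.gutt_C_estimate_fixed_order[of _ _ n]
      by (intro bexI[OF _ seminorms_atI] exI[of _ "fact n powr (1 - R)"]) (auto simp: mult.assoc)
  qed (auto simp: N.gutt_C_symmetric N.gutt_C_add)
qed

lemma bounded_bilinear_gutt_C_limit:
  assumes M: "ad_vanish br M" "M \<ge> 1"
  shows "bounded_bilinear_map tscale (symmetric_algebra scale) seminorms_below_1 (gutt_C scale br n)"
proof -
  interpret N: nilpotent_lie_algebra_normed scale br M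
    by (rule nilpotent_lie_algebra_normed[OF M(1)])
  show ?thesis
  proof (intro bounded_bilinear_map.intro bounded_bilinear_map_axioms.intro seminormed_subspace_limit)
    fix \<rho> assume "\<rho> \<in> seminorms_below_1"
    then obtain p R where p: "\<rho> = tensor_seminorm scale p R" "continuous_seminorm scale p" "R < 1" by (rule seminorms_below_1E)
    let ?R = "max R 0"
    have R: "0 \<le> ?R" "?R < 1" using p(3) by auto
    interpret F: bounded_bilinear_map tscale "symmetric_algebra scale" "seminorms_at ?R" "gutt_C scale br n"
      by (rule bounded_bilinear_gutt_C_fixed[OF M R])
    from F.B_bound[OF seminorms_atI[OF p(2)]] obtain \<sigma> C where \<sigma>: "\<sigma> \<in> seminorms_at ?R"
      "\<And>x y. x \<in> symmetric_algebra scale \<Longrightarrow> y \<in> symmetric_algebra scale \<Longrightarrow> tensor_seminorm scale p ?R (gutt_C scale br n x y) \<le> C * (\<sigma> x * \<sigma> y)"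
      by blast
    have "\<rho> (gutt_C scale br n x y) \<le> C * (\<sigma> x * \<sigma> y)" if "x \<in> symmetric_algebra scale" "y \<in> symmetric_algebra scale" for x y
      using order_trans[OF tensor_seminorm_max_0[OF p(2) N.gutt_C_symmetric[OF that]] \<sigma>(2)[OF that]] p(1) by simp
    moreover have "\<sigma> \<in> seminorms_below_1"
      using \<sigma>(1) R(2) by (metis seminorms_atE seminorms_below_1I)
    ultimately show "\<exists>\<sigma>\<in>seminorms_below_1. \<exists>C. \<forall>x\<in>symmetric_algebra scale. \<forall>y\<in>symmetric_algebra scale.
        \<rho> (gutt_C scale br n x y) \<le> C * (\<sigma> x * \<sigma> y)"
      by blast
  qed (auto simp: N.gutt_C_symmetric N.gutt_C_add)
qed

text \<open>One \<sigma> serves all m: it is built with 2 |z| in place of |z|, which releases the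
  factor 2^-m. The bound for the star product is the remainder at m = 0.\<close>

lemma gutt_limit_estimates:
  assumes M: "ad_vanish br M" "M \<ge> 1" and p: "continuous_seminorm scale p" "R < 1"
  obtains \<sigma> where "\<sigma> \<in> seminorms_below_1"
    "\<And>x y. \<lbrakk>x \<in> symmetric_algebra scale; y \<in> symmetric_algebra scale\<rbrakk> \<Longrightarrow>
      tensor_seminorm scale p R (gutt_star scale br z x y) \<le> \<sigma> x * \<sigma> y"
    "\<And>x y m. \<lbrakk>x \<in> symmetric_algebra scale; y \<in> symmetric_algebra scale\<rbrakk> \<Longrightarrow>
      tensor_seminorm scale p R (tscale (z ^ m) (gutt_C scale br m x y)) \<le> (1 / 2) ^ m * (\<sigma> x * \<sigma> y)"
    "\<And>x y m. \<lbrakk>x \<in> symmetric_algebra scale; y \<in> symmetric_algebra scale\<rbrakk> \<Longrightarrow>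
      tensor_seminorm scale p R (gutt_star scale br z x y - (\<Sum>n<m. tscale (z ^ n) (gutt_C scale br n x y))) \<le> (1 / 2) ^ m * (\<sigma> x * \<sigma> y)"
proof -
  interpret N: nilpotent_lie_algebra_normed scale br M
    by (rule nilpotent_lie_algebra_normed[OF M(1)])
  let ?R = "max R 0"
  let ?S = "?R + (real M - 1) / real M * (1 - ?R)"
  have R: "0 \<le> ?R" "?R < 1" using p(2) by auto
  obtain q where q: "asymptotic_estimate scale br p q"
    using asymptotic_estimate_exists[OF M(1) p(1)] by blast
  interpret E: gutt_estimate scale br M p q ?R ?S
    by (rule gutt_estimate[OF M p(1) q R])
  let ?\<sigma> = "tensor_seminorm scale (\<lambda>v. 32 * exp 1 * (2 * norm z + 1) * q v) ?S"
  have "continuous_seminorm scale (\<lambda>v. 32 * exp 1 * (2 * norm z + 1) * q v)"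
    using q by (intro continuous_seminorm_mult) (auto simp: asymptotic_estimate_def)
  then have \<sigma>: "?\<sigma> \<in> seminorms_below_1"
    using gutt_exponent_less_1[OF M(2) R(2)] by (rule seminorms_below_1I)
  have rem: "tensor_seminorm scale p R (gutt_star scale br z x y - (\<Sum>n<m. tscale (z ^ n) (gutt_C scale br n x y))) \<le> (1 / 2) ^ m * (?\<sigma> x * ?\<sigma> y)"
    if xy: "x \<in> symmetric_algebra scale" "y \<in> symmetric_algebra scale" for x y m
  proof -
    have "gutt_star scale br z x y - (\<Sum>n<m. tscale (z ^ n) (gutt_C scale br n x y)) \<in> symmetric_algebra scale"
      by (intro symmetric_algebra_closed N.gutt_star_symmetric N.gutt_C_symmetric xy)
    from order_trans[OF tensor_seminorm_max_0[OF p(1) this] E.gutt_star_remainder(2)[OF xy]] show ?thesis .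
  qed
  show ?thesis
  proof (rule that[OF \<sigma> _ _ rem])
    fix x y m assume xy: "x \<in> symmetric_algebra scale" "y \<in> symmetric_algebra scale"
    show "tensor_seminorm scale p R (gutt_star scale br z x y) \<le> ?\<sigma> x * ?\<sigma> y"
      using rem[OF xy, of 0] by simp
    have "tensor_seminorm scale p R (tscale (z ^ m) (gutt_C scale br m x y)) \<le> tensor_seminorm scale p ?R (tscale (z ^ m) (gutt_C scale br m x y))"
      by (intro tensor_seminorm_max_0 p symmetric_algebra_closed N.gutt_C_symmetric xy)
    also have "\<dots> = norm z ^ m * tensor_seminorm scale p ?R (gutt_C scale br m x y)"
      by (simp add: tensor_seminorm_symmetric(2)[OF p(1) N.gutt_C_symmetric[OF xy] N.gutt_C_symmetric[OF xy]] norm_power)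
    also have "\<dots> \<le> (1 / 2) ^ m * (?\<sigma> x * ?\<sigma> y)"
      by (rule E.gutt_star_remainder(1)[OF xy])
    finally show "tensor_seminorm scale p R (tscale (z ^ m) (gutt_C scale br m x y)) \<le> (1 / 2) ^ m * (?\<sigma> x * ?\<sigma> y)" .
  qed
qed

lemma bounded_bilinear_gutt_star:
  assumes M: "ad_vanish br M" "M \<ge> 1"
  shows "bounded_bilinear_map tscale (symmetric_algebra scale) seminorms_below_1 (gutt_star scale br z)"
proof -
  interpret N: nilpotent_lie_algebra_normed scale br M
    by (rule nilpotent_lie_algebra_normed[OF M(1)])
  show ?thesis
  proof (intro bounded_bilinear_map.intro bounded_bilinear_map_axioms.intro seminormed_subspace_limit)
    fix \<rho> assume "\<rho> \<in> seminorms_below_1"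
    then obtain p R where p: "\<rho> = tensor_seminorm scale p R" "continuous_seminorm scale p" "R < 1" by (rule seminorms_below_1E)
    obtain \<sigma> where \<sigma>: "\<sigma> \<in> seminorms_below_1"
      "\<And>x y. \<lbrakk>x \<in> symmetric_algebra scale; y \<in> symmetric_algebra scale\<rbrakk> \<Longrightarrow>
      tensor_seminorm scale p R (gutt_star scale br z x y) \<le> \<sigma> x * \<sigma> y"
      by (rule gutt_limit_estimates[OF M p(2,3), where z = z]) blast
    then show "\<exists>\<sigma>\<in>seminorms_below_1. \<exists>C. \<forall>x\<in>symmetric_algebra scale. \<forall>y\<in>symmetric_algebra scale.
        \<rho> (gutt_star scale br z x y) \<le> C * (\<sigma> x * \<sigma> y)"
      unfolding p(1) by (intro bexI[of _ \<sigma>] exI[of _ 1] ballI) simp_all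
  qed (auto simp: N.gutt_star_symmetric N.gutt_star_bilinear)
qed

end

text \<open>M bounds the number of letters of a nonvanishing word. If N + 1 nested brackets vanish
  but N do not, words of N + 1 letters survive and M = N + 1: in the Heisenberg algebra with N = 1,
  the growth of C_k (P^k, Q^k) excludes \<epsilon> = 0. The factor 1 at order 0 is forced by the
  unit, for which C_0(1, 1) = 1 and both seminorms on the right are 1.\<close>

theorem theorem6p1p1:
  fixes scale :: "'k::real_or_complex \<Rightarrow> 'g::topological_ab_group_add \<Rightarrow> 'g"
    and br :: "'g \<Rightarrow> 'g \<Rightarrow> 'g"
    and N M :: nat
    and z :: 'k
    and \<epsilon> :: "real \<Rightarrow> real"
  assumes "locally_convex_lie_algebra scale br"
    and "N \<ge> 1"
    and "ad_vanish br (N + 1)"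
    and "M = (if ad_vanish br N then N else N + 1)"
    and "\<And>R. \<epsilon> R = (real M - 1) / real M * (1 - R)"
  shows
    "(\<forall>R n. 0 \<le> R \<and> R < 1 \<longrightarrow>
        continuous_map (prod_topology (sym_topology scale R) (sym_topology scale R))
          (sym_topology scale R) (\<lambda>(x, y). gutt_C scale br n x y) \<and>
        (\<forall>p q. continuous_seminorm scale p \<and> asymptotic_estimate scale br p q \<longrightarrow>
          (\<forall>x\<in>symmetric_algebra scale. \<forall>y\<in>symmetric_algebra scale.
            tensor_seminorm scale p R (gutt_C scale br n x y)
              \<le> (if n = 0 \<and> tproj scale 0 x \<noteq> 0 \<and> tproj scale 0 y \<noteq> 0 then 1 else 1 / (2 * 8 ^ n))
                * tensor_seminorm scale (\<lambda>v. 32 * exp 1 * q v) (R + \<epsilon> R) x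
                * tensor_seminorm scale (\<lambda>v. 32 * exp 1 * q v) (R + \<epsilon> R) y)))
     \<and>
     continuous_map (prod_topology (sym_limit_topology scale) (sym_limit_topology scale))
       (sym_limit_topology scale) (\<lambda>(x, y). gutt_star scale br z x y)
     \<and>
     (\<forall>R p q. 0 \<le> R \<and> R < 1 \<and> continuous_seminorm scale p \<and> asymptotic_estimate scale br p q \<longrightarrow>
        (\<forall>x\<in>symmetric_algebra scale. \<forall>y\<in>symmetric_algebra scale.
          tensor_seminorm scale p R (gutt_star scale br z x y)
            \<le> tensor_seminorm scale (\<lambda>v. 32 * exp 1 * (norm z + 1) * q v) (R + \<epsilon> R) x
              * tensor_seminorm scale (\<lambda>v. 32 * exp 1 * (norm z + 1) * q v) (R + \<epsilon> R) y))
     \<and>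
     (\<forall>(s' :: 'k \<Rightarrow> 'h \<Rightarrow>
          'h::{topological_ab_group_add,uniform_topological_group_add,complete_uniform_space,t2_space}) \<iota>.
        tensor_completion (symmetric_algebra scale) (sym_limit_topology scale) s' \<iota> \<longrightarrow>
        (\<exists>(star' :: 'h \<Rightarrow> 'h \<Rightarrow> 'h) (C' :: nat \<Rightarrow> 'h \<Rightarrow> 'h \<Rightarrow> 'h).
          continuous_on UNIV (\<lambda>(x, y). star' x y) \<and>
          (\<forall>x\<in>symmetric_algebra scale. \<forall>y\<in>symmetric_algebra scale.
            star' (\<iota> x) (\<iota> y) = \<iota> (gutt_star scale br z x y)) \<and>
          (\<forall>n. continuous_on UNIV (\<lambda>(x, y). C' n x y)) \<and>
          (\<forall>n. \<forall>x\<in>symmetric_algebra scale. \<forall>y\<in>symmetric_algebra scale.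
            C' n (\<iota> x) (\<iota> y) = \<iota> (gutt_C scale br n x y)) \<and>
          (\<forall>x y r. continuous_seminorm s' r \<longrightarrow> summable (\<lambda>n. r (s' (z ^ n) (C' n x y)))) \<and>
          (\<forall>x y. (\<lambda>n. s' (z ^ n) (C' n x y)) sums star' x y)))"
  proof -
  interpret locally_convex_lie_algebra scale br by fact
  have M: "ad_vanish br M" "M \<ge> 1"
    using assms(2-4) by (auto split: if_splits)
  have top: "sym_topology scale R = seminorm_topology (symmetric_algebra scale) (seminorms_at R)" for R
    by (simp add: sym_topology_def seminorms_at_def)
  have lim: "sym_limit_topology scale = seminorm_topology (symmetric_algebra scale) seminorms_below_1"
    by (simp add: sym_limit_topology_def seminorms_below_1_def)
  have estimate: "gutt_estimate scale br M p q R (R + \<epsilon> R)"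
    if "0 \<le> R" "R < 1" "continuous_seminorm scale p" "asymptotic_estimate scale br p q" for R p q
    unfolding assms(5) by (rule gutt_estimate[OF M that(3,4,1,2)])
  have completion: "\<exists>(star' :: 'h \<Rightarrow> 'h \<Rightarrow> 'h) (C' :: nat \<Rightarrow> 'h \<Rightarrow> 'h \<Rightarrow> 'h).
          continuous_on UNIV (\<lambda>(x, y). star' x y) \<and>
          (\<forall>x\<in>symmetric_algebra scale. \<forall>y\<in>symmetric_algebra scale.
            star' (\<iota> x) (\<iota> y) = \<iota> (gutt_star scale br z x y)) \<and>
          (\<forall>n. continuous_on UNIV (\<lambda>(x, y). C' n x y)) \<and>
          (\<forall>n. \<forall>x\<in>symmetric_algebra scale. \<forall>y\<in>symmetric_algebra scale.
            C' n (\<iota> x) (\<iota> y) = \<iota> (gutt_C scale br n x y)) \<and>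
          (\<forall>x y r. continuous_seminorm s' r \<longrightarrow> summable (\<lambda>n. r (s' (z ^ n) (C' n x y)))) \<and>
          (\<forall>x y. (\<lambda>n. s' (z ^ n) (C' n x y)) sums star' x y)"
    if compl: "tensor_completion (symmetric_algebra scale) (sym_limit_topology scale) s' \<iota>"
    for s' :: "'k \<Rightarrow> 'h \<Rightarrow>
        'h::{topological_ab_group_add,uniform_topological_group_add,complete_uniform_space,t2_space}"
      and \<iota>
  proof -
    have "seminormed_completion tscale (symmetric_algebra scale) seminorms_below_1 s' \<iota>"
      using compl unfolding tensor_completion_def lim
      by (intro seminormed_completion.intro seminormed_completion_axioms.intro seminormed_subspace_limit) auto
    note bilinear_completion = bilinear_completion.intro[OF this]
    have star: "bilinear_completion tscale (symmetric_algebra scale) seminorms_below_1 s' \<iota> (gutt_star scale br z)"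
      by (rule bilinear_completion[OF bounded_bilinear_gutt_star[OF M]])
    have C: "bilinear_completion tscale (symmetric_algebra scale) seminorms_below_1 s' \<iota> (gutt_C scale br n)" for n
      by (rule bilinear_completion[OF bounded_bilinear_gutt_C_limit[OF M]])
    interpret S: bilinear_completion tscale "symmetric_algebra scale" seminorms_below_1 s' \<iota> "gutt_star scale br z"
      by (rule star)
    interpret C: bilinear_completion tscale "symmetric_algebra scale" seminorms_below_1 s' \<iota> "gutt_C scale br n" for n
      by (rule C)
    have est: "\<exists>\<sigma>\<in>seminorms_below_1. \<forall>m. \<forall>x\<in>symmetric_algebra scale. \<forall>y\<in>symmetric_algebra scale.
        \<rho> (tscale (z ^ m) (gutt_C scale br m x y)) \<le> (1 / 2) ^ m * (\<sigma> x * \<sigma> y) \<and>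
        \<rho> (gutt_star scale br z x y - (\<Sum>n<m. tscale (z ^ n) (gutt_C scale br n x y))) \<le> (1 / 2) ^ m * (\<sigma> x * \<sigma> y)"
      if \<rho>: "\<rho> \<in> seminorms_below_1" for \<rho>
    proof -
      obtain p R where p: "\<rho> = tensor_seminorm scale p R" "continuous_seminorm scale p" "R < 1"
        by (rule seminorms_below_1E[OF \<rho>])
      show ?thesis
        unfolding p(1) by (rule gutt_limit_estimates[OF M p(2,3), where z = z]) blast
    qed
    show ?thesis
      by (intro exI[of _ S.extension] exI[of _ C.extension] conjI allI ballI impI S.continuous_extension
          C.continuous_extension S.extension_\<iota> C.extension_\<iota> S.extension_summable[OF star C est] S.extension_sums[OF star C est])
  qed
  show ?thesis
    unfolding top
  proof (intro conjI allI impI ballI completion)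
    fix R :: real and n assume R: "0 \<le> R \<and> R < 1"
    then interpret bounded_bilinear_map tscale "symmetric_algebra scale" "seminorms_at R" "gutt_C scale br n"
      using bounded_bilinear_gutt_C_fixed[OF M] by blast
    show "continuous_map (prod_topology (seminorm_topology (symmetric_algebra scale) (seminorms_at R))
        (seminorm_topology (symmetric_algebra scale) (seminorms_at R)))
        (seminorm_topology (symmetric_algebra scale) (seminorms_at R)) (\<lambda>(x, y). gutt_C scale br n x y)"
      by (rule continuous_map_B)
  next
    fix R :: real and n p q x y
    assume "0 \<le> R \<and> R < 1" "continuous_seminorm scale p \<and> asymptotic_estimate scale br p q"
      and xy: "x \<in> symmetric_algebra scale" "y \<in> symmetric_algebra scale"
    then interpret gutt_estimate scale br M p q R "R + \<epsilon> R"
      by (intro estimate) auto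
    show "tensor_seminorm scale p R (gutt_C scale br n x y)
        \<le> (if n = 0 \<and> tproj scale 0 x \<noteq> 0 \<and> tproj scale 0 y \<noteq> 0 then 1 else 1 / (2 * 8 ^ n))
          * tensor_seminorm scale (\<lambda>v. 32 * exp 1 * q v) (R + \<epsilon> R) x
          * tensor_seminorm scale (\<lambda>v. 32 * exp 1 * q v) (R + \<epsilon> R) y"
      by (rule gutt_C_estimate[OF xy])
  next
    interpret bounded_bilinear_map tscale "symmetric_algebra scale" seminorms_below_1 "gutt_star scale br z"
      by (rule bounded_bilinear_gutt_star[OF M])
    show "continuous_map (prod_topology (sym_limit_topology scale) (sym_limit_topology scale))
        (sym_limit_topology scale) (\<lambda>(x, y). gutt_star scale br z x y)"
      unfolding lim by (rule continuous_map_B)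
  next
    fix R :: real and p q x y
    assume "0 \<le> R \<and> R < 1 \<and> continuous_seminorm scale p \<and> asymptotic_estimate scale br p q"
      and xy: "x \<in> symmetric_algebra scale" "y \<in> symmetric_algebra scale"
    then interpret gutt_estimate scale br M p q R "R + \<epsilon> R"
      by (intro estimate) auto
    show "tensor_seminorm scale p R (gutt_star scale br z x y)
        \<le> tensor_seminorm scale (\<lambda>v. 32 * exp 1 * (norm z + 1) * q v) (R + \<epsilon> R) x
          * tensor_seminorm scale (\<lambda>v. 32 * exp 1 * (norm z + 1) * q v) (R + \<epsilon> R) y"
      by (rule gutt_star_estimate[OF xy])
  qed
qed

end
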